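(* Suppose $\alpha$ is rational. If $T$ is strongly dependent, then so is $\mathbb{T}_\alpha$.
   Context: Let $T$ be a complete theory in a countable first-order language $\mathcal{L}$, with no finite models, admitting quantifier elimination, and geometric: $T$ eliminates $\exists^{\infty}$ and in every model of $T$ the algebraic closure $\operatorname{acl}$ satisfies exchange. $\dim$ is the associated dimension. Sets $Y,Z$ are free over $X$ if $\dim(\bar a/X)=\dim(\bar a/XZ)$ for all finite tuples $\bar a$ from $Y$ and $Y\cap Z=X$. $T$ is indecomposable (no finite-dimensional algebraically closed set $X$ is a finite union of sets of dimension $<\dim(X)$) and has the free-amalgamation property (for $M_0,M_1,M_2\models T^{\forall}$ and embeddings $f_i:M_0\to M_i$ with $\operatorname{acl}(f_i(M_0))=f_i(M_0)$, there are $M\models T$ and embeddings $g_i:M_i\to M$ with $g_1f_1=g_2f_2$ and $g_1(M_1),g_2(M_2)$ free over $g_1f_1(M_0)$). $\mathcal{L}_p=\mathcal{L}\cup\{p\}$, $p$ a new unary predicate ("colored" elements); $\mathcal K$ is the class of $\mathcal L_p$-structures whose $\mathcal L$-reduct models $T^\forall$. Fix real $0<\alpha\le1$. $\delta(A)=\dim(A)-\alpha|p(A)|$, $\delta(A/X)=\dim(A/X)-\alpha|p(A/X)|$ ($p(A/X)$ the colored elements of $A\setminus X$). $\mathcal K_\alpha^+$: those $M\in\mathcal K$ with $\delta(A)\ge0$ for all finite $A$. $X\le Y$ means $X\subseteq Y$ and $\delta(A/X)\ge0$ for all finite $A\subseteq Y$. For finite tuples $\bar a,\bar d$ in a structure of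 $\mathcal K_\alpha^+$ with $\bar a\le\bar a\bar d$, $\bar d$ is transcendental over $\bar a$ if $\dim(d/\bar a)=1$ for each entry $d$ of $\bar d$ not in $\bar a$. An $\mathcal L$-formula $\varphi(\bar x,\bar y)$ is strong w.r.t. tuples $\bar d,\bar a$ (with pairwise distinct entries) if $\varphi(\bar x,\bar a)$ is in the quantifier-free $\mathcal L$-type of $\bar d$ over $\bar a$ and in a sufficiently saturated model of $T$: (i) any $\bar d'\bar a'$ satisfying $\varphi$ has pairwise distinct entries; (ii) if $\varphi(\bar d',\bar a')$ and $\dim(\bar d'/\bar a')=\dim(\bar d/\bar a)$ then for every partition $(\bar x_1,\bar x_2)$ of $\bar x$ with corresponding splittings, $\dim(\bar d_2'/\bar d_1'\bar a')\le\dim(\bar d_2/\bar d_1\bar a)$. $d_{\varphi,k}(\bar y)$ is an $\mathcal L$-formula defining the set of $\bar b$ with $\max\{\dim(\bar e/\bar b):\varphi(\bar e,\bar b)\}=k$, and $D_{\varphi,k}(\bar y)$ one defining the set of $\bar b$ such that some $\bar e$ with $\varphi(\bar e,\bar b)$ has $\dim(\bar e/\bar b)\ge k$ and no entry in $\operatorname{acl}(\bar b)$. $\mathbb T_\alpha$ is the $\mathcal L_p$-theory whose models $\mathbb M$ satisfy: $\mathbb M\models T$; $\mathbb M\in\mathcal K_\alpha^+$; and for all $\bar a,\bar d=(d_1,\dots,d_n)$ in a structure of $\mathcal K_\alpha^+$ with $\bar a\le\bar a\bar d$, $\bar d$ transcendental over $\bar a$, $\dim(\bar d/\bar a)=k$,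 and every $\varphi$ strong w.r.t. $\bar d,\bar a$: $\mathbb M\models\forall\bar y[D_{\varphi,k}(\bar y)\wedge d_{\varphi,k}(\bar y)\to\exists\bar z(\varphi(\bar z,\bar y)\wedge\bigwedge_{p(d_i)}p(z_i)\wedge\bigwedge_{\neg p(d_i)}\neg p(z_i))]$. (This theory is complete.) Strong dependence: sequences $\{I_t:t\in X\}$ in a monster model are mutually indiscernible over $A$ if each $I_t$ is indiscernible over $A\cup\bigcup_{s\ne t}I_s$. For a partial type $\Sigma(\bar x)$ over $A$ and a cardinal $\kappa$, $\mathrm{dp\text{-}rk}(\Sigma,A)<\kappa$ means: for every family $\{I_t:t<\kappa\}$ of sequences mutually indiscernible over $A$ and every realization $\bar b$ of $\Sigma$, some $I_t$ is indiscernible over $A\bar b$. A dependent (NIP) theory is strongly dependent if $\mathrm{dp\text{-}rk}(\bar x=\bar x,\emptyset)<\aleph_0$ for tuples $\bar x$ of any length. *)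

theory Defs
  imports Complex_Main "HOL-Library.Countable_Set" "HOL-Library.Equipollence"
begin

record ('f, 'r) language =
  funs :: "'f set"
  farity :: "'f \<Rightarrow> nat"
  rels :: "'r set"
  rarity :: "'r \<Rightarrow> nat"

datatype 'f tm = Var nat | App 'f "'f tm list"

datatype ('f, 'r) fm =
    Falsum
  | Equal "'f tm" "'f tm"
  | Rel 'r "'f tm list"
  | Imp "('f, 'r) fm" "('f, 'r) fm"
  | All nat "('f, 'r) fm"

abbreviation Neg :: "('f, 'r) fm \<Rightarrow> ('f, 'r) fm" where
  "Neg \<phi> \<equiv> Imp \<phi> Falsum"

fun fv_tm :: "'f tm \<Rightarrow> nat set" where
  "fv_tm (Var x) = {x}"
| "fv_tm (App f ts) = (\<Union>t\<in>set ts. fv_tm t)"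

fun fv :: "('f, 'r) fm \<Rightarrow> nat set" where
  "fv Falsum = {}"
| "fv (Equal t u) = fv_tm t \<union> fv_tm u"
| "fv (Rel r ts) = (\<Union>t\<in>set ts. fv_tm t)"
| "fv (Imp \<phi> \<psi>) = fv \<phi> \<union> fv \<psi>"
| "fv (All x \<phi>) = fv \<phi> - {x}"

fun wf_tm :: "('f, 'r) language \<Rightarrow> 'f tm \<Rightarrow> bool" where
  "wf_tm L (Var x) \<longleftrightarrow> True"
| "wf_tm L (App f ts) \<longleftrightarrow> f \<in> funs L \<and> length ts = farity L f \<and> (\<forall>t\<in>set ts. wf_tm L t)"

fun wf_fm :: "('f, 'r) language \<Rightarrow> ('f, 'r) fm \<Rightarrow> bool" where
  "wf_fm L Falsum \<longleftrightarrow> True"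
| "wf_fm L (Equal t u) \<longleftrightarrow> wf_tm L t \<and> wf_tm L u"
| "wf_fm L (Rel r ts) \<longleftrightarrow> r \<in> rels L \<and> length ts = rarity L r \<and> (\<forall>t\<in>set ts. wf_tm L t)"
| "wf_fm L (Imp \<phi> \<psi>) \<longleftrightarrow> wf_fm L \<phi> \<and> wf_fm L \<psi>"
| "wf_fm L (All x \<phi>) \<longleftrightarrow> wf_fm L \<phi>"

fun qfree :: "('f, 'r) fm \<Rightarrow> bool" where
  "qfree (Imp \<phi> \<psi>) \<longleftrightarrow> qfree \<phi> \<and> qfree \<psi>"
| "qfree (All x \<phi>) \<longleftrightarrow> False"
| "qfree _ \<longleftrightarrow> True"

fun universal :: "('f, 'r) fm \<Rightarrow> bool" where
  "universal (All x \<phi>) \<longleftrightarrow> universal \<phi>"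
| "universal \<phi> \<longleftrightarrow> qfree \<phi>"

definition formula :: "('f, 'r) language \<Rightarrow> nat \<Rightarrow> ('f, 'r) fm \<Rightarrow> bool" where
  "formula L n \<phi> \<longleftrightarrow> wf_fm L \<phi> \<and> fv \<phi> \<subseteq> {..<n}"

definition sentence :: "('f, 'r) language \<Rightarrow> ('f, 'r) fm \<Rightarrow> bool" where
  "sentence L \<phi> \<longleftrightarrow> formula L 0 \<phi>"

record ('f, 'r, 'u) struct =
  carrier :: "'u set"
  fint :: "'f \<Rightarrow> 'u list \<Rightarrow> 'u"
  rint :: "'r \<Rightarrow> 'u list \<Rightarrow> bool"

definition is_structure :: "('f, 'r) language \<Rightarrow> ('f, 'r, 'u) struct \<Rightarrow> bool" where
  "is_structure L M \<longleftrightarrow> carrier M \<noteq> {} \<and>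
     (\<forall>f\<in>funs L. \<forall>as\<in>lists (carrier M). length as = farity L f \<longrightarrow> fint M f as \<in> carrier M)"

fun val :: "('f, 'r, 'u) struct \<Rightarrow> (nat \<Rightarrow> 'u) \<Rightarrow> 'f tm \<Rightarrow> 'u" where
  "val M s (Var x) = s x"
| "val M s (App f ts) = fint M f (map (val M s) ts)"

fun sat :: "('f, 'r, 'u) struct \<Rightarrow> (nat \<Rightarrow> 'u) \<Rightarrow> ('f, 'r) fm \<Rightarrow> bool" where
  "sat M s Falsum \<longleftrightarrow> False"
| "sat M s (Equal t u) \<longleftrightarrow> val M s t = val M s u"
| "sat M s (Rel r ts) \<longleftrightarrow> rint M r (map (val M s) ts)"
| "sat M s (Imp \<phi> \<psi>) \<longleftrightarrow> (sat M s \<phi> \<longrightarrow> sat M s \<psi>)"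
| "sat M s (All x \<phi>) \<longleftrightarrow> (\<forall>a\<in>carrier M. sat M (s(x := a)) \<phi>)"

text \<open>Truth of a formula at a finite tuple: entry \<open>i\<close> of the tuple is the value of the variable
  \<open>Var i\<close>.  It is only used for \<open>formula L (length as) \<phi>\<close>, where the unspecified value of
  \<open>as ! i\<close> for \<open>i \<ge> length as\<close> plays no role.\<close>

abbreviation sat_at :: "('f, 'r, 'u) struct \<Rightarrow> ('f, 'r) fm \<Rightarrow> 'u list \<Rightarrow> bool" where
  "sat_at M \<phi> as \<equiv> sat M (\<lambda>i. as ! i) \<phi>"

definition tuples :: "('f, 'r, 'u) struct \<Rightarrow> nat \<Rightarrow> 'u list set" where
  "tuples M n = {as. length as = n \<and> set as \<subseteq> carrier M}"

definition embedding ::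
  "('f, 'r) language \<Rightarrow> ('u \<Rightarrow> 'u) \<Rightarrow> ('f, 'r, 'u) struct \<Rightarrow> ('f, 'r, 'u) struct \<Rightarrow> bool" where
  "embedding L h M N \<longleftrightarrow> h ` carrier M \<subseteq> carrier N \<and> inj_on h (carrier M) \<and>
     (\<forall>f\<in>funs L. \<forall>as\<in>tuples M (farity L f). h (fint M f as) = fint N f (map h as)) \<and>
     (\<forall>r\<in>rels L. \<forall>as\<in>tuples M (rarity L r). rint M r as \<longleftrightarrow> rint N r (map h as))"

text \<open>All structures have their carrier inside one type \<open>'u\<close>; notions that quantify over
  the models of a theory take it as an argument of type \<open>'u itself\<close>.  For countable languages and
  \<open>'u\<close> at least of the size of the continuum this is harmless: by the Loewenheim-Skolem theorem
  entailment is the usual one, and every theory with an infinite model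
  has \<open>\<aleph>\<^sub>1\<close>-saturated models in \<open>'u\<close>.\<close>

definition models :: "('f, 'r) language \<Rightarrow> ('f, 'r) fm set \<Rightarrow> ('f, 'r, 'u) struct \<Rightarrow> bool" where
  "models L T M \<longleftrightarrow> is_structure L M \<and> (\<forall>\<sigma>\<in>T. sat_at M \<sigma> [])"

definition entails :: "'u itself \<Rightarrow> ('f, 'r) language \<Rightarrow> ('f, 'r) fm set \<Rightarrow> ('f, 'r) fm \<Rightarrow> bool" where
  "entails U L T \<sigma> \<longleftrightarrow> (\<forall>M :: ('f, 'r, 'u) struct. models L T M \<longrightarrow> sat_at M \<sigma> [])"

definition complete_theory :: "'u itself \<Rightarrow> ('f, 'r) language \<Rightarrow> ('f, 'r) fm set \<Rightarrow> bool" where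
  "complete_theory U L T \<longleftrightarrow> (\<forall>\<sigma>\<in>T. sentence L \<sigma>) \<and> (\<exists>M :: ('f, 'r, 'u) struct. models L T M) \<and>
     (\<forall>\<sigma>. sentence L \<sigma> \<longrightarrow> entails U L T \<sigma> \<or> entails U L T (Neg \<sigma>))"

definition no_finite_models :: "'u itself \<Rightarrow> ('f, 'r) language \<Rightarrow> ('f, 'r) fm set \<Rightarrow> bool" where
  "no_finite_models U L T \<longleftrightarrow> (\<forall>M :: ('f, 'r, 'u) struct. models L T M \<longrightarrow> infinite (carrier M))"

definition quantifier_elimination :: "'u itself \<Rightarrow> ('f, 'r) language \<Rightarrow> ('f, 'r) fm set \<Rightarrow> bool" where
  "quantifier_elimination U L T \<longleftrightarrow>
     (\<forall>n \<phi>. formula L n \<phi> \<longrightarrow> (\<exists>\<psi>. formula L n \<psi> \<and> qfree \<psi> \<and>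
        (\<forall>M :: ('f, 'r, 'u) struct. models L T M \<longrightarrow>
           (\<forall>as\<in>tuples M n. sat_at M \<phi> as \<longleftrightarrow> sat_at M \<psi> as))))"

definition universal_part :: "'u itself \<Rightarrow> ('f, 'r) language \<Rightarrow> ('f, 'r) fm set \<Rightarrow> ('f, 'r) fm set" where
  "universal_part U L T = {\<sigma>. sentence L \<sigma> \<and> universal \<sigma> \<and> entails U L T \<sigma>}"

text \<open>A partial type in \<open>n\<close> variables over \<open>A\<close>: a set of pairs of a formula and a tuple of
  parameters from \<open>A\<close>; the first \<open>n\<close> variables are those of the type.\<close>

definition partial_type ::
  "('f, 'r) language \<Rightarrow> nat \<Rightarrow> 'u set \<Rightarrow> (('f, 'r) fm \<times> 'u list) set \<Rightarrow> bool" where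
  "partial_type L n A \<Sigma> \<longleftrightarrow> (\<forall>(\<phi>, as)\<in>\<Sigma>. set as \<subseteq> A \<and> formula L (n + length as) \<phi>)"

definition realizes ::
  "('f, 'r, 'u) struct \<Rightarrow> nat \<Rightarrow> (('f, 'r) fm \<times> 'u list) set \<Rightarrow> 'u list \<Rightarrow> bool" where
  "realizes M n \<Sigma> bs \<longleftrightarrow> bs \<in> tuples M n \<and> (\<forall>(\<phi>, as)\<in>\<Sigma>. sat_at M \<phi> (bs @ as))"

definition aleph1_saturated :: "('f, 'r) language \<Rightarrow> ('f, 'r, 'u) struct \<Rightarrow> bool" where
  "aleph1_saturated L M \<longleftrightarrow>
     (\<forall>A \<Sigma>. countable A \<and> A \<subseteq> carrier M \<and> partial_type L 1 A \<Sigma> \<and>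
        (\<forall>\<Sigma>0. finite \<Sigma>0 \<and> \<Sigma>0 \<subseteq> \<Sigma> \<longrightarrow> (\<exists>bs. realizes M 1 \<Sigma>0 bs))
      \<longrightarrow> (\<exists>bs. realizes M 1 \<Sigma> bs))"

text \<open>Everything evaluated in monster models below involves only countably many parameters and
  countable languages, so \<open>\<aleph>\<^sub>1\<close>-saturation is all the saturation that is needed.\<close>

definition monster :: "('f, 'r) language \<Rightarrow> ('f, 'r) fm set \<Rightarrow> ('f, 'r, 'u) struct \<Rightarrow> bool" where
  "monster L T M \<longleftrightarrow> models L T M \<and> aleph1_saturated L M"

definition acl :: "('f, 'r) language \<Rightarrow> ('f, 'r, 'u) struct \<Rightarrow> 'u set \<Rightarrow> 'u set" where
  "acl L M A = {b \<in> carrier M. \<exists>\<phi> as. set as \<subseteq> A \<and> formula L (Suc (length as)) \<phi> \<and>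
     sat_at M \<phi> (b # as) \<and> finite {c \<in> carrier M. sat_at M \<phi> (c # as)}}"

definition eliminates_exists_infinity ::
  "'u itself \<Rightarrow> ('f, 'r) language \<Rightarrow> ('f, 'r) fm set \<Rightarrow> bool" where
  "eliminates_exists_infinity U L T \<longleftrightarrow>
     (\<forall>n \<phi>. formula L (Suc n) \<phi> \<longrightarrow> (\<exists>\<psi>. formula L n \<psi> \<and>
        (\<forall>M :: ('f, 'r, 'u) struct. models L T M \<longrightarrow>
           (\<forall>as\<in>tuples M n. sat_at M \<psi> as \<longleftrightarrow> infinite {b \<in> carrier M. sat_at M \<phi> (b # as)}))))"

definition acl_exchange :: "('f, 'r) language \<Rightarrow> ('f, 'r, 'u) struct \<Rightarrow> bool" where
  "acl_exchange L M \<longleftrightarrow>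
     (\<forall>A a b. A \<subseteq> carrier M \<and> a \<in> carrier M \<and> b \<in> carrier M \<and>
        a \<in> acl L M (insert b A) \<and> a \<notin> acl L M A \<longrightarrow> b \<in> acl L M (insert a A))"

definition geometric :: "'u itself \<Rightarrow> ('f, 'r) language \<Rightarrow> ('f, 'r) fm set \<Rightarrow> bool" where
  "geometric U L T \<longleftrightarrow> eliminates_exists_infinity U L T \<and>
     (\<forall>M :: ('f, 'r, 'u) struct. models L T M \<longrightarrow> acl_exchange L M)"

definition cl_basis :: "('u set \<Rightarrow> 'u set) \<Rightarrow> 'u set \<Rightarrow> 'u set \<Rightarrow> 'u set \<Rightarrow> bool" where
  "cl_basis cl A X B \<longleftrightarrow> B \<subseteq> A \<and> A \<subseteq> cl (X \<union> B) \<and> (\<forall>b\<in>B. b \<notin> cl (X \<union> (B - {b})))"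

definition finite_dimensional :: "('u set \<Rightarrow> 'u set) \<Rightarrow> 'u set \<Rightarrow> 'u set \<Rightarrow> bool" where
  "finite_dimensional cl A X \<longleftrightarrow> (\<exists>B. finite B \<and> cl_basis cl A X B)"

text \<open>Dimension of \<open>A\<close> over \<open>X\<close>.  It is well defined by exchange, and only meaningful when \<open>A\<close> is
  finite-dimensional over \<open>X\<close>.\<close>

definition cl_dim :: "('u set \<Rightarrow> 'u set) \<Rightarrow> 'u set \<Rightarrow> 'u set \<Rightarrow> nat" where
  "cl_dim cl A X = (THE n. \<exists>B. finite B \<and> cl_basis cl A X B \<and> card B = n)"

definition free_over ::
  "('f, 'r) language \<Rightarrow> ('f, 'r, 'u) struct \<Rightarrow> 'u set \<Rightarrow> 'u set \<Rightarrow> 'u set \<Rightarrow> bool" where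
  "free_over L M Y Z X \<longleftrightarrow>
     (\<forall>as. set as \<subseteq> Y \<longrightarrow> cl_dim (acl L M) (set as) X = cl_dim (acl L M) (set as) (X \<union> Z)) \<and> Y \<inter> Z = X"

text \<open>The family is required to be nonempty because the empty set, which may be algebraically
  closed, would otherwise be an empty union.\<close>

definition indecomposable :: "'u itself \<Rightarrow> ('f, 'r) language \<Rightarrow> ('f, 'r) fm set \<Rightarrow> bool" where
  "indecomposable U L T \<longleftrightarrow>
     (\<forall>M :: ('f, 'r, 'u) struct. models L T M \<longrightarrow>
        (\<forall>X \<subseteq> carrier M. acl L M X = X \<and> finite_dimensional (acl L M) X {} \<longrightarrow>
           \<not> (\<exists>\<Y>. finite \<Y> \<and> \<Y> \<noteq> {} \<and> X = \<Union>\<Y> \<and>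
                 (\<forall>Y\<in>\<Y>. cl_dim (acl L M) Y {} < cl_dim (acl L M) X {}))))"

text \<open>For \<open>M \<Turnstile> T\<^sup>\<forall>\<close>, algebraic closure is computed in models of \<open>T\<close> in which \<open>M\<close> embeds; by
  quantifier elimination the choice of the model and of the embedding does not matter.\<close>

definition ambient_closed ::
  "('f, 'r) language \<Rightarrow> ('f, 'r) fm set \<Rightarrow> ('f, 'r, 'u) struct \<Rightarrow> 'u set \<Rightarrow> bool" where
  "ambient_closed L T M X \<longleftrightarrow>
     (\<forall>(N :: ('f, 'r, 'u) struct) h. models L T N \<and> embedding L h M N \<longrightarrow> acl L N (h ` X) = h ` X)"

definition ambient_acl ::
  "('f, 'r) language \<Rightarrow> ('f, 'r) fm set \<Rightarrow> ('f, 'r, 'u) struct \<Rightarrow> 'u set \<Rightarrow> 'u set" where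
  "ambient_acl L T M A = {b \<in> carrier M. \<exists>(N :: ('f, 'r, 'u) struct) h.
     models L T N \<and> embedding L h M N \<and> h b \<in> acl L N (h ` A)}"

definition free_amalgamation :: "'u itself \<Rightarrow> ('f, 'r) language \<Rightarrow> ('f, 'r) fm set \<Rightarrow> bool" where
  "free_amalgamation U L T \<longleftrightarrow>
     (\<forall>(M0 :: ('f, 'r, 'u) struct) (M1 :: ('f, 'r, 'u) struct) (M2 :: ('f, 'r, 'u) struct) f1 f2.
        models L (universal_part U L T) M0 \<and> models L (universal_part U L T) M1 \<and>
        models L (universal_part U L T) M2 \<and> embedding L f1 M0 M1 \<and> embedding L f2 M0 M2 \<and>
        ambient_closed L T M1 (f1 ` carrier M0) \<and> ambient_closed L T M2 (f2 ` carrier M0) \<longrightarrow>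
        (\<exists>(M :: ('f, 'r, 'u) struct) g1 g2. models L T M \<and> embedding L g1 M1 M \<and> embedding L g2 M2 M \<and>
           (\<forall>x\<in>carrier M0. g1 (f1 x) = g2 (f2 x)) \<and>
           free_over L M (g1 ` carrier M1) (g2 ` carrier M2) (g1 ` f1 ` carrier M0)))"

text \<open>The relation symbols of \<open>L\<close> become \<open>Some r\<close>, and \<open>None\<close> is the new unary predicate \<open>p\<close>.\<close>

definition colored_language :: "('f, 'r) language \<Rightarrow> ('f, 'r option) language" where
  "colored_language L = \<lparr> funs = funs L, farity = farity L,
     rels = insert None (Some ` rels L), rarity = case_option 1 (rarity L) \<rparr>"

definition reduct :: "('f, 'r option, 'u) struct \<Rightarrow> ('f, 'r, 'u) struct" where
  "reduct M = \<lparr> carrier = carrier M, fint = fint M, rint = (\<lambda>r. rint M (Some r)) \<rparr>"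

definition colored :: "('f, 'r option, 'u) struct \<Rightarrow> 'u set" where
  "colored M = {a \<in> carrier M. rint M None [a]}"

definition K_class :: "('f, 'r) language \<Rightarrow> ('f, 'r) fm set \<Rightarrow> ('f, 'r option, 'u) struct \<Rightarrow> bool" where
  "K_class L T M \<longleftrightarrow> is_structure (colored_language L) M \<and>
     models L (universal_part TYPE('u) L T) (reduct M)"

definition kdim ::
  "('f, 'r) language \<Rightarrow> ('f, 'r) fm set \<Rightarrow> ('f, 'r option, 'u) struct \<Rightarrow> 'u set \<Rightarrow> 'u set \<Rightarrow> nat" where
  "kdim L T M A X = cl_dim (ambient_acl L T (reduct M)) A X"

definition predim ::
  "('f, 'r) language \<Rightarrow> ('f, 'r) fm set \<Rightarrow> real \<Rightarrow> ('f, 'r option, 'u) struct \<Rightarrow> 'u set \<Rightarrow> 'u set \<Rightarrow> real"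
  where
  "predim L T \<alpha> M A X = real (kdim L T M A X) - \<alpha> * real (card (colored M \<inter> (A - X)))"

definition K_plus ::
  "('f, 'r) language \<Rightarrow> ('f, 'r) fm set \<Rightarrow> real \<Rightarrow> ('f, 'r option, 'u) struct \<Rightarrow> bool" where
  "K_plus L T \<alpha> M \<longleftrightarrow> K_class L T M \<and>
     (\<forall>A. finite A \<and> A \<subseteq> carrier M \<longrightarrow> predim L T \<alpha> M A {} \<ge> 0)"

definition self_sufficient ::
  "('f, 'r) language \<Rightarrow> ('f, 'r) fm set \<Rightarrow> real \<Rightarrow> ('f, 'r option, 'u) struct \<Rightarrow> 'u set \<Rightarrow> 'u set \<Rightarrow> bool"
  where
  "self_sufficient L T \<alpha> M X Y \<longleftrightarrow> X \<subseteq> Y \<and>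
     (\<forall>A. finite A \<and> A \<subseteq> Y \<longrightarrow> predim L T \<alpha> M A X \<ge> 0)"

definition transcendental ::
  "('f, 'r) language \<Rightarrow> ('f, 'r) fm set \<Rightarrow> ('f, 'r option, 'u) struct \<Rightarrow> 'u list \<Rightarrow> 'u list \<Rightarrow> bool" where
  "transcendental L T M ds as \<longleftrightarrow>
     (\<forall>d\<in>set ds. d \<notin> set as \<longrightarrow> kdim L T M {d} (set as) = 1)"

text \<open>In \<open>\<phi>(x, y)\<close> the variables \<open>x\<close> come first.  A partition of \<open>x\<close> is given by the set \<open>S\<close> of
  the positions of \<open>x\<^sub>1\<close>; the positions of \<open>x\<^sub>2\<close> are the others.\<close>

definition strong_formula ::
  "('f, 'r) language \<Rightarrow> ('f, 'r) fm set \<Rightarrow> ('f, 'r option, 'u) struct \<Rightarrow> 'u list \<Rightarrow> 'u list \<Rightarrow>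
   ('f, 'r) fm \<Rightarrow> bool" where
  "strong_formula L T N ds as \<phi> \<longleftrightarrow>
     distinct (ds @ as) \<and>
     formula L (length ds + length as) \<phi> \<and> qfree \<phi> \<and> sat_at (reduct N) \<phi> (ds @ as) \<and>
     (\<forall>M :: ('f, 'r, 'u) struct. monster L T M \<longrightarrow>
        (\<forall>ds'\<in>tuples M (length ds). \<forall>as'\<in>tuples M (length as). sat_at M \<phi> (ds' @ as') \<longrightarrow>
           distinct (ds' @ as') \<and>
           (cl_dim (acl L M) (set ds') (set as') = kdim L T N (set ds) (set as) \<longrightarrow>
             (\<forall>S \<subseteq> {..<length ds}.
                cl_dim (acl L M) (set (nths ds' (- S))) (set (nths ds' S) \<union> set as')
                \<le> kdim L T N (set (nths ds (- S))) (set (nths ds S) \<union> set as)))))"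

definition defines_max_dim ::
  "'u itself \<Rightarrow> ('f, 'r) language \<Rightarrow> ('f, 'r) fm set \<Rightarrow> nat \<Rightarrow> nat \<Rightarrow> ('f, 'r) fm \<Rightarrow> nat \<Rightarrow>
   ('f, 'r) fm \<Rightarrow> bool" where
  "defines_max_dim U L T n m \<phi> k \<theta> \<longleftrightarrow> formula L m \<theta> \<and>
     (\<forall>M :: ('f, 'r, 'u) struct. monster L T M \<longrightarrow>
        (\<forall>bs\<in>tuples M m. sat_at M \<theta> bs \<longleftrightarrow>
           (\<exists>es\<in>tuples M n. sat_at M \<phi> (es @ bs) \<and> cl_dim (acl L M) (set es) (set bs) = k) \<and>
           (\<forall>es\<in>tuples M n. sat_at M \<phi> (es @ bs) \<longrightarrow> cl_dim (acl L M) (set es) (set bs) \<le> k)))"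

definition defines_nonalgebraic_dim ::
  "'u itself \<Rightarrow> ('f, 'r) language \<Rightarrow> ('f, 'r) fm set \<Rightarrow> nat \<Rightarrow> nat \<Rightarrow> ('f, 'r) fm \<Rightarrow> nat \<Rightarrow>
   ('f, 'r) fm \<Rightarrow> bool" where
  "defines_nonalgebraic_dim U L T n m \<phi> k \<theta> \<longleftrightarrow> formula L m \<theta> \<and>
     (\<forall>M :: ('f, 'r, 'u) struct. monster L T M \<longrightarrow>
        (\<forall>bs\<in>tuples M m. sat_at M \<theta> bs \<longleftrightarrow>
           (\<exists>es\<in>tuples M n. sat_at M \<phi> (es @ bs) \<and> cl_dim (acl L M) (set es) (set bs) \<ge> k \<and>
              set es \<inter> acl L M (set bs) = {})))"

text \<open>In the extension axioms, \<open>\<theta>d\<close> and \<open>\<theta>D\<close> range over all formulas defining the sets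
  \<open>d\<^sub>\<phi>\<^sub>k\<close> and \<open>D\<^sub>\<phi>\<^sub>k\<close> in saturated models; any two choices are equivalent modulo \<open>T\<close>.\<close>

definition T_alpha_model ::
  "('f, 'r) language \<Rightarrow> ('f, 'r) fm set \<Rightarrow> real \<Rightarrow> ('f, 'r option, 'u) struct \<Rightarrow> bool" where
  "T_alpha_model L T \<alpha> M \<longleftrightarrow> models L T (reduct M) \<and> K_plus L T \<alpha> M \<and>
     (\<forall>(N :: ('f, 'r option, 'u) struct) as ds k \<phi> \<theta>d \<theta>D.
        K_plus L T \<alpha> N \<and> set as \<subseteq> carrier N \<and> set ds \<subseteq> carrier N \<and>
        self_sufficient L T \<alpha> N (set as) (set as \<union> set ds) \<and>
        transcendental L T N ds as \<and>
        kdim L T N (set ds) (set as) = k \<and>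
        strong_formula L T N ds as \<phi> \<and>
        defines_max_dim TYPE('u) L T (length ds) (length as) \<phi> k \<theta>d \<and>
        defines_nonalgebraic_dim TYPE('u) L T (length ds) (length as) \<phi> k \<theta>D \<longrightarrow>
        (\<forall>bs\<in>tuples M (length as).
           sat_at (reduct M) \<theta>D bs \<and> sat_at (reduct M) \<theta>d bs \<longrightarrow>
           (\<exists>es\<in>tuples M (length ds). sat_at (reduct M) \<phi> (es @ bs) \<and>
              (\<forall>i<length ds. es ! i \<in> colored M \<longleftrightarrow> ds ! i \<in> colored N))))"

definition T_alpha ::
  "'u itself \<Rightarrow> ('f, 'r) language \<Rightarrow> ('f, 'r) fm set \<Rightarrow> real \<Rightarrow> ('f, 'r option) fm set" where
  "T_alpha U L T \<alpha> = {\<sigma>. sentence (colored_language L) \<sigma> \<and>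
     (\<forall>M :: ('f, 'r option, 'u) struct. T_alpha_model L T \<alpha> M \<longrightarrow> sat_at M \<sigma> [])}"

definition has_IP :: "('f, 'r, 'u) struct \<Rightarrow> nat \<Rightarrow> nat \<Rightarrow> ('f, 'r) fm \<Rightarrow> bool" where
  "has_IP M n m \<phi> \<longleftrightarrow> (\<exists>(a :: nat \<Rightarrow> 'u list) (b :: nat set \<Rightarrow> 'u list).
     (\<forall>i. a i \<in> tuples M n) \<and> (\<forall>S. b S \<in> tuples M m) \<and>
     (\<forall>i S. sat_at M \<phi> (a i @ b S) \<longleftrightarrow> i \<in> S))"

definition NIP :: "'u itself \<Rightarrow> ('f, 'r) language \<Rightarrow> ('f, 'r) fm set \<Rightarrow> bool" where
  "NIP U L T \<longleftrightarrow> (\<forall>M :: ('f, 'r, 'u) struct. monster L T M \<longrightarrow>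
     (\<forall>n m \<phi>. formula L (n + m) \<phi> \<longrightarrow> \<not> has_IP M n m \<phi>))"

definition indiscernible ::
  "('f, 'r) language \<Rightarrow> ('f, 'r, 'u) struct \<Rightarrow> 'u set \<Rightarrow> (nat \<Rightarrow> 'u list) \<Rightarrow> bool" where
  "indiscernible L M A I \<longleftrightarrow> (\<exists>n. range I \<subseteq> tuples M n) \<and>
     (\<forall>\<phi> as is js. set as \<subseteq> A \<and> sorted_wrt (<) is \<and> sorted_wrt (<) js \<and> length is = length js \<and>
        formula L (length (concat (map I is)) + length as) \<phi> \<longrightarrow>
        (sat_at M \<phi> (concat (map I is) @ as) \<longleftrightarrow> sat_at M \<phi> (concat (map I js) @ as)))"

definition mutually_indiscernible ::
  "('f, 'r) language \<Rightarrow> ('f, 'r, 'u) struct \<Rightarrow> 'u set \<Rightarrow> 'k set \<Rightarrow> ('k \<Rightarrow> nat \<Rightarrow> 'u list) \<Rightarrow> bool" where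
  "mutually_indiscernible L M A X I \<longleftrightarrow>
     (\<forall>t\<in>X. indiscernible L M (A \<union> (\<Union>s\<in>X - {t}. \<Union>i. set (I s i))) (I t))"

text \<open>\<open>dp_rank_less L M n \<Sigma> A X\<close>: the dp-rank of the partial type \<open>\<Sigma>\<close> in \<open>n\<close> variables over \<open>A\<close> is
  less than the cardinality of \<open>X\<close>.\<close>

definition dp_rank_less ::
  "('f, 'r) language \<Rightarrow> ('f, 'r, 'u) struct \<Rightarrow> nat \<Rightarrow> (('f, 'r) fm \<times> 'u list) set \<Rightarrow> 'u set \<Rightarrow>
   'k set \<Rightarrow> bool" where
  "dp_rank_less L M n \<Sigma> A X \<longleftrightarrow>
     (\<forall>I bs. mutually_indiscernible L M A X I \<and> realizes M n \<Sigma> bs \<longrightarrow>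
        (\<exists>t\<in>X. indiscernible L M (A \<union> set bs) (I t)))"

definition strongly_dependent :: "'u itself \<Rightarrow> ('f, 'r) language \<Rightarrow> ('f, 'r) fm set \<Rightarrow> bool" where
  "strongly_dependent U L T \<longleftrightarrow> NIP U L T \<and>
     (\<forall>M :: ('f, 'r, 'u) struct. monster L T M \<longrightarrow>
        (\<forall>n. dp_rank_less L M n {(Equal (Var i) (Var i), []) | i. i < n} {} (UNIV :: nat set)))"

end

theory Submission
  imports Defs "HOL-Library.Ramsey"
begin

text \<open>Let \<open>\<alpha> = p / q\<close> and scale the predimension to \<open>\<delta>(Z) = q dim(Z) - p |Z \<inter> C|\<close>, where \<open>C\<close> is the set of
  colored elements.  It takes values in the natural numbers, so every finite set has a finite superset
  of least predimension \<open>d(Z)\<close>, and a finite set is closed if \<open>\<delta> = d\<close>.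

  In a saturated model of the colored theory, the type of a closed finite tuple is determined by its
  \<open>L\<close>-type and its colors.  This is a back-and-forth argument.  To extend a map to a closed set \<open>Y \<supseteq> X\<close>
  one adds to \<open>Y\<close> many colored points in general position (they exist by indecomposability) until the
  predimension over \<open>X\<close> is exactly \<open>0\<close>.  The extension axioms then produce an image which is
  automatically closed, and by general position no small set can witness that the image of \<open>Y\<close> is not.

  Now let \<open>I\<close> be a mutually indiscernible array and \<open>b\<close> a finite tuple such that no row is indiscernible over
  \<open>b\<close>; cutting the rows into blocks, the first two entries of each row have different types over \<open>b\<close>.
  Choose a finite set \<open>F\<close> of entries minimizing \<open>d(F b) - d(F)\<close>, and let \<open>E\<close> be a closed hull of \<open>F b\<close>.
  By submodularity, \<open>E\<close> together with a closed hull of \<open>F I\<^sub>t(i)\<close> is closed for every \<open>t\<close> and \<open>i\<close>.  The hulls of the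
  \<open>F I\<^sub>t(i)\<close> can be enumerated so that they form mutually indiscernible sequences again.  Since \<open>T\<close> is strongly dependent,
  one of these is \<open>L\<close>-indiscernible over \<open>E\<close>, so the first two entries of that row have the same colored
  type over \<open>b\<close>, a contradiction.  Finally, NIP follows from the finiteness of the dp-rank.\<close>

section \<open>First-order logic and saturation\<close>

text \<open>The extension axioms control a solution only from above: a strong formula bounds all
  relative dimensions, and nothing in it asks that the solution be self-sufficient. Closedness of
  the image therefore has to be forced. If the added part has predimension exactly 0 over X, the
  closed image of X supplies the missing lower bound on the rank, because a smaller rank would make
  the predimension over it negative. Exactness means solving p * (colored points) = q * (dimension)
  in natural numbers. That is one place where rationality of \<alpha> enters; the other is that
  minima of the predimension, and of its increments in the last argument, are attained. Saturation
  over countable sets does not provide automorphisms. Hulls are moved by elementary maps that are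
  extended to one countable set at a time, and uniformity along a row is then recovered by
  compactness and a product Ramsey theorem. Moreover, the saturated model is only known to satisfy
  the sentences true in the axiomatized class, so every use of an axiom or of nonnegativity passes
  through a sentence.\<close>

lemma val_cong: "(\<And>x. x \<in> fv_tm t \<Longrightarrow> s x = s' x) \<Longrightarrow> val M s t = val M s' t"
proof (induction t)
  case (App f ts)
  have "map (val M s) ts = map (val M s') ts"
    using App by auto
  then show ?case by (metis val.simps(2))
qed simp

lemma sat_cong: "(\<And>x. x \<in> fv \<phi> \<Longrightarrow> s x = s' x) \<Longrightarrow> sat M s \<phi> \<longleftrightarrow> sat M s' \<phi>"
proof (induction \<phi> arbitrary: s s')
  case (Equal t u)
  then have "val M s t = val M s' t" "val M s u = val M s' u" by (auto intro!: val_cong)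
  then show ?case by simp
next
  case (Rel r ts)
  then have "map (val M s) ts = map (val M s') ts" by (auto intro!: val_cong)
  then show ?case by (metis sat.simps(3))
next
  case (Imp \<phi> \<psi>)
  then show ?case by (metis UnCI fv.simps(4) sat.simps(4))
next
  case (All x \<phi>)
  have "sat M (s(x := a)) \<phi> \<longleftrightarrow> sat M (s'(x := a)) \<phi>" for a
    using All.prems by (intro All.IH) auto
  then show ?case by simp
qed simp

lemma finite_fv_tm [simp]: "finite (fv_tm t)"
  by (induction t) auto

lemma finite_fv [simp]: "finite (fv \<phi>)"
  by (induction \<phi>) auto

lemma val_closed:
  assumes "is_structure L M" "wf_tm L t" "\<And>x. x \<in> fv_tm t \<Longrightarrow> s x \<in> carrier M"
  shows "val M s t \<in> carrier M"
  using assms(2,3)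
proof (induction t)
  case (App f ts)
  have "val M s t \<in> carrier M" if "t \<in> set ts" for t
    using App.prems that by (intro App.IH) auto
  then have "map (val M s) ts \<in> lists (carrier M)" "length (map (val M s) ts) = farity L f" "f \<in> funs L"
    using App.prems by auto
  then show ?case using assms(1) unfolding is_structure_def by auto
qed simp

section \<open>Derived connectives, renaming and substitution of variables\<close>

definition And :: "('f, 'r) fm \<Rightarrow> ('f, 'r) fm \<Rightarrow> ('f, 'r) fm" where
  "And \<phi> \<psi> = Neg (Imp \<phi> (Neg \<psi>))"

definition Ex :: "nat \<Rightarrow> ('f, 'r) fm \<Rightarrow> ('f, 'r) fm" where
  "Ex x \<phi> = Neg (All x (Neg \<phi>))"

definition ConjL :: "('f, 'r) fm list \<Rightarrow> ('f, 'r) fm" where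
  "ConjL \<phi>s = foldr And \<phi>s (Neg Falsum)"

definition ExL :: "nat list \<Rightarrow> ('f, 'r) fm \<Rightarrow> ('f, 'r) fm" where
  "ExL xs \<phi> = foldr Ex xs \<phi>"

definition AllL :: "nat list \<Rightarrow> ('f, 'r) fm \<Rightarrow> ('f, 'r) fm" where
  "AllL xs \<phi> = foldr All xs \<phi>"

lemma And_simps [simp]:
  "sat M s (And \<phi> \<psi>) \<longleftrightarrow> sat M s \<phi> \<and> sat M s \<psi>"
  "wf_fm L (And \<phi> \<psi>) \<longleftrightarrow> wf_fm L \<phi> \<and> wf_fm L \<psi>"
  "fv (And \<phi> \<psi>) = fv \<phi> \<union> fv \<psi>"
  by (auto simp: And_def)

lemma Ex_simps [simp]:
  "sat M s (Ex x \<phi>) \<longleftrightarrow> (\<exists>a\<in>carrier M. sat M (s(x := a)) \<phi>)"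
  "wf_fm L (Ex x \<phi>) \<longleftrightarrow> wf_fm L \<phi>"
  "fv (Ex x \<phi>) = fv \<phi> - {x}"
  by (auto simp: Ex_def)

lemma ConjL_simps [simp]:
  "sat M s (ConjL \<phi>s) \<longleftrightarrow> (\<forall>\<phi>\<in>set \<phi>s. sat M s \<phi>)"
  "wf_fm L (ConjL \<phi>s) \<longleftrightarrow> (\<forall>\<phi>\<in>set \<phi>s. wf_fm L \<phi>)"
  "fv (ConjL \<phi>s) = (\<Union>\<phi>\<in>set \<phi>s. fv \<phi>)"
  by (induction \<phi>s) (auto simp: ConjL_def)

lemma sat_ExL:
  "sat M s (ExL xs \<phi>) \<longleftrightarrow>
     (\<exists>s'. (\<forall>x. x \<notin> set xs \<longrightarrow> s' x = s x) \<and> (\<forall>x\<in>set xs. s' x \<in> carrier M) \<and> sat M s' \<phi>)"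
proof (induction xs arbitrary: s)
  case Nil
  have "(\<forall>x. s' x = s x) \<longleftrightarrow> s' = s" for s' by (simp add: fun_eq_iff)
  then show ?case by (simp add: ExL_def)
next
  case (Cons y ys)
  have "sat M s (ExL (y # ys) \<phi>) \<longleftrightarrow> (\<exists>a\<in>carrier M. sat M (s(y := a)) (ExL ys \<phi>))"
    by (simp add: ExL_def)
  also have "\<dots> \<longleftrightarrow> (\<exists>s'. (\<forall>x. x \<notin> set (y # ys) \<longrightarrow> s' x = s x) \<and> (\<forall>x\<in>set (y # ys). s' x \<in> carrier M) \<and> sat M s' \<phi>)"
    (is "?l \<longleftrightarrow> ?r")
  proof
    assume ?l
    then obtain a s' where s': "a \<in> carrier M" "\<forall>x. x \<notin> set ys \<longrightarrow> s' x = (s(y := a)) x"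
      "\<forall>x\<in>set ys. s' x \<in> carrier M" "sat M s' \<phi>"
      using Cons.IH by blast
    then have "s' y \<in> carrier M" by (cases "y \<in> set ys") auto
    then show ?r using s' by (intro exI[of _ s']) simp
  next
    assume ?r
    then obtain s' where s': "\<forall>x. x \<notin> set (y # ys) \<longrightarrow> s' x = s x" "\<forall>x\<in>set (y # ys). s' x \<in> carrier M" "sat M s' \<phi>"
      by blast
    then have "sat M (s(y := s' y)) (ExL ys \<phi>)"
      unfolding Cons.IH by (intro exI[of _ s']) auto
    then show ?l using s' by auto
  qed
  finally show ?case .
qed

lemma ExL_simps [simp]:
  "wf_fm L (ExL xs \<phi>) \<longleftrightarrow> wf_fm L \<phi>"
  "fv (ExL xs \<phi>) = fv \<phi> - set xs"
  by (induction xs) (auto simp: ExL_def)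

lemma sat_AllL:
  "sat M s (AllL xs \<phi>) \<longleftrightarrow>
     (\<forall>s'. (\<forall>x. x \<notin> set xs \<longrightarrow> s' x = s x) \<and> (\<forall>x\<in>set xs. s' x \<in> carrier M) \<longrightarrow> sat M s' \<phi>)"
proof -
  have "sat M s (AllL xs \<phi>) \<longleftrightarrow> \<not> sat M s (ExL xs (Neg \<phi>))"
    by (induction xs arbitrary: s) (auto simp: AllL_def ExL_def)
  then show ?thesis unfolding sat_ExL by auto
qed

lemma AllL_simps [simp]:
  "wf_fm L (AllL xs \<phi>) \<longleftrightarrow> wf_fm L \<phi>"
  "fv (AllL xs \<phi>) = fv \<phi> - set xs"
  by (induction xs) (auto simp: AllL_def)

fun rename_tm :: "(nat \<Rightarrow> nat) \<Rightarrow> 'f tm \<Rightarrow> 'f tm" where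
  "rename_tm g (Var x) = Var (g x)"
| "rename_tm g (App f ts) = App f (map (rename_tm g) ts)"

fun rename :: "(nat \<Rightarrow> nat) \<Rightarrow> ('f, 'r) fm \<Rightarrow> ('f, 'r) fm" where
  "rename g Falsum = Falsum"
| "rename g (Equal t u) = Equal (rename_tm g t) (rename_tm g u)"
| "rename g (Rel r ts) = Rel r (map (rename_tm g) ts)"
| "rename g (Imp \<phi> \<psi>) = Imp (rename g \<phi>) (rename g \<psi>)"
| "rename g (All x \<phi>) = All (g x) (rename g \<phi>)"

lemma rename_tm_simps [simp]:
  "fv_tm (rename_tm g t) = g ` fv_tm t"
  "wf_tm L (rename_tm g t) \<longleftrightarrow> wf_tm L t"
  by (induction t) auto

lemma val_rename_tm [simp]: "val M s (rename_tm g t) = val M (s \<circ> g) t"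
proof (induction t)
  case (App f ts)
  then have "map (val M s) (map (rename_tm g) ts) = map (val M (s \<circ> g)) ts" by (auto simp: comp_def)
  then show ?case by (metis rename_tm.simps(2) val.simps(2))
qed simp

lemma wf_rename [simp]: "wf_fm L (rename g \<phi>) \<longleftrightarrow> wf_fm L \<phi>"
  by (induction \<phi>) auto

lemma fv_rename: "inj g \<Longrightarrow> fv (rename g \<phi>) = g ` fv \<phi>"
  by (induction \<phi>) (auto simp: inj_def)

text \<open>Bound variables are renamed together with the free ones, so it is injectivity of
  \<open>g\<close> that keeps the update of a bound variable from touching any other
  variable.\<close>

lemma sat_rename: "inj g \<Longrightarrow> sat M s (rename g \<phi>) \<longleftrightarrow> sat M (s \<circ> g) \<phi>"
proof (induction \<phi> arbitrary: s)
  case (Rel r ts)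
  have "map (val M s) (map (rename_tm g) ts) = map (val M (s \<circ> g)) ts" by auto
  then show ?case by (metis rename.simps(3) sat.simps(3))
next
  case (All x \<phi>)
  have "(s(g x := a)) \<circ> g = (s \<circ> g)(x := a)" for a
    using All.prems by (auto simp: inj_def fun_eq_iff)
  then show ?case using All by (simp add: comp_def)
qed auto

text \<open>Bound variables are first moved out of the way by an injective renaming, so \<open>g\<close> itself need
  not be injective.\<close>

definition subst :: "(nat \<Rightarrow> nat) \<Rightarrow> ('f, 'r) fm \<Rightarrow> ('f, 'r) fm" where
  "subst g \<phi> = (let xs = sorted_list_of_set (fv \<phi>); N = Suc (Max (insert 0 (g ` fv \<phi>))) in
     AllL (map ((+) N) xs)
       (Imp (ConjL (map (\<lambda>x. Equal (Var (N + x)) (Var (g x))) xs)) (rename ((+) N) \<phi>)))"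

lemma wf_subst [simp]: "wf_fm L (subst g \<phi>) \<longleftrightarrow> wf_fm L \<phi>"
  by (auto simp: subst_def Let_def)

lemma fv_subst: "fv (subst g \<phi>) \<subseteq> g ` fv \<phi>"
  by (auto simp: subst_def Let_def fv_rename)

text \<open>The fresh copies of the variables lie above all \<open>g x\<close> and range over the
  carrier, so exactly one choice of their values satisfies the equations. If some
  \<open>s (g x)\<close> lay outside the carrier, no choice would, and the universally quantified
  implication would hold vacuously; hence the hypothesis.\<close>

lemma sat_subst:
  assumes "\<And>x. x \<in> fv \<phi> \<Longrightarrow> s (g x) \<in> carrier M"
  shows "sat M s (subst g \<phi>) \<longleftrightarrow> sat M (\<lambda>x. s (g x)) \<phi>"
proof -
  define N where "N = Suc (Max (insert 0 (g ` fv \<phi>)))"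
  have N: "g x < N" if "x \<in> fv \<phi>" for x
    using that unfolding N_def by (auto simp: less_Suc_eq_le)
  have "sat M s (subst g \<phi>) \<longleftrightarrow> (\<forall>s'. (\<forall>x. x \<notin> (+) N ` fv \<phi> \<longrightarrow> s' x = s x) \<and>
     (\<forall>x\<in>fv \<phi>. s' (N + x) \<in> carrier M) \<longrightarrow> (\<forall>x\<in>fv \<phi>. s' (N + x) = s' (g x)) \<longrightarrow> sat M (s' \<circ> (+) N) \<phi>)"
    by (simp add: subst_def Let_def N_def[symmetric] sat_AllL sat_rename)
  also have "\<dots> \<longleftrightarrow> sat M (\<lambda>x. s (g x)) \<phi>" (is "?l \<longleftrightarrow> ?r")
  proof
    assume l: ?l
    define s' where "s' y = (if y \<in> (+) N ` fv \<phi> then s (g (y - N)) else s y)" for y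
    have g: "g x \<notin> (+) N ` fv \<phi>" if "x \<in> fv \<phi>" for x
      using N[OF that] by auto
    have "sat M (s' \<circ> (+) N) \<phi>"
      using g assms by (intro l[rule_format]) (auto simp: s'_def)
    then show ?r by (rule sat_cong[THEN iffD1, rotated]) (auto simp: s'_def)
  next
    assume r: ?r
    show ?l
    proof (intro allI impI, elim conjE)
      fix s' assume s': "\<forall>x. x \<notin> (+) N ` fv \<phi> \<longrightarrow> s' x = s x" "\<forall>x\<in>fv \<phi>. s' (N + x) = s' (g x)"
      have "g x \<notin> (+) N ` fv \<phi>" if "x \<in> fv \<phi>" for x
        using N[OF that] by auto
      then show "sat M (s' \<circ> (+) N) \<phi>"
        using s' by (intro r[THEN sat_cong[THEN iffD1, rotated]]) auto
    qed
  qed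
  finally show ?thesis .
qed

section \<open>Passing between assignments and tuples\<close>

definition index_of :: "'a list \<Rightarrow> 'a \<Rightarrow> nat" where
  "index_of xs x = (LEAST i. i < length xs \<and> xs ! i = x)"

lemma index_of: "x \<in> set xs \<Longrightarrow> index_of xs x < length xs \<and> xs ! index_of xs x = x"
  unfolding index_of_def by (rule LeastI_ex) (auto simp: in_set_conv_nth)

text \<open>Algebraic closure, types and both eliminations are stated for tuples, where entry i is
  the value of variable i, whereas the arguments below use assignments with freely chosen variables.
  Each variable is replaced by its first position in \<open>xs\<close>, so repetitions in
  \<open>xs\<close> do no harm.\<close>

definition at_tuple :: "nat list \<Rightarrow> ('f, 'r) fm \<Rightarrow> ('f, 'r) fm" where
  "at_tuple xs \<phi> = subst (index_of xs) \<phi>"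

lemma formula_at_tuple:
  "wf_fm L \<phi> \<Longrightarrow> fv \<phi> \<subseteq> set xs \<Longrightarrow> length xs = n \<Longrightarrow> formula L n (at_tuple xs \<phi>)"
  unfolding formula_def at_tuple_def using fv_subst[of "index_of xs" \<phi>] index_of[of _ xs] by fastforce

lemma sat_at_tuple:
  assumes "fv \<phi> \<subseteq> set xs" "\<And>x. x \<in> set xs \<Longrightarrow> s x \<in> carrier M"
  shows "sat_at M (at_tuple xs \<phi>) (map s xs) \<longleftrightarrow> sat M s \<phi>"
proof -
  have *: "map s xs ! index_of xs x = s x" if "x \<in> fv \<phi>" for x
    using index_of[of x xs] assms(1) that by auto
  have "sat_at M (at_tuple xs \<phi>) (map s xs) \<longleftrightarrow> sat M (\<lambda>x. map s xs ! index_of xs x) \<phi>"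
    unfolding at_tuple_def by (rule sat_subst) (use * assms in auto)
  also have "\<dots> \<longleftrightarrow> sat M s \<phi>" by (rule sat_cong) (rule *)
  finally show ?thesis .
qed

section \<open>Realizing types in countably many variables\<close>

definition assignments_over :: "('f, 'r, 'u) struct \<Rightarrow> nat set \<Rightarrow> (nat \<Rightarrow> 'u) \<Rightarrow> (nat \<Rightarrow> 'u) set" where
  "assignments_over M P s0 = {s. range s \<subseteq> carrier M \<and> (\<forall>x\<in>P. s x = s0 x)}"

text \<open>The variables in \<open>P\<close> stand for parameters.\<close>

lemma saturated_assignment:
  fixes M :: "('f, 'r, 'u) struct"
  assumes sat1: "aleph1_saturated L M" and wf: "\<And>\<phi>. \<phi> \<in> \<Gamma> \<Longrightarrow> wf_fm L \<phi>"
    and fin: "\<And>\<Gamma>0. finite \<Gamma>0 \<Longrightarrow> \<Gamma>0 \<subseteq> \<Gamma> \<Longrightarrow> \<exists>s\<in>assignments_over M P s0. \<forall>\<phi>\<in>\<Gamma>0. sat M s \<phi>"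
  shows "\<exists>s\<in>assignments_over M P s0. \<forall>\<phi>\<in>\<Gamma>. sat M s \<phi>"
proof -
  \<comment> \<open>The values of \<open>s\<close> below \<open>n\<close> are regarded as final:
    each finite part of \<Gamma> is still satisfied by an assignment that agrees with them and with
    the parameters. Saturation handles one variable at a time, so this invariant is carried from
    \<open>n\<close> to \<open>Suc n\<close>.\<close>
  define good where "good n s \<longleftrightarrow> range s \<subseteq> carrier M \<and>
    (\<forall>\<Gamma>0. finite \<Gamma>0 \<longrightarrow> \<Gamma>0 \<subseteq> \<Gamma> \<longrightarrow> (\<exists>s'\<in>assignments_over M (P \<union> {..<n}) s. \<forall>\<phi>\<in>\<Gamma>0. sat M s' \<phi>))" for n s
  have step: "\<exists>s'. good (Suc n) s' \<and> (\<forall>x\<in>P \<union> {..<n}. s' x = s x)" if g: "good n s" for n s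
  proof (cases "n \<in> P")
    case True
    then have "P \<union> {..<Suc n} = P \<union> {..<n}" by (auto simp: less_Suc_eq)
    then show ?thesis using g unfolding good_def by (intro exI[of _ s]) auto
  next
    case False
    define Q where "Q = P \<union> {..<n}"
    have nQ: "n \<notin> Q" using False by (auto simp: Q_def)
    have sc: "s x \<in> carrier M" for x using g unfolding good_def by auto
    define xs where "xs \<Gamma>0 = sorted_list_of_set ((\<Union>\<phi>\<in>\<Gamma>0. fv \<phi>) \<inter> Q)" for \<Gamma>0 :: "('f, 'r) fm set"
    define c where "c \<Gamma>0 = (SOME l. set l = \<Gamma>0)" for \<Gamma>0 :: "('f, 'r) fm set"
    have c: "set (c \<Gamma>0) = \<Gamma>0" if "finite \<Gamma>0" for \<Gamma>0
      unfolding c_def by (rule someI_ex) (rule finite_list[OF that])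
    \<comment> \<open>For a finite part of \<Gamma>, all variables that are neither fixed already
      nor equal to \<open>n\<close> are quantified away. What remains is a formula about
      \<open>n\<close> with the values of \<open>s\<close> on \<open>Q\<close> as
      parameters.\<close>
    define e where "e \<Gamma>0 = ExL (sorted_list_of_set ((\<Union>\<phi>\<in>\<Gamma>0. fv \<phi>) - Q - {n})) (ConjL (c \<Gamma>0))" for \<Gamma>0
    have fve: "fv (e \<Gamma>0) \<subseteq> set (n # xs \<Gamma>0)" if "finite \<Gamma>0" for \<Gamma>0
      using that by (auto simp: e_def xs_def c)
    have sate: "sat M (s(n := b)) (e \<Gamma>0) \<longleftrightarrow>
        (\<exists>s'\<in>assignments_over M (Q \<union> {n}) (s(n := b)). \<forall>\<phi>\<in>\<Gamma>0. sat M s' \<phi>)"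
      if fb: "finite \<Gamma>0" "b \<in> carrier M" for \<Gamma>0 b
    proof
      assume "sat M (s(n := b)) (e \<Gamma>0)"
      then obtain s' where s': "\<forall>x. x \<notin> (\<Union>\<phi>\<in>\<Gamma>0. fv \<phi>) - Q - {n} \<longrightarrow> s' x = (s(n := b)) x"
        "\<forall>x\<in>(\<Union>\<phi>\<in>\<Gamma>0. fv \<phi>) - Q - {n}. s' x \<in> carrier M" "\<forall>\<phi>\<in>\<Gamma>0. sat M s' \<phi>"
        unfolding e_def sat_ExL ConjL_simps c[OF fb(1)]
          set_sorted_list_of_set[OF finite_Diff[OF finite_Diff[OF finite_UN_I[OF fb(1) finite_fv]]]]
        by blast
      have "s' x \<in> carrier M" for x
        using s'(1,2) sc that by (cases "x \<in> (\<Union>\<phi>\<in>\<Gamma>0. fv \<phi>) - Q - {n}") auto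
      then have "s' \<in> assignments_over M (Q \<union> {n}) (s(n := b))"
        unfolding assignments_over_def using s'(1) by auto
      then show "\<exists>s'\<in>assignments_over M (Q \<union> {n}) (s(n := b)). \<forall>\<phi>\<in>\<Gamma>0. sat M s' \<phi>"
        using s'(3) by blast
    next
      assume "\<exists>s'\<in>assignments_over M (Q \<union> {n}) (s(n := b)). \<forall>\<phi>\<in>\<Gamma>0. sat M s' \<phi>"
      then obtain s' where s': "range s' \<subseteq> carrier M" "\<forall>x\<in>Q \<union> {n}. s' x = (s(n := b)) x" "\<forall>\<phi>\<in>\<Gamma>0. sat M s' \<phi>"
        unfolding assignments_over_def by auto
      define V where "V = (\<Union>\<phi>\<in>\<Gamma>0. fv \<phi>)"
      define s'' where "s'' x = (if x \<in> V - Q - {n} then s' x else (s(n := b)) x)" for x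
      have "\<forall>\<phi>\<in>\<Gamma>0. sat M s'' \<phi>"
      proof
        fix \<phi> assume \<phi>: "\<phi> \<in> \<Gamma>0"
        show "sat M s'' \<phi>"
          using s'(3)[rule_format, OF \<phi>] by (rule sat_cong[THEN iffD1, rotated])
            (use \<phi> s'(2) in \<open>auto simp: s''_def V_def\<close>)
      qed
      then show "sat M (s(n := b)) (e \<Gamma>0)"
        unfolding e_def sat_ExL using s'(1) that
        by (intro exI[of _ s'']) (auto simp: c s''_def V_def)
    qed
    \<comment> \<open>One formula for each finite part of \<Gamma>, all in the single variable
      \<open>n\<close>. Finitely many of them come from finitely many finite parts, whose union is
      again a finite part of \<Gamma>; this gives finite satisfiability.\<close>
    define \<Sigma> where "\<Sigma> = (\<lambda>\<Gamma>0. (at_tuple (n # xs \<Gamma>0) (e \<Gamma>0), map s (xs \<Gamma>0))) ` {\<Gamma>0. finite \<Gamma>0 \<and> \<Gamma>0 \<subseteq> \<Gamma>}"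
    have real: "realizes M 1 ((\<lambda>\<Gamma>0. (at_tuple (n # xs \<Gamma>0) (e \<Gamma>0), map s (xs \<Gamma>0))) ` G) bs \<longleftrightarrow>
      (\<exists>b\<in>carrier M. bs = [b] \<and> (\<forall>\<Gamma>0\<in>G. sat M (s(n := b)) (e \<Gamma>0)))"
      if G: "\<And>\<Gamma>0. \<Gamma>0 \<in> G \<Longrightarrow> finite \<Gamma>0" for G bs
    proof -
      have *: "sat_at M (at_tuple (n # xs \<Gamma>0) (e \<Gamma>0)) (b # map s (xs \<Gamma>0)) \<longleftrightarrow> sat M (s(n := b)) (e \<Gamma>0)"
        if "\<Gamma>0 \<in> G" "b \<in> carrier M" for \<Gamma>0 b
      proof -
        have "n \<notin> set (xs \<Gamma>0)" using nQ G[OF that(1)] by (auto simp: xs_def)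
        then have eq: "b # map s (xs \<Gamma>0) = map (s(n := b)) (n # xs \<Gamma>0)" by auto
        show ?thesis
          unfolding eq by (rule sat_at_tuple[OF fve[OF G[OF that(1)]]]) (use that(2) sc in auto)
      qed
      show ?thesis
        unfolding realizes_def tuples_def by (auto simp: length_Suc_conv *)
    qed
    have "\<exists>bs. realizes M 1 \<Sigma> bs"
    proof (rule sat1[unfolded aleph1_saturated_def, rule_format], intro conjI allI impI)
      show "countable (range s)" "range s \<subseteq> carrier M" using sc by auto
      have "formula L (Suc (length (xs \<Gamma>0))) (at_tuple (n # xs \<Gamma>0) (e \<Gamma>0))"
        if "finite \<Gamma>0" "\<Gamma>0 \<subseteq> \<Gamma>" for \<Gamma>0
        by (rule formula_at_tuple) (use that fve wf in \<open>auto simp: e_def c\<close>)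
      then show "partial_type L 1 (range s) \<Sigma>"
        unfolding partial_type_def \<Sigma>_def by auto
      fix \<Sigma>0 assume "finite \<Sigma>0 \<and> \<Sigma>0 \<subseteq> \<Sigma>"
      then obtain G where G: "finite G" "G \<subseteq> {\<Gamma>0. finite \<Gamma>0 \<and> \<Gamma>0 \<subseteq> \<Gamma>}"
        "\<Sigma>0 = (\<lambda>\<Gamma>0. (at_tuple (n # xs \<Gamma>0) (e \<Gamma>0), map s (xs \<Gamma>0))) ` G"
        unfolding \<Sigma>_def by (metis (no_types, lifting) finite_subset_image)
      obtain s' where s': "s' \<in> assignments_over M Q s" "\<forall>\<phi>\<in>\<Union>G. sat M s' \<phi>"
        using g G(1,2) unfolding good_def Q_def by (auto dest!: spec[of _ "\<Union>G"])
      have "sat M (s(n := s' n)) (e \<Gamma>0)" if "\<Gamma>0 \<in> G" for \<Gamma>0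
      proof -
        have "finite \<Gamma>0" "s' n \<in> carrier M" using that G s'(1) by (auto simp: assignments_over_def)
        then show ?thesis unfolding sate[OF \<open>finite \<Gamma>0\<close> \<open>s' n \<in> carrier M\<close>]
          using s' that by (intro bexI[of _ s']) (auto simp: assignments_over_def)
      qed
      moreover have "s' n \<in> carrier M" using s'(1) by (auto simp: assignments_over_def)
      ultimately have "realizes M 1 \<Sigma>0 [s' n]"
        unfolding G(3) using G(2) by (subst real) auto
      then show "\<exists>bs. realizes M 1 \<Sigma>0 bs" by blast
    qed
    then obtain b where b: "b \<in> carrier M" "\<And>\<Gamma>0. finite \<Gamma>0 \<Longrightarrow> \<Gamma>0 \<subseteq> \<Gamma> \<Longrightarrow> sat M (s(n := b)) (e \<Gamma>0)"
      unfolding \<Sigma>_def by (subst (asm) real) auto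
    have "P \<union> {..<Suc n} = Q \<union> {n}" by (auto simp: Q_def less_Suc_eq)
    then have "good (Suc n) (s(n := b))"
      unfolding good_def using b sate[OF _ b(1)] sc by auto
    then show ?thesis using nQ by (intro exI[of _ "s(n := b)"]) (auto simp: Q_def)
  qed
  obtain s00 where "s00 \<in> assignments_over M P s0" using fin[of "{}"] by auto
  have "good 0 s00"
  proof -
    have "assignments_over M P s0 = assignments_over M P s00"
      using \<open>s00 \<in> _\<close> by (auto simp: assignments_over_def)
    then show ?thesis using fin \<open>s00 \<in> _\<close> unfolding good_def by (auto simp: assignments_over_def)
  qed
  obtain S where S: "S 0 = s00" "\<And>n. good n (S n)" "\<And>n x. x \<in> P \<union> {..<n} \<Longrightarrow> S (Suc n) x = S n x"
  proof -
    have "\<exists>S. \<forall>n. (good n (S n) \<and> (n = 0 \<longrightarrow> S n = s00)) \<and> (\<forall>x\<in>P \<union> {..<n}. S (Suc n) x = S n x)"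
    proof (rule dependent_nat_choice)
      show "\<exists>x. good 0 x \<and> (0 = 0 \<longrightarrow> x = s00)" for n :: nat using \<open>good 0 s00\<close> by auto
      show "\<exists>y. (good (Suc n) y \<and> (Suc n = 0 \<longrightarrow> y = s00)) \<and> (\<forall>x\<in>P \<union> {..<n}. y x = s x)"
        if "good n s \<and> (n = 0 \<longrightarrow> s = s00)" for s n
        using step[of n s] that by auto
    qed
    then show thesis using that by metis
  qed
  have stable: "S (n + k) x = S n x" if "x \<in> P \<union> {..<n}" for n k x
    by (induction k) (use S(3) that in auto)
  \<comment> \<open>From stage \<open>Suc x\<close> on the value at \<open>x\<close> no longer
    changes, so the limit reads it there.\<close>
  define s where "s x = S (Suc x) x" for x
  have s: "s x = S n x" if "x \<in> P \<union> {..<n}" for x n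
  proof -
    have "S (n + Suc x) x = S n x" by (rule stable) (use that in auto)
    moreover have "S (Suc x + n) x = S (Suc x) x" by (rule stable) auto
    ultimately show ?thesis by (simp add: s_def add.commute)
  qed
  have "s \<in> assignments_over M P s0"
  proof -
    have "s x \<in> carrier M" for x using S(2)[of "Suc x"] unfolding s_def good_def by auto
    moreover have "s x = s0 x" if "x \<in> P" for x
      using s[of x 0] that S(1) \<open>s00 \<in> _\<close> by (auto simp: assignments_over_def)
    ultimately show ?thesis by (auto simp: assignments_over_def)
  qed
  moreover have "sat M s \<phi>" if "\<phi> \<in> \<Gamma>" for \<phi>
  proof -
    define n where "n = Suc (Max (insert 0 (fv \<phi>)))"
    have n: "x < n" if "x \<in> fv \<phi>" for x using that by (auto simp: n_def less_Suc_eq_le)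
    obtain s' where s': "s' \<in> assignments_over M (P \<union> {..<n}) (S n)" "sat M s' \<phi>"
      using S(2)[of n, unfolded good_def, THEN conjunct2, rule_format, of "{\<phi>}"] \<open>\<phi> \<in> \<Gamma>\<close> by auto
    show ?thesis using s'(2) by (rule sat_cong[THEN iffD1, rotated])
        (use s'(1) n s[of _ n] in \<open>auto simp: assignments_over_def\<close>)
  qed
  ultimately show ?thesis by blast
qed

section \<open>Pregeometries\<close>

locale pregeometry =
  fixes C :: "'a set" and cl :: "'a set \<Rightarrow> 'a set"
  assumes cl_extensive: "A \<subseteq> C \<Longrightarrow> A \<subseteq> cl A"
    and cl_closed: "A \<subseteq> C \<Longrightarrow> cl A \<subseteq> C"
    and cl_mono: "A \<subseteq> B \<Longrightarrow> B \<subseteq> C \<Longrightarrow> cl A \<subseteq> cl B"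
    and cl_idem: "A \<subseteq> C \<Longrightarrow> cl (cl A) = cl A"
    and cl_finitary: "A \<subseteq> C \<Longrightarrow> b \<in> cl A \<Longrightarrow> \<exists>A0\<subseteq>A. finite A0 \<and> b \<in> cl A0"
    and cl_exchange: "A \<subseteq> C \<Longrightarrow> a \<in> C \<Longrightarrow> b \<in> C \<Longrightarrow> a \<in> cl (insert b A) \<Longrightarrow> a \<notin> cl A \<Longrightarrow> b \<in> cl (insert a A)"
begin

definition indep :: "'a set \<Rightarrow> 'a set \<Rightarrow> bool" where
  "indep X B \<longleftrightarrow> (\<forall>b\<in>B. b \<notin> cl (X \<union> (B - {b})))"

lemma cl_least: "A \<subseteq> cl B \<Longrightarrow> B \<subseteq> C \<Longrightarrow> cl A \<subseteq> cl B"
  using cl_mono[of A "cl B"] cl_closed cl_idem by auto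

lemma indep_subset: "indep X B \<Longrightarrow> B' \<subseteq> B \<Longrightarrow> X \<subseteq> C \<Longrightarrow> B \<subseteq> C \<Longrightarrow> indep X B'"
  unfolding indep_def
proof
  fix b assume *: "\<forall>b\<in>B. b \<notin> cl (X \<union> (B - {b}))" "B' \<subseteq> B" "X \<subseteq> C" "B \<subseteq> C" "b \<in> B'"
  then have "cl (X \<union> (B' - {b})) \<subseteq> cl (X \<union> (B - {b}))" by (intro cl_mono) auto
  then show "b \<notin> cl (X \<union> (B' - {b}))" using * by auto
qed

text \<open>If adding \<open>x\<close> made some \<open>b\<close> dependent on the rest, exchange
  would put \<open>x\<close> into the span of \<open>X\<close> and \<open>B\<close>.\<close>

lemma indep_insert:
  assumes "indep X B" "x \<notin> cl (X \<union> B)" "X \<subseteq> C" "B \<subseteq> C" "x \<in> C"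
  shows "indep X (insert x B)"
  unfolding indep_def
proof
  fix b assume b: "b \<in> insert x B"
  show "b \<notin> cl (X \<union> (insert x B - {b}))"
  proof (cases "b = x")
    case True
    then have "X \<union> (insert x B - {b}) \<subseteq> X \<union> B" by auto
    then show ?thesis using cl_mono[of "X \<union> (insert x B - {b})" "X \<union> B"] assms True by auto
  next
    case False
    show ?thesis
    proof
      assume *: "b \<in> cl (X \<union> (insert x B - {b}))"
      have eq: "X \<union> (insert x B - {b}) = insert x (X \<union> (B - {b}))" using False by auto
      have "b \<notin> cl (X \<union> (B - {b}))" using assms(1) b False by (auto simp: indep_def)
      then have "x \<in> cl (insert b (X \<union> (B - {b})))"
        using cl_exchange[of "X \<union> (B - {b})" b x] * eq assms b False by auto
      moreover have "insert b (X \<union> (B - {b})) = X \<union> B" using b False by auto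
      ultimately show False using assms(2) by simp
    qed
  qed
qed

text \<open>Induction on the number of elements of \<open>B\<close> outside \<open>S\<close>: such
  an element is exchanged for an element of \<open>S\<close> outside \<open>B\<close>, which keeps
  the size of \<open>S\<close> and loses nothing of its span. An infinite \<open>B\<close> is
  excluded by applying this to a subset with one element more than \<open>S\<close>.\<close>

lemma steinitz:
  assumes "finite S" "S \<subseteq> C" "X \<subseteq> C" "B \<subseteq> C" "indep X B" "B \<subseteq> cl (X \<union> S)"
  shows "finite B \<and> card B \<le> card S"
proof -
  have main: "card B \<le> card S"
    if "finite S" "S \<subseteq> C" "finite B" "B \<subseteq> C" "indep X B" "B \<subseteq> cl (X \<union> S)" for B S
    using that
  proof (induction "card (B - S)" arbitrary: S)
    case 0
    then show ?case by (simp add: card_mono)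
  next
    case (Suc n)
    then obtain b where b: "b \<in> B" "b \<notin> S" by (metis Diff_iff card.empty ex_in_conv nat.distinct(1))
    have nb: "b \<notin> cl (X \<union> (B - {b}))" using Suc.prems b by (auto simp: indep_def)
    have "\<exists>s\<in>S. s \<notin> cl (X \<union> (B - {b}))"
    proof (rule ccontr)
      assume "\<not> ?thesis"
      then have "X \<union> S \<subseteq> cl (X \<union> (B - {b}))"
        using cl_extensive[of "X \<union> (B - {b})"] assms(3) Suc.prems by auto
      then have "cl (X \<union> S) \<subseteq> cl (X \<union> (B - {b}))"
        using assms(3) Suc.prems(4) by (intro cl_least) blast+
      then show False using nb b Suc.prems by auto
    qed
    text \<open>Exchange \<open>b\<close> against an element of \<open>S\<close>: choose a maximal part of \<open>S\<close> not spanning \<open>b\<close>.\<close>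
    have "\<exists>S'\<subseteq>S. B \<inter> S \<subseteq> S' \<and> b \<notin> cl (X \<union> S') \<and>
        (\<forall>S''. S' \<subseteq> S'' \<longrightarrow> S'' \<subseteq> S \<longrightarrow> b \<notin> cl (X \<union> S'') \<longrightarrow> S'' = S')"
    proof -
      have fin: "finite {S'. S' \<subseteq> S \<and> B \<inter> S \<subseteq> S' \<and> b \<notin> cl (X \<union> S')}" using Suc.prems(1) by auto
      have "X \<union> (B \<inter> S) \<subseteq> X \<union> (B - {b})" using b by auto
      then have "b \<notin> cl (X \<union> (B \<inter> S))"
        using nb cl_mono[of "X \<union> (B \<inter> S)" "X \<union> (B - {b})"] assms(3) Suc.prems by auto
      then have "B \<inter> S \<in> {S'. S' \<subseteq> S \<and> B \<inter> S \<subseteq> S' \<and> b \<notin> cl (X \<union> S')}" by auto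
      from finite_has_maximal2[OF fin this] obtain S' where
        S': "S' \<subseteq> S" "B \<inter> S \<subseteq> S'" "b \<notin> cl (X \<union> S')"
        and max: "\<And>S''. S'' \<subseteq> S \<and> B \<inter> S \<subseteq> S'' \<and> b \<notin> cl (X \<union> S'') \<Longrightarrow> S' \<subseteq> S'' \<Longrightarrow> S' = S''"
        by (metis (mono_tags, lifting) mem_Collect_eq)
      have "S'' = S'" if "S' \<subseteq> S''" "S'' \<subseteq> S" "b \<notin> cl (X \<union> S'')" for S''
      proof -
        have "B \<inter> S \<subseteq> S''" using that(1) S'(2) by auto
        then show ?thesis using max[OF _ that(1)] that(2,3) by simp
      qed
      then show ?thesis using S' by (intro exI[of _ S']) simp
    qed
    then obtain S' where S': "S' \<subseteq> S" "B \<inter> S \<subseteq> S'" "b \<notin> cl (X \<union> S')"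
      "\<And>S''. S' \<subseteq> S'' \<Longrightarrow> S'' \<subseteq> S \<Longrightarrow> b \<notin> cl (X \<union> S'') \<Longrightarrow> S'' = S'" by blast
    have "b \<in> cl (X \<union> S)" using b Suc.prems by auto
    then have "S' \<noteq> S" using S'(3) by auto
    then obtain s where s: "s \<in> S" "s \<notin> S'" using S'(1) by blast
    have SC: "X \<union> S' \<subseteq> C" "b \<in> C" using S'(1) Suc.prems assms(3) b by auto
    have spans: "t \<in> cl (X \<union> insert b S')" if "t \<in> S" for t
    proof (cases "t \<in> S'")
      case True
      then show ?thesis using cl_extensive[of "X \<union> insert b S'"] SC by auto
    next
      case False
      then have "insert t S' \<noteq> S'" by blast
      then have "b \<in> cl (X \<union> insert t S')"
        using S'(1) S'(4)[OF subset_insertI, of t] that by blast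
      then show ?thesis using cl_exchange[of "X \<union> S'" b t] SC S'(3) that Suc.prems by auto
    qed
    define S1 where "S1 = insert b (S - {s})"
    have "X \<union> insert b S' \<subseteq> X \<union> S1" using S' s by (auto simp: S1_def)
    moreover have S1C: "X \<union> S1 \<subseteq> C" using SC Suc.prems by (auto simp: S1_def)
    ultimately have "S \<subseteq> cl (X \<union> S1)" using spans cl_mono by blast
    then have "cl (X \<union> S) \<subseteq> cl (X \<union> S1)"
      using cl_extensive[OF S1C] S1C by (intro cl_least) auto
    then have 1: "B \<subseteq> cl (X \<union> S1)" using Suc.prems by auto
    have "s \<notin> B" using s S' by auto
    then have "B - S1 = (B - S) - {b}" by (auto simp: S1_def)
    then have 2: "n = card (B - S1)" using Suc.hyps(2) b Suc.prems by simp
    have "card B \<le> card S1"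
      by (rule Suc.hyps(1)[OF 2]) (use 1 Suc.prems S1C in \<open>auto simp: S1_def\<close>)
    also have "card S1 = card S"
      using Suc.prems(1) s b card_gt_0_iff[of S] by (auto simp: S1_def)
    finally show ?case .
  qed
  have "finite B"
  proof (rule ccontr)
    assume "infinite B"
    then obtain B' where "B' \<subseteq> B" "finite B'" "card B' = Suc (card S)"
      by (metis infinite_arbitrarily_large)
    moreover from this have "B' \<subseteq> C" "B' \<subseteq> cl (X \<union> S)" using assms(4,6) by blast+
    ultimately show False using main[of S B'] assms indep_subset[of X B B'] by auto
  qed
  then show ?thesis using main assms by auto
qed

text \<open>A maximal independent set between \<open>B0\<close> and \<open>B0 \<union> S\<close>
  spans each element of \<open>S\<close>, since otherwise it could be enlarged, and hence it spans
  \<open>A\<close>.\<close>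

lemma basis_exists:
  assumes "finite S" "S \<subseteq> A" "A \<subseteq> C" "X \<subseteq> C" "B0 \<subseteq> A" "finite B0" "indep X B0" "A \<subseteq> cl (X \<union> S)"
  shows "\<exists>B. finite B \<and> B0 \<subseteq> B \<and> B \<subseteq> B0 \<union> S \<and> cl_basis cl A X B"
proof -
  have fin: "finite {B. B \<subseteq> B0 \<union> S \<and> B0 \<subseteq> B \<and> indep X B}" using assms by auto
  have "B0 \<in> {B. B \<subseteq> B0 \<union> S \<and> B0 \<subseteq> B \<and> indep X B}" using assms by auto
  from finite_has_maximal2[OF fin this] obtain B where B: "B \<subseteq> B0 \<union> S" "B0 \<subseteq> B" "indep X B"
    "\<And>B'. B' \<subseteq> B0 \<union> S \<Longrightarrow> B0 \<subseteq> B' \<Longrightarrow> indep X B' \<Longrightarrow> B \<subseteq> B' \<Longrightarrow> B = B'" by auto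
  have BC: "X \<union> B \<subseteq> C" using B(1) assms(2-5) by blast
  have "s \<in> cl (X \<union> B)" if "s \<in> S" for s
  proof (rule ccontr)
    assume "s \<notin> cl (X \<union> B)"
    then have "indep X (insert s B)" using indep_insert B BC assms that by auto
    then have "B = insert s B" using B(4)[of "insert s B"] B(1,2) that by blast
    then have "s \<in> B" by blast
    then show False using \<open>s \<notin> cl (X \<union> B)\<close> cl_extensive[OF BC] by auto
  qed
  then have "cl (X \<union> S) \<subseteq> cl (X \<union> B)" using cl_extensive[OF BC] BC by (intro cl_least) auto
  then have "cl_basis cl A X B"
    using B assms unfolding cl_basis_def indep_def by auto
  moreover have "finite B" using B(1) assms(1,6) finite_subset by auto
  ultimately show ?thesis using B(1,2) by (intro exI[of _ B]) simp
qed

section \<open>Dimension over a set and the rank function\<close>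

lemma cl_dim_eq:
  assumes "cl_basis cl A X B" "finite B" "A \<subseteq> C" "X \<subseteq> C"
  shows "cl_dim cl A X = card B"
  unfolding cl_dim_def
proof (rule the_equality)
  show "\<exists>B'. finite B' \<and> cl_basis cl A X B' \<and> card B' = card B" using assms by auto
  fix n assume "\<exists>B'. finite B' \<and> cl_basis cl A X B' \<and> card B' = n"
  then obtain B' where B': "finite B'" "cl_basis cl A X B'" "card B' = n" by auto
  have *: "B \<subseteq> C" "B' \<subseteq> C" "indep X B" "indep X B'" "B' \<subseteq> cl (X \<union> B)" "B \<subseteq> cl (X \<union> B')"
    using assms B' unfolding cl_basis_def indep_def by blast+
  have "card B' \<le> card B" "card B \<le> card B'"
    using steinitz[OF assms(2) *(1) assms(4) *(2) *(4) *(5)]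
      steinitz[OF B'(1) *(2) assms(4) *(1) *(3) *(6)] by blast+
  then show "n = card B" using B' by simp
qed

abbreviation rk :: "'a set \<Rightarrow> nat" where
  "rk A \<equiv> cl_dim cl A {}"

lemma finite_basis:
  assumes "finite A" "A \<subseteq> C" "X \<subseteq> C" "B0 \<subseteq> A" "indep X B0"
  obtains B where "finite B" "B0 \<subseteq> B" "cl_basis cl A X B" "card B = cl_dim cl A X"
proof -
  have "A \<subseteq> cl (X \<union> A)" using cl_extensive[of "X \<union> A"] assms by auto
  then obtain B where "finite B" "B0 \<subseteq> B" "cl_basis cl A X B"
    using basis_exists[OF assms(1) order_refl assms(2-4) finite_subset[OF assms(4,1)] assms(5)] by blast
  then show thesis using that cl_dim_eq[of A X B] assms(2,3) by simp
qed

lemma indep_empty [simp]: "indep X {}" by (simp add: indep_def)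

text \<open>A basis of \<open>X\<close> together with a basis of \<open>A\<close> over
  \<open>X\<close> is a basis of the union. Relative dimensions are mostly handled through this
  formula, as differences of ranks.\<close>

lemma dim_additive:
  assumes "finite A" "finite X" "A \<subseteq> C" "X \<subseteq> C"
  shows "rk (A \<union> X) = cl_dim cl A X + rk X"
proof -
  obtain BX where BX: "finite BX" "cl_basis cl X {} BX" "card BX = rk X"
    using finite_basis[of X "{}" "{}"] assms by auto
  obtain BA where BA: "finite BA" "cl_basis cl A X BA" "card BA = cl_dim cl A X"
    using finite_basis[of A X "{}"] assms by auto
  have sub: "BX \<subseteq> X" "X \<subseteq> cl BX" "BA \<subseteq> A" "A \<subseteq> cl (X \<union> BA)" "indep {} BX" "indep X BA"
    using BX BA unfolding cl_basis_def indep_def by auto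
  have C: "BX \<subseteq> C" "BA \<subseteq> C" using sub assms by auto
  have disj: "BA \<inter> BX = {}"
  proof -
    have "b \<notin> X" if "b \<in> BA" for b
    proof
      assume "b \<in> X"
      then have "b \<in> cl (X \<union> (BA - {b}))" using cl_extensive[of "X \<union> (BA - {b})"] assms C by auto
      then show False using sub(6) that by (auto simp: indep_def)
    qed
    then show ?thesis using sub by auto
  qed
  have ind: "indep {} (BX \<union> B)" if "B \<subseteq> BA" for B
  proof -
    have "finite B" using that BA finite_subset by auto
    then show ?thesis using that
    proof (induction B)
      case empty
      then show ?case using sub by simp
    next
      case (insert b B)
      have "b \<notin> cl ({} \<union> (BX \<union> B))"
      proof
        assume "b \<in> cl ({} \<union> (BX \<union> B))"
        moreover have "BX \<union> B \<subseteq> X \<union> (BA - {b})" using insert sub by auto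
        ultimately have "b \<in> cl (X \<union> (BA - {b}))"
          using cl_mono[of "BX \<union> B" "X \<union> (BA - {b})"] assms C by auto
        then show False using sub(6) insert by (auto simp: indep_def)
      qed
      then have "indep {} (insert b (BX \<union> B))"
        using insert C by (intro indep_insert) auto
      then show ?case by simp
    qed
  qed
  have "X \<union> BA \<subseteq> cl (BX \<union> BA)"
    using sub(2) cl_mono[of BX "BX \<union> BA"] cl_extensive[of "BX \<union> BA"] C by auto
  then have "cl (X \<union> BA) \<subseteq> cl (BX \<union> BA)" using C by (intro cl_least) auto
  then have "A \<union> X \<subseteq> cl ({} \<union> (BX \<union> BA))"
    using sub(2,4) cl_mono[of BX "BX \<union> BA"] C by auto
  then have "cl_basis cl (A \<union> X) {} (BX \<union> BA)"
    using ind[of BA] sub unfolding cl_basis_def indep_def by auto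
  then have "rk (A \<union> X) = card (BX \<union> BA)"
    using cl_dim_eq[of "A \<union> X" "{}" "BX \<union> BA"] BX BA assms by simp
  then show ?thesis using BX BA disj by (simp add: card_Un_disjoint Int_commute)
qed

lemma cl_dim_le_card: 
  assumes "S \<subseteq> C" "finite S" "A \<subseteq> C" "finite A" "X \<subseteq> C" "A \<subseteq> cl (X \<union> S)"
  shows "cl_dim cl A X \<le> card S"
proof -
  obtain B where B: "finite B" "cl_basis cl A X B" "card B = cl_dim cl A X"
    using finite_basis[of A X "{}"] assms by auto
  then show ?thesis using steinitz[of S X B] assms unfolding cl_basis_def indep_def by auto
qed

lemma rk_mono:
  assumes "finite B" "A \<subseteq> B" "B \<subseteq> C"
  shows "rk A \<le> rk B"
  using dim_additive[of B A] assms finite_subset[of A B] Un_absorb2[of A B] by auto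

lemma rk_le_card: "finite A \<Longrightarrow> A \<subseteq> C \<Longrightarrow> rk A \<le> card A"
  using cl_dim_le_card[of A A "{}"] cl_extensive[of A] by auto

lemma dim_insert:
  assumes "finite X" "X \<subseteq> C" "x \<in> C"
  shows "cl_dim cl {x} X = (if x \<in> cl X then 0 else 1)"
proof (cases "x \<in> cl X")
  case True
  then have "cl_basis cl {x} X {}" unfolding cl_basis_def by auto
  then show ?thesis using cl_dim_eq[of "{x}" X "{}"] assms True by auto
next
  case False
  have "x \<in> cl (insert x X)" using cl_extensive[of "insert x X"] assms by auto
  then have "cl_basis cl {x} X {x}" unfolding cl_basis_def using False by auto
  then show ?thesis using cl_dim_eq[of "{x}" X "{x}"] assms False by auto
qed

lemma rk_insert:
  assumes "finite X" "X \<subseteq> C" "x \<in> C"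
  shows "rk (insert x X) = (if x \<in> cl X then rk X else Suc (rk X))"
  using dim_additive[of "{x}" X] dim_insert[OF assms] assms by auto

lemma dim_antimono:
  assumes "finite A" "A \<subseteq> C" "X \<subseteq> Y" "Y \<subseteq> C"
  shows "cl_dim cl A Y \<le> cl_dim cl A X"
proof -
  have "X \<subseteq> C" using assms by auto
  then obtain B where B: "finite B" "cl_basis cl A X B" "card B = cl_dim cl A X"
    using finite_basis[of A X "{}"] assms(1,2) by auto
  have "B \<subseteq> A" "A \<subseteq> cl (X \<union> B)" using B unfolding cl_basis_def by auto
  moreover have "cl (X \<union> B) \<subseteq> cl (Y \<union> B)" using assms \<open>B \<subseteq> A\<close> by (intro cl_mono) auto
  ultimately show ?thesis using cl_dim_le_card[of B A Y] assms B by auto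
qed

text \<open>The dimension of \<open>A\<close> over \<open>B\<close> is at most its dimension over
  the smaller set \<open>A \<inter> B\<close>; additivity turns this into the inequality between
  ranks.\<close>

lemma rk_submodular:
  assumes "finite A" "finite B" "A \<subseteq> C" "B \<subseteq> C"
  shows "rk (A \<union> B) + rk (A \<inter> B) \<le> rk A + rk B"
proof -
  have "A \<union> B = A \<union> B" "A \<union> (A \<inter> B) = A" by auto
  then have "rk (A \<union> B) = cl_dim cl A B + rk B" "rk A = cl_dim cl A (A \<inter> B) + rk (A \<inter> B)"
    using dim_additive[of A B] dim_additive[of A "A \<inter> B"] assms by auto
  moreover have "cl_dim cl A B \<le> cl_dim cl A (A \<inter> B)" using assms by (intro dim_antimono) auto
  ultimately show ?thesis by simp
qed

text \<open>A basis of \<open>S\<close> is also a basis of its closure, so the rank makes sense for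
  this possibly infinite set. Indecomposability is applied to such closures.\<close>

lemma rk_cl:
  assumes "finite S" "S \<subseteq> C"
  shows "rk (cl S) = rk S" and "finite_dimensional cl (cl S) {}"
proof -
  obtain B where B: "finite B" "cl_basis cl S {} B" "card B = rk S"
    using finite_basis[of S "{}" "{}"] assms by auto
  have "cl S \<subseteq> cl B" using B assms unfolding cl_basis_def by (intro cl_least) auto
  then have *: "cl_basis cl (cl S) {} B"
    using B(2) assms cl_extensive[of S] unfolding cl_basis_def by auto
  then show "rk (cl S) = rk S" using cl_dim_eq[OF * B(1)] B cl_closed assms by auto
  show "finite_dimensional cl (cl S) {}" unfolding finite_dimensional_def using * B(1) by auto
qed

end

section \<open>Algebraic closure and elementary maps\<close>

text \<open>Together with \<open>aclE\<close> this describes algebraic closure by formulas under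
  assignments, with a freely chosen variable \<open>x\<close> for the algebraic element, in place of
  the tuples of the definition.\<close>

lemma aclI:
  assumes "b \<in> carrier M" "A \<subseteq> carrier M" "wf_fm L \<phi>" "s ` (fv \<phi> - {x}) \<subseteq> A"
    "sat M (s(x := b)) \<phi>" "finite {c \<in> carrier M. sat M (s(x := c)) \<phi>}"
  shows "b \<in> acl L M A"
proof -
  define xs where "xs = sorted_list_of_set (fv \<phi> - {x})"
  have xs: "set xs = fv \<phi> - {x}" by (simp add: xs_def)
  have *: "sat_at M (at_tuple (x # xs) \<phi>) (c # map s xs) \<longleftrightarrow> sat M (s(x := c)) \<phi>" if "c \<in> carrier M" for c
  proof -
    have eq: "c # map s xs = map (s(x := c)) (x # xs)" using xs by auto
    show ?thesis unfolding eq
      by (rule sat_at_tuple) (use that xs assms(2,4) in auto)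
  qed
  have "formula L (Suc (length (map s xs))) (at_tuple (x # xs) \<phi>)"
    by (rule formula_at_tuple) (use assms xs in auto)
  moreover have "{c \<in> carrier M. sat_at M (at_tuple (x # xs) \<phi>) (c # map s xs)} =
      {c \<in> carrier M. sat M (s(x := c)) \<phi>}" using * by auto
  moreover have "set (map s xs) \<subseteq> A" using xs assms(4) by auto
  ultimately show ?thesis unfolding acl_def
    using *[OF assms(1)] assms(1,5,6)
    by (intro CollectI conjI exI[of _ "at_tuple (x # xs) \<phi>"] exI[of _ "map s xs"]) simp_all
qed

lemma aclE:
  assumes "b \<in> acl L M (s ` V)" "x \<notin> V" "s ` V \<subseteq> carrier M"
  obtains \<phi> where "wf_fm L \<phi>" "fv \<phi> \<subseteq> insert x V" "sat M (s(x := b)) \<phi>"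
    "finite {c \<in> carrier M. sat M (s(x := c)) \<phi>}"
proof -
  obtain \<phi>0 as where \<phi>0: "set as \<subseteq> s ` V" "formula L (Suc (length as)) \<phi>0" "sat_at M \<phi>0 (b # as)"
    "finite {c \<in> carrier M. sat_at M \<phi>0 (c # as)}" "b \<in> carrier M"
    using assms(1) unfolding acl_def by blast
  \<comment> \<open>Position 0 is the algebraic element; a later position is sent to some variable
    of \<open>V\<close> that names the parameter there. The default \<open>x\<close> for large
    indices is never reached on the free variables of \<open>\<phi>0\<close>.\<close>
  define g where "g i = (case i of 0 \<Rightarrow> x | Suc j \<Rightarrow> if j < length as then inv_into V s (as ! j) else x)" for i
  have g: "inv_into V s (as ! j) \<in> V \<and> s (inv_into V s (as ! j)) = as ! j" if "j < length as" for j
  proof -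
    have "as ! j \<in> s ` V" using \<phi>0(1) nth_mem[OF that] by blast
    then show ?thesis by (simp add: inv_into_into f_inv_into_f)
  qed
  have *: "sat M (s(x := c)) (subst g \<phi>0) \<longleftrightarrow> sat_at M \<phi>0 (c # as)" if "c \<in> carrier M" for c
  proof -
    have eq: "(s(x := c)) (g i) = (c # as) ! i \<and> (s(x := c)) (g i) \<in> carrier M" if "i \<in> fv \<phi>0" for i
    proof (cases i)
      case 0
      then show ?thesis using \<open>c \<in> carrier M\<close> by (simp add: g_def)
    next
      case (Suc j)
      then have j: "j < length as" using that \<phi>0(2) by (auto simp: formula_def)
      then have "as ! j \<in> carrier M" "inv_into V s (as ! j) \<noteq> x"
        using g[OF j] assms(2,3) \<phi>0(1) nth_mem[OF j] by auto
      then show ?thesis using g[OF j] j Suc by (simp add: g_def)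
    qed
    then have "sat M (s(x := c)) (subst g \<phi>0) \<longleftrightarrow> sat M (\<lambda>i. (s(x := c)) (g i)) \<phi>0"
      by (intro sat_subst) blast
    also have "\<dots> \<longleftrightarrow> sat_at M \<phi>0 (c # as)" by (rule sat_cong) (use eq in auto)
    finally show ?thesis .
  qed
  have "{c \<in> carrier M. sat M (s(x := c)) (subst g \<phi>0)} = {c \<in> carrier M. sat_at M \<phi>0 (c # as)}"
    using * by auto
  moreover have "fv (subst g \<phi>0) \<subseteq> insert x V"
  proof -
    have "g i \<in> insert x V" if "i \<in> fv \<phi>0" for i
      using that \<phi>0(2) g by (cases i) (auto simp: g_def formula_def subset_iff)
    then show ?thesis using fv_subst[of g \<phi>0] by auto
  qed
  ultimately show thesis using * \<phi>0 that[of "subst g \<phi>0"] by (auto simp: formula_def)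
qed

lemma acl_mono: "A \<subseteq> B \<Longrightarrow> acl L M A \<subseteq> acl L M B"
  unfolding acl_def by blast

lemma acl_carrier: "acl L M A \<subseteq> carrier M"
  unfolding acl_def by blast

lemma acl_extensive:
  assumes "A \<subseteq> carrier M" shows "A \<subseteq> acl L M A"
proof
  fix b assume b: "b \<in> A"
  have "{c \<in> carrier M. sat M ((\<lambda>_. b)(0 := c)) (Equal (Var 0) (Var 1))} \<subseteq> {b}" by auto
  then show "b \<in> acl L M A"
    by (intro aclI[of b M A L "Equal (Var 0) (Var 1)" "\<lambda>_. b" 0])
      (use b assms finite_subset in auto)
qed

lemma acl_finitary:
  assumes "b \<in> acl L M A" obtains A0 where "finite A0" "A0 \<subseteq> A" "b \<in> acl L M A0"
proof -
  obtain \<phi> as where "set as \<subseteq> A" "formula L (Suc (length as)) \<phi>" "sat_at M \<phi> (b # as)"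
    "finite {c \<in> carrier M. sat_at M \<phi> (c # as)}" "b \<in> carrier M"
    using assms unfolding acl_def by blast
  then show thesis by (intro that[of "set as"]) (auto simp: acl_def)
qed

text \<open>Parameters receive fresh names from \<open>k\<close> on, so that the variables below
  \<open>k\<close> stay available for the formulas at hand.\<close>

lemma enum_vars:
  fixes s :: "nat \<Rightarrow> 'u" and k :: nat
  assumes "finite A" "A \<subseteq> carrier M" "range s \<subseteq> carrier M"
  obtains s' n where "s' ` {k..<k + n} = A" "inj_on s' {k..<k + n}" "\<And>i. i < k \<Longrightarrow> s' i = s i"
    "range s' \<subseteq> carrier M"
proof -
  obtain as where as: "set as = A" "distinct as" using assms(1) finite_distinct_list by auto
  define s' where "s' i = (if k \<le> i \<and> i < k + length as then as ! (i - k) else s i)" for i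
  have "{k..<k + length as} = (+) k ` {0..<length as}"
    by (simp add: add.commute)
  then have "s' ` {k..<k + length as} = (\<lambda>i. s' (k + i)) ` {0..<length as}"
    by (simp only: image_image)
  also have "\<dots> = (!) as ` {0..<length as}"
    by (rule image_cong) (auto simp: s'_def)
  also have "\<dots> = A" using as(1) by (auto simp: set_conv_nth)
  finally have "s' ` {k..<k + length as} = A" .
  moreover have "inj_on s' {k..<k + length as}"
    using as(2) by (auto simp: inj_on_def s'_def nth_eq_iff_index_eq)
  moreover have "range s' \<subseteq> carrier M"
    using assms(3) as(1) assms(2) nth_mem[of _ as] by (auto simp: s'_def)
  ultimately show thesis using that[of s' "length as"] by (auto simp: s'_def)
qed

section \<open>Partial elementary maps\<close>

definition elem :: "('f, 'r) language \<Rightarrow> ('f, 'r, 'u) struct \<Rightarrow> 'u set \<Rightarrow> ('u \<Rightarrow> 'u) \<Rightarrow> bool" where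
  "elem L M X f \<longleftrightarrow> X \<subseteq> carrier M \<and> f ` X \<subseteq> carrier M \<and>
     (\<forall>\<phi> s. wf_fm L \<phi> \<longrightarrow> s ` fv \<phi> \<subseteq> X \<longrightarrow> (sat M s \<phi> \<longleftrightarrow> sat M (f \<circ> s) \<phi>))"

lemma elemD: "elem L M X f \<Longrightarrow> wf_fm L \<phi> \<Longrightarrow> s ` fv \<phi> \<subseteq> X \<Longrightarrow> sat M s \<phi> \<longleftrightarrow> sat M (f \<circ> s) \<phi>"
  unfolding elem_def by blast

lemma elem_subset: "elem L M X f \<Longrightarrow> Y \<subseteq> X \<Longrightarrow> elem L M Y f"
  unfolding elem_def by (meson image_mono subset_trans)

lemma elem_inj: "elem L M X f \<Longrightarrow> inj_on f X"
proof (rule inj_onI)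
  fix x y assume *: "elem L M X f" "x \<in> X" "y \<in> X" "f x = f y"
  define s where "s i = (if i = 0 then x else y)" for i :: nat
  have "sat M s (Equal (Var 0) (Var 1)) \<longleftrightarrow> sat M (f \<circ> s) (Equal (Var 0) (Var 1))"
    by (rule elemD[OF *(1)]) (use * in \<open>auto simp: s_def\<close>)
  then show "x = y" using * by (simp add: s_def)
qed

lemma elem_inv:
  assumes "elem L M X f" shows "elem L M (f ` X) (inv_into X f)"
proof -
  note inj = elem_inj[OF assms]
  have "inv_into X f ` (f ` X) \<subseteq> X" by (auto intro: inv_into_into)
  moreover have "sat M s \<phi> \<longleftrightarrow> sat M (inv_into X f \<circ> s) \<phi>" if "wf_fm L \<phi>" "s ` fv \<phi> \<subseteq> f ` X" for s \<phi>
  proof -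
    have "sat M (inv_into X f \<circ> s) \<phi> \<longleftrightarrow> sat M (f \<circ> (inv_into X f \<circ> s)) \<phi>"
      by (rule elemD[OF assms that(1)]) (use that(2) inv_into_into[of _ f X] in fastforce)
    also have "\<dots> \<longleftrightarrow> sat M s \<phi>"
      by (rule sat_cong) (use that(2) in \<open>auto simp: f_inv_into_f subset_iff\<close>)
    finally show ?thesis by simp
  qed
  ultimately show ?thesis using assms unfolding elem_def by blast
qed

text \<open>An implication suffices as hypothesis because negations are among the formulas. The
  equations among them make the assignment \<open>s1 v \<mapsto> s2 v\<close> well defined.\<close>

lemma elem_of_assignments:
  assumes "s1 ` V \<subseteq> carrier M" "s2 ` V \<subseteq> carrier M"
    "\<And>\<phi>. wf_fm L \<phi> \<Longrightarrow> fv \<phi> \<subseteq> V \<Longrightarrow> sat M s1 \<phi> \<Longrightarrow> sat M s2 \<phi>"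
  obtains f where "elem L M (s1 ` V) f" "\<And>v. v \<in> V \<Longrightarrow> f (s1 v) = s2 v"
proof -
  have iff: "sat M s1 \<phi> \<longleftrightarrow> sat M s2 \<phi>" if "wf_fm L \<phi>" "fv \<phi> \<subseteq> V" for \<phi>
    using assms(3)[of \<phi>] assms(3)[of "Neg \<phi>"] that by auto
  define f where "f = s2 \<circ> inv_into V s1"
  have f: "f (s1 v) = s2 v" if "v \<in> V" for v
  proof -
    define w where "w = inv_into V s1 (s1 v)"
    have w: "w \<in> V" "s1 w = s1 v" using that by (auto simp: w_def intro: inv_into_into f_inv_into_f)
    then have "s2 w = s2 v" using iff[of "Equal (Var w) (Var v)"] that by simp
    then show ?thesis by (simp add: f_def w_def)
  qed
  have "sat M s \<phi> \<longleftrightarrow> sat M (f \<circ> s) \<phi>" if *: "wf_fm L \<phi>" "s ` fv \<phi> \<subseteq> s1 ` V" for \<phi> s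
  proof -
    define g where "g x = inv_into V s1 (s x)" for x
    have g: "g x \<in> V" "s1 (g x) = s x" if "x \<in> fv \<phi>" for x
    proof -
      have "s x \<in> s1 ` V" using *(2) that by blast
      then show "g x \<in> V" "s1 (g x) = s x" by (simp_all add: g_def inv_into_into f_inv_into_f)
    qed
    have "sat M s \<phi> \<longleftrightarrow> sat M (\<lambda>x. s1 (g x)) \<phi>" by (rule sat_cong) (simp add: g)
    also have "\<dots> \<longleftrightarrow> sat M s1 (subst g \<phi>)" by (rule sat_subst[symmetric]) (use g(1) assms(1) in blast)
    also have "\<dots> \<longleftrightarrow> sat M s2 (subst g \<phi>)" by (rule iff) (use * g fv_subst[of g \<phi>] in auto)
    also have "\<dots> \<longleftrightarrow> sat M (\<lambda>x. s2 (g x)) \<phi>" by (rule sat_subst) (use g(1) assms(2) in blast)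
    also have "\<dots> \<longleftrightarrow> sat M (f \<circ> s) \<phi>" by (rule sat_cong) (use f g in \<open>metis comp_apply\<close>)
    finally show ?thesis .
  qed
  moreover have "f ` s1 ` V \<subseteq> carrier M" using f assms(2) by auto
  ultimately have "elem L M (s1 ` V) f" unfolding elem_def using assms(1) by blast
  then show thesis using f that by blast
qed

text \<open>Enumerate \<open>Y\<close> by all the variables and realize the type of this
  enumeration, the variables with value in \<open>X\<close> being fixed to their images under
  \<open>f\<close>. This does the work that automorphisms do in a strongly homogeneous
  model.\<close>

lemma elem_extend:
  assumes sat1: "aleph1_saturated L M" and el: "elem L M X f"
    and Y: "X \<subseteq> Y" "Y \<subseteq> carrier M" "countable Y"
  obtains g where "elem L M Y g" "\<And>x. x \<in> X \<Longrightarrow> g x = f x"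
proof (cases "Y = {}")
  case True
  then show thesis using that[of f] el Y by auto
next
  case False
  define s1 where "s1 = from_nat_into Y"
  have s1: "range s1 = Y" using range_from_nat_into[OF False Y(3)] by (simp add: s1_def)
  define P where "P = s1 -` X"
  define \<Gamma> where "\<Gamma> = {\<phi>. wf_fm L \<phi> \<and> sat M s1 \<phi>}"
  have "\<exists>s\<in>assignments_over M P (f \<circ> s1). \<forall>\<phi>\<in>\<Gamma>. sat M s \<phi>"
  proof (rule saturated_assignment[OF sat1])
    fix \<Gamma>0 assume \<Gamma>0: "finite \<Gamma>0" "\<Gamma>0 \<subseteq> \<Gamma>"
    obtain c where c: "set c = \<Gamma>0" using finite_list[OF \<Gamma>0(1)] by blast
    define V where "V = (\<Union>\<phi>\<in>\<Gamma>0. fv \<phi>)"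
    have V: "finite V" using \<Gamma>0(1) by (auto simp: V_def)
    \<comment> \<open>With the new elements quantified away, a finite part of the type is a formula
      over \<open>X\<close>, and \<open>f\<close> preserves it.\<close>
    define \<psi> where "\<psi> = ExL (sorted_list_of_set (V - P)) (ConjL c)"
    have fv: "fv \<psi> \<subseteq> P" using V c by (auto simp: \<psi>_def V_def)
    have "sat M s1 \<psi>" unfolding \<psi>_def sat_ExL
      using s1 Y(2) \<Gamma>0 c by (intro exI[of _ s1]) (auto simp: \<Gamma>_def)
    then have "sat M (f \<circ> s1) \<psi>"
      by (subst (asm) elemD[OF el]) (use fv \<Gamma>0 c in \<open>auto simp: P_def \<psi>_def \<Gamma>_def\<close>)
    then obtain s' where s': "\<forall>x. x \<notin> V - P \<longrightarrow> s' x = (f \<circ> s1) x" "\<forall>x\<in>V - P. s' x \<in> carrier M"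
      "\<forall>\<phi>\<in>\<Gamma>0. sat M s' \<phi>"
      unfolding \<psi>_def sat_ExL using V c by auto
    define s'' where "s'' x = (if x \<in> P \<union> V then s' x else s1 x)" for x
    have "s'' x \<in> carrier M" for x
    proof (cases "x \<in> P")
      case True
      then have "s'' x = f (s1 x)" "s1 x \<in> X" using s'(1) by (auto simp: s''_def P_def)
      then show ?thesis using el unfolding elem_def by auto
    next
      case False
      then show ?thesis using s'(2) s1 Y(2) by (auto simp: s''_def)
    qed
    moreover have "sat M s'' \<phi>" if "\<phi> \<in> \<Gamma>0" for \<phi>
      using s'(3)[rule_format, OF that] by (rule sat_cong[THEN iffD1, rotated])
        (use that in \<open>auto simp: s''_def V_def\<close>)
    ultimately show "\<exists>s\<in>assignments_over M P (f \<circ> s1). \<forall>\<phi>\<in>\<Gamma>0. sat M s \<phi>"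
      using s'(1) by (intro bexI[of _ s'']) (auto simp: assignments_over_def, auto simp: s''_def)
  qed (auto simp: \<Gamma>_def)
  then obtain s2 where s2: "s2 \<in> assignments_over M P (f \<circ> s1)" "\<And>\<phi>. \<phi> \<in> \<Gamma> \<Longrightarrow> sat M s2 \<phi>" by blast
  obtain g where g: "elem L M (s1 ` UNIV) g" "\<And>v. v \<in> UNIV \<Longrightarrow> g (s1 v) = s2 v"
    by (rule elem_of_assignments[of s1 UNIV M s2 L]) (use s1 s2 Y in \<open>auto simp: assignments_over_def \<Gamma>_def\<close>)
  have "g x = f x" if x: "x \<in> X" for x
  proof -
    obtain v where "s1 v = x" using x Y(1) s1 by auto
    then show ?thesis using g(2)[of v] s2(1) x by (auto simp: assignments_over_def P_def)
  qed
  then show thesis using that g(1) s1 by auto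
qed

section \<open>Geometric theories\<close>

fun seq_indep :: "('u set \<Rightarrow> 'u set) \<Rightarrow> 'u set \<Rightarrow> 'u list \<Rightarrow> bool" where
  "seq_indep cl D [] \<longleftrightarrow> True"
| "seq_indep cl D (a # as) \<longleftrightarrow> a \<notin> cl D \<and> seq_indep cl (insert a D) as"

text \<open>Each entry raises the rank by at most one, and by exactly one if it is outside the
  closure of \<open>D\<close> and the entries before it. The sequential form is the one that
  iterated quantifiers produce.\<close>

lemma (in pregeometry) seq_indep_iff:
  assumes "finite D" "D \<subseteq> C" "set as \<subseteq> C"
  shows "seq_indep cl D as \<longleftrightarrow> cl_dim cl (set as) D = length as"
proof -
  have "seq_indep cl D as \<longleftrightarrow> rk (set as \<union> D) = length as + rk D" "rk (set as \<union> D) \<le> length as + rk D"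
    using assms
  proof (induction as arbitrary: D)
    case (Cons a as)
    {
      case 1
      have "rk (set as \<union> insert a D) \<le> length as + rk (insert a D)" using Cons.IH(2)[of "insert a D"] 1 by auto
      then show ?case using Cons.IH(1)[of "insert a D"] 1 rk_insert[of D a] by auto
    next
      case 2
      then show ?case using Cons.IH(2)[of "insert a D"] rk_insert[of D a] by (auto split: if_splits)
    }
  qed auto
  then show ?thesis using dim_additive[of "set as" D] assms by auto
qed

section \<open>Algebraic closure and dimension under elimination of the quantifier for
  infinity\<close>

locale geometric_theory =
  fixes U :: "'u itself" and L :: "('f, 'r) language" and T :: "('f, 'r) fm set"
  assumes geometric: "geometric U L T" and qe: "quantifier_elimination U L T"
    and no_finite: "no_finite_models U L T"
begin

lemma ex_inf_formula:
  assumes "wf_fm L \<phi>"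
  shows "\<exists>\<psi>. wf_fm L \<psi> \<and> fv \<psi> \<subseteq> fv \<phi> - {x} \<and>
    (\<forall>(M :: ('f, 'r, 'u) struct) s. models L T M \<longrightarrow> s ` (fv \<phi> - {x}) \<subseteq> carrier M \<longrightarrow>
       (sat M s \<psi> \<longleftrightarrow> infinite {c \<in> carrier M. sat M (s(x := c)) \<phi>}))"
proof -
  define xs where "xs = sorted_list_of_set (fv \<phi> - {x})"
  have xs: "set xs = fv \<phi> - {x}" by (simp add: xs_def)
  have "formula L (Suc (length xs)) (at_tuple (x # xs) \<phi>)"
    by (rule formula_at_tuple) (use assms xs in auto)
  then obtain \<psi>0 where \<psi>0: "formula L (length xs) \<psi>0" and
    eq: "\<And>(M :: ('f, 'r, 'u) struct) as. models L T M \<Longrightarrow> as \<in> tuples M (length xs) \<Longrightarrow>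
      sat_at M \<psi>0 as \<longleftrightarrow> infinite {b \<in> carrier M. sat_at M (at_tuple (x # xs) \<phi>) (b # as)}"
    using geometric unfolding geometric_def eliminates_exists_infinity_def by meson
  define \<psi> where "\<psi> = subst (\<lambda>i. xs ! i) \<psi>0"
  have fv0: "i < length xs" if "i \<in> fv \<psi>0" for i using \<psi>0 that by (auto simp: formula_def)
  have "sat M s \<psi> \<longleftrightarrow> infinite {c \<in> carrier M. sat M (s(x := c)) \<phi>}"
    if M: "models L T M" "s ` (fv \<phi> - {x}) \<subseteq> carrier M" for M :: "('f, 'r, 'u) struct" and s
  proof -
    have sc: "s (xs ! i) \<in> carrier M" if "i < length xs" for i
      using nth_mem[OF that] xs M(2) by auto
    have "sat M s \<psi> \<longleftrightarrow> sat M (\<lambda>i. s (xs ! i)) \<psi>0"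
      unfolding \<psi>_def by (rule sat_subst) (use sc fv0 in auto)
    also have "\<dots> \<longleftrightarrow> sat_at M \<psi>0 (map s xs)" by (rule sat_cong) (use fv0 in auto)
    also have "\<dots> \<longleftrightarrow> infinite {b \<in> carrier M. sat_at M (at_tuple (x # xs) \<phi>) (b # map s xs)}"
      by (rule eq[OF M(1)]) (use xs M(2) in \<open>auto simp: tuples_def\<close>)
    also have "{b \<in> carrier M. sat_at M (at_tuple (x # xs) \<phi>) (b # map s xs)} = {c \<in> carrier M. sat M (s(x := c)) \<phi>}"
    proof -
      have "sat_at M (at_tuple (x # xs) \<phi>) (b # map s xs) \<longleftrightarrow> sat M (s(x := b)) \<phi>" if "b \<in> carrier M" for b
      proof -
        have eq: "b # map s xs = map (s(x := b)) (x # xs)" using xs by auto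
        show ?thesis unfolding eq by (rule sat_at_tuple) (use that xs M in auto)
      qed
      then show ?thesis by auto
    qed
    finally show ?thesis .
  qed
  moreover have "wf_fm L \<psi>" using \<psi>0 by (simp add: \<psi>_def formula_def)
  moreover have "fv \<psi> \<subseteq> fv \<phi> - {x}"
    using fv_subst[of "\<lambda>i. xs ! i" \<psi>0] fv0 xs nth_mem[of _ xs] by (fastforce simp: \<psi>_def)
  ultimately show ?thesis by blast
qed

text \<open>The quantifier "for infinitely many x" as a formula; the elimination hypothesis only
  says that one exists, hence the choice. With it, finiteness of a solution set can be stated inside
  a formula and so be transferred to other models and along elementary maps.\<close>

definition ExInf :: "nat \<Rightarrow> ('f, 'r) fm \<Rightarrow> ('f, 'r) fm" where
  "ExInf x \<phi> = (SOME \<psi>. wf_fm L \<psi> \<and> fv \<psi> \<subseteq> fv \<phi> - {x} \<and>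
    (\<forall>(M :: ('f, 'r, 'u) struct) s. models L T M \<longrightarrow> s ` (fv \<phi> - {x}) \<subseteq> carrier M \<longrightarrow>
       (sat M s \<psi> \<longleftrightarrow> infinite {c \<in> carrier M. sat M (s(x := c)) \<phi>})))"

lemma ExInf:
  assumes "wf_fm L \<phi>"
  shows "wf_fm L (ExInf x \<phi>)" "fv (ExInf x \<phi>) \<subseteq> fv \<phi> - {x}"
    and "\<And>(M :: ('f, 'r, 'u) struct) s. models L T M \<Longrightarrow> s ` (fv \<phi> - {x}) \<subseteq> carrier M \<Longrightarrow>
       sat M s (ExInf x \<phi>) \<longleftrightarrow> infinite {c \<in> carrier M. sat M (s(x := c)) \<phi>}"
  using someI_ex[OF ex_inf_formula[OF assms, of x], folded ExInf_def] by blast+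

context
  fixes M :: "('f, 'r, 'u) struct"
  assumes M: "models L T M"
begin

lemma ex_assignment: obtains s :: "nat \<Rightarrow> 'u" where "range s \<subseteq> carrier M"
proof -
  obtain a where "a \<in> carrier M" using M unfolding models_def is_structure_def by auto
  then show thesis by (intro that[of "\<lambda>_. a"]) auto
qed

text \<open>The element \<open>c\<close> satisfies: some root \<open>d\<close> of the algebraic
  formula for \<open>b\<close> has this element in its fibre of \<phi>, and that fibre is finite.
  The last clause matters because roots other than \<open>b\<close> may have infinite fibres; with
  it the solution set is contained in a finite union of finite sets.\<close>

lemma acl_insert:
  assumes "A \<subseteq> carrier M" "b \<in> acl L M A" "c \<in> acl L M (insert b A)"
  shows "c \<in> acl L M A"
proof -
  have bM: "b \<in> carrier M" "c \<in> carrier M"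
    using assms(2,3) acl_carrier[of L M A] acl_carrier[of L M "insert b A"] by auto
  obtain A1 where A1: "finite A1" "A1 \<subseteq> A" "b \<in> acl L M A1" using acl_finitary[OF assms(2)] by blast
  obtain A2 where A2: "finite A2" "A2 \<subseteq> insert b A" "c \<in> acl L M A2" using acl_finitary[OF assms(3)] by blast
  define D where "D = A1 \<union> (A2 - {b})"
  have D: "finite D" "D \<subseteq> A" "b \<in> acl L M D" "c \<in> acl L M (insert b D)"
    using A1 A2 acl_mono[of A1 D L M] acl_mono[of A2 "insert b D" L M] by (auto simp: D_def)
  obtain s0 :: "nat \<Rightarrow> 'u" where s0: "range s0 \<subseteq> carrier M" by (rule ex_assignment)
  have DM: "D \<subseteq> carrier M" using D(2) assms(1) by (rule order_trans)
  obtain s n where s: "s ` {2::nat..<2 + n} = D" "range s \<subseteq> carrier M"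
    by (rule enum_vars[OF D(1) DM s0, of 2], rule that)
  define V where "V = {2..<2 + n}"
  obtain \<beta> where \<beta>: "wf_fm L \<beta>" "fv \<beta> \<subseteq> insert 1 V" "sat M (s(1 := b)) \<beta>"
    "finite {c \<in> carrier M. sat M (s(1 := c)) \<beta>}"
    by (rule aclE[of b L M s V 1]) (use D s in \<open>auto simp: V_def\<close>)
  have im: "(s(1 := b)) ` insert 1 V = insert b D" using s by (auto simp: V_def)
  obtain \<phi> where \<phi>: "wf_fm L \<phi>" "fv \<phi> \<subseteq> insert 0 (insert 1 V)" "sat M (s(1 := b, 0 := c)) \<phi>"
    "finite {c \<in> carrier M. sat M (s(1 := b, 0 := c)) \<phi>}"
    by (rule aclE[of c L M "s(1 := b)" "insert 1 V" 0]) (use im D(4) DM bM in \<open>auto simp: V_def\<close>)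
  have sc: "s x \<in> carrier M" for x using s by auto
  have InfM: "sat M (s(0 := e, 1 := d)) (ExInf 0 \<phi>) \<longleftrightarrow> infinite {c \<in> carrier M. sat M (s(1 := d, 0 := c)) \<phi>}"
    if "d \<in> carrier M" "e \<in> carrier M" for d e
  proof -
    have "sat M (s(0 := e, 1 := d)) (ExInf 0 \<phi>) \<longleftrightarrow> infinite {c \<in> carrier M. sat M (s(0 := e, 1 := d, 0 := c)) \<phi>}"
      by (rule ExInf(3)[OF \<phi>(1) M]) (use that sc in auto)
    then show ?thesis by (simp add: fun_upd_twist[of 0 1])
  qed
  define \<theta> where "\<theta> = Ex 1 (And \<beta> (And \<phi> (Neg (ExInf 0 \<phi>))))"
  have sat\<theta>: "sat M (s(0 := e)) \<theta> \<longleftrightarrow> (\<exists>d\<in>carrier M. sat M (s(1 := d)) \<beta> \<and> sat M (s(1 := d, 0 := e)) \<phi> \<and>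
      finite {c \<in> carrier M. sat M (s(1 := d, 0 := c)) \<phi>})" if "e \<in> carrier M" for e
  proof -
    have 1: "sat M (s(0 := e, 1 := d)) \<beta> \<longleftrightarrow> sat M (s(1 := d)) \<beta>" for d
      by (rule sat_cong) (use \<beta>(2) in \<open>auto simp: V_def\<close>)
    have "s(0 := e, 1 := d) = s(1 := d, 0 := e)" for d by (rule fun_upd_twist) simp
    then have 2: "sat M (s(0 := e, 1 := d)) \<phi> \<longleftrightarrow> sat M (s(1 := d, 0 := e)) \<phi>" for d by (simp only:)
    show ?thesis unfolding \<theta>_def Ex_simps And_simps sat.simps
      by (rule bex_cong[OF refl]) (use 1 2 InfM[OF _ that] in blast)
  qed
  have "sat M (s(0 := c)) \<theta>" unfolding sat\<theta>[OF bM(2)] using bM \<beta>(3) \<phi>(3,4) by blast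
  moreover have "finite {e \<in> carrier M. sat M (s(0 := e)) \<theta>}"
  proof (rule finite_subset)
    show "{e \<in> carrier M. sat M (s(0 := e)) \<theta>} \<subseteq> (\<Union>d\<in>{d \<in> carrier M. sat M (s(1 := d)) \<beta>}.
      if finite {c \<in> carrier M. sat M (s(1 := d, 0 := c)) \<phi>} then {c \<in> carrier M. sat M (s(1 := d, 0 := c)) \<phi>} else {})"
      using sat\<theta> by auto
  qed (use \<beta>(4) in auto)
  moreover have "s ` (fv \<theta> - {0}) \<subseteq> A"
  proof -
    have "fv \<theta> - {0} \<subseteq> V" using \<beta>(2) \<phi>(2) ExInf(2)[OF \<phi>(1), of 0] by (auto simp: \<theta>_def)
    then show ?thesis using s(1) D(2) V_def by (metis image_mono subset_trans)
  qed
  moreover have "wf_fm L \<theta>" using \<beta>(1) \<phi>(1) ExInf(1) by (simp add: \<theta>_def)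
  ultimately show ?thesis using bM assms(1) by (intro aclI) auto
qed

lemma acl_idem:
  assumes "A \<subseteq> carrier M" shows "acl L M (acl L M A) = acl L M A"
proof
  show "acl L M (acl L M A) \<subseteq> acl L M A"
  proof
    fix c assume c: "c \<in> acl L M (acl L M A)"
    obtain D where D: "finite D" "D \<subseteq> acl L M A" "c \<in> acl L M D" by (rule acl_finitary[OF c])
    have "c \<in> acl L M A" if "finite D" "D \<subseteq> acl L M A" "c \<in> acl L M (D \<union> A)" for D
      using that
    proof (induction D)
      case (insert d D)
      have "d \<in> acl L M (D \<union> A)" using insert.prems(1) acl_mono[of A "D \<union> A" L M] by auto
      then have "c \<in> acl L M (D \<union> A)"
        using insert acl_insert[of "D \<union> A" d c] assms acl_carrier[of L M A] by auto
      then show ?case using insert by auto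
    qed simp
    moreover have "c \<in> acl L M (D \<union> A)" using D(3) acl_mono[of D "D \<union> A" L M] by auto
    ultimately show "c \<in> acl L M A" using D(1,2) by simp
  qed
qed (rule acl_extensive[OF acl_carrier])

lemma pregeometry_acl: "pregeometry (carrier M) (acl L M)"
proof
  show "\<exists>A0\<subseteq>A. finite A0 \<and> b \<in> acl L M A0" if "b \<in> acl L M A" for A b
    using acl_finitary[OF that] by blast
  show "b \<in> acl L M (insert a A)"
    if "A \<subseteq> carrier M" "a \<in> carrier M" "b \<in> carrier M" "a \<in> acl L M (insert b A)" "a \<notin> acl L M A" for A a b
    using geometric M that unfolding geometric_def acl_exchange_def by blast
qed (auto intro: acl_extensive[THEN subsetD] acl_carrier[THEN subsetD] acl_mono[THEN subsetD] simp: acl_idem)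

text \<open>Dimensions of colored structures are computed in ambient models of \<open>T\<close>. For
  a model of \<open>T\<close> this changes nothing: a formula that is algebraic in the ambient model
  is equivalent to a quantifier-free one, which means the same in \<open>M\<close> and has at most
  as many solutions there.\<close>

lemma ambient_acl_eq:
  assumes "A \<subseteq> carrier M" shows "ambient_acl L T M A = acl L M A"
proof
  have "embedding L id M M" unfolding embedding_def by auto
  then show "acl L M A \<subseteq> ambient_acl L T M A"
    unfolding ambient_acl_def using M acl_carrier[of L M A] by fastforce
  show "ambient_acl L T M A \<subseteq> acl L M A"
  proof
    fix b assume "b \<in> ambient_acl L T M A"
    then obtain N h where N: "b \<in> carrier M" "models L T N" "embedding L h M N" "h b \<in> acl L N (h ` A)"
      unfolding ambient_acl_def by blast
    have emb: "h ` carrier M \<subseteq> carrier N" "inj_on h (carrier M)"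
      "\<And>f as. f \<in> funs L \<Longrightarrow> as \<in> tuples M (farity L f) \<Longrightarrow> h (fint M f as) = fint N f (map h as)"
      "\<And>r as. r \<in> rels L \<Longrightarrow> as \<in> tuples M (rarity L r) \<Longrightarrow> rint M r as \<longleftrightarrow> rint N r (map h as)"
      using N(3) unfolding embedding_def by auto
    have str: "is_structure L M" using M by (simp add: models_def)
    have val: "h (val M s t) = val N (h \<circ> s) t" if "wf_tm L t" "s ` fv_tm t \<subseteq> carrier M" for s t
      using that
    proof (induction t)
      case (App f ts)
      have "val M s t \<in> carrier M" if "t \<in> set ts" for t
        by (rule val_closed[OF str]) (use App.prems that in auto)
      then have "map (val M s) ts \<in> tuples M (farity L f)" using App.prems by (auto simp: tuples_def)
      then have "h (val M s (App f ts)) = fint N f (map h (map (val M s) ts))"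
        using emb(3) App.prems by auto
      also have "map h (map (val M s) ts) = map (val N (h \<circ> s)) ts"
        using App by (auto simp: image_subset_iff comp_def)
      finally show ?case by (simp add: comp_def)
    qed simp
    have qf: "sat M s \<psi> \<longleftrightarrow> sat N (h \<circ> s) \<psi>" if "qfree \<psi>" "wf_fm L \<psi>" "s ` fv \<psi> \<subseteq> carrier M" for s \<psi>
      using that
    proof (induction \<psi>)
      case (Equal t u)
      have "val M s t \<in> carrier M" "val M s u \<in> carrier M"
        using val_closed[OF str, of t s] val_closed[OF str, of u s] Equal.prems by auto
      moreover have "h (val M s t) = val N (h \<circ> s) t" "h (val M s u) = val N (h \<circ> s) u"
        using val[of t s] val[of u s] Equal.prems by auto
      ultimately show ?case using inj_on_eq_iff[OF emb(2)] by (metis sat.simps(2))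
    next
      case (Rel r ts)
      have "val M s t \<in> carrier M" if "t \<in> set ts" for t
        by (rule val_closed[OF str]) (use Rel.prems that in auto)
      then have "map (val M s) ts \<in> tuples M (rarity L r)" using Rel.prems by (auto simp: tuples_def)
      then have "sat M s (Rel r ts) \<longleftrightarrow> rint N r (map h (map (val M s) ts))"
        using emb(4) Rel.prems by auto
      also have "map h (map (val M s) ts) = map (val N (h \<circ> s)) ts"
        using val Rel.prems by (auto simp: image_subset_iff)
      finally show ?case by (simp add: comp_def)
    qed (auto simp: image_Un)
    obtain \<phi> as where \<phi>: "set as \<subseteq> h ` A" "formula L (Suc (length as)) \<phi>" "sat_at N \<phi> (h b # as)"
      "finite {c \<in> carrier N. sat_at N \<phi> (c # as)}" using N(4) unfolding acl_def by blast
    obtain as0 where as0: "as = map h as0" "set as0 \<subseteq> A"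
    proof -
      have "\<forall>x\<in>set as. \<exists>y. x = h y \<and> y \<in> A" using \<phi>(1) by blast
      then obtain g where "\<forall>x\<in>set as. x = h (g x) \<and> g x \<in> A" by metis
      then show ?thesis by (intro that[of "map g as"]) (auto simp: map_idI)
    qed
    define n where "n = Suc (length as)"
    obtain \<psi> where \<psi>: "formula L n \<psi>" "qfree \<psi>"
      "\<And>(M :: ('f, 'r, 'u) struct) as. models L T M \<Longrightarrow> as \<in> tuples M n \<Longrightarrow> sat_at M \<phi> as \<longleftrightarrow> sat_at M \<psi> as"
      using qe \<phi>(2) unfolding quantifier_elimination_def n_def by meson
    have eq: "sat_at M \<phi> (c # as0) \<longleftrightarrow> sat_at N \<phi> (h c # as)" if "c \<in> carrier M" for c
    proof -
      have t: "c # as0 \<in> tuples M n" "h c # as \<in> tuples N n"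
        using that as0 assms emb(1) by (auto simp: tuples_def n_def)
      then have "sat_at M \<phi> (c # as0) \<longleftrightarrow> sat_at M \<psi> (c # as0)" using \<psi>(3) M by blast
      also have "\<dots> \<longleftrightarrow> sat N (h \<circ> (!) (c # as0)) \<psi>"
      proof (rule qf)
        have "(c # as0) ! i \<in> carrier M" if "i \<in> fv \<psi>" for i
        proof -
          have "i < length (c # as0)" using t(1) that \<psi>(1) by (auto simp: tuples_def formula_def)
          then show ?thesis using t(1) nth_mem[of i "c # as0"] by (auto simp: tuples_def)
        qed
        then show "(!) (c # as0) ` fv \<psi> \<subseteq> carrier M" by auto
      qed (use \<psi> in \<open>auto simp: formula_def\<close>)
      also have "\<dots> \<longleftrightarrow> sat_at N \<psi> (h c # as)"
      proof (rule sat_cong)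
        fix i assume "i \<in> fv \<psi>"
        then have "i < length (c # as0)" using \<psi>(1) as0 by (auto simp: formula_def n_def)
        then have "map h (c # as0) ! i = h ((c # as0) ! i)" by (rule nth_map)
        then show "(h \<circ> (!) (c # as0)) i = (h c # as) ! i" using as0 by simp
      qed
      also have "\<dots> \<longleftrightarrow> sat_at N \<phi> (h c # as)" using \<psi>(3)[OF N(2) t(2)] by simp
      finally show ?thesis .
    qed
    have "finite {c \<in> carrier M. sat_at M \<phi> (c # as0)}"
    proof (rule inj_on_finite[OF _ _ \<phi>(4)])
      show "inj_on h {c \<in> carrier M. sat_at M \<phi> (c # as0)}" using emb(2) by (auto simp: inj_on_def)
      show "h ` {c \<in> carrier M. sat_at M \<phi> (c # as0)} \<subseteq> {c \<in> carrier N. sat_at N \<phi> (c # as)}"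
        using emb(1) eq by auto
    qed
    then show "b \<in> acl L M A"
      unfolding acl_def using as0 \<phi> N(1) eq by (intro CollectI conjI exI[of _ \<phi>] exI[of _ as0]) auto
  qed
qed

lemma cl_dim_ambient:
  assumes "A \<subseteq> carrier M" "X \<subseteq> carrier M"
  shows "cl_dim (ambient_acl L T M) A X = cl_dim (acl L M) A X"
proof -
  have "cl_basis (ambient_acl L T M) A X B \<longleftrightarrow> cl_basis (acl L M) A X B" for B
  proof (cases "B \<subseteq> A")
    case True
    then have "ambient_acl L T M (X \<union> B) = acl L M (X \<union> B)"
      "ambient_acl L T M (X \<union> (B - {b})) = acl L M (X \<union> (B - {b}))" for b
      using assms by (auto intro!: ambient_acl_eq)
    then show ?thesis by (simp add: cl_basis_def)
  qed (auto simp: cl_basis_def)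
  then show ?thesis unfolding cl_dim_def by simp
qed

text \<open>An elementary map preserves formulas only, so the finiteness of the solution set has to
  be carried over by \<open>ExInf\<close>.\<close>

lemma elem_acl:
  assumes el: "elem L M X f" and "A \<subseteq> X" "b \<in> X" "b \<in> acl L M A"
  shows "f b \<in> acl L M (f ` A)"
proof -
  obtain D where D: "finite D" "D \<subseteq> A" "b \<in> acl L M D" by (rule acl_finitary[OF assms(4)])
  have XM: "X \<subseteq> carrier M" "f ` X \<subseteq> carrier M" using el by (auto simp: elem_def)
  obtain s0 :: "nat \<Rightarrow> 'u" where s0: "range s0 \<subseteq> carrier M" by (rule ex_assignment)
  have DM: "D \<subseteq> carrier M" using D(2) assms(2) XM(1) by (meson order_trans)
  obtain s n where s: "s ` {1::nat..<1 + n} = D" "range s \<subseteq> carrier M"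
    by (rule enum_vars[OF D(1) DM s0, of 1], rule that)
  define V where "V = {1..<1 + n}"
  obtain \<phi> where \<phi>: "wf_fm L \<phi>" "fv \<phi> \<subseteq> insert 0 V" "sat M (s(0 := b)) \<phi>"
    "finite {c \<in> carrier M. sat M (s(0 := c)) \<phi>}"
    by (rule aclE[of b L M s V 0]) (use D s in \<open>auto simp: V_def\<close>)
  have sV: "s ` V \<subseteq> X" using s(1) D assms by (auto simp: V_def)
  have "f \<circ> s(0 := b) = (f \<circ> s)(0 := f b)" by auto
  then have "sat M ((f \<circ> s)(0 := f b)) \<phi>"
    using elemD[OF el \<phi>(1), of "s(0 := b)"] \<phi>(2,3) sV assms(3) by auto
  moreover have "finite {c \<in> carrier M. sat M ((f \<circ> s)(0 := c)) \<phi>}"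
  proof -
    have "fv (ExInf 0 \<phi>) \<subseteq> V" using ExInf(2)[OF \<phi>(1), of 0] \<phi>(2) by auto
    then have "sat M s (ExInf 0 \<phi>) \<longleftrightarrow> sat M (f \<circ> s) (ExInf 0 \<phi>)"
      using elemD[OF el ExInf(1)[OF \<phi>(1)], of s] sV by blast
    moreover have "sat M s (ExInf 0 \<phi>) \<longleftrightarrow> infinite {c \<in> carrier M. sat M (s(0 := c)) \<phi>}"
      by (rule ExInf(3)[OF \<phi>(1) M]) (use s(2) in auto)
    moreover have "sat M (f \<circ> s) (ExInf 0 \<phi>) \<longleftrightarrow> infinite {c \<in> carrier M. sat M ((f \<circ> s)(0 := c)) \<phi>}"
    proof (rule ExInf(3)[OF \<phi>(1) M])
      have "fv \<phi> - {0} \<subseteq> V" using \<phi>(2) by auto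
      then show "(f \<circ> s) ` (fv \<phi> - {0}) \<subseteq> carrier M" using sV XM(2) by fastforce
    qed
    ultimately show ?thesis using \<phi>(4) by blast
  qed
  moreover have "(f \<circ> s) ` (fv \<phi> - {0}) \<subseteq> f ` A"
  proof -
    have "fv \<phi> - {0} \<subseteq> V" using \<phi>(2) by auto
    then show ?thesis using s(1) D(2) by (fastforce simp: V_def)
  qed
  ultimately show ?thesis
    using assms XM \<phi> by (intro aclI[of "f b" M "f ` A" L \<phi> "f \<circ> s" 0]) blast+
qed

lemma elem_acl_iff:
  assumes el: "elem L M X f" and "A \<subseteq> X" "b \<in> X"
  shows "f b \<in> acl L M (f ` A) \<longleftrightarrow> b \<in> acl L M A"
proof
  note inj = elem_inj[OF el]
  assume "f b \<in> acl L M (f ` A)"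
  then have "inv_into X f (f b) \<in> acl L M (inv_into X f ` f ` A)"
    using assms by (intro elem_acl[OF elem_inv[OF el]]) auto
  moreover have "inv_into X f ` f ` A = A" using inj assms(2) by (simp add: inv_into_image_cancel)
  ultimately show "b \<in> acl L M A" using inj assms(3) by simp
qed (rule elem_acl[OF assms])

lemma elem_rk:
  assumes el: "elem L M X f" and "A \<subseteq> X" "finite A"
  shows "cl_dim (acl L M) (f ` A) {} = cl_dim (acl L M) A {}"
  using assms(3,2)
proof (induction A)
  case (insert a A)
  interpret pregeometry "carrier M" "acl L M" by (rule pregeometry_acl)
  have "X \<subseteq> carrier M" "f ` X \<subseteq> carrier M" using el by (auto simp: elem_def)
  then have "rk (insert a A) = (if a \<in> acl L M A then rk A else Suc (rk A))"
    "rk (insert (f a) (f ` A)) = (if f a \<in> acl L M (f ` A) then rk (f ` A) else Suc (rk (f ` A)))"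
    using insert by (intro rk_insert; auto)+
  then show ?case using elem_acl_iff[OF el, of A a] insert by simp
qed simp

text \<open>The formula certifies algebraicity in every model of \<open>T\<close>, because the
  finiteness of each fibre is one of its conjuncts. In this way upper bounds on dimension become
  first-order conditions.\<close>

lemma acl_witness:
  assumes "finite V" "s ` V \<subseteq> acl L M (s ` D)" "s ` D \<subseteq> carrier M"
  shows "\<exists>W. wf_fm L W \<and> fv W \<subseteq> V \<union> D \<and> sat M s W \<and>
    (\<forall>(N :: ('f, 'r, 'u) struct) s'. models L T N \<longrightarrow> s' ` (V \<union> D) \<subseteq> carrier N \<longrightarrow> sat N s' W \<longrightarrow>
       s' ` V \<subseteq> acl L N (s' ` D))"
proof -
  have one: "\<exists>W. wf_fm L W \<and> fv W \<subseteq> insert v D \<and> sat M s W \<and>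
    (\<forall>(N :: ('f, 'r, 'u) struct) s'. models L T N \<longrightarrow> s' ` (V \<union> D) \<subseteq> carrier N \<longrightarrow> sat N s' W \<longrightarrow>
       s' v \<in> acl L N (s' ` D))" if v: "v \<in> V" for v
  proof (cases "v \<in> D")
    case True
    have "s' v \<in> acl L N (s' ` D)" if "s' ` (V \<union> D) \<subseteq> carrier N" for N :: "('f, 'r, 'u) struct" and s'
      using acl_extensive[of "s' ` D" N L] that True by auto
    then show ?thesis by (intro exI[of _ "Neg Falsum"]) auto
  next
    case False
    obtain \<phi> where \<phi>: "wf_fm L \<phi>" "fv \<phi> \<subseteq> insert v D" "sat M (s(v := s v)) \<phi>"
      "finite {c \<in> carrier M. sat M (s(v := c)) \<phi>}"
      by (rule aclE[of "s v" L M s D v]) (use v assms False in auto)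
    define W where "W = And \<phi> (Neg (ExInf v \<phi>))"
    have "s ` (fv \<phi> - {v}) \<subseteq> carrier M" using \<phi>(2) assms(3) by auto
    then have "sat M s W" using \<phi> ExInf(3)[OF \<phi>(1) M, of s v] by (simp add: W_def)
    moreover have "s' v \<in> acl L N (s' ` D)" if N: "models L T N" "s' ` (V \<union> D) \<subseteq> carrier N" "sat N s' W"
      for N :: "('f, 'r, 'u) struct" and s'
    proof -
      have "s' ` (fv \<phi> - {v}) \<subseteq> carrier N" using \<phi>(2) N(2) by auto
      then have "sat N s' \<phi>" "finite {c \<in> carrier N. sat N (s'(v := c)) \<phi>}"
        using N(3) ExInf(3)[OF \<phi>(1) N(1), of s' v] by (simp_all add: W_def)
      then show ?thesis
        using v N(2) \<phi>(1,2) by (intro aclI[of _ N _ L \<phi> s' v]) auto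
    qed
    moreover have "wf_fm L W" "fv W \<subseteq> insert v D"
      using \<phi> ExInf(1,2)[OF \<phi>(1), of v] by (auto simp: W_def)
    ultimately show ?thesis by blast
  qed
  obtain W where W: "\<And>v. v \<in> V \<Longrightarrow> wf_fm L (W v) \<and> fv (W v) \<subseteq> insert v D \<and> sat M s (W v) \<and>
    (\<forall>(N :: ('f, 'r, 'u) struct) s'. models L T N \<longrightarrow> s' ` (V \<union> D) \<subseteq> carrier N \<longrightarrow> sat N s' (W v) \<longrightarrow>
       s' v \<in> acl L N (s' ` D))"
    using one by metis
  obtain vs where vs: "set vs = V" using finite_list[OF assms(1)] by blast
  show ?thesis
  proof (intro exI[of _ "ConjL (map W vs)"] conjI allI impI)
    show "wf_fm L (ConjL (map W vs))" "sat M s (ConjL (map W vs))" using W vs by simp_all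
    show "fv (ConjL (map W vs)) \<subseteq> V \<union> D" using W vs by fastforce
    fix N :: "('f, 'r, 'u) struct" and s'
    assume N: "models L T N" "s' ` (V \<union> D) \<subseteq> carrier N" "sat N s' (ConjL (map W vs))"
    have "s' v \<in> acl L N (s' ` D)" if "v \<in> V" for v
    proof -
      have "sat N s' (W v)" using N(3) vs that by simp
      then show ?thesis using W[OF that] N(1,2) by blast
    qed
    then show "s' ` V \<subseteq> acl L N (s' ` D)" by blast
  qed
qed

text \<open>Removing finitely many finite sets from the infinite set defined by \<theta> leaves it
  nonempty; by saturation all finite sets definable over \<open>D\<close> are avoided
  simultaneously.\<close>

lemma nonalgebraic_realization:
  assumes sat1: "aleph1_saturated L M" and D: "finite D" "D \<subseteq> carrier M"
    and \<theta>: "wf_fm L \<theta>" "range s \<subseteq> carrier M" "infinite {c \<in> carrier M. sat M (s(x := c)) \<theta>}"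
  shows "\<exists>c\<in>carrier M. sat M (s(x := c)) \<theta> \<and> c \<notin> acl L M D"
proof -
  \<comment> \<open>The names for the elements of \<open>D\<close> start above \<open>x\<close> and
    above all variables of \<theta>, so introducing them does not affect the truth of
    \<theta>.\<close>
  define k where "k = Suc (Max (insert x (fv \<theta>)))"
  have k: "y < k" if "y \<in> insert x (fv \<theta>)" for y
    unfolding k_def less_Suc_eq_le by (rule Max_ge) (use that in auto)
  obtain s2 n where s2: "s2 ` {k..<k + n} = D" "\<And>i. i < k \<Longrightarrow> s2 i = s i" "range s2 \<subseteq> carrier M"
    by (rule enum_vars[OF D \<theta>(2), of k], rule that)
  define V where "V = {k..<k + n}"
  have xV: "x \<notin> V" using k[of x] by (auto simp: V_def)
  have eq: "sat M (s2(x := c)) \<theta> \<longleftrightarrow> sat M (s(x := c)) \<theta>" for c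
    by (rule sat_cong) (use s2(2) k in auto)
  \<comment> \<open>All formulas with finitely many solutions in \<open>x\<close> are negated, the
    other variables having their values under \<open>s2\<close> as parameters; every element of
    \<open>D\<close> is among these values.\<close>
  define \<Gamma> where "\<Gamma> = insert \<theta> {Neg \<alpha> | \<alpha>. wf_fm L \<alpha> \<and> finite {c \<in> carrier M. sat M (s2(x := c)) \<alpha>}}"
  have "\<exists>s\<in>assignments_over M (- {x}) s2. \<forall>\<phi>\<in>\<Gamma>. sat M s \<phi>"
  proof (rule saturated_assignment[OF sat1])
    show "wf_fm L \<phi>" if "\<phi> \<in> \<Gamma>" for \<phi> using that \<theta>(1) by (auto simp: \<Gamma>_def)
    fix \<Gamma>0 assume \<Gamma>0: "finite \<Gamma>0" "\<Gamma>0 \<subseteq> \<Gamma>"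
    define F where "F = (\<Union>\<phi>\<in>\<Gamma>0 - {\<theta>}. {c \<in> carrier M. \<not> sat M (s2(x := c)) \<phi>})"
    have "finite F" unfolding F_def using \<Gamma>0 by (auto simp: \<Gamma>_def)
    then have "infinite ({c \<in> carrier M. sat M (s(x := c)) \<theta>} - F)" using \<theta>(3) by simp
    then obtain c where c: "c \<in> carrier M" "sat M (s(x := c)) \<theta>" "c \<notin> F"
      using infinite_imp_nonempty by blast
    have "sat M (s2(x := c)) \<phi>" if "\<phi> \<in> \<Gamma>0" for \<phi>
      using c that eq by (cases "\<phi> = \<theta>") (auto simp: F_def)
    then show "\<exists>s\<in>assignments_over M (- {x}) s2. \<forall>\<phi>\<in>\<Gamma>0. sat M s \<phi>"
      using c s2(3) by (intro bexI[of _ "s2(x := c)"]) (auto simp: assignments_over_def)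
  qed
  then obtain s' where s': "s' \<in> assignments_over M (- {x}) s2" "\<And>\<phi>. \<phi> \<in> \<Gamma> \<Longrightarrow> sat M s' \<phi>" by blast
  have s'eq: "s' = s2(x := s' x)" using s'(1) by (auto simp: assignments_over_def)
  have "s' x \<notin> acl L M D"
  proof
    assume "s' x \<in> acl L M D"
    then have *: "s' x \<in> acl L M (s2 ` V)" "s2 ` V \<subseteq> carrier M" using s2 by (auto simp: V_def)
    obtain \<phi> where \<phi>: "wf_fm L \<phi>" "sat M (s2(x := s' x)) \<phi>" "finite {c \<in> carrier M. sat M (s2(x := c)) \<phi>}"
      
      by (rule aclE[OF *(1) xV *(2)], rule that)
    then have "Neg \<phi> \<in> \<Gamma>" by (auto simp: \<Gamma>_def)
    then have "\<not> sat M s' \<phi>" using s'(2)[of "Neg \<phi>"] by simp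
    then show False using \<phi>(2) s'eq by simp
  qed
  moreover have "sat M (s2(x := s' x)) \<theta>" using s'(2)[of \<theta>] s'eq by (simp add: \<Gamma>_def)
  moreover have "s' x \<in> carrier M" using s'(1) by (auto simp: assignments_over_def)
  ultimately show ?thesis using eq by blast
qed

lemma ex_indep_list:
  assumes sat1: "aleph1_saturated L M" and D: "finite D" "D \<subseteq> carrier M"
  shows "\<exists>us. length us = n \<and> set us \<subseteq> carrier M \<and> seq_indep (acl L M) D us"
  using D
proof (induction n arbitrary: D)
  case (Suc n)
  obtain s :: "nat \<Rightarrow> 'u" where s: "range s \<subseteq> carrier M" by (rule ex_assignment)
  have "infinite (carrier M)" using no_finite M by (simp add: no_finite_models_def)
  then obtain c where c: "c \<in> carrier M" "c \<notin> acl L M D"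
    using nonalgebraic_realization[OF sat1 Suc.prems, of "Neg Falsum" s 0] s by auto
  then obtain us where "length us = n" "set us \<subseteq> carrier M" "seq_indep (acl L M) (insert c D) us"
    using Suc.IH[of "insert c D"] Suc.prems by auto
  then show ?case using c by (intro exI[of _ "c # us"]) auto
qed auto

end

text \<open>In a saturated model \<open>ExInf\<close> is a quantifier for a generic value: an
  infinite solution set has a point outside the algebraic closure of \<open>D\<close>, and a set
  over \<open>D\<close> with such a point is infinite. Iterated along \<open>xs\<close> it asks for
  a solution independent over \<open>D\<close>, by one formula for all finite \<open>D\<close> that
  contain the parameters.\<close>

lemma generic_ex_formula:
  assumes "wf_fm L \<chi>" "distinct xs"
  shows "\<exists>\<theta>. wf_fm L \<theta> \<and> fv \<theta> \<subseteq> fv \<chi> - set xs \<and>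
    (\<forall>(M :: ('f, 'r, 'u) struct) s D. monster L T M \<longrightarrow> range s \<subseteq> carrier M \<longrightarrow> finite D \<longrightarrow> D \<subseteq> carrier M \<longrightarrow>
      s ` (fv \<chi> - set xs) \<subseteq> D \<longrightarrow>
      (sat M s \<theta> \<longleftrightarrow> (\<exists>s'. range s' \<subseteq> carrier M \<and> (\<forall>x. x \<notin> set xs \<longrightarrow> s' x = s x) \<and> sat M s' \<chi> \<and>
        seq_indep (acl L M) D (map s' xs))))"
  using assms(2)
proof (induction xs)
  case Nil
  have "(\<forall>x. s' x = s x) \<longleftrightarrow> s' = s" for s' s :: "nat \<Rightarrow> 'u" by (simp add: fun_eq_iff)
  then show ?case using assms(1) by (intro exI[of _ \<chi>]) simp
next
  case (Cons x xs)
  then obtain \<theta>' where \<theta>': "wf_fm L \<theta>'" "fv \<theta>' \<subseteq> fv \<chi> - set xs"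
    "\<And>(M :: ('f, 'r, 'u) struct) s D. monster L T M \<Longrightarrow> range s \<subseteq> carrier M \<Longrightarrow> finite D \<Longrightarrow> D \<subseteq> carrier M \<Longrightarrow>
      s ` (fv \<chi> - set xs) \<subseteq> D \<Longrightarrow>
      (sat M s \<theta>' \<longleftrightarrow> (\<exists>s'. range s' \<subseteq> carrier M \<and> (\<forall>x. x \<notin> set xs \<longrightarrow> s' x = s x) \<and> sat M s' \<chi> \<and>
        seq_indep (acl L M) D (map s' xs)))"
    by auto
  have "sat M s (ExInf x \<theta>') \<longleftrightarrow> (\<exists>s'. range s' \<subseteq> carrier M \<and> (\<forall>y. y \<notin> set (x # xs) \<longrightarrow> s' y = s y) \<and> sat M s' \<chi> \<and>
        seq_indep (acl L M) D (map s' (x # xs)))" (is "_ \<longleftrightarrow> ?r")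
    if *: "monster L T M" "range s \<subseteq> carrier M" "finite D" "D \<subseteq> carrier M" "s ` (fv \<chi> - set (x # xs)) \<subseteq> D"
    for M :: "('f, 'r, 'u) struct" and s D
  proof -
    have M: "models L T M" "aleph1_saturated L M" using * by (auto simp: monster_def)
    have sc: "s y \<in> carrier M" for y using * by auto
    have "sat M s (ExInf x \<theta>') \<longleftrightarrow> infinite {c \<in> carrier M. sat M (s(x := c)) \<theta>'}"
      by (rule ExInf(3)[OF \<theta>'(1) M(1)]) (use sc in auto)
    also have "\<dots> \<longleftrightarrow> ?r"
    proof
      assume "infinite {c \<in> carrier M. sat M (s(x := c)) \<theta>'}"
      then obtain c where c: "c \<in> carrier M" "sat M (s(x := c)) \<theta>'" "c \<notin> acl L M D"
        using nonalgebraic_realization[OF M *(3,4) \<theta>'(1) *(2)] by blast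
      have "\<exists>s'. range s' \<subseteq> carrier M \<and> (\<forall>y. y \<notin> set xs \<longrightarrow> s' y = (s(x := c)) y) \<and> sat M s' \<chi> \<and>
        seq_indep (acl L M) (insert c D) (map s' xs)"
      proof (rule \<theta>'(3)[OF *(1), THEN iffD1])
        show "range (s(x := c)) \<subseteq> carrier M" "(s(x := c)) ` (fv \<chi> - set xs) \<subseteq> insert c D"
          using * c(1) sc by auto
        show "sat M (s(x := c)) \<theta>'" by (rule c(2))
      qed (use * c in auto)
      then obtain s' where s': "range s' \<subseteq> carrier M" "\<forall>y. y \<notin> set xs \<longrightarrow> s' y = (s(x := c)) y" "sat M s' \<chi>"
        "seq_indep (acl L M) (insert c D) (map s' xs)" by blast
      have "s' x = c" using s'(2) Cons.prems by auto
      then show ?r using s' c by (intro exI[of _ s']) auto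
    next
      assume ?r
      then obtain s' where s': "range s' \<subseteq> carrier M" "\<And>y. y \<notin> set (x # xs) \<Longrightarrow> s' y = s y" "sat M s' \<chi>"
        "s' x \<notin> acl L M D" "seq_indep (acl L M) (insert (s' x) D) (map s' xs)" by auto
      have "sat M (s(x := s' x)) \<theta>'"
        by (rule \<theta>'(3)[THEN iffD2, of M _ "insert (s' x) D"])
          (use * s' sc in \<open>auto simp: image_subset_iff intro!: exI[of _ s']\<close>)
      moreover have "fv \<theta>' - {x} \<subseteq> fv \<chi> - set (x # xs)" using \<theta>'(2) by auto
      ultimately show "infinite {c \<in> carrier M. sat M (s(x := c)) \<theta>'}"
        using aclI[of "s' x" M D L \<theta>' s x] s'(1,4) * \<theta>'(1) by (meson image_mono rangeI subset_iff)
    qed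
    finally show ?thesis .
  qed
  moreover have "wf_fm L (ExInf x \<theta>')" "fv (ExInf x \<theta>') \<subseteq> fv \<chi> - set (x # xs)"
    using ExInf(1,2)[OF \<theta>'(1), of x] \<theta>'(2) by auto
  ultimately show ?case by blast
qed

end

section \<open>Colored structures and predimension\<close>

text \<open>The values at \<open>B\<close> form a basis of those at \<open>V\<close> over those at
  \<open>D\<close>. The formula certifies that \<open>B\<close> and \<open>D\<close> span
  \<open>V\<close>, so for any other solution, in any model, the dimension can only drop.\<close>

lemma (in geometric_theory) dim_witness:
  fixes M :: "('f, 'r, 'u) struct"
  assumes M: "models L T M" and fin: "finite V" "finite D" and sM: "s ` (V \<union> D) \<subseteq> carrier M"
  obtains W B where "B \<subseteq> V" "card B = cl_dim (acl L M) (s ` V) (s ` D)" "wf_fm L W" "fv W \<subseteq> V \<union> D" "sat M s W"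
    "\<And>(N :: ('f, 'r, 'u) struct) s'. models L T N \<Longrightarrow> s' ` (V \<union> D) \<subseteq> carrier N \<Longrightarrow> sat N s' W \<Longrightarrow>
       s' ` V \<subseteq> acl L N (s' ` (B \<union> D)) \<and> cl_dim (acl L N) (s' ` V) (s' ` D) \<le> card B"
proof -
  interpret pregeometry "carrier M" "acl L M" by (rule pregeometry_acl[OF M])
  obtain B0 where B0: "finite B0" "cl_basis (acl L M) (s ` V) (s ` D) B0"
    "card B0 = cl_dim (acl L M) (s ` V) (s ` D)"
    using finite_basis[of "s ` V" "s ` D" "{}"] fin sM by auto
  have B0V: "B0 \<subseteq> s ` V" "s ` V \<subseteq> acl L M (s ` D \<union> B0)" using B0(2) by (auto simp: cl_basis_def)
  define B where "B = inv_into V s ` B0"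
  have sB: "s ` B = B0" unfolding B_def using B0V(1) by (rule image_inv_into_cancel[OF refl])
  have BV: "B \<subseteq> V" using B0V(1) by (auto simp: B_def intro: inv_into_into)
  have cB: "card B = card B0" unfolding B_def using B0V(1) by (intro card_image inj_on_inv_into)
  have "s ` V \<subseteq> acl L M (s ` (B \<union> D))" "s ` (B \<union> D) \<subseteq> carrier M"
    using B0V(2) sB BV sM by (simp add: image_Un Un_commute, blast)
  from acl_witness[OF M fin(1) this] obtain W where
    W: "wf_fm L W" "fv W \<subseteq> V \<union> (B \<union> D)" "sat M s W"
    and W4: "\<forall>(N :: ('f, 'r, 'u) struct) s'. models L T N \<longrightarrow> s' ` (V \<union> (B \<union> D)) \<subseteq> carrier N \<longrightarrow> sat N s' W \<longrightarrow>
       s' ` V \<subseteq> acl L N (s' ` (B \<union> D))"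
    by (elim exE conjE) (rule that)
  have VB: "V \<union> (B \<union> D) = V \<union> D" using BV by auto
  show thesis
  proof (rule that[of B W])
    fix N :: "('f, 'r, 'u) struct" and s' :: "nat \<Rightarrow> 'u"
    assume N: "models L T N" "s' ` (V \<union> D) \<subseteq> carrier N" "sat N s' W"
    interpret N: pregeometry "carrier N" "acl L N" by (rule pregeometry_acl[OF N(1)])
    have "s' ` V \<subseteq> acl L N (s' ` (B \<union> D))" by (rule W4[rule_format]) (use N VB in simp_all)
    moreover have "cl_dim (acl L N) (s' ` V) (s' ` D) \<le> card (s' ` B)"
    proof (rule N.cl_dim_le_card)
      show "s' ` V \<subseteq> acl L N (s' ` D \<union> s' ` B)"
        using calculation by (simp add: image_Un Un_commute)
    qed (use N BV fin finite_subset[OF BV] in auto)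
    moreover have "card (s' ` B) \<le> card B" by (rule card_image_le) (rule finite_subset[OF BV fin(1)])
    ultimately show "s' ` V \<subseteq> acl L N (s' ` (B \<union> D)) \<and> cl_dim (acl L N) (s' ` V) (s' ` D) \<le> card B" by simp
  qed (use W VB BV cB B0 in simp_all)
qed

section \<open>Colored structures and their reducts\<close>

definition lift :: "('f, 'r) fm \<Rightarrow> ('f, 'r option) fm" where
  "lift = map_fm id Some"

lemma reduct_simps [simp]:
  "carrier (reduct M) = carrier M" "fint (reduct M) = fint M" "rint (reduct M) r = rint M (Some r)"
  by (simp_all add: reduct_def)

lemma val_reduct [simp]: "val (reduct M) s t = val M s t"
proof (induction t)
  case (App f ts)
  then have "map (val (reduct M) s) ts = map (val M s) ts" by simp
  then show ?case by (metis reduct_simps(2) val.simps(2))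
qed simp

lemma map_tm_id [simp]: "map_tm id t = t"
  by (simp add: tm.map_id)

lemma fv_lift [simp]: "fv (lift \<phi>) = fv \<phi>"
  by (induction \<phi>) (auto simp: lift_def)

lemma sat_lift [simp]: "sat M s (lift \<phi>) \<longleftrightarrow> sat (reduct M) s \<phi>"
proof (induction \<phi> arbitrary: s)
  case (Rel r ts)
  have "map (val M s) (map (map_tm id) ts) = map (val (reduct M) s) ts" by simp
  then show ?case unfolding lift_def fm.map sat.simps reduct_simps by (rule arg_cong)
qed (auto simp: lift_def)

lemma colored_language_simps [simp]:
  "funs (colored_language L) = funs L" "farity (colored_language L) = farity L"
  "rels (colored_language L) = insert None (Some ` rels L)"
  "rarity (colored_language L) None = 1" "rarity (colored_language L) (Some r) = rarity L r"
  by (simp_all add: colored_language_def)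

lemma wf_tm_colored [simp]: "wf_tm (colored_language L) t \<longleftrightarrow> wf_tm L t"
  by (induction t) auto

lemma wf_lift [simp]: "wf_fm (colored_language L) (lift \<phi>) \<longleftrightarrow> wf_fm L \<phi>"
  by (induction \<phi>) (auto simp: lift_def)

lemma formula_lift [simp]: "formula (colored_language L) n (lift \<phi>) \<longleftrightarrow> formula L n \<phi>"
  by (simp add: formula_def)

definition Col :: "nat \<Rightarrow> ('f, 'r option) fm" where
  "Col x = Rel None [Var x]"

lemma Col_simps [simp]:
  "sat M s (Col x) \<longleftrightarrow> rint M None [s x]" "fv (Col x) = {x}" "wf_fm (colored_language L) (Col x)"
  by (simp_all add: Col_def)

definition Distinct :: "nat list \<Rightarrow> ('f, 'r) fm" where
  "Distinct xs = ConjL [Neg (Equal (Var i) (Var j)). i \<leftarrow> xs, j \<leftarrow> xs, i \<noteq> j]"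

lemma Distinct_simps [simp]:
  "sat M s (Distinct xs) \<longleftrightarrow> inj_on s (set xs)" "fv (Distinct xs) \<subseteq> set xs" "wf_fm L (Distinct xs)"
  by (auto simp: Distinct_def inj_on_def split: if_splits)

lemma is_structure_reduct: "is_structure (colored_language L) M \<Longrightarrow> is_structure L (reduct M)"
  by (simp add: is_structure_def)

lemma aleph1_saturated_reduct:
  assumes "aleph1_saturated (colored_language L) M" shows "aleph1_saturated L (reduct M)"
  unfolding aleph1_saturated_def
proof (intro allI impI, elim conjE)
  fix A \<Sigma>
  assume *: "countable A" "A \<subseteq> carrier (reduct M)" "partial_type L 1 A \<Sigma>"
    "\<forall>\<Sigma>0. finite \<Sigma>0 \<and> \<Sigma>0 \<subseteq> \<Sigma> \<longrightarrow> (\<exists>bs. realizes (reduct M) 1 \<Sigma>0 bs)"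
  have real: "realizes M 1 (map_prod lift id ` \<Sigma>0) bs \<longleftrightarrow> realizes (reduct M) 1 \<Sigma>0 bs" for \<Sigma>0 bs
    by (auto simp: realizes_def tuples_def split: prod.splits)
  have "\<exists>bs. realizes M 1 (map_prod lift id ` \<Sigma>) bs"
  proof (rule assms[unfolded aleph1_saturated_def, rule_format], intro conjI allI impI)
    show "partial_type (colored_language L) 1 A (map_prod lift id ` \<Sigma>)"
      using *(3) by (fastforce simp: partial_type_def)
    fix \<Sigma>0 assume "finite \<Sigma>0 \<and> \<Sigma>0 \<subseteq> map_prod lift id ` \<Sigma>"
    then obtain \<Sigma>1 where "finite \<Sigma>1" "\<Sigma>1 \<subseteq> \<Sigma>" "\<Sigma>0 = map_prod lift id ` \<Sigma>1"
      by (metis finite_subset_image)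
    then show "\<exists>bs. realizes M 1 \<Sigma>0 bs" using *(4) real by metis
  qed (use * in auto)
  then show "\<exists>bs. realizes (reduct M) 1 \<Sigma> bs" using real by simp
qed

locale colored_theory = geometric_theory U L T
  for U :: "'u itself" and L :: "('f, 'r) language" and T :: "('f, 'r) fm set" +
  fixes \<alpha> :: real and p q :: nat
  assumes indec: "indecomposable U L T" and sentences: "\<And>\<sigma>. \<sigma> \<in> T \<Longrightarrow> sentence L \<sigma>"
    and alpha: "\<alpha> = real p / real q" "0 < p" "p \<le> q"
begin

text \<open>Multiplying by the denominator \<open>q\<close> turns the real inequality into one
  between natural numbers, and in a model of \<open>T\<close> the ambient dimension is the usual
  one.\<close>

lemma predim_nonneg_iff:
  fixes N :: "('f, 'r option, 'u) struct"
  assumes "models L T (reduct N)" "A \<subseteq> carrier N" "X \<subseteq> carrier N"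
  shows "predim L T \<alpha> N A X \<ge> 0 \<longleftrightarrow>
    p * card (colored N \<inter> (A - X)) \<le> q * cl_dim (acl L (reduct N)) A X"
proof -
  have "kdim L T N A X = cl_dim (acl L (reduct N)) A X"
    unfolding kdim_def by (rule cl_dim_ambient) (use assms in simp_all)
  moreover have "real p / real q * real c \<le> real k \<longleftrightarrow> p * c \<le> q * k" for c k
  proof -
    have "real p / real q * real c \<le> real k \<longleftrightarrow> real (p * c) \<le> real (q * k)"
      using alpha(2,3) by (simp add: field_simps)
    then show ?thesis by (simp only: of_nat_le_iff)
  qed
  ultimately show ?thesis by (simp add: predim_def alpha(1))
qed

lemma T_alpha_model_rank:
  fixes N :: "('f, 'r option, 'u) struct"
  assumes "T_alpha_model L T \<alpha> N" "finite A" "A \<subseteq> carrier N"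
  shows "p * card (colored N \<inter> A) \<le> q * cl_dim (acl L (reduct N)) A {}"
proof -
  have "models L T (reduct N)" "predim L T \<alpha> N A {} \<ge> 0"
    using assms unfolding T_alpha_model_def K_plus_def by auto
  then show ?thesis using predim_nonneg_iff[of N A "{}"] assms(3) by simp
qed

end

section \<open>Predimension in a saturated model of the colored theory\<close>

locale T_alpha_monster = colored_theory U L T \<alpha> p q
  for U :: "'u itself" and L :: "('f, 'r) language" and T :: "('f, 'r) fm set" and \<alpha> p q +
  fixes M :: "('f, 'r option, 'u) struct"
  assumes mon: "monster (colored_language L) (T_alpha U L T \<alpha>) M"
begin

abbreviation "R \<equiv> reduct M"
abbreviation "C \<equiv> colored M"
abbreviation "cl \<equiv> acl L R"

lemma sat_M: "aleph1_saturated (colored_language L) M"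
  using mon by (simp add: monster_def)

text \<open>\<open>T_alpha\<close> consists of the sentences true throughout the axiomatized class,
  so \<open>M\<close> is a model of these sentences without being known to belong to the class. What
  holds in the class reaches \<open>M\<close> only through a sentence.\<close>

lemma true_in_M:
  assumes "wf_fm (colored_language L) \<sigma>" "fv \<sigma> = {}"
    "\<And>N :: ('f, 'r option, 'u) struct. T_alpha_model L T \<alpha> N \<Longrightarrow> sat_at N \<sigma> []"
  shows "sat M s \<sigma>"
proof -
  have "\<sigma> \<in> T_alpha U L T \<alpha>" using assms by (auto simp: T_alpha_def sentence_def formula_def)
  then have "sat_at M \<sigma> []" using mon by (simp add: monster_def models_def)
  then show ?thesis using sat_cong[of \<sigma> s "(!) []" M] assms(2) by simp
qed

lemma R_models: "models L T R"
proof -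
  have "is_structure L R" using mon by (auto simp: monster_def models_def intro: is_structure_reduct)
  moreover have "sat_at R \<sigma> []" if \<sigma>: "\<sigma> \<in> T" for \<sigma>
  proof -
    have "sat M ((!) []) (lift \<sigma>)"
    proof (rule true_in_M)
      show "wf_fm (colored_language L) (lift \<sigma>)" "fv (lift \<sigma>) = {}"
        using sentences[OF \<sigma>] by (auto simp: sentence_def formula_def)
    qed (use \<sigma> in \<open>auto simp: T_alpha_model_def models_def\<close>)
    then show ?thesis by simp
  qed
  ultimately show ?thesis by (simp add: models_def)
qed

lemma sat_R: "aleph1_saturated L R"
  by (rule aleph1_saturated_reduct[OF sat_M])

lemma R_monster: "monster L T R"
  using R_models sat_R by (simp add: monster_def)

sublocale pregeometry "carrier M" "cl"
  using pregeometry_acl[OF R_models] by simp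

lemma C_carrier: "C \<subseteq> carrier M" by (auto simp: colored_def)

text \<open>Nonnegativity of the predimension is transferred one configuration at a time. A
  counterexample in \<open>M\<close> comes with a formula \<open>W\<close> certifying that its rank
  is too small; the sentence \<sigma> says that no tuple of distinct colored points satisfies
  \<open>W\<close>, and it holds throughout the class.\<close>

lemma rank_bound:
  assumes "finite A" "A \<subseteq> carrier M"
  shows "p * card (C \<inter> A) \<le> q * rk A"
proof (rule ccontr)
  assume neg: "\<not> p * card (C \<inter> A) \<le> q * rk A"
  define Z where "Z = C \<inter> A"
  have Z: "finite Z" "Z \<subseteq> carrier M" "Z \<subseteq> C" using assms by (auto simp: Z_def)
  have "rk Z \<le> rk A" by (rule rk_mono) (use assms in \<open>auto simp: Z_def\<close>)
  then have "q * rk Z \<le> q * rk A" by (rule mult_le_mono2)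
  then have less: "q * rk Z < p * card Z" using neg unfolding Z_def by linarith
  obtain s0 :: "nat \<Rightarrow> 'u" where s0: "range s0 \<subseteq> carrier R" by (rule ex_assignment[OF R_models])
  have ZR: "Z \<subseteq> carrier R" using Z by simp
  obtain s n where s: "s ` {0::nat..<0 + n} = Z" "inj_on s {0::nat..<0+n}" "range s \<subseteq> carrier R"
    by (rule enum_vars[OF Z(1) ZR s0, of 0], rule that)
  define V where "V = set [0..<n]"
  have sV: "s ` V = Z" "inj_on s V" using s by (simp_all add: V_def atLeast0LessThan)
  obtain W B where W: "B \<subseteq> V" "card B = cl_dim cl (s ` V) (s ` {})" "wf_fm L W" "fv W \<subseteq> V \<union> {}" "sat R s W"
    "\<And>(N :: ('f, 'r, 'u) struct) s'. models L T N \<Longrightarrow> s' ` (V \<union> {}) \<subseteq> carrier N \<Longrightarrow> sat N s' W \<Longrightarrow>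
       s' ` V \<subseteq> acl L N (s' ` (B \<union> {})) \<and> cl_dim (acl L N) (s' ` V) (s' ` {}) \<le> card B"
    by (rule dim_witness[OF R_models, of V "{}" s], simp add: V_def, simp, use s(3) in auto)
  define \<sigma> where "\<sigma> = AllL [0..<n] (Neg (And (lift W) (And (Distinct [0..<n]) (ConjL (map Col [0..<n])))))"
  have "sat M s \<sigma>"
  proof (rule true_in_M)
    show "wf_fm (colored_language L) \<sigma>" using W(3) by (simp add: \<sigma>_def)
    show "fv \<sigma> = {}" using W(4) Distinct_simps(2)[of "[0..<n]"] by (auto simp: \<sigma>_def V_def)
    fix N :: "('f, 'r option, 'u) struct" assume N: "T_alpha_model L T \<alpha> N"
    show "sat_at N \<sigma> []" unfolding \<sigma>_def sat_AllL
    proof (intro allI impI, elim conjE)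
      fix s' assume s': "\<forall>x\<in>set [0..<n]. s' x \<in> carrier N"
      show "sat N s' (Neg (And (lift W) (And (Distinct [0..<n]) (ConjL (map Col [0..<n])))))"
      proof (rule ccontr)
        assume "\<not> ?thesis"
        then have *: "sat (reduct N) s' W" "inj_on s' V" "\<forall>x\<in>V. rint N None [s' x]"
          by (simp_all add: V_def)
        have s'N: "s' ` V \<subseteq> carrier N" using s' by (auto simp: V_def)
        have "cl_dim (acl L (reduct N)) (s' ` V) {} \<le> card B"
          using W(6)[of "reduct N" s'] * s'N N by (auto simp: T_alpha_model_def)
        moreover have "colored N \<inter> s' ` V = s' ` V" using * s'N by (auto simp: colored_def)
        then have "p * card (s' ` V) \<le> q * cl_dim (acl L (reduct N)) (s' ` V) {}"
          using T_alpha_model_rank[OF N, of "s' ` V"] s'N by (simp add: V_def)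
        moreover have "card (s' ` V) = card Z" using * sV by (metis card_image)
        moreover have "card B = rk Z" using W(2) sV by simp
        ultimately have "q * cl_dim (acl L (reduct N)) (s' ` V) {} \<le> q * rk Z"
          "p * card Z \<le> q * cl_dim (acl L (reduct N)) (s' ` V) {}"
          by (simp_all add: mult_le_mono2)
        then show False using less by linarith
      qed
    qed
  qed
  then have "sat M s (Neg (And (lift W) (And (Distinct [0..<n]) (ConjL (map Col [0..<n])))))"
    unfolding \<sigma>_def sat_AllL using s(3) by (auto simp: image_subset_iff)
  then show False using W(5) sV Z(3) by (auto simp: V_def colored_def)
qed

definition \<delta> :: "'u set \<Rightarrow> int" where
  "\<delta> Z = int q * int (rk Z) - int p * int (card (C \<inter> Z))"

definition dd :: "'u set \<Rightarrow> nat" where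
  "dd Z = (LEAST n. \<exists>Z'. finite Z' \<and> Z \<subseteq> Z' \<and> Z' \<subseteq> carrier M \<and> \<delta> Z' = int n)"

definition closed :: "'u set \<Rightarrow> bool" where
  "closed Z \<longleftrightarrow> finite Z \<and> Z \<subseteq> carrier M \<and> (\<forall>Z'. finite Z' \<longrightarrow> Z \<subseteq> Z' \<longrightarrow> Z' \<subseteq> carrier M \<longrightarrow> \<delta> Z \<le> \<delta> Z')"

lemma \<delta>_nonneg: "finite Z \<Longrightarrow> Z \<subseteq> carrier M \<Longrightarrow> 0 \<le> \<delta> Z"
  using rank_bound[of Z] unfolding \<delta>_def by (metis diff_ge_0_iff_ge of_nat_le_iff of_nat_mult)

lemma hull:
  assumes "finite Z" "Z \<subseteq> carrier M"
  obtains E where "finite E" "Z \<subseteq> E" "E \<subseteq> carrier M" "\<delta> E = int (dd Z)"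
proof -
  have "\<exists>n Z'. finite Z' \<and> Z \<subseteq> Z' \<and> Z' \<subseteq> carrier M \<and> \<delta> Z' = int n"
    using \<delta>_nonneg[OF assms] assms by (intro exI[of _ "nat (\<delta> Z)"] exI[of _ Z]) simp
  from LeastI_ex[OF this] obtain E where "finite E \<and> Z \<subseteq> E \<and> E \<subseteq> carrier M \<and> \<delta> E = int (dd Z)"
    unfolding dd_def by blast
  then show thesis using that by blast
qed

lemma dd_le:
  assumes "finite Z'" "Z \<subseteq> Z'" "Z' \<subseteq> carrier M" shows "int (dd Z) \<le> \<delta> Z'"
proof -
  have "dd Z \<le> nat (\<delta> Z')" unfolding dd_def
    by (rule Least_le) (use assms \<delta>_nonneg[OF assms(1,3)] in auto)
  then show ?thesis using \<delta>_nonneg[OF assms(1,3)] by linarith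
qed

lemma dd_mono:
  assumes "finite Z'" "Z \<subseteq> Z'" "Z' \<subseteq> carrier M" shows "dd Z \<le> dd Z'"
proof -
  obtain E where "finite E" "Z' \<subseteq> E" "E \<subseteq> carrier M" "\<delta> E = int (dd Z')"
    by (rule hull[OF assms(1,3)], rule that)
  then show ?thesis using dd_le[of E Z] assms(2) by simp
qed

lemma closed_iff_dd: "finite Z \<Longrightarrow> Z \<subseteq> carrier M \<Longrightarrow> closed Z \<longleftrightarrow> \<delta> Z \<le> int (dd Z)"
proof -
  assume Z: "finite Z" "Z \<subseteq> carrier M"
  obtain E where E: "finite E" "Z \<subseteq> E" "E \<subseteq> carrier M" "\<delta> E = int (dd Z)" by (rule hull[OF Z], rule that)
  show ?thesis
  proof
    assume "closed Z"
    then have "\<delta> Z \<le> \<delta> E" using E(1-3) by (simp add: closed_def)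
    then show "\<delta> Z \<le> int (dd Z)" using E(4) by simp
  next
    assume "\<delta> Z \<le> int (dd Z)"
    then show "closed Z" unfolding closed_def using Z dd_le by (meson order_trans)
  qed
qed

text \<open>The rank is submodular and the number of colored points is modular.\<close>

lemma \<delta>_submodular:
  assumes "finite A" "finite B" "A \<subseteq> carrier M" "B \<subseteq> carrier M"
  shows "\<delta> (A \<union> B) + \<delta> (A \<inter> B) \<le> \<delta> A + \<delta> B"
proof -
  have "card (C \<inter> A) + card (C \<inter> B) = card (C \<inter> (A \<union> B)) + card (C \<inter> (A \<inter> B))"
    using card_Un_Int[of "C \<inter> A" "C \<inter> B"] assms by (simp add: Int_Un_distrib Int_ac)
  then have c: "int p * int (card (C \<inter> A)) + int p * int (card (C \<inter> B)) =
      int p * int (card (C \<inter> (A \<union> B))) + int p * int (card (C \<inter> (A \<inter> B)))"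
    by (metis distrib_left of_nat_add)
  have "int q * int (rk (A \<union> B) + rk (A \<inter> B)) \<le> int q * int (rk A + rk B)"
    using rk_submodular[OF assms] by (intro mult_left_mono) simp_all
  then have "int q * int (rk (A \<union> B)) + int q * int (rk (A \<inter> B)) \<le> int q * int (rk A) + int q * int (rk B)"
    by (simp only: distrib_left of_nat_add)
  then show ?thesis using c unfolding \<delta>_def by linarith
qed

text \<open>The points are added one at a time. By indecomposability the closure of
  \<open>S0\<close> is not covered by the closures of the finitely many subsets of
  \<open>Y \<union> Q\<close> of smaller rank, and a point outside all of these raises the rank of
  each such subset by one. As \<open>Y\<close> has smaller rank, the point is not in
  \<open>Y\<close>; as the rank of \<open>S0\<close> is at least 2, singletons have smaller rank
  too, so the point is not in \<open>Q\<close>.\<close>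

lemma general_position:
  assumes S0: "finite S0" "S0 \<subseteq> carrier M" and Y: "finite Y" "Y \<subseteq> cl S0" "rk Y < rk S0" and 2: "2 \<le> rk S0"
  shows "\<exists>Q. finite Q \<and> card Q = l \<and> Q \<subseteq> cl S0 \<and> Q \<inter> Y = {} \<and>
    (\<forall>S1 \<subseteq> Y. \<forall>Q1 \<subseteq> Q. min (rk S1 + card Q1) (rk S0) \<le> rk (S1 \<union> Q1))"
proof (induction l)
  case 0
  show ?case by (intro exI[of _ "{}"]) auto
next
  case (Suc l)
  then obtain Q where Q: "finite Q" "card Q = l" "Q \<subseteq> cl S0" "Q \<inter> Y = {}"
    and Q_gen: "\<forall>S1 \<subseteq> Y. \<forall>Q1 \<subseteq> Q. min (rk S1 + card Q1) (rk S0) \<le> rk (S1 \<union> Q1)"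
    by (elim exE conjE) (rule that)
  define G where "G = cl S0"
  have G: "cl G = G" "finite_dimensional cl G {}" "rk G = rk S0" "G \<subseteq> carrier M"
    using cl_idem rk_cl S0 cl_closed by (simp_all add: G_def)
  define \<S> where "\<S> = {S. S \<subseteq> Y \<union> Q \<and> rk S < rk S0}"
  have YQ: "Y \<union> Q \<subseteq> G" using Y Q by (simp add: G_def)
  have \<S>G: "cl S \<subseteq> G" if "S \<in> \<S>" for S
  proof -
    have "S \<subseteq> G" using that YQ by (auto simp: \<S>_def)
    then show ?thesis using cl_mono[of S G] G by simp
  qed
  have "\<exists>x\<in>G. \<forall>S\<in>\<S>. x \<notin> cl S"
  proof (rule ccontr)
    assume "\<not> ?thesis"
    then have "G = \<Union> (cl ` \<S>)" using \<S>G by blast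
    moreover have "finite (cl ` \<S>)"
      by (rule finite_imageI) (rule finite_subset[of _ "Pow (Y \<union> Q)"], use Y Q in \<open>auto simp: \<S>_def\<close>)
    moreover have "rk {} = 0" using rk_le_card[of "{}"] by simp
    then have "{} \<in> \<S>" using 2 by (simp add: \<S>_def)
    then have "cl ` \<S> \<noteq> {}" by blast
    moreover have "rk (cl S) < rk G" if "S \<in> \<S>" for S
    proof -
      have "S \<subseteq> Y \<union> Q" using that by (simp add: \<S>_def)
      then have "finite S" "S \<subseteq> carrier M"
        using Y(1) Q(1) YQ G(4) by (blast intro: finite_subset[of S "Y \<union> Q"])+
      then show ?thesis using rk_cl(1) that G(3) by (simp add: \<S>_def)
    qed
    ultimately have "\<exists>\<Y>. finite \<Y> \<and> \<Y> \<noteq> {} \<and> G = \<Union>\<Y> \<and> (\<forall>Y\<in>\<Y>. rk Y < rk G)"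
      by (intro exI[of _ "cl ` \<S>"]) blast
    moreover have "G \<subseteq> carrier R" using G(4) by simp
    ultimately show False
      using indec[unfolded indecomposable_def, THEN spec, THEN mp, OF R_models, THEN spec[of _ G]] G(1,2)
      by blast
  qed
  then obtain x where x: "x \<in> G" "\<And>S. S \<in> \<S> \<Longrightarrow> x \<notin> cl S" by blast
  have xM: "x \<in> carrier M" using x G by auto
  have xY: "x \<notin> Y"
  proof
    assume "x \<in> Y"
    moreover have "Y \<in> \<S>" using Y(3) by (simp add: \<S>_def)
    moreover have "Y \<subseteq> carrier M" using YQ G(4) by auto
    ultimately show False using x(2)[of Y] cl_extensive[of Y] by auto
  qed
  have xQ: "x \<notin> Q"
  proof
    assume "x \<in> Q"
    moreover have "rk {x} \<le> 1" using rk_le_card[of "{x}"] xM by simp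
    ultimately have "{x} \<in> \<S>" using 2 by (auto simp: \<S>_def)
    then show False using x(2)[of "{x}"] cl_extensive[of "{x}"] xM by auto
  qed
  have "min (rk S1 + card Q1) (rk S0) \<le> rk (S1 \<union> Q1)" if S1: "S1 \<subseteq> Y" and Q1: "Q1 \<subseteq> insert x Q" for S1 Q1
  proof (cases "x \<in> Q1")
    case False
    then show ?thesis using Q_gen[rule_format, OF S1, of Q1] Q1 by auto
  next
    case True
    define Q2 where "Q2 = Q1 - {x}"
    have Q2: "Q2 \<subseteq> Q" "Q1 = insert x Q2" "x \<notin> Q2" "finite Q2"
      using Q1 True Q(1) finite_subset[of Q2 Q] by (auto simp: Q2_def)
    have S1Q2: "finite (S1 \<union> Q2)" "S1 \<union> Q2 \<subseteq> carrier M" "S1 \<union> Q2 \<subseteq> Y \<union> Q"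
      using S1 Q2 YQ G(4) Y(1) finite_subset[of S1 Y] by auto
    have le: "min (rk S1 + card Q2) (rk S0) \<le> rk (S1 \<union> Q2)" by (rule Q_gen[rule_format, OF S1 Q2(1)])
    have eq: "rk (S1 \<union> Q1) = (if x \<in> cl (S1 \<union> Q2) then rk (S1 \<union> Q2) else Suc (rk (S1 \<union> Q2)))"
      using rk_insert[OF S1Q2(1,2) xM] Q2 by simp
    show ?thesis
    proof (cases "rk (S1 \<union> Q2) < rk S0")
      case True
      then have "x \<notin> cl (S1 \<union> Q2)" using x(2)[of "S1 \<union> Q2"] S1Q2 by (simp add: \<S>_def)
      then show ?thesis using le eq Q2 by auto
    next
      case False
      then show ?thesis using le eq by auto
    qed
  qed
  then show ?case using Q x xY xQ by (intro exI[of _ "insert x Q"]) (auto simp: G_def)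
qed

end

section \<open>Definability of generic solutions and transfer of axioms to the saturated
  model\<close>

lemma (in pregeometry) dim_eq_of_spanning:
  assumes "finite A" "finite X" "A \<subseteq> C" "X \<subseteq> C" "B \<subseteq> A" "A \<subseteq> cl (B \<union> X)"
  shows "cl_dim cl A X = cl_dim cl B X"
proof -
  have fin: "finite B" "B \<subseteq> C" using assms finite_subset by auto
  have "cl_dim cl A (B \<union> X) \<le> card ({} :: 'a set)"
    using assms fin by (intro cl_dim_le_card) auto
  then have "rk (A \<union> (B \<union> X)) = rk (B \<union> X)" using dim_additive[of A "B \<union> X"] assms fin by auto
  moreover have "A \<union> (B \<union> X) = A \<union> X" using assms(5) by auto
  ultimately show ?thesis using dim_additive[of A X] dim_additive[of B X] assms fin by simp
qed

text \<open>Each solution is spanned over the parameters by its coordinates in \<open>B\<close>, so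
  it has dimension \<open>card B\<close> precisely when these are independent. Hence the coordinates
  in \<open>B\<close> are quantified generically, and the others by ordinary existential
  quantifiers.\<close>

lemma (in geometric_theory) generic_definable:
  assumes \<phi>: "formula L (n + m) \<phi>" and B: "B \<subseteq> {..<n}"
    and span: "\<And>(M :: ('f, 'r, 'u) struct) es bs. models L T M \<Longrightarrow> es \<in> tuples M n \<Longrightarrow> bs \<in> tuples M m \<Longrightarrow>
      sat_at M \<phi> (es @ bs) \<Longrightarrow> set es \<subseteq> acl L M ((\<lambda>i. es ! i) ` B \<union> set bs)"
  obtains \<theta> where "formula L m \<theta>"
    "\<And>(M :: ('f, 'r, 'u) struct) bs. monster L T M \<Longrightarrow> bs \<in> tuples M m \<Longrightarrow>
      (sat_at M \<theta> bs \<longleftrightarrow> (\<exists>es\<in>tuples M n. sat_at M \<phi> (es @ bs) \<and> cl_dim (acl L M) (set es) (set bs) = card B))"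
proof -
  define xs where "xs = sorted_list_of_set B"
  define ys where "ys = sorted_list_of_set ({..<n} - B)"
  have fB: "finite B" using B finite_subset by blast
  have xs: "set xs = B" "distinct xs" "length xs = card B" using fB by (simp_all add: xs_def)
  have ys: "set ys = {..<n} - B" by (simp add: ys_def)
  define \<chi> where "\<chi> = ExL ys \<phi>"
  have wf\<chi>: "wf_fm L \<chi>" using \<phi> by (simp add: \<chi>_def formula_def)
  have fv\<chi>: "fv \<chi> - set xs \<subseteq> {n..<n + m}" using \<phi> xs ys by (auto simp: \<chi>_def formula_def)
  obtain \<theta>0 where \<theta>0: "wf_fm L \<theta>0" "fv \<theta>0 \<subseteq> fv \<chi> - set xs"
    and \<theta>0_iff: "\<forall>(M :: ('f, 'r, 'u) struct) s D. monster L T M \<longrightarrow> range s \<subseteq> carrier M \<longrightarrow> finite D \<longrightarrow> D \<subseteq> carrier M \<longrightarrow>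
      s ` (fv \<chi> - set xs) \<subseteq> D \<longrightarrow>
      (sat M s \<theta>0 \<longleftrightarrow> (\<exists>s'. range s' \<subseteq> carrier M \<and> (\<forall>x. x \<notin> set xs \<longrightarrow> s' x = s x) \<and> sat M s' \<chi> \<and>
        seq_indep (acl L M) D (map s' xs)))"
    using generic_ex_formula[OF wf\<chi> xs(2)] by (elim exE conjE) (rule that)
  \<comment> \<open>The free variables of \<open>\<theta>0\<close> lie between \<open>n\<close> and
    \<open>n + m - 1\<close>, behind the solution; they are moved down to the positions of the
    parameters.\<close>
  define \<theta> where "\<theta> = subst (\<lambda>i. i - n) \<theta>0"
  have fv\<theta>0: "n \<le> i \<and> i < n + m" if "i \<in> fv \<theta>0" for i using \<theta>0(2) fv\<chi> that by fastforce
  show thesis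
  proof (rule that)
    show "formula L m \<theta>"
      unfolding formula_def \<theta>_def using \<theta>0(1) fv_subst[of "\<lambda>i. i - n" \<theta>0] fv\<theta>0 by fastforce
    fix M :: "('f, 'r, 'u) struct" and bs
    assume mon: "monster L T M" and bs: "bs \<in> tuples M m"
    have M: "models L T M" using mon by (simp add: monster_def)
    interpret pregeometry "carrier M" "acl L M" by (rule pregeometry_acl[OF M])
    obtain c where c: "c \<in> carrier M" using M by (auto simp: models_def is_structure_def)
    have lbs: "length bs = m" "set bs \<subseteq> carrier M" using bs by (auto simp: tuples_def)
    define s where "s i = (if n \<le> i \<and> i < n + m then bs ! (i - n) else c)" for i
    have sM: "s i \<in> carrier M" for i using lbs c nth_mem[of "i - n" bs] by (auto simp: s_def)
    have "sat_at M \<theta> bs \<longleftrightarrow> sat M (\<lambda>i. bs ! (i - n)) \<theta>0"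
      unfolding \<theta>_def
    proof (rule sat_subst)
      fix i assume "i \<in> fv \<theta>0"
      then have "i - n < length bs" using fv\<theta>0[of i] lbs by auto
      then show "bs ! (i - n) \<in> carrier M" using lbs nth_mem by blast
    qed
    also have "\<dots> \<longleftrightarrow> sat M s \<theta>0" by (rule sat_cong) (use fv\<theta>0 in \<open>auto simp: s_def\<close>)
    also have "\<dots> \<longleftrightarrow> (\<exists>s'. range s' \<subseteq> carrier M \<and> (\<forall>x. x \<notin> set xs \<longrightarrow> s' x = s x) \<and> sat M s' \<chi> \<and>
        seq_indep (acl L M) (set bs) (map s' xs))" (is "_ \<longleftrightarrow> ?r1")
    proof (rule \<theta>0_iff[rule_format])
      have "s i \<in> set bs" if "i \<in> {n..<n + m}" for i using that lbs by (auto simp: s_def)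
      then show "s ` (fv \<chi> - set xs) \<subseteq> set bs" using fv\<chi> by blast
    qed (use mon sM lbs in auto)
    also have "\<dots> \<longleftrightarrow> (\<exists>es\<in>tuples M n. sat_at M \<phi> (es @ bs) \<and> cl_dim (acl L M) (set es) (set bs) = card B)"
      (is "_ \<longleftrightarrow> ?r2")
    proof
      assume ?r1
      then obtain s' where s': "range s' \<subseteq> carrier M" "\<forall>x. x \<notin> set xs \<longrightarrow> s' x = s x" "sat M s' \<chi>"
        "seq_indep (acl L M) (set bs) (map s' xs)" by (elim exE conjE) (rule that)
      obtain s'' where s'': "\<forall>x. x \<notin> set ys \<longrightarrow> s'' x = s' x" "\<forall>x\<in>set ys. s'' x \<in> carrier M" "sat M s'' \<phi>"
        using s'(3) unfolding \<chi>_def sat_ExL by (elim exE conjE) (rule that)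
      have s''M: "s'' i \<in> carrier M" for i using s'(1) s''(1,2) by (cases "i \<in> set ys") auto
      define es where "es = map s'' [0..<n]"
      have es: "es \<in> tuples M n" using s''M by (auto simp: es_def tuples_def)
      have "(es @ bs) ! i = s'' i" if "i < n + m" for i
      proof (cases "i < n")
        case False
        then have "s'' i = s i" using s''(1) s'(2) xs ys B by auto
        then show ?thesis using that False by (simp add: es_def nth_append s_def)
      qed (simp add: es_def nth_append)
      then have sat: "sat_at M \<phi> (es @ bs)"
        using \<phi> by (intro s''(3)[THEN sat_cong[THEN iffD1, rotated]]) (auto simp: formula_def subset_iff)
      have im: "(\<lambda>i. es ! i) ` B = set (map s' xs)"
      proof -
        have "es ! i = s' i" if "i \<in> B" for i using that B s''(1) ys by (auto simp: es_def)
        then show ?thesis using xs by auto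
      qed
      have sub: "(\<lambda>i. es ! i) ` B \<subseteq> set es" using B by (auto simp: es_def)
      have "cl_dim (acl L M) (set es) (set bs) = cl_dim (acl L M) ((\<lambda>i. es ! i) ` B) (set bs)"
        by (rule dim_eq_of_spanning) (use span[OF M es bs sat] es lbs sub in \<open>auto simp: tuples_def\<close>)
      also have "\<dots> = card B"
        unfolding im using s'(4) seq_indep_iff[of "set bs" "map s' xs"] lbs s'(1) xs(3) by auto
      finally show ?r2 using es sat by blast
    next
      assume ?r2
      then obtain es where es: "es \<in> tuples M n" "sat_at M \<phi> (es @ bs)"
        "cl_dim (acl L M) (set es) (set bs) = card B" by blast
      have les: "length es = n" "set es \<subseteq> carrier M" using es(1) by (auto simp: tuples_def)
      have esM: "es ! i \<in> carrier M" if "i < n" for i using les nth_mem[of i es] that by auto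
      define s' where "s' i = (if i \<in> B then es ! i else s i)" for i
      define s'' where "s'' i = (if i < n then es ! i else s i)" for i
      have "sat M s'' \<phi>"
        using es(2) \<phi> by (rule_tac sat_cong[THEN iffD1, rotated, OF es(2)])
          (auto simp: formula_def nth_append s''_def s_def les)
      then have "sat M s' \<chi>" unfolding \<chi>_def sat_ExL
        using B ys esM by (intro exI[of _ s'']) (auto simp: s'_def s''_def s_def)
      moreover have s'M: "range s' \<subseteq> carrier M" using sM esM B by (auto simp: s'_def)
      moreover have "seq_indep (acl L M) (set bs) (map s' xs)"
      proof -
        have im: "(\<lambda>i. es ! i) ` B = set (map s' xs)" using xs by (auto simp: s'_def)
        have sub: "(\<lambda>i. es ! i) ` B \<subseteq> set es" using B les by auto
        have "cl_dim (acl L M) (set es) (set bs) = cl_dim (acl L M) ((\<lambda>i. es ! i) ` B) (set bs)"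
          by (rule dim_eq_of_spanning) (use span[OF M es(1) bs es(2)] les lbs sub in auto)
        then have "cl_dim (acl L M) (set (map s' xs)) (set bs) = length (map s' xs)"
          using im es(3) xs(3) by simp
        then show ?thesis using seq_indep_iff[of "set bs" "map s' xs"] s'M lbs by auto
      qed
      ultimately show ?r1 using xs by (intro exI[of _ s']) (auto simp: s'_def)
    qed
    finally show "sat_at M \<theta> bs \<longleftrightarrow> (\<exists>es\<in>tuples M n. sat_at M \<phi> (es @ bs) \<and> cl_dim (acl L M) (set es) (set bs) = card B)" .
  qed
qed

lemma index_of_nth: "distinct xs \<Longrightarrow> i < length xs \<Longrightarrow> index_of xs (xs ! i) = i"
  using index_of[of "xs ! i" xs] nth_eq_iff_index_eq[of xs "index_of xs (xs ! i)" i] by auto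

lemma image_nth_append:
  assumes "length es = n" "length bs = m" "I \<subseteq> {..<n}" "\<And>i. i < n + m \<Longrightarrow> t i = (es @ bs) ! i"
  shows "t ` ({..<n} - I) = set (nths es (- I))" "t ` (I \<union> {n..<n + m}) = set (nths es I) \<union> set bs"
proof -
  have 1: "t i = es ! i" if "i < n" for i using assms that by (simp add: nth_append)
  have 2: "t ` {n..<n + m} = set bs"
  proof
    show "t ` {n..<n + m} \<subseteq> set bs" using assms by (auto simp: nth_append)
    show "set bs \<subseteq> t ` {n..<n + m}"
    proof
      fix b assume "b \<in> set bs"
      then obtain i where "i < m" "bs ! i = b" using assms(2) by (auto simp: in_set_conv_nth)
      then have "t (n + i) = b" using assms by (simp add: nth_append)
      then show "b \<in> t ` {n..<n + m}" using \<open>i < m\<close> by force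
    qed
  qed
  show "t ` ({..<n} - I) = set (nths es (- I))"
  proof -
    have "t ` ({..<n} - I) = (!) es ` ({..<n} - I)" by (rule image_cong) (use 1 in auto)
    also have "\<dots> = set (nths es (- I))" unfolding set_nths image_def using assms(1) by blast
    finally show ?thesis .
  qed
  have "t ` I = (!) es ` I" by (rule image_cong) (use 1 assms(3) in auto)
  also have "\<dots> = set (nths es I)" unfolding set_nths image_def using assms(1,3) by blast
  finally have "t ` I = set (nths es I)" .
  then show "t ` (I \<union> {n..<n + m}) = set (nths es I) \<union> set bs" using 2 by (simp add: image_Un)
qed

context T_alpha_monster
begin

text \<open>Once \<phi>, \<theta> and the prescribed colors are fixed, the implication is a single
  sentence \<sigma> of the colored language, in which the parameters are the variables from
  \<open>n\<close> to \<open>n + m - 1\<close>.\<close>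

lemma axiom_transfer:
  assumes \<phi>: "formula L (n + m) \<phi>" and \<theta>: "formula L m \<theta>"
    and ax: "\<And>(N :: ('f, 'r option, 'u) struct) bs. T_alpha_model L T \<alpha> N \<Longrightarrow> bs \<in> tuples N m \<Longrightarrow>
      sat_at (reduct N) \<theta> bs \<Longrightarrow>
      \<exists>es\<in>tuples N n. sat_at (reduct N) \<phi> (es @ bs) \<and> (\<forall>i<n. es ! i \<in> colored N \<longleftrightarrow> c i)"
    and bs: "bs \<in> tuples M m" "sat_at R \<theta> bs"
  shows "\<exists>es\<in>tuples M n. sat_at R \<phi> (es @ bs) \<and> (\<forall>i<n. es ! i \<in> C \<longleftrightarrow> c i)"
proof -
  define \<kappa> :: "('f, 'r option) fm" where "\<kappa> = ConjL (map (\<lambda>i. if c i then Col i else Neg (Col i)) [0..<n])"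
  define \<sigma> where "\<sigma> = AllL [n..<n + m] (Imp (lift (rename ((+) n) \<theta>)) (ExL [0..<n] (And (lift \<phi>) \<kappa>)))"
  have sat_\<sigma>: "sat N s \<sigma> \<longleftrightarrow> (\<forall>bs\<in>tuples N m. sat_at (reduct N) \<theta> bs \<longrightarrow>
      (\<exists>es\<in>tuples N n. sat_at (reduct N) \<phi> (es @ bs) \<and> (\<forall>i<n. es ! i \<in> colored N \<longleftrightarrow> c i)))"
    for N :: "('f, 'r option, 'u) struct" and s
  proof -
    have key: "sat N s' (ExL [0..<n] (And (lift \<phi>) \<kappa>)) \<longleftrightarrow>
      (\<exists>es\<in>tuples N n. sat_at (reduct N) \<phi> (es @ map s' [n..<n+m]) \<and> (\<forall>i<n. es ! i \<in> colored N \<longleftrightarrow> c i))" for s'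
    proof -
      have \<kappa>: "sat N s'' \<kappa> \<longleftrightarrow> (\<forall>i<n. s'' i \<in> colored N \<longleftrightarrow> c i)" if "\<forall>i<n. s'' i \<in> carrier N" for s''
      proof -
        have "sat N s'' \<kappa> \<longleftrightarrow> (\<forall>i\<in>set [0..<n]. sat N s'' (if c i then Col i else Neg (Col i)))"
          unfolding \<kappa>_def ConjL_simps set_map by blast
        also have "\<dots> \<longleftrightarrow> (\<forall>i<n. s'' i \<in> colored N \<longleftrightarrow> c i)" using that by (auto simp: colored_def)
        finally show ?thesis .
      qed
      show ?thesis
      proof
        assume "sat N s' (ExL [0..<n] (And (lift \<phi>) \<kappa>))"
        then obtain s'' where s'': "\<forall>x. x \<notin> set [0..<n] \<longrightarrow> s'' x = s' x" "\<forall>x\<in>set [0..<n]. s'' x \<in> carrier N"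
          "sat N s'' (And (lift \<phi>) \<kappa>)" unfolding sat_ExL by (elim exE conjE) (rule that)
        have "(map s'' [0..<n] @ map s' [n..<n+m]) ! i = s'' i" if "i < n + m" for i
          using that s''(1) by (simp add: nth_append)
        then have "sat_at (reduct N) \<phi> (map s'' [0..<n] @ map s' [n..<n+m]) \<longleftrightarrow> sat (reduct N) s'' \<phi>"
          using \<phi> by (intro sat_cong) (auto simp: formula_def)
        then show "\<exists>es\<in>tuples N n. sat_at (reduct N) \<phi> (es @ map s' [n..<n+m]) \<and> (\<forall>i<n. es ! i \<in> colored N \<longleftrightarrow> c i)"
          using s'' \<kappa>[of s''] by (intro bexI[of _ "map s'' [0..<n]"]) (auto simp: tuples_def)
      next
        assume "\<exists>es\<in>tuples N n. sat_at (reduct N) \<phi> (es @ map s' [n..<n+m]) \<and> (\<forall>i<n. es ! i \<in> colored N \<longleftrightarrow> c i)"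
        then obtain es where es: "es \<in> tuples N n" "sat_at (reduct N) \<phi> (es @ map s' [n..<n+m])"
          "\<forall>i<n. es ! i \<in> colored N \<longleftrightarrow> c i" by blast
        define s'' where "s'' i = (if i < n then es ! i else s' i)" for i
        have les: "length es = n" "set es \<subseteq> carrier N" using es(1) by (auto simp: tuples_def)
        have esN: "es ! i \<in> carrier N" if "i < n" for i using les nth_mem[of i es] that by auto
        have "(es @ map s' [n..<n+m]) ! i = s'' i" if "i < n + m" for i
          using that les by (simp add: nth_append s''_def)
        then have "sat_at (reduct N) \<phi> (es @ map s' [n..<n+m]) \<longleftrightarrow> sat (reduct N) s'' \<phi>"
          using \<phi> by (intro sat_cong) (auto simp: formula_def)
        then have "sat N s'' (And (lift \<phi>) \<kappa>)" using es \<kappa>[of s''] esN by (simp add: s''_def)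
        then show "sat N s' (ExL [0..<n] (And (lift \<phi>) \<kappa>))"
          unfolding sat_ExL using esN by (intro exI[of _ s'']) (auto simp: s''_def)
      qed
    qed
    have th: "sat N s' (lift (rename ((+) n) \<theta>)) \<longleftrightarrow> sat_at (reduct N) \<theta> (map s' [n..<n+m])" for s'
    proof -
      have "sat N s' (lift (rename ((+) n) \<theta>)) \<longleftrightarrow> sat (reduct N) (s' \<circ> (+) n) \<theta>"
        by (simp add: sat_rename)
      also have "\<dots> \<longleftrightarrow> sat_at (reduct N) \<theta> (map s' [n..<n+m])"
        using \<theta> by (intro sat_cong) (auto simp: formula_def)
      finally show ?thesis .
    qed
    show ?thesis
    proof
      assume l: "sat N s \<sigma>"
      show "\<forall>bs\<in>tuples N m. sat_at (reduct N) \<theta> bs \<longrightarrow>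
        (\<exists>es\<in>tuples N n. sat_at (reduct N) \<phi> (es @ bs) \<and> (\<forall>i<n. es ! i \<in> colored N \<longleftrightarrow> c i))"
      proof (intro ballI impI)
        fix bs assume bs: "bs \<in> tuples N m" "sat_at (reduct N) \<theta> bs"
        define s' where "s' i = (if n \<le> i \<and> i < n + m then bs ! (i - n) else s i)" for i
        have lbs: "length bs = m" "set bs \<subseteq> carrier N" using bs(1) by (auto simp: tuples_def)
        have m: "map s' [n..<n+m] = bs" using lbs by (intro nth_equalityI) (auto simp: s'_def)
        have "s' i \<in> carrier N" if "i \<in> set [n..<n+m]" for i
          using lbs nth_mem[of "i - n" bs] that by (auto simp: s'_def)
        then have "sat N s' (Imp (lift (rename ((+) n) \<theta>)) (ExL [0..<n] (And (lift \<phi>) \<kappa>)))"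
          using l unfolding \<sigma>_def sat_AllL by (elim allE[of _ s']) (auto simp: s'_def)
        then show "\<exists>es\<in>tuples N n. sat_at (reduct N) \<phi> (es @ bs) \<and> (\<forall>i<n. es ! i \<in> colored N \<longleftrightarrow> c i)"
          using th[of s'] key[of s'] m bs(2) by simp
      qed
    next
      assume r: "\<forall>bs\<in>tuples N m. sat_at (reduct N) \<theta> bs \<longrightarrow>
        (\<exists>es\<in>tuples N n. sat_at (reduct N) \<phi> (es @ bs) \<and> (\<forall>i<n. es ! i \<in> colored N \<longleftrightarrow> c i))"
      show "sat N s \<sigma>" unfolding \<sigma>_def sat_AllL
      proof (intro allI impI, elim conjE)
        fix s' assume "\<forall>x\<in>set [n..<n+m]. s' x \<in> carrier N"
        then have "map s' [n..<n+m] \<in> tuples N m" by (auto simp: tuples_def)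
        then show "sat N s' (Imp (lift (rename ((+) n) \<theta>)) (ExL [0..<n] (And (lift \<phi>) \<kappa>)))"
          using r th[of s'] key[of s'] by simp
      qed
    qed
  qed
  have "sat M (\<lambda>_. undefined) \<sigma>"
  proof (rule true_in_M)
    show "wf_fm (colored_language L) \<sigma>" using \<phi> \<theta> by (auto simp: \<sigma>_def \<kappa>_def formula_def)
    have "fv \<kappa> \<subseteq> {..<n}" by (auto simp: \<kappa>_def split: if_splits)
    then show "fv \<sigma> = {}" using \<phi> \<theta> by (auto simp: \<sigma>_def formula_def fv_rename)
  qed (use sat_\<sigma> ax in blast)
  then show ?thesis using sat_\<sigma> bs by blast
qed

end

section \<open>Extension axioms\<close>

lemma set_nths_UNIV [simp]: "set (nths xs UNIV) = set xs"
  by (auto simp: set_nths in_set_conv_nth)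

context T_alpha_monster
begin

text \<open>An extension axiom takes a structure of the class \<open>K_plus\<close> as its pattern.
  The pattern used is \<open>M\<close> itself with \<open>P\<close> as the new set of colored
  points, so that its dimensions remain those of \<open>R\<close>.\<close>

definition recolor :: "'u set \<Rightarrow> ('f, 'r option, 'u) struct" where
  "recolor P = M\<lparr>rint := \<lambda>r as. case r of None \<Rightarrow> (\<exists>x\<in>P. as = [x]) | Some r' \<Rightarrow> rint M (Some r') as\<rparr>"

lemma recolor_simps [simp]:
  "reduct (recolor P) = R" "carrier (recolor P) = carrier M"
  "P \<subseteq> carrier M \<Longrightarrow> colored (recolor P) = P"
  by (auto simp: recolor_def reduct_def colored_def)

lemma kdim_recolor:
  assumes "A \<subseteq> carrier M" "X \<subseteq> carrier M"
  shows "kdim L T (recolor P) A X = cl_dim cl A X"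
  using cl_dim_ambient[OF R_models] assms by (simp add: kdim_def)

text \<open>Uncolored points can only raise the rank, so the bound has to be checked for finite sets
  of colored points alone.\<close>

lemma K_plus_recolor:
  assumes P: "P \<subseteq> carrier M" "\<And>S. finite S \<Longrightarrow> S \<subseteq> P \<Longrightarrow> p * card S \<le> q * rk S"
  shows "K_plus L T \<alpha> (recolor P)"
  unfolding K_plus_def
proof (intro conjI allI impI)
  have "is_structure (colored_language L) M" using mon by (simp add: monster_def models_def)
  then have "is_structure (colored_language L) (recolor P)" by (simp add: is_structure_def recolor_def)
  moreover have "models L (universal_part TYPE('u) L T) R"
    using R_models by (auto simp: models_def universal_part_def entails_def)
  ultimately show "K_class L T (recolor P)" by (simp add: K_class_def)
  fix A assume A: "finite A \<and> A \<subseteq> carrier (recolor P)"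
  have "p * card (P \<inter> A) \<le> q * rk (P \<inter> A)" using A by (intro P(2)) auto
  also have "\<dots> \<le> q * rk A" using A by (intro mult_le_mono2 rk_mono) auto
  finally show "0 \<le> predim L T \<alpha> (recolor P) A {}"
    using predim_nonneg_iff[of "recolor P" A "{}"] A P(1) R_models by simp
qed

text \<open>There are finitely many partitions of the positions, and each has a certificate bounding
  the relative dimension. Their conjunction with \<chi> and distinctness is made quantifier-free by
  elimination. The partition with \<open>I = {}\<close> also supplies the spanning positions
  \<open>B\<close>.\<close>

lemma strong_tuple_formula:
  assumes ds: "distinct (ds @ as)" "set (ds @ as) \<subseteq> carrier M" "length ds = n" "length as = m"
    and \<chi>: "formula L (n + m) \<chi>" "sat_at R \<chi> (ds @ as)"
  obtains \<phi> B where "formula L (n + m) \<phi>" "qfree \<phi>" "sat_at R \<phi> (ds @ as)" "B \<subseteq> {..<n}"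
    "card B = cl_dim cl (set ds) (set as)"
    "\<And>(N :: ('f, 'r, 'u) struct) es bs. models L T N \<Longrightarrow> es \<in> tuples N n \<Longrightarrow> bs \<in> tuples N m \<Longrightarrow>
       sat_at N \<phi> (es @ bs) \<Longrightarrow> sat_at N \<chi> (es @ bs) \<and> distinct (es @ bs) \<and>
         set es \<subseteq> acl L N ((\<lambda>i. es ! i) ` B \<union> set bs) \<and>
         (\<forall>I\<subseteq>{..<n}. cl_dim (acl L N) (set (nths es (- I))) (set (nths es I) \<union> set bs) \<le>
           cl_dim cl (set (nths ds (- I))) (set (nths ds I) \<union> set as))"
proof -
  obtain c where c: "c \<in> carrier M" using R_models by (auto simp: models_def is_structure_def)
  define t where "t i = (if i < n + m then (ds @ as) ! i else c)" for i
  have lcs: "length (ds @ as) = n + m" using ds by simp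
  have tM: "t i \<in> carrier M" for i
    using c ds(2) nth_mem[of i "ds @ as"] lcs by (auto simp: t_def simp del: nth_append)
  have tim: "t ` ({..<n} - I) = set (nths ds (- I))" "t ` (I \<union> {n..<n + m}) = set (nths ds I) \<union> set as"
    if "I \<subseteq> {..<n}" for I
    by (rule image_nth_append[OF ds(3,4) that], simp add: t_def)+
  define good where "good I W B \<longleftrightarrow>
      B \<subseteq> {..<n} - I \<and> card B = cl_dim cl (set (nths ds (- I))) (set (nths ds I) \<union> set as) \<and>
      formula L (n + m) W \<and> sat R t W \<and>
      (\<forall>(N :: ('f, 'r, 'u) struct) s'. models L T N \<longrightarrow> s' ` {..<n + m} \<subseteq> carrier N \<longrightarrow> sat N s' W \<longrightarrow>
       s' ` ({..<n} - I) \<subseteq> acl L N (s' ` (B \<union> (I \<union> {n..<n + m}))) \<and>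
       cl_dim (acl L N) (s' ` ({..<n} - I)) (s' ` (I \<union> {n..<n + m})) \<le> card B)" for I W B
  have ex: "\<exists>W B. good I W B" if I: "I \<subseteq> {..<n}" for I
  proof -
    have un: "({..<n} - I) \<union> (I \<union> {n..<n + m}) = {..<n + m}" using I by auto
    have fin: "finite ({..<n} - I)" "finite (I \<union> {n..<n + m})" using I finite_subset by auto
    have sub: "t ` (({..<n} - I) \<union> (I \<union> {n..<n + m})) \<subseteq> carrier R" using tM by auto
    obtain W B where W: "B \<subseteq> {..<n} - I" "card B = cl_dim cl (t ` ({..<n} - I)) (t ` (I \<union> {n..<n + m}))"
      "wf_fm L W" "fv W \<subseteq> ({..<n} - I) \<union> (I \<union> {n..<n + m})" "sat R t W"
      and W6: "\<And>(N :: ('f, 'r, 'u) struct) s'. models L T N \<Longrightarrow>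
        s' ` (({..<n} - I) \<union> (I \<union> {n..<n + m})) \<subseteq> carrier N \<Longrightarrow> sat N s' W \<Longrightarrow>
       s' ` ({..<n} - I) \<subseteq> acl L N (s' ` (B \<union> (I \<union> {n..<n + m}))) \<and>
       cl_dim (acl L N) (s' ` ({..<n} - I)) (s' ` (I \<union> {n..<n + m})) \<le> card B"
      by (rule dim_witness[OF R_models fin sub], rule that)
    have "good I W B" unfolding good_def
    proof (intro conjI allI impI)
      show "card B = cl_dim cl (set (nths ds (- I))) (set (nths ds I) \<union> set as)"
        using W(2) unfolding tim[OF I] .
      show "formula L (n + m) W" using W(3,4) unfolding un formula_def by blast
      fix N :: "('f, 'r, 'u) struct" and s'
      assume N: "models L T N" "s' ` {..<n + m} \<subseteq> carrier N" "sat N s' W"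
      show "s' ` ({..<n} - I) \<subseteq> acl L N (s' ` (B \<union> (I \<union> {n..<n + m})))"
        "cl_dim (acl L N) (s' ` ({..<n} - I)) (s' ` (I \<union> {n..<n + m})) \<le> card B"
        using W6[OF N(1) _ N(3)] N(2) unfolding un by blast+
    qed (rule W(1), rule W(5))
    then show ?thesis by blast
  qed
  define W where "W I = (SOME W. \<exists>B. good I W B)" for I
  define B where "B I = (SOME B. good I (W I) B)" for I
  have good: "good I (W I) (B I)" if "I \<subseteq> {..<n}" for I
    unfolding B_def by (rule someI_ex, unfold W_def, rule someI_ex, rule ex[OF that])
  note WB = good[unfolded good_def]
  have "finite (Pow {..<n})" by simp
  from finite_list[OF this] obtain Is where Is: "set Is = Pow {..<n}" by (rule exE)
  define \<phi>1 where "\<phi>1 = And \<chi> (And (Distinct [0..<n + m]) (ConjL (map W Is)))"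
  have f\<phi>1: "formula L (n + m) \<phi>1"
  proof -
    have "wf_fm L (W I) \<and> fv (W I) \<subseteq> {..<n + m}" if "I \<in> set Is" for I
      using WB[of I] Is that by (simp add: formula_def)
    moreover have "fv (Distinct [0..<n + m]) \<subseteq> {..<n + m}"
      using Distinct_simps(2)[of "[0..<n + m]"] by (simp add: atLeast0LessThan)
    ultimately show ?thesis using \<chi>(1) unfolding \<phi>1_def formula_def by auto
  qed
  have inj: "inj_on t {..<n + m}"
    using ds(1) lcs nth_eq_iff_index_eq[OF ds(1)] by (auto simp: inj_on_def t_def simp del: nth_append)
  have eq_t: "sat R t \<psi> \<longleftrightarrow> sat_at R \<psi> (ds @ as)" if "formula L (n + m) \<psi>" for \<psi>
    using that by (intro sat_cong) (auto simp: formula_def t_def)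
  have "sat R t \<phi>1"
    using \<chi> eq_t[OF \<chi>(1)] WB Is inj by (auto simp: \<phi>1_def atLeast0LessThan)
  then have sat1: "sat_at R \<phi>1 (ds @ as)" using eq_t[OF f\<phi>1] by simp
  obtain \<phi> where \<phi>: "formula L (n + m) \<phi>" "qfree \<phi>"
    and \<phi>_iff: "\<forall>(N :: ('f, 'r, 'u) struct). models L T N \<longrightarrow> (\<forall>as\<in>tuples N (n + m). sat_at N \<phi>1 as \<longleftrightarrow> sat_at N \<phi> as)"
    using qe f\<phi>1 unfolding quantifier_elimination_def by meson
  have cs: "ds @ as \<in> tuples R (n + m)" using ds by (simp add: tuples_def)
  show thesis
  proof (rule that[OF \<phi>])
    show "sat_at R \<phi> (ds @ as)" using sat1 \<phi>_iff R_models cs by blast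
    show "B {} \<subseteq> {..<n}" "card (B {}) = cl_dim cl (set ds) (set as)" using WB[of "{}"] by simp_all
    fix N :: "('f, 'r, 'u) struct" and es bs
    assume N: "models L T N" "es \<in> tuples N n" "bs \<in> tuples N m" "sat_at N \<phi> (es @ bs)"
    have l: "length es = n" "length bs = m" "set es \<subseteq> carrier N" "set bs \<subseteq> carrier N"
      using N(2,3) by (auto simp: tuples_def)
    have "es @ bs \<in> tuples N (n + m)" using l by (simp add: tuples_def)
    then have *: "sat_at N \<phi>1 (es @ bs)" using \<phi>_iff N(1,4) by blast
    have im: "(!) (es @ bs) ` {..<n + m} \<subseteq> carrier N"
      using l nth_mem[of _ "es @ bs"] by (auto simp del: nth_append)
    have "inj_on ((!) (es @ bs)) {..<n + m}" using * by (simp add: \<phi>1_def atLeast0LessThan)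
    then have "distinct (es @ bs)"
      using l by (simp only: distinct_conv_nth inj_on_def) (auto simp del: nth_append)
    moreover have "set es \<subseteq> acl L N ((\<lambda>i. es ! i) ` B {} \<union> set bs)"
    proof -
      have sW: "sat N ((!) (es @ bs)) (W {})" using * Is by (simp add: \<phi>1_def)
      have s: "(!) (es @ bs) ` ({..<n} - {}) \<subseteq> acl L N ((!) (es @ bs) ` (B {} \<union> ({} \<union> {n..<n + m})))"
        using WB[of "{}"] N(1) im sW by blast
      have "(!) (es @ bs) ` B {} = (\<lambda>i. es ! i) ` B {}"
        by (rule image_cong) (use WB[of "{}"] l in \<open>auto simp: nth_append\<close>)
      then show ?thesis
        using s image_nth_append[OF l(1,2), of "{}" "(!) (es @ bs)"] by (simp add: image_Un)
    qed
    moreover have "cl_dim (acl L N) (set (nths es (- I))) (set (nths es I) \<union> set bs) \<le>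
           cl_dim cl (set (nths ds (- I))) (set (nths ds I) \<union> set as)" if I: "I \<subseteq> {..<n}" for I
    proof -
      have sW: "sat N ((!) (es @ bs)) (W I)" using * Is I by (simp add: \<phi>1_def)
      have "cl_dim (acl L N) ((!) (es @ bs) ` ({..<n} - I)) ((!) (es @ bs) ` (I \<union> {n..<n + m})) \<le> card (B I)"
        using WB[OF I] N(1) im sW by blast
      then show ?thesis
        using WB[OF I] image_nth_append[OF l(1,2) I, of "(!) (es @ bs)"] by simp
    qed
    ultimately show "sat_at N \<chi> (es @ bs) \<and> distinct (es @ bs) \<and>
         set es \<subseteq> acl L N ((\<lambda>i. es ! i) ` B {} \<union> set bs) \<and>
         (\<forall>I\<subseteq>{..<n}. cl_dim (acl L N) (set (nths es (- I))) (set (nths es I) \<union> set bs) \<le>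
           cl_dim cl (set (nths ds (- I))) (set (nths ds I) \<union> set as))"
      using * by (simp add: \<phi>1_def)
  qed
qed

text \<open>For the strong formula \<phi> one formula \<theta> serves as both definability
  conditions of the axiom: the bound for the whole tuple makes \<open>k\<close> the largest possible
  dimension, and the bounds for single positions keep solutions of dimension \<open>k\<close> free
  of algebraic entries. Since \<open>as\<close> satisfies \<theta>, with \<open>ds\<close> as
  witness, so does its image under the elementary map \<open>f\<close>.\<close>

lemma extension_tuple:
  assumes ds: "distinct (ds @ as)" "set (ds @ as) \<subseteq> carrier M" "length ds = n" "length as = m"
    and alg: "set ds \<inter> cl (set as) = {}" and P: "P \<subseteq> set (ds @ as)"
    and K: "\<And>S. S \<subseteq> P \<Longrightarrow> p * card S \<le> q * rk S"
    and suff: "\<And>S. S \<subseteq> set (ds @ as) \<Longrightarrow> p * card (P \<inter> (S - set as)) \<le> q * cl_dim cl S (set as)"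
    and f: "elem L R (set as) f"
    and \<chi>: "formula L (n + m) \<chi>" "sat_at R \<chi> (ds @ as)"
  obtains es where "es \<in> tuples M n" "sat_at R \<chi> (es @ map f as)" "distinct (es @ map f as)"
    "\<And>i. i < n \<Longrightarrow> es ! i \<in> C \<longleftrightarrow> ds ! i \<in> P"
    "\<And>I. I \<subseteq> {..<n} \<Longrightarrow> cl_dim cl (set (nths es (- I))) (set (nths es I) \<union> set (map f as)) \<le>
           cl_dim cl (set (nths ds (- I))) (set (nths ds I) \<union> set as)"
proof -
  define k where "k = cl_dim cl (set ds) (set as)"
  obtain \<phi> B where \<phi>: "formula L (n + m) \<phi>" "qfree \<phi>" "sat_at R \<phi> (ds @ as)" "B \<subseteq> {..<n}"
      "card B = cl_dim cl (set ds) (set as)"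
    and strong: "\<And>(N :: ('f, 'r, 'u) struct) es bs. models L T N \<Longrightarrow> es \<in> tuples N n \<Longrightarrow> bs \<in> tuples N m \<Longrightarrow>
       sat_at N \<phi> (es @ bs) \<Longrightarrow> sat_at N \<chi> (es @ bs) \<and> distinct (es @ bs) \<and>
         set es \<subseteq> acl L N ((\<lambda>i. es ! i) ` B \<union> set bs) \<and>
         (\<forall>I\<subseteq>{..<n}. cl_dim (acl L N) (set (nths es (- I))) (set (nths es I) \<union> set bs) \<le>
           cl_dim cl (set (nths ds (- I))) (set (nths ds I) \<union> set as))"
    by (rule strong_tuple_formula[OF ds \<chi>], rule that)
  have cardB: "card B = k" using \<phi>(5) by (simp add: k_def)
  obtain \<theta> where \<theta>: "formula L m \<theta>"
    and \<theta>_iff: "\<And>(N :: ('f, 'r, 'u) struct) bs. monster L T N \<Longrightarrow> bs \<in> tuples N m \<Longrightarrow>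
      (sat_at N \<theta> bs \<longleftrightarrow> (\<exists>es\<in>tuples N n. sat_at N \<phi> (es @ bs) \<and> cl_dim (acl L N) (set es) (set bs) = card B))"
  proof (rule generic_definable[OF \<phi>(1,4)])
    show "set es \<subseteq> acl L N ((\<lambda>i. es ! i) ` B \<union> set bs)"
      if "models L T N" "es \<in> tuples N n" "bs \<in> tuples N m" "sat_at N \<phi> (es @ bs)"
      for N :: "('f, 'r, 'u) struct" and es bs
      using strong[OF that] by (elim conjE)
  qed (rule that)
  have dM: "set ds \<subseteq> carrier M" "set as \<subseteq> carrier M" using ds(2) by auto
  have le_k: "cl_dim (acl L N) (set es) (set bs) \<le> k"
    if "models L T N" "es \<in> tuples N n" "bs \<in> tuples N m" "sat_at N \<phi> (es @ bs)" for N :: "('f, 'r, 'u) struct" and es bs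
    using strong[OF that] by (auto dest!: conjunct2 spec[of _ "{}"] simp: k_def)
  \<comment> \<open>If entry \<open>j\<close> were algebraic, the remaining entries would still have
    dimension at least \<open>k\<close> over it. The bound for the partition that splits off
    \<open>j\<close> only allows \<open>k - 1\<close>, because \<open>ds ! j\<close> is
    transcendental over \<open>as\<close>.\<close>
  have nonalg: "set es \<inter> acl L N (set bs) = {}"
    if N: "models L T N" "es \<in> tuples N n" "bs \<in> tuples N m" "sat_at N \<phi> (es @ bs)"
      and dim: "k \<le> cl_dim (acl L N) (set es) (set bs)" for N :: "('f, 'r, 'u) struct" and es bs
  proof (rule ccontr)
    interpret N: pregeometry "carrier N" "acl L N" by (rule pregeometry_acl[OF N(1)])
    assume "set es \<inter> acl L N (set bs) \<noteq> {}"
    then obtain j where j: "j < length es" "es ! j \<in> acl L N (set bs)" by (auto simp: in_set_conv_nth)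
    have l: "length es = n" "length bs = m" "set es \<subseteq> carrier N" "set bs \<subseteq> carrier N"
      using N(2,3) by (auto simp: tuples_def)
    have jn: "j < n" using j l by simp
    have nj: "set (nths xs {j}) = {xs ! j}" "set xs = set (nths xs (- {j})) \<union> {xs ! j}" if "length xs = n" for xs :: "'u list"
      using jn that by (auto simp: set_nths in_set_conv_nth)
    have sub: "set (nths xs (- {j})) \<subseteq> set xs" for xs :: "'u list" by (rule set_nths_subset)
    have dj: "ds ! j \<in> carrier M" "ds ! j \<notin> cl (set as)"
    proof -
      have "ds ! j \<in> set ds" using jn ds(3) by simp
      then show "ds ! j \<in> carrier M" "ds ! j \<notin> cl (set as)" using alg dM by blast+
    qed
    have ej: "es ! j \<in> carrier N" using j l nth_mem[of j es] by auto
    have 1: "cl_dim (acl L N) (set (nths es (- {j}))) (insert (es ! j) (set bs)) \<le>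
      cl_dim cl (set (nths ds (- {j}))) (insert (ds ! j) (set as))"
      using strong[OF N] jn nj(1)[OF l(1)] nj(1)[OF ds(3)] by (auto dest!: conjunct2 spec[of _ "{j}"])
    have 2: "N.rk (set es \<union> set bs) = cl_dim (acl L N) (set (nths es (- {j}))) (insert (es ! j) (set bs)) + N.rk (set bs)"
    proof -
      have "set es \<union> set bs = set (nths es (- {j})) \<union> insert (es ! j) (set bs)" using nj(2)[OF l(1)] by auto
      moreover have "N.rk (insert (es ! j) (set bs)) = N.rk (set bs)"
        using N.rk_insert[of "set bs" "es ! j"] j(2) l ej by simp
      moreover have "set (nths es (- {j})) \<subseteq> carrier N" using sub[of es] l by auto
      ultimately show ?thesis
        using N.dim_additive[of "set (nths es (- {j}))" "insert (es ! j) (set bs)"] l ej by simp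
    qed
    have 3: "rk (set ds \<union> set as) = cl_dim cl (set (nths ds (- {j}))) (insert (ds ! j) (set as)) + Suc (rk (set as))"
    proof -
      have "set ds \<union> set as = set (nths ds (- {j})) \<union> insert (ds ! j) (set as)" using nj(2)[OF ds(3)] by auto
      moreover have "rk (insert (ds ! j) (set as)) = Suc (rk (set as))"
        using rk_insert[of "set as" "ds ! j"] dj dM by simp
      moreover have "set (nths ds (- {j})) \<subseteq> carrier M" using sub[of ds] dM by auto
      ultimately show ?thesis
        using dim_additive[of "set (nths ds (- {j}))" "insert (ds ! j) (set as)"] dj dM by simp
    qed
    have "N.rk (set es \<union> set bs) = cl_dim (acl L N) (set es) (set bs) + N.rk (set bs)"
      using l by (intro N.dim_additive) auto
    moreover have "rk (set ds \<union> set as) = k + rk (set as)"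
      unfolding k_def using dM by (intro dim_additive) auto
    ultimately show False using 1 2 3 dim by linarith
  qed
  define N where "N = recolor P"
  have PM: "P \<subseteq> carrier M" using P ds(2) by blast
  have finP: "finite P" using P finite_subset by blast
  have ax: "\<exists>es\<in>tuples N' n. sat_at (reduct N') \<phi> (es @ bs) \<and> (\<forall>i<n. es ! i \<in> colored N' \<longleftrightarrow> ds ! i \<in> P)"
    if N': "T_alpha_model L T \<alpha> N'" "bs \<in> tuples N' m" "sat_at (reduct N') \<theta> bs" for N' :: "('f, 'r option, 'u) struct" and bs
  proof -
    have h1: "K_plus L T \<alpha> N" unfolding N_def using K by (intro K_plus_recolor PM)
    have h2: "self_sufficient L T \<alpha> N (set as) (set as \<union> set ds)"
      unfolding self_sufficient_def
    proof (intro conjI allI impI)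
      fix A assume A: "finite A \<and> A \<subseteq> set as \<union> set ds"
      then have "A \<subseteq> set (ds @ as)" by auto
      then show "0 \<le> predim L T \<alpha> N A (set as)"
        using predim_nonneg_iff[of N A "set as"] suff[of A] dM PM R_models A unfolding N_def by auto
    qed simp
    have h3: "transcendental L T N ds as"
      unfolding transcendental_def
    proof (intro ballI impI)
      fix d assume "d \<in> set ds"
      then have "d \<in> carrier M" "d \<notin> cl (set as)" using dM alg by blast+
      then show "kdim L T N {d} (set as) = 1"
        unfolding N_def using dM dim_insert[of "set as" d] by (subst kdim_recolor) simp_all
    qed
    have h4: "kdim L T N (set ds) (set as) = k"
      unfolding N_def k_def using dM by (intro kdim_recolor)
    have h5: "strong_formula L T N ds as \<phi>"
      unfolding strong_formula_def ds(3,4)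
    proof (intro conjI allI impI ballI)
      fix M' :: "('f, 'r, 'u) struct" and es bs
      assume M': "monster L T M'" "es \<in> tuples M' n" "bs \<in> tuples M' m" "sat_at M' \<phi> (es @ bs)"
      have st: "distinct (es @ bs) \<and> (\<forall>I\<subseteq>{..<n}. cl_dim (acl L M') (set (nths es (- I))) (set (nths es I) \<union> set bs) \<le>
           cl_dim cl (set (nths ds (- I))) (set (nths ds I) \<union> set as))"
        using strong[OF _ M'(2-4)] M'(1) by (simp add: monster_def)
      then show "distinct (es @ bs)" by simp
      fix I :: "nat set" assume I: "I \<subseteq> {..<n}"
      have "set (nths ds (- I)) \<subseteq> carrier M" "set (nths ds I) \<union> set as \<subseteq> carrier M"
        using set_nths_subset[of ds "- I"] set_nths_subset[of ds I] dM by blast+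
      then show "cl_dim (acl L M') (set (nths es (- I))) (set (nths es I) \<union> set bs) \<le>
        kdim L T N (set (nths ds (- I))) (set (nths ds I) \<union> set as)"
        unfolding N_def using st I by (subst kdim_recolor) simp_all
    qed (use ds \<phi> in \<open>simp_all add: N_def\<close>)
    have h6: "defines_max_dim TYPE('u) L T (length ds) (length as) \<phi> k \<theta>"
      unfolding defines_max_dim_def ds(3,4)
    proof (intro conjI allI impI ballI)
      fix M' :: "('f, 'r, 'u) struct" and bs
      assume M': "monster L T M'" "bs \<in> tuples M' m"
      then have "models L T M'" by (simp add: monster_def)
      then show "sat_at M' \<theta> bs \<longleftrightarrow>
           (\<exists>es\<in>tuples M' n. sat_at M' \<phi> (es @ bs) \<and> cl_dim (acl L M') (set es) (set bs) = k) \<and>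
           (\<forall>es\<in>tuples M' n. sat_at M' \<phi> (es @ bs) \<longrightarrow> cl_dim (acl L M') (set es) (set bs) \<le> k)"
        using \<theta>_iff[OF M'] le_k[OF _ _ M'(2)] cardB by auto
    qed (rule \<theta>)
    have h7: "defines_nonalgebraic_dim TYPE('u) L T (length ds) (length as) \<phi> k \<theta>"
      unfolding defines_nonalgebraic_dim_def ds(3,4)
    proof (intro conjI allI impI ballI)
      fix M' :: "('f, 'r, 'u) struct" and bs
      assume M': "monster L T M'" "bs \<in> tuples M' m"
      then have mM': "models L T M'" by (simp add: monster_def)
      show "sat_at M' \<theta> bs \<longleftrightarrow> (\<exists>es\<in>tuples M' n. sat_at M' \<phi> (es @ bs) \<and>
          k \<le> cl_dim (acl L M') (set es) (set bs) \<and> set es \<inter> acl L M' (set bs) = {})"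
        unfolding \<theta>_iff[OF M'] cardB
        by (rule bex_cong[OF refl]) (use le_k[OF mM' _ M'(2)] nonalg[OF mM' _ M'(2)] in fastforce)
    qed (rule \<theta>)
    have cond: "K_plus L T \<alpha> N \<and> set as \<subseteq> carrier N \<and> set ds \<subseteq> carrier N \<and>
        self_sufficient L T \<alpha> N (set as) (set as \<union> set ds) \<and>
        transcendental L T N ds as \<and>
        kdim L T N (set ds) (set as) = k \<and>
        strong_formula L T N ds as \<phi> \<and>
        defines_max_dim TYPE('u) L T (length ds) (length as) \<phi> k \<theta> \<and>
        defines_nonalgebraic_dim TYPE('u) L T (length ds) (length as) \<phi> k \<theta>"
      using h1 h2 h3 h4 h5 h6 h7 dM by (simp add: N_def)
    have "\<exists>es\<in>tuples N' (length ds). sat_at (reduct N') \<phi> (es @ bs) \<and>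
              (\<forall>i<length ds. es ! i \<in> colored N' \<longleftrightarrow> ds ! i \<in> colored N)"
      using N'(1)[unfolded T_alpha_model_def, THEN conjunct2, THEN conjunct2, rule_format, OF cond, of bs] N'(2,3) ds(4)
      by simp
    then show ?thesis using PM ds(3) by (simp add: N_def)
  qed
  have f': "f ` set as \<subseteq> carrier M" using f by (auto simp: elem_def)
  have bs: "map f as \<in> tuples M m" using f' ds(4) by (auto simp: tuples_def)
  have asR: "as \<in> tuples R m" "ds \<in> tuples R n" using dM ds by (auto simp: tuples_def)
  have "sat_at R \<theta> as" unfolding \<theta>_iff[OF R_monster asR(1)] using asR(2) \<phi>(3) cardB by (auto simp: k_def)
  then have "sat R (f \<circ> (!) as) \<theta>"
  proof (subst (asm) elemD[OF f])
    show "(!) as ` fv \<theta> \<subseteq> set as" using \<theta> ds(4) by (auto simp: formula_def)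
  qed (use \<theta> in \<open>auto simp: formula_def\<close>)
  then have \<theta>bs: "sat_at R \<theta> (map f as)"
    using \<theta> ds(4) by (elim sat_cong[THEN iffD1, rotated]) (auto simp: formula_def subset_iff)
  obtain es where es: "es \<in> tuples M n" "sat_at R \<phi> (es @ map f as)" "\<forall>i<n. es ! i \<in> C \<longleftrightarrow> ds ! i \<in> P"
    using axiom_transfer[OF \<phi>(1) \<theta> ax bs \<theta>bs] by blast
  have tR: "es \<in> tuples R n" "map f as \<in> tuples R m" using es(1) bs by (simp_all add: tuples_def)
  show thesis using that[OF es(1)] strong[OF R_models tR es(2)] es(3) by blast
qed


text \<open>The form in which the axiom is used later: a map \<open>h\<close> replaces the new
  tuple, and subsets of \<open>E\<close> replace sets of positions. Dimensions of the image are
  bounded only from above.\<close>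

lemma extension_set:
  assumes X: "finite X" "X \<subseteq> carrier M" and E: "finite E" "E \<subseteq> carrier M" "E \<inter> cl X = {}" and P: "P \<subseteq> X \<union> E"
    and K: "\<And>S. S \<subseteq> P \<Longrightarrow> p * card S \<le> q * rk S"
    and suff: "\<And>S. S \<subseteq> X \<union> E \<Longrightarrow> p * card (P \<inter> (S - X)) \<le> q * cl_dim cl S X"
    and f: "elem L R X f"
    and \<chi>: "wf_fm L \<chi>" "s ` fv \<chi> \<subseteq> X \<union> E" "sat R s \<chi>"
  obtains h where "inj_on h (X \<union> E)" "\<And>x. x \<in> X \<Longrightarrow> h x = f x" "h ` E \<subseteq> carrier M"
    "\<And>x. x \<in> E \<Longrightarrow> h x \<in> C \<longleftrightarrow> x \<in> P" "sat R (h \<circ> s) \<chi>"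
    "\<And>A. A \<subseteq> E \<Longrightarrow> cl_dim cl (h ` (E - A)) (h ` A \<union> f ` X) \<le> cl_dim cl (E - A) (A \<union> X)"
proof -
  obtain as where as: "set as = X" "distinct as" using finite_distinct_list[OF X(1)] by (elim exE conjE) (rule that)
  obtain ds where ds: "set ds = E" "distinct ds" using finite_distinct_list[OF E(1)] by (elim exE conjE) (rule that)
  define n where "n = length ds"
  define m where "m = length as"
  define cs where "cs = ds @ as"
  have XE: "X \<inter> E = {}" using E(3) cl_extensive[OF X(2)] by blast
  have cs: "distinct cs" "set cs = X \<union> E" "length cs = n + m"
    using as ds XE by (auto simp: cs_def n_def m_def)
  define \<chi>' where "\<chi>' = subst (\<lambda>v. index_of cs (s v)) \<chi>"
  have idx: "index_of cs x < n + m \<and> cs ! index_of cs x = x" if "x \<in> X \<union> E" for x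
    using index_of[of x cs] that cs by simp
  have sx: "s v \<in> X \<union> E" if "v \<in> fv \<chi>" for v using \<chi>(2) that by blast
  have \<chi>': "formula L (n + m) \<chi>'"
    unfolding formula_def \<chi>'_def using \<chi>(1) fv_subst[of "\<lambda>v. index_of cs (s v)" \<chi>] idx sx by fastforce
  have sat_\<chi>': "sat_at R \<chi>' l \<longleftrightarrow> sat R (\<lambda>v. l ! index_of cs (s v)) \<chi>"
    if "length l = n + m" "set l \<subseteq> carrier M" for l
    unfolding \<chi>'_def
  proof (rule sat_subst)
    fix v assume "v \<in> fv \<chi>"
    then have "index_of cs (s v) < length l" using idx sx that by simp
    then show "l ! index_of cs (s v) \<in> carrier R" using that(2) nth_mem by auto
  qed
  have csM: "set cs \<subseteq> carrier M" using cs X E by simp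
  have "sat R (\<lambda>v. cs ! index_of cs (s v)) \<chi>"
    using \<chi>(3) by (rule sat_cong[THEN iffD1, rotated]) (use idx sx in metis)
  then have \<chi>'cs: "sat_at R \<chi>' (ds @ as)" using sat_\<chi>'[OF cs(3) csM] by (simp add: cs_def)
  have alg: "set ds \<inter> cl (set as) = {}" using E(3) as ds by simp
  have P': "P \<subseteq> set (ds @ as)" using P as ds by auto
  have suff': "p * card (P \<inter> (S - set as)) \<le> q * cl_dim cl S (set as)" if "S \<subseteq> set (ds @ as)" for S
    using suff[of S] that as ds by (simp add: Un_commute)
  have f': "elem L R (set as) f" using f as by simp
  obtain es where es: "es \<in> tuples M n" "sat_at R \<chi>' (es @ map f as)" "distinct (es @ map f as)"
    and col: "\<And>i. i < n \<Longrightarrow> es ! i \<in> C \<longleftrightarrow> ds ! i \<in> P"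
    and dims: "\<And>I. I \<subseteq> {..<n} \<Longrightarrow> cl_dim cl (set (nths es (- I))) (set (nths es I) \<union> set (map f as)) \<le>
           cl_dim cl (set (nths ds (- I))) (set (nths ds I) \<union> set as)"
    by (rule extension_tuple[OF cs(1)[unfolded cs_def] csM[unfolded cs_def] n_def[symmetric] m_def[symmetric]
          alg P' K suff' f' \<chi>' \<chi>'cs], assumption, assumption, rule that)
  have les: "length es = n" "set es \<subseteq> carrier M" using es(1) by (auto simp: tuples_def)
  define h where "h x = (es @ map f as) ! index_of cs x" for x
  have h_nth: "h (cs ! i) = (es @ map f as) ! i" if "i < n + m" for i
    using index_of_nth[OF cs(1)] that cs(3) by (simp add: h_def)
  have h_ds: "h (ds ! i) = es ! i" if "i < n" for i
    using h_nth[of i] that les by (simp add: cs_def nth_append n_def)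
  have h_as: "h x = f x" if "x \<in> X" for x
  proof -
    obtain i where i: "i < m" "as ! i = x" using \<open>x \<in> X\<close> as by (auto simp: in_set_conv_nth m_def)
    then have "cs ! (n + i) = x" by (simp add: cs_def nth_append n_def)
    then have "h x = (es @ map f as) ! (n + i)" using h_nth[of "n + i"] i by simp
    then show ?thesis using i les by (simp add: nth_append m_def)
  qed
  have hE: "h ` {ds ! i | i. i < n \<and> i \<in> I} = {es ! i | i. i < n \<and> i \<in> I}" for I
    using h_ds by force
  show thesis
  proof (rule that)
    show "inj_on h (X \<union> E)"
    proof (rule inj_onI)
      fix x y assume xy: "x \<in> X \<union> E" "y \<in> X \<union> E" "h x = h y"
      then have "(es @ map f as) ! index_of cs x = (es @ map f as) ! index_of cs y" by (simp add: h_def)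
      then have "index_of cs x = index_of cs y"
        using nth_eq_iff_index_eq[OF es(3)] idx xy les by (simp add: m_def)
      then show "x = y" using idx xy by metis
    qed
    show "h ` E \<subseteq> carrier M"
    proof -
      have "h x \<in> carrier M" if x: "x \<in> E" for x
      proof -
        obtain i where i: "i < n" "ds ! i = x" using x ds by (auto simp: in_set_conv_nth n_def)
        then show ?thesis using h_ds[of i] les nth_mem[of i es] by auto
      qed
      then show ?thesis by blast
    qed
    show "h x \<in> C \<longleftrightarrow> x \<in> P" if x: "x \<in> E" for x
    proof -
      obtain i where i: "i < n" "ds ! i = x" using x ds by (auto simp: in_set_conv_nth n_def)
      then show ?thesis using h_ds[of i] col[of i] by simp
    qed
    have "set (es @ map f as) \<subseteq> carrier M" using les f as by (auto simp: elem_def)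
    then have "sat R (\<lambda>v. (es @ map f as) ! index_of cs (s v)) \<chi>"
      using sat_\<chi>'[of "es @ map f as"] es(2) les by (simp add: m_def)
    then show "sat R (h \<circ> s) \<chi>" by (rule sat_cong[THEN iffD1, rotated]) (simp add: h_def)
    fix A assume A: "A \<subseteq> E"
    define I where "I = {i. i < n \<and> ds ! i \<in> A}"
    have 1: "set (nths ds I) = A" "set (nths ds (- I)) = E - A"
    proof -
      have idx: "\<exists>i<length ds. ds ! i = x" if "x \<in> E" for x using that ds by (auto simp: in_set_conv_nth)
      have E: "ds ! i \<in> E" if "i < length ds" for i using that ds nth_mem by blast
      have I: "i \<in> I \<longleftrightarrow> ds ! i \<in> A" if "i < length ds" for i using that by (simp add: I_def n_def)
      show "set (nths ds I) = A" unfolding set_nths using I idx A by blast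
      show "set (nths ds (- I)) = E - A" unfolding set_nths using I idx E by blast
    qed
    have 2: "set (nths es J) = h ` set (nths ds J)" for J
      using hE[of J] les by (simp add: set_nths n_def)
    have "I \<subseteq> {..<n}" by (auto simp: I_def)
    from dims[OF this] show "cl_dim cl (h ` (E - A)) (h ` A \<union> f ` X) \<le> cl_dim cl (E - A) (A \<union> X)"
      using 1 2 as by simp
  qed (rule h_as)
qed

section \<open>Isomorphisms between closed sets and their generic extensions\<close>

definition iso :: "'u set \<Rightarrow> ('u \<Rightarrow> 'u) \<Rightarrow> bool" where
  "iso X f \<longleftrightarrow> closed X \<and> closed (f ` X) \<and> elem L R X f \<and> (\<forall>x\<in>X. f x \<in> C \<longleftrightarrow> x \<in> C)"

lemma closedD: "closed Z \<Longrightarrow> finite Z" "closed Z \<Longrightarrow> Z \<subseteq> carrier M"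
  "closed Z \<Longrightarrow> finite Z' \<Longrightarrow> Z \<subseteq> Z' \<Longrightarrow> Z' \<subseteq> carrier M \<Longrightarrow> \<delta> Z \<le> \<delta> Z'"
  by (auto simp: closed_def)

text \<open>The last conclusion approximates closedness of the image of \<open>Y\<close>: at most
  \<open>N\<close> colored points cannot witness a failure. It is obtained by comparing the image of
  \<open>Y\<close> and such points with the closed image of a larger set, inside which
  \<open>N\<close> points are too few to be dependent over \<open>Y\<close>. Saturation later
  combines the approximations for all \<open>N\<close>.\<close>

lemma generic_extension:
  assumes iso: "iso X f" and Y: "X \<subseteq> Y" "finite Y" "Y \<subseteq> carrier M" "(Y - X) \<inter> cl X = {}"
    and \<chi>: "wf_fm L \<chi>" "s ` fv \<chi> \<subseteq> Y" "sat R s \<chi>"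
  obtains h where "\<And>x. x \<in> X \<Longrightarrow> h x = f x" "h ` Y \<subseteq> carrier M" "inj_on h Y"
    "\<And>y. y \<in> Y \<Longrightarrow> h y \<in> C \<longleftrightarrow> y \<in> C" "sat R (h \<circ> s) \<chi>"
    "\<And>Z. Z \<subseteq> C \<Longrightarrow> finite Z \<Longrightarrow> card Z \<le> N \<Longrightarrow> \<delta> Y \<le> \<delta> (h ` Y \<union> Z)"
proof -
  have X: "closed X" "closed (f ` X)" "elem L R X f" "\<And>x. x \<in> X \<Longrightarrow> f x \<in> C \<longleftrightarrow> x \<in> C"
    using iso by (auto simp: iso_def)
  have Xf: "finite X" "X \<subseteq> carrier M" using closedD(1,2)[OF X(1)] by auto
  define k where "k = cl_dim cl Y X"
  define cd where "cd = card (C \<inter> (Y - X))"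
  have "Y \<union> X = Y" using Y(1) by auto
  then have rkY: "rk Y = k + rk X" using dim_additive[of Y X] Y(2,3) Xf by (simp add: k_def)
  have cY: "card (C \<inter> Y) = card (C \<inter> X) + cd"
  proof -
    have "C \<inter> Y = (C \<inter> X) \<union> (C \<inter> (Y - X))" using Y(1) by auto
    then show ?thesis unfolding cd_def using Y(2) Xf(1) by (subst card_Un_disjoint[symmetric]) auto
  qed
  \<comment> \<open>The common factor \<open>j\<close> produces \<open>k + k' = p * j\<close> and
    \<open>cd + l = q * j\<close>, which balance to predimension 0 over \<open>X\<close>. It is so
    large that the subtractions in \<open>k'\<close> and \<open>l\<close> are not truncated and that
    \<open>k'\<close> is at least \<open>N + 2\<close>.\<close>
  define j where "j = N + 2 + cd + k"
  define k' where "k' = p * j - k"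
  define l where "l = q * j - cd"
  have pj: "j \<le> p * j" "j \<le> q * j" using alpha(2,3) by simp_all
  have k': "k + k' = p * j" "N + 2 \<le> k'" using pj by (simp_all add: k'_def j_def)
  have l: "l + cd = q * j" using pj by (simp add: l_def j_def)
  have key: "p * (cd + l) = q * (k + k')" using l k'(1) by (simp add: ac_simps)
  text \<open>\<open>k'\<close> new dimensions are spent on \<open>l\<close> new colored points in general position, chosen so that
    the whole extension has predimension \<open>0\<close> over \<open>X\<close>; here rationality of \<open>\<alpha>\<close> is used.\<close>
  have YR: "Y \<subseteq> carrier R" using Y(3) by simp
  obtain us where us: "length us = k'" "set us \<subseteq> carrier R" "seq_indep cl Y us"
    using ex_indep_list[OF R_models sat_R Y(2) YR, of k'] by (elim exE conjE) (rule that)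
  define S0 where "S0 = Y \<union> set us"
  have S0: "finite S0" "S0 \<subseteq> carrier M" using Y us by (auto simp: S0_def)
  have rkS0: "rk S0 = rk Y + k'"
  proof -
    have "cl_dim cl (set us) Y = k'" using seq_indep_iff[of Y us] us Y by simp
    moreover have "S0 = set us \<union> Y" by (auto simp: S0_def)
    ultimately show ?thesis using dim_additive[of "set us" Y] us(2) Y by simp
  qed
  have rkS0': "rk S0 = rk X + (k + k')" using rkS0 rkY by simp
  have YS0: "Y \<subseteq> cl S0" using cl_extensive[OF S0(2)] by (auto simp: S0_def)
  obtain Q where Q: "finite Q" "card Q = l" "Q \<subseteq> cl S0" "Q \<inter> Y = {}"
    and gp: "\<forall>S1 \<subseteq> Y. \<forall>Q1 \<subseteq> Q. min (rk S1 + card Q1) (rk S0) \<le> rk (S1 \<union> Q1)"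
  proof -
    have "rk Y < rk S0" "2 \<le> rk S0" using rkS0 k' by simp_all
    from general_position[OF S0 Y(2) YS0 this, of l] show thesis by (elim exE conjE) (rule that)
  qed
  note gp = gp[rule_format]
  have QM: "Q \<subseteq> carrier M" using Q(3) cl_closed[OF S0(2)] by auto
  define E where "E = (Y - X) \<union> Q"
  define P where "P = (C \<inter> Y) \<union> Q"
  have XE: "X \<union> E = Y \<union> Q" using Y(1) by (auto simp: E_def)
  have E: "finite E" "E \<subseteq> carrier M" using Y Q QM by (auto simp: E_def)
  have "x \<notin> cl X" if "x \<in> Q" for x
  proof -
    have "min (rk X + 1) (rk S0) \<le> rk (X \<union> {x})" using gp[of X "{x}"] Y(1) that by simp
    then show ?thesis using rk_insert[OF Xf, of x] that QM rkS0' k' by auto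
  qed
  then have Ecl: "E \<inter> cl X = {}" using Y(4) by (auto simp: E_def)
  \<comment> \<open>By general position there are two cases. Either each point of \<open>S\<close>
    in \<open>Q\<close> adds one to the rank of the part in \<open>Y\<close>, and so contributes
    \<open>q - p \<ge> 0\<close>; or \<open>S\<close> already has the rank of \<open>S0\<close>, and
    then counting all points of \<open>P\<close> suffices.\<close>
  have K: "p * card S \<le> q * rk S" if S: "S \<subseteq> P" for S
  proof -
    define S1 where "S1 = S \<inter> Y"
    define S2 where "S2 = S \<inter> Q"
    have S12: "S = S1 \<union> S2" "S1 \<inter> S2 = {}" "S1 \<subseteq> Y" "S2 \<subseteq> Q" "S1 \<subseteq> C"
      using S Q(4) by (auto simp: S1_def S2_def P_def)
    have fin: "finite S1" "finite S2" using finite_subset[OF S12(3) Y(2)] finite_subset[OF S12(4) Q(1)] by simp_all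
    have c: "card S = card S1 + card S2" using card_Un_disjoint[OF fin S12(2)] S12(1) by simp
    have r1: "p * card S1 \<le> q * rk S1"
      using rank_bound[OF fin(1)] S12(3,5) Y(3) by (simp add: Int_absorb1 subset_trans)
    have "min (rk S1 + card S2) (rk S0) \<le> rk S" using gp[OF S12(3,4)] S12(1) by simp
    then consider "rk S1 + card S2 \<le> rk S" | "rk S0 \<le> rk S" by linarith
    then show ?thesis
    proof cases
      case 1
      have "p * card S2 \<le> q * card S2" using alpha(3) by (rule mult_le_mono1)
      then have "p * card S \<le> q * (rk S1 + card S2)" unfolding c distrib_left using r1 by linarith
      also have "\<dots> \<le> q * rk S" by (rule mult_le_mono2[OF 1])
      finally show ?thesis .
    next
      case 2
      have "S1 \<subseteq> C \<inter> Y" using S12(3,5) by blast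
      then have "card S1 \<le> card (C \<inter> X) + cd" unfolding cY[symmetric] using Y(2) by (intro card_mono) auto
      moreover have "card S2 \<le> l" using card_mono[OF Q(1) S12(4)] Q(2) by simp
      ultimately have "p * card S \<le> p * (card (C \<inter> X) + (cd + l))" using c by (intro mult_le_mono2) simp
      also have "\<dots> = p * card (C \<inter> X) + q * (k + k')" using key by (simp only: distrib_left[of p "card (C \<inter> X)"])
      also have "\<dots> \<le> q * rk S0" unfolding rkS0' using rank_bound[OF Xf] by (simp add: distrib_left)
      also have "\<dots> \<le> q * rk S" by (rule mult_le_mono2[OF 2])
      finally show ?thesis .
    qed
  qed
  \<comment> \<open>The same two cases relative to \<open>X\<close>. In the first, the part of
    \<open>S\<close> inside \<open>Y\<close> is taken care of by closedness of \<open>X\<close>; in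
    the second, the equation \<open>key\<close> is used.\<close>
  have suff: "p * card (P \<inter> (S - X)) \<le> q * cl_dim cl S X" if S: "S \<subseteq> X \<union> E" for S
  proof -
    define S1 where "S1 = (S \<inter> Y) \<union> X"
    define S2 where "S2 = S \<inter> Q"
    have SYQ: "S \<subseteq> Y \<union> Q" using S XE by simp
    have S12: "S \<union> X = S1 \<union> S2" "S1 \<subseteq> Y" "S2 \<subseteq> Q" using SYQ Y(1) by (auto simp: S1_def S2_def)
    have fin: "finite S1" "finite S2" "finite S" "S \<subseteq> carrier M" "S1 \<subseteq> carrier M"
      using S12 Y Q(1) QM SYQ finite_subset[of S "Y \<union> Q"] finite_subset[of S1 Y] finite_subset[of S2 Q] by auto
    have "P \<inter> (S - X) = (C \<inter> (S1 - X)) \<union> S2"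
      using Q(4) Y(1) SYQ by (auto simp: P_def S1_def S2_def)
    moreover have "(C \<inter> (S1 - X)) \<inter> S2 = {}" using S12 Q(4) by auto
    ultimately have c: "card (P \<inter> (S - X)) = card (C \<inter> (S1 - X)) + card S2"
      using fin by (simp add: card_Un_disjoint)
    have r: "rk (S1 \<union> S2) = cl_dim cl S X + rk X" using dim_additive[OF fin(3) Xf(1) fin(4) Xf(2)] S12(1) by simp
    have cS1: "card (C \<inter> S1) = card (C \<inter> X) + card (C \<inter> (S1 - X))"
    proof -
      have "C \<inter> S1 = (C \<inter> X) \<union> (C \<inter> (S1 - X))" by (auto simp: S1_def)
      then show ?thesis using fin(1) Xf(1) by (subst card_Un_disjoint[symmetric]) auto
    qed
    have "\<delta> X \<le> \<delta> S1" by (rule closedD(3)[OF X(1)]) (use fin S1_def in auto)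
    then have d: "int q * int (rk X) + int p * int (card (C \<inter> (S1 - X))) \<le> int q * int (rk S1)"
      unfolding \<delta>_def cS1 by (simp add: distrib_left)
    have "min (rk S1 + card S2) (rk S0) \<le> rk (S1 \<union> S2)" by (rule gp[OF S12(2,3)])
    then consider "rk S1 + card S2 \<le> rk (S1 \<union> S2)" | "rk S0 \<le> rk (S1 \<union> S2)" by linarith
    then show ?thesis
    proof cases
      case 1
      have "q * (rk S1 + card S2) \<le> q * (cl_dim cl S X + rk X)" using 1 r by (intro mult_le_mono2) simp
      moreover have "p * card S2 \<le> q * card S2" using alpha(3) by (rule mult_le_mono1)
      moreover have "q * rk X + p * card (C \<inter> (S1 - X)) \<le> q * rk S1"
        using d by (metis of_nat_add of_nat_le_iff of_nat_mult)
      ultimately show ?thesis unfolding c distrib_left by linarith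
    next
      case 2
      then have "k + k' \<le> cl_dim cl S X" using r rkS0' by simp
      then have "p * (cd + l) \<le> q * cl_dim cl S X" unfolding key by (rule mult_le_mono2)
      moreover have "card (C \<inter> (S1 - X)) \<le> cd" unfolding cd_def using S12(2) Y(2) by (intro card_mono) auto
      moreover have "card S2 \<le> l" using card_mono[OF Q(1) S12(3)] Q(2) by simp
      ultimately show ?thesis unfolding c using mult_le_mono2[of "card (C \<inter> (S1 - X)) + card S2" "cd + l" p] by linarith
    qed
  qed
  have PXE: "P \<subseteq> X \<union> E" unfolding XE by (auto simp: P_def)
  have \<chi>XE: "s ` fv \<chi> \<subseteq> X \<union> E" using \<chi>(2) XE by auto
  obtain h where h: "inj_on h (X \<union> E)" "\<And>x. x \<in> X \<Longrightarrow> h x = f x" "h ` E \<subseteq> carrier M"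
    "\<And>x. x \<in> E \<Longrightarrow> h x \<in> C \<longleftrightarrow> x \<in> P" "sat R (h \<circ> s) \<chi>"
    and dims: "\<And>A. A \<subseteq> E \<Longrightarrow> cl_dim cl (h ` (E - A)) (h ` A \<union> f ` X) \<le> cl_dim cl (E - A) (A \<union> X)"
    by (rule extension_set[OF Xf E Ecl PXE K suff X(3) \<chi>(1) \<chi>XE \<chi>(3)], assumption, assumption, rule that)
  have fX: "f ` X \<subseteq> carrier M" "finite (f ` X)" "rk (f ` X) = rk X"
    using closedD(1,2)[OF X(2)] elem_rk[OF R_models X(3) order_refl Xf(1)] by auto
  have hX: "h ` X = f ` X" using h(2) by auto
  have hYQ: "h ` (Y \<union> Q) \<subseteq> carrier M" using h(3) hX fX(1) XE[symmetric] by (simp add: image_Un)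
  have finYQ: "finite (Y \<union> Q)" using Y Q by simp
  have hC: "h x \<in> C \<longleftrightarrow> x \<in> P" if "x \<in> Y \<union> Q" for x
  proof (cases "x \<in> X")
    case True
    then have "x \<in> P \<longleftrightarrow> x \<in> C" using Y(1) Q(4) by (auto simp: P_def)
    then show ?thesis using True h(2) X(4) by simp
  next
    case False
    then show ?thesis using that XE h(4)[of x] by blast
  qed
  have card_C: "card (C \<inter> h ` D) = card (P \<inter> D)" if "D \<subseteq> Y \<union> Q" for D
  proof -
    have "C \<inter> h ` D = h ` (P \<inter> D)" using hC that by blast
    moreover have "inj_on h (P \<inter> D)" using h(1) that XE by (auto intro: inj_on_subset)
    ultimately show ?thesis by (simp add: card_image)
  qed
  have card_P: "card (P \<inter> (Y \<union> Q1)) = card (C \<inter> Y) + card Q1" if "Q1 \<subseteq> Q" for Q1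
  proof -
    have "P \<inter> (Y \<union> Q1) = (C \<inter> Y) \<union> Q1" "(C \<inter> Y) \<inter> Q1 = {}" using that Q(4) by (auto simp: P_def)
    then show ?thesis using Y(2) finite_subset[OF that Q(1)] by (simp add: card_Un_disjoint)
  qed
  have \<delta>_h: "\<delta> (h ` (Y \<union> Q1)) = int q * int (rk (h ` (Y \<union> Q1))) - int p * int (card (C \<inter> Y) + card Q1)"
    if "Q1 \<subseteq> Q" for Q1
  proof -
    have "Y \<union> Q1 \<subseteq> Y \<union> Q" using that by auto
    from card_C[OF this] show ?thesis unfolding \<delta>_def by (simp only: card_P[OF that])
  qed
  have \<delta>_fX: "\<delta> (f ` X) = int q * int (rk X) - int p * int (card (C \<inter> X))"
  proof -
    have "P \<inter> X = C \<inter> X" using Y(1) Q(4) by (auto simp: P_def)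
    then show ?thesis unfolding \<delta>_def fX(3) using card_C[of X] hX Y(1) by auto
  qed
  have keyi: "int p * (int cd + int l) = int q * (int k + int k')"
    using key by (metis of_nat_add of_nat_mult)
  \<comment> \<open>The axiom bounds the rank of the image only from above. The lower bound comes
    from the closed image of \<open>X\<close>: the colors of the new points are prescribed, so a
    smaller rank would give a superset of smaller predimension.\<close>
  have low: "rk S0 \<le> rk (h ` (Y \<union> Q))"
  proof -
    have "\<delta> (f ` X) \<le> \<delta> (h ` (Y \<union> Q))"
    proof (rule closedD(3)[OF X(2)])
      show "f ` X \<subseteq> h ` (Y \<union> Q)" unfolding hX[symmetric] using Y(1) by (intro image_mono) auto
    qed (use hYQ finYQ in auto)
    then have "int q * int (rk X) - int p * int (card (C \<inter> X)) \<le>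
        int q * int (rk (h ` (Y \<union> Q))) - int p * int (card (C \<inter> X) + cd + l)"
      using \<delta>_fX \<delta>_h[OF order_refl] cY Q(2) by simp
    then have "int q * int (rk X) + int p * (int cd + int l) \<le> int q * int (rk (h ` (Y \<union> Q)))"
      by (simp add: distrib_left)
    then have "int q * (int (rk X) + (int k + int k')) \<le> int q * int (rk (h ` (Y \<union> Q)))"
      using keyi by (simp add: distrib_left)
    then show ?thesis using alpha(2,3) rkS0' by simp
  qed
  have up: "rk (Y \<union> Q) \<le> rk S0"
  proof -
    have YQM: "Y \<union> Q \<subseteq> carrier M" using Y QM by simp
    have "cl_dim cl (Y \<union> Q) S0 \<le> card ({} :: 'u set)"
      using YS0 Q(3) S0 finYQ YQM by (intro cl_dim_le_card) auto
    then have "rk ((Y \<union> Q) \<union> S0) = rk S0" using dim_additive[OF finYQ S0(1) YQM S0(2)] by simp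
    moreover have "rk (Y \<union> Q) \<le> rk ((Y \<union> Q) \<union> S0)" using finYQ S0 YQM by (intro rk_mono) auto
    ultimately show ?thesis by simp
  qed
  \<comment> \<open>Subtracted from the total rank, the upper bound for the dimension of the rest
    over a part becomes a lower bound for the rank of that part.\<close>
  have ge: "rk (A \<union> X) + rk (h ` (Y \<union> Q)) \<le> rk (h ` (A \<union> X)) + rk (Y \<union> Q)" if A: "A \<subseteq> E" for A
  proof -
    have finA: "finite A" "finite (E - A)" using A E finite_subset by auto
    have AX: "A \<union> X \<subseteq> carrier M" "E - A \<subseteq> carrier M" using A E Xf by auto
    have hA: "h ` (A \<union> X) \<subseteq> carrier M" "h ` (E - A) \<subseteq> carrier M"
      using A h(3) fX(1) unfolding image_Un hX by blast+
    have "(E - A) \<union> (A \<union> X) = Y \<union> Q" using A XE by auto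
    then have "rk (Y \<union> Q) = cl_dim cl (E - A) (A \<union> X) + rk (A \<union> X)"
      "rk (h ` (Y \<union> Q)) = cl_dim cl (h ` (E - A)) (h ` (A \<union> X)) + rk (h ` (A \<union> X))"
      using dim_additive[of "E - A" "A \<union> X"] dim_additive[of "h ` (E - A)" "h ` (A \<union> X)"] finA Xf AX hA
      by (simp_all add: image_Un[symmetric])
    then show ?thesis using dims[OF A] hX by (simp add: image_Un)
  qed
  have rk_h: "rk (A \<union> X) \<le> rk (h ` (A \<union> X))" if "A \<subseteq> E" for A using ge[OF that] low up by linarith
  have top: "rk (h ` (Y \<union> Q)) = rk S0"
    using ge[of "{}"] hX fX(3) low up by simp
  \<comment> \<open>The predimension here equals that of the closed image of \<open>X\<close>, which
    no finite superset can undercut.\<close>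
  have clV: "closed (h ` (Y \<union> Q))"
    unfolding closed_def
  proof (intro conjI allI impI)
    fix Z' assume Z': "finite Z'" "h ` (Y \<union> Q) \<subseteq> Z'" "Z' \<subseteq> carrier M"
    have "f ` X \<subseteq> h ` (Y \<union> Q)" unfolding hX[symmetric] using Y(1) by (intro image_mono) auto
    then have "f ` X \<subseteq> Z'" using Z'(2) by (rule order_trans)
    then have "\<delta> (f ` X) \<le> \<delta> Z'" using closedD(3)[OF X(2)] Z' by simp
    moreover have "\<delta> (h ` (Y \<union> Q)) = \<delta> (f ` X)"
      unfolding \<delta>_h[OF order_refl] \<delta>_fX top rkS0' cY Q(2) using keyi by (simp add: distrib_left)
    ultimately show "\<delta> (h ` (Y \<union> Q)) \<le> \<delta> Z'" by simp
  qed (use finYQ hYQ in auto)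
  \<comment> \<open>By submodularity against the closed set, \<open>Z\<close> may be replaced by the
    images of the at most \<open>N\<close> points of \<open>Q\<close> that it contains. As
    \<open>N\<close> is less than \<open>k'\<close>, each of these points adds one to the rank over
    \<open>Y\<close>, so together they do not lower the predimension.\<close>
  have Zle: "\<delta> Y \<le> \<delta> (h ` Y \<union> Z)" if Z: "Z \<subseteq> C" "finite Z" "card Z \<le> N" for Z
  proof -
    define Q1 where "Q1 = {x \<in> Q. h x \<in> Z}"
    have Q1: "Q1 \<subseteq> Q" by (auto simp: Q1_def)
    have W: "(h ` Y \<union> Z) \<inter> h ` (Y \<union> Q) = h ` (Y \<union> Q1)" by (auto simp: Q1_def)
    have WM: "finite (h ` Y \<union> Z)" "h ` Y \<union> Z \<subseteq> carrier M"
      using Z Y(2) hYQ C_carrier by (auto simp: image_Un)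
    have "card Q1 = card (h ` Q1)" using h(1) Q1 XE by (intro card_image[symmetric] inj_on_subset[OF h(1)]) auto
    also have "\<dots> \<le> card Z" using Z(2) by (intro card_mono) (auto simp: Q1_def)
    finally have cQ1: "card Q1 \<le> N" using Z(3) by simp
    have "\<delta> (h ` Y \<union> Z \<union> h ` (Y \<union> Q)) + \<delta> (h ` (Y \<union> Q1)) \<le> \<delta> (h ` Y \<union> Z) + \<delta> (h ` (Y \<union> Q))"
      using \<delta>_submodular[of "h ` Y \<union> Z" "h ` (Y \<union> Q)"] W WM hYQ finYQ by simp
    moreover have "\<delta> (h ` (Y \<union> Q)) \<le> \<delta> (h ` Y \<union> Z \<union> h ` (Y \<union> Q))"
      by (rule closedD(3)[OF clV]) (use WM hYQ finYQ in auto)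
    ultimately have 1: "\<delta> (h ` (Y \<union> Q1)) \<le> \<delta> (h ` Y \<union> Z)" by simp
    have "min (rk Y + card Q1) (rk S0) \<le> rk (Y \<union> Q1)" by (rule gp[OF order_refl Q1])
    then have "rk Y + card Q1 \<le> rk (Y \<union> Q1)" using rkS0 cQ1 k'(2) by simp
    also have "\<dots> \<le> rk (h ` (Y \<union> Q1))"
    proof -
      have "(Y - X) \<union> Q1 \<subseteq> E" "(Y - X) \<union> Q1 \<union> X = Y \<union> Q1" using Q1 Y(1) by (auto simp: E_def)
      then show ?thesis using rk_h by metis
    qed
    finally have "int q * (int (rk Y) + int (card Q1)) \<le> int q * int (rk (h ` (Y \<union> Q1)))"
      by (intro mult_left_mono) simp_all
    moreover have "int p * int (card Q1) \<le> int q * int (card Q1)" using alpha(3) by (intro mult_right_mono) simp_all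
    ultimately have "\<delta> Y \<le> \<delta> (h ` (Y \<union> Q1))" unfolding \<delta>_h[OF Q1] by (simp add: \<delta>_def distrib_left)
    then show ?thesis using 1 by simp
  qed
  show thesis
  proof (rule that)
    show "h ` Y \<subseteq> carrier M" using hYQ by auto
    show "inj_on h Y" using h(1) XE by (auto intro: inj_on_subset)
    show "h y \<in> C \<longleftrightarrow> y \<in> C" if "y \<in> Y" for y using hC[of y] that Q(4) by (auto simp: P_def)
  qed (use h(2,5) Zle in auto)
qed

section \<open>Types of closed sets\<close>


lemma \<delta>_elem:
  assumes "elem L R Y g" "\<And>y. y \<in> Y \<Longrightarrow> g y \<in> C \<longleftrightarrow> y \<in> C" "finite Y"
  shows "\<delta> (g ` Y) = \<delta> Y" "card (C \<inter> g ` Y) = card (C \<inter> Y)" "rk (g ` Y) = rk Y"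
proof -
  show r: "rk (g ` Y) = rk Y" by (rule elem_rk[OF R_models assms(1) order_refl assms(3)])
  have "C \<inter> g ` Y = g ` (C \<inter> Y)" using assms(2) by blast
  moreover have "inj_on g (C \<inter> Y)" using elem_inj[OF assms(1)] by (rule inj_on_subset) simp
  ultimately show c: "card (C \<inter> g ` Y) = card (C \<inter> Y)" by (simp add: card_image)
  show "\<delta> (g ` Y) = \<delta> Y" by (simp only: \<delta>_def r c)
qed

text \<open>If among \<open>n + c\<close> entries there are \<open>card (C \<inter> Y) + c\<close>
  colored points, the inequality says that their predimension is smaller than that of
  \<open>Y\<close>. It is demanded for all solutions of \<open>W\<close>, so that satisfying this
  \<open>L\<close>-formula is already a certificate.\<close>

definition bad :: "nat \<Rightarrow> 'u set \<Rightarrow> nat \<Rightarrow> ('f, 'r) fm \<Rightarrow> bool" where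
  "bad n Y c W \<longleftrightarrow> wf_fm L W \<and> fv W \<subseteq> {..<n + c} \<and>
     (\<forall>s. s ` {..<n + c} \<subseteq> carrier M \<longrightarrow> sat R s W \<longrightarrow>
       int q * int (rk (s ` {..<n + c})) < \<delta> Y + int p * int (card (C \<inter> Y) + c))"

text \<open>If \<open>bad n Y c W\<close>, a solution of \<open>W\<close> with \<open>c\<close> new colored entries witnesses that the first \<open>n\<close>
  entries do not form a closed set; closedness is therefore expressed by the formulas \<open>no_bad\<close>.\<close>

definition no_bad :: "nat \<Rightarrow> nat \<Rightarrow> ('f, 'r) fm \<Rightarrow> ('f, 'r option) fm" where
  "no_bad n c W = Neg (ExL [n..<n + c] (And (ConjL (map Col [n..<n + c])) (And (Distinct [n..<n + c])
     (And (ConjL [Neg (Equal (Var i) (Var j)). i \<leftarrow> [0..<n], j \<leftarrow> [n..<n + c]]) (lift W)))))"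

lemma sat_no_bad:
  "sat M s (no_bad n c W) \<longleftrightarrow> \<not> (\<exists>s'. (\<forall>x. x \<notin> {n..<n + c} \<longrightarrow> s' x = s x) \<and> s' ` {n..<n + c} \<subseteq> C \<and>
     inj_on s' {n..<n + c} \<and> s' ` {..<n} \<inter> s' ` {n..<n + c} = {} \<and> sat R s' W)"
proof -
  have 1: "sat M s' (And (ConjL (map Col [n..<n + c])) (And (Distinct [n..<n + c])
     (And (ConjL [Neg (Equal (Var i) (Var j)). i \<leftarrow> [0..<n], j \<leftarrow> [n..<n + c]]) (lift W)))) \<longleftrightarrow>
     (\<forall>x\<in>{n..<n + c}. rint M None [s' x]) \<and> inj_on s' {n..<n + c} \<and>
     (\<forall>i<n. \<forall>j\<in>{n..<n + c}. s' i \<noteq> s' j) \<and> sat R s' W" for s'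
    by (auto simp del: upt_Suc)
  have 2: "(\<forall>i<n. \<forall>j\<in>{n..<n + c}. s' i \<noteq> s' j) \<longleftrightarrow> s' ` {..<n} \<inter> s' ` {n..<n + c} = {}" for s' :: "nat \<Rightarrow> 'u"
    by fastforce
  have 3: "(\<forall>x\<in>{n..<n + c}. s' x \<in> carrier M) \<and> (\<forall>x\<in>{n..<n + c}. rint M None [s' x]) \<and> A \<longleftrightarrow>
      s' ` {n..<n + c} \<subseteq> C \<and> A" for s' A
    by (auto simp: colored_def)
  show ?thesis unfolding no_bad_def sat.simps(4) sat_ExL set_upt 1 2 3 by simp
qed

text \<open>Closedness of the image is an infinite conjunction, of the formulas
  \<open>no_bad\<close> for all \<open>c\<close> and all certificates. A finite part of it mentions
  a bounded number of new colored points and only finitely much of the \<open>L\<close>-type of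
  \<open>Y\<close>, so \<open>generic_extension\<close> satisfies it; saturation does the
  rest.\<close>

lemma iso_extend_transcendental:
  assumes iso: "iso X f" and Y: "closed Y" "X \<subseteq> Y" "(Y - X) \<inter> cl X = {}"
  obtains g where "iso Y g" "\<And>x. x \<in> X \<Longrightarrow> g x = f x"
proof -
  have X: "closed X" "closed (f ` X)" "elem L R X f" "\<And>x. x \<in> X \<Longrightarrow> f x \<in> C \<longleftrightarrow> x \<in> C"
    using iso by (auto simp: iso_def)
  note Yf = closedD(1,2)[OF Y(1)]
  have fX: "f ` X \<subseteq> carrier M" using X(3) by (simp add: elem_def)
  obtain s0 :: "nat \<Rightarrow> 'u" where s0: "range s0 \<subseteq> carrier R" by (rule ex_assignment[OF R_models])
  have YR: "Y \<subseteq> carrier R" using Yf by simp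
  obtain s1 n where s1: "s1 ` {0::nat..<0 + n} = Y" "range s1 \<subseteq> carrier R"
    by (rule enum_vars[OF Yf(1) YR s0, of 0], rule that)
  define V where "V = {..<n}"
  have s1V: "s1 ` V = Y" "range s1 \<subseteq> carrier M" using s1 by (simp_all add: V_def atLeast0LessThan)
  define P where "P = {v \<in> V. s1 v \<in> X}"
  define \<Gamma> where "\<Gamma> = lift ` {\<phi>. wf_fm L \<phi> \<and> fv \<phi> \<subseteq> V \<and> sat R s1 \<phi>} \<union>
    Col ` {v \<in> V. s1 v \<in> C} \<union> (\<lambda>v. Neg (Col v)) ` {v \<in> V. s1 v \<notin> C} \<union>
    (\<lambda>(c, W). no_bad n c W) ` {(c, W). bad n Y c W}"
  have "\<exists>s\<in>assignments_over M P (f \<circ> s1). \<forall>\<phi>\<in>\<Gamma>. sat M s \<phi>"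
  proof (rule saturated_assignment[OF sat_M])
    fix \<phi> assume "\<phi> \<in> \<Gamma>"
    then show "wf_fm (colored_language L) \<phi>" by (auto simp: \<Gamma>_def bad_def no_bad_def)
  next
    fix \<Gamma>0 assume \<Gamma>0: "finite \<Gamma>0" "\<Gamma>0 \<subseteq> \<Gamma>"
    have "finite (\<Gamma>0 \<inter> lift ` {\<phi>. wf_fm L \<phi> \<and> fv \<phi> \<subseteq> V \<and> sat R s1 \<phi>})" using \<Gamma>0(1) by simp
    from finite_subset_image[OF this Int_lower2] obtain \<Phi> where
      \<Phi>: "\<Phi> \<subseteq> {\<phi>. wf_fm L \<phi> \<and> fv \<phi> \<subseteq> V \<and> sat R s1 \<phi>}" "finite \<Phi>"
        "\<Gamma>0 \<inter> lift ` {\<phi>. wf_fm L \<phi> \<and> fv \<phi> \<subseteq> V \<and> sat R s1 \<phi>} = lift ` \<Phi>" by (elim exE conjE) (rule that)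
    have "finite (\<Gamma>0 \<inter> (\<lambda>(c, W). no_bad n c W) ` {(c, W). bad n Y c W})" using \<Gamma>0(1) by simp
    from finite_subset_image[OF this Int_lower2] obtain D where
      D: "D \<subseteq> {(c, W). bad n Y c W}" "finite D"
        "\<Gamma>0 \<inter> (\<lambda>(c, W). no_bad n c W) ` {(c, W). bad n Y c W} = (\<lambda>(c, W). no_bad n c W) ` D"
      by (elim exE conjE) (rule that)
    obtain \<phi>s where \<phi>s: "set \<phi>s = \<Phi>" using finite_list[OF \<Phi>(2)] by (elim exE) (rule that)
    define \<chi> where "\<chi> = ConjL \<phi>s"
    define N where "N = Max (insert 0 (fst ` D))"
    have N: "c \<le> N" if "(c, W) \<in> D" for c W
      unfolding N_def by (rule Max_ge) (use D(2) that in force)+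
    have \<chi>: "wf_fm L \<chi>" "sat R s1 \<chi>" "fv \<chi> \<subseteq> V" using \<Phi>(1) \<phi>s by (auto simp: \<chi>_def)
    have s1\<chi>: "s1 ` fv \<chi> \<subseteq> Y" using \<chi>(3) s1V(1) by blast
    obtain h where h: "\<And>x. x \<in> X \<Longrightarrow> h x = f x" "h ` Y \<subseteq> carrier M" "inj_on h Y"
      "\<And>y. y \<in> Y \<Longrightarrow> h y \<in> C \<longleftrightarrow> y \<in> C" "sat R (h \<circ> s1) \<chi>"
      "\<And>Z. Z \<subseteq> C \<Longrightarrow> finite Z \<Longrightarrow> card Z \<le> N \<Longrightarrow> \<delta> Y \<le> \<delta> (h ` Y \<union> Z)"
      by (rule generic_extension[OF iso Y(2) Yf Y(3) \<chi>(1) s1\<chi> \<chi>(2), of N], rule that)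
    define s' where "s' i = (if i < n then h (s1 i) else s1 i)" for i
    have s'Y: "s' ` {..<n} = h ` Y" unfolding s1V(1)[symmetric] V_def by (auto simp: s'_def image_image)
    have s'M: "range s' \<subseteq> carrier M"
    proof -
      have "s' i \<in> carrier M" for i
      proof (cases "i < n")
        case True
        then have "s' i \<in> h ` Y" using s'Y by auto
        then show ?thesis using h(2) by auto
      next
        case False
        then show ?thesis using s1V(2) by (auto simp: s'_def)
      qed
      then show ?thesis by blast
    qed
    have cY: "card (C \<inter> h ` Y) = card (C \<inter> Y)"
    proof -
      have "C \<inter> h ` Y = h ` (C \<inter> Y)" using h(4) by blast
      moreover have "inj_on h (C \<inter> Y)" using h(3) by (rule inj_on_subset) simp
      ultimately show ?thesis by (simp add: card_image)
    qed
    have sat: "sat M s' \<phi>" if \<phi>: "\<phi> \<in> \<Gamma>0" for \<phi>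
    proof -
      consider "\<phi> \<in> lift ` \<Phi>" | v where "v \<in> V" "s1 v \<in> C" "\<phi> = Col v"
        | v where "v \<in> V" "s1 v \<notin> C" "\<phi> = Neg (Col v)" | c W where "(c, W) \<in> D" "\<phi> = no_bad n c W"
      proof -
        have "\<phi> \<in> lift ` \<Phi> \<or> (\<exists>v\<in>V. s1 v \<in> C \<and> \<phi> = Col v) \<or> (\<exists>v\<in>V. s1 v \<notin> C \<and> \<phi> = Neg (Col v)) \<or>
          \<phi> \<in> (\<lambda>(c, W). no_bad n c W) ` D"
          using \<phi> \<Gamma>0(2) unfolding \<Phi>(3)[symmetric] D(3)[symmetric] \<Gamma>_def by blast
        then show thesis using that by (elim disjE bexE imageE conjE) (auto split: prod.splits)
      qed
      then show ?thesis
      proof cases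
        case 1
        then obtain \<psi> where \<psi>: "\<psi> \<in> \<Phi>" "\<phi> = lift \<psi>" by blast
        have "sat R (h \<circ> s1) \<psi>" using h(5) \<psi>(1) \<phi>s by (simp add: \<chi>_def)
        then have "sat R s' \<psi>" by (rule sat_cong[THEN iffD1, rotated])
            (use \<psi>(1) \<Phi>(1) in \<open>auto simp: s'_def V_def\<close>)
        then show ?thesis using \<psi>(2) by simp
      next
        case (2 v)
        then have "h (s1 v) \<in> C" using h(4)[of "s1 v"] s1V(1) by blast
        then show ?thesis using 2 by (simp add: s'_def V_def colored_def)
      next
        case (3 v)
        then have "h (s1 v) \<notin> C" "h (s1 v) \<in> carrier M" using h(2,4) s1V(1) by blast+
        then show ?thesis using 3 by (simp add: s'_def V_def colored_def)
      next
        case (4 c W)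
        have b: "bad n Y c W" using 4(1) D(1) by blast
        show ?thesis unfolding 4(2) sat_no_bad
        proof (intro notI, elim exE conjE)
          fix s'' assume s'': "\<forall>x. x \<notin> {n..<n + c} \<longrightarrow> s'' x = s' x" "s'' ` {n..<n + c} \<subseteq> C"
            "inj_on s'' {n..<n + c}" "s'' ` {..<n} \<inter> s'' ` {n..<n + c} = {}" "sat R s'' W"
          define Z where "Z = s'' ` {n..<n + c}"
          have cZ: "card Z = c" unfolding Z_def using s''(3) by (simp add: card_image)
          have im: "s'' ` {..<n} = h ` Y" unfolding s'Y[symmetric] by (rule image_cong) (use s''(1) in auto)
          have "{..<n + c} = {..<n} \<union> {n..<n + c}" by auto
          then have all: "s'' ` {..<n + c} = h ` Y \<union> Z" by (simp only: image_Un im Z_def)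
          have ZC: "Z \<subseteq> C" "finite Z" using s''(2) by (simp_all add: Z_def)
          have "h ` Y \<inter> Z = {}" using s''(4) im by (simp add: Z_def)
          moreover have "C \<inter> (h ` Y \<union> Z) = (C \<inter> h ` Y) \<union> Z" using ZC by auto
          ultimately have cc: "card (C \<inter> (h ` Y \<union> Z)) = card (C \<inter> Y) + c"
            using cY cZ ZC(2) Yf(1) by (simp add: card_Un_disjoint Int_assoc)
          have "s'' ` {..<n + c} \<subseteq> carrier M" using all h(2) ZC C_carrier by auto
          then have "int q * int (rk (h ` Y \<union> Z)) < \<delta> Y + int p * int (card (C \<inter> Y) + c)"
            using b s''(5) unfolding bad_def all[symmetric] by blast
          moreover have "\<delta> Y \<le> \<delta> (h ` Y \<union> Z)" by (rule h(6)[OF ZC]) (use N[OF 4(1)] cZ in simp)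
          ultimately show False unfolding \<delta>_def[of "h ` Y \<union> Z"] cc by linarith
        qed
      qed
    qed
    have "s' x = (f \<circ> s1) x" if "x \<in> P" for x
      using that h(1) by (simp add: P_def V_def s'_def)
    then show "\<exists>s\<in>assignments_over M P (f \<circ> s1). \<forall>\<phi>\<in>\<Gamma>0. sat M s \<phi>"
      using sat s'M by (intro bexI[of _ s']) (simp_all add: assignments_over_def)
  qed
  then obtain s2 where s2: "s2 \<in> assignments_over M P (f \<circ> s1)" "\<forall>\<phi>\<in>\<Gamma>. sat M s2 \<phi>" by blast
  have s2M: "range s2 \<subseteq> carrier M" using s2(1) by (simp add: assignments_over_def)
  have sV: "s1 ` V \<subseteq> carrier R" "s2 ` V \<subseteq> carrier R" using s1V(2) s2M by auto
  have imp: "sat R s2 \<phi>" if "wf_fm L \<phi>" "fv \<phi> \<subseteq> V" "sat R s1 \<phi>" for \<phi>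
  proof -
    have "lift \<phi> \<in> \<Gamma>" using that by (simp add: \<Gamma>_def)
    then have "sat M s2 (lift \<phi>)" using s2(2) by blast
    then show ?thesis by simp
  qed
  obtain g where g: "elem L R (s1 ` V) g" "\<And>v. v \<in> V \<Longrightarrow> g (s1 v) = s2 v"
    by (rule elem_of_assignments[OF sV imp], assumption, assumption, assumption, rule that)
  have gY: "elem L R Y g" using g(1) s1V(1) by simp
  have gs: "g ` Y = s2 ` V" unfolding s1V(1)[symmetric] using g(2) by force
  have g_ext: "g x = f x" if x: "x \<in> X" for x
  proof -
    obtain v where v: "v \<in> V" "s1 v = x" using x Y(2) s1V(1) by blast
    then have "s2 v = f (s1 v)" using s2(1) x by (simp add: assignments_over_def P_def)
    then show ?thesis using g(2) v by auto
  qed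
  have gC: "g y \<in> C \<longleftrightarrow> y \<in> C" if y: "y \<in> Y" for y
  proof -
    obtain v where v: "v \<in> V" "s1 v = y" using y s1V(1) by blast
    have "s2 v \<in> carrier M" using s2M by auto
    moreover have "sat M s2 (if y \<in> C then Col v else Neg (Col v))"
      using s2(2) v by (simp add: \<Gamma>_def)
    ultimately have "s2 v \<in> C \<longleftrightarrow> y \<in> C" by (simp add: colored_def split: if_splits)
    then show ?thesis using g(2)[OF v(1)] v(2) by simp
  qed
  note \<delta>g = \<delta>_elem[OF gY gC Yf(1)]
  have gYM: "g ` Y \<subseteq> carrier M" using gY by (simp add: elem_def)
  have "closed (g ` Y)" unfolding closed_def
  proof (intro conjI allI impI)
    fix Z' assume Z': "finite Z'" "g ` Y \<subseteq> Z'" "Z' \<subseteq> carrier M"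
    show "\<delta> (g ` Y) \<le> \<delta> Z'"
    proof (rule ccontr)
      assume neg: "\<not> \<delta> (g ` Y) \<le> \<delta> Z'"
      \<comment> \<open>Only the colored points of \<open>Z'\<close> are kept as new points. Leaving
        out uncolored ones does not raise the predimension, so a failure of closedness always has a
        witness of this form.\<close>
      define Z where "Z = (C \<inter> Z') - g ` Y"
      define c where "c = card Z"
      define A where "A = g ` Y \<union> Z"
      have A: "A \<subseteq> Z'" "finite A" "C \<inter> Z' = C \<inter> A" using Z' finite_subset[of A Z'] by (auto simp: A_def Z_def)
      have "rk A \<le> rk Z'" using A(1) Z' by (intro rk_mono)
      then have "int q * int (rk A) \<le> int q * int (rk Z')" by (intro mult_left_mono) simp_all
      then have less: "\<delta> A < \<delta> Y" using neg \<delta>g(1) A(3) by (simp add: \<delta>_def)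
      have cA: "card (C \<inter> A) = card (C \<inter> Y) + c"
      proof -
        have "C \<inter> A = (C \<inter> g ` Y) \<union> Z" "(C \<inter> g ` Y) \<inter> Z = {}" by (auto simp: A_def Z_def)
        moreover have "finite (C \<inter> g ` Y)" "finite Z" using Z'(1) Yf(1) by (simp_all add: Z_def)
        ultimately have "card (C \<inter> A) = card (C \<inter> g ` Y) + card Z" by (simp only: card_Un_disjoint)
        then show ?thesis using \<delta>g(2) by (simp add: c_def)
      qed
      have Z: "finite Z" "Z \<subseteq> carrier R" using Z' by (auto simp: Z_def)
      have s2R: "range s2 \<subseteq> carrier R" using s2M by simp
      obtain s3 n' where s3: "s3 ` {n..<n + n'} = Z" "inj_on s3 {n..<n + n'}"
        "\<And>i. i < n \<Longrightarrow> s3 i = s2 i" "range s3 \<subseteq> carrier R"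
        by (rule enum_vars[OF Z s2R, of n], rule that)
      have n': "n' = c" unfolding c_def s3(1)[symmetric] using card_image[OF s3(2)] by simp
      define s4 where "s4 i = (if i \<in> {n..<n + c} then s3 i else s2 i)" for i
      have s4: "s4 ` {n..<n + c} = Z" "inj_on s4 {n..<n + c}" "s4 ` {..<n} = g ` Y" "range s4 \<subseteq> carrier M"
      proof -
        show "s4 ` {n..<n + c} = Z" unfolding s3(1)[symmetric] n' by (rule image_cong) (auto simp: s4_def)
        show "inj_on s4 {n..<n + c}" using s3(2) unfolding n' by (auto simp: inj_on_def s4_def)
        show "s4 ` {..<n} = g ` Y" unfolding gs V_def by (rule image_cong) (auto simp: s4_def)
        show "range s4 \<subseteq> carrier M" using s3(4) s2M by (auto simp: s4_def)
      qed
      have "{..<n + c} = {..<n} \<union> {n..<n + c}" by auto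
      then have s4A: "s4 ` {..<n + c} = A" by (simp only: image_Un s4 A_def)
      have fin: "finite {..<n + c}" "finite ({} :: nat set)" by simp_all
      have sub: "s4 ` ({..<n + c} \<union> {}) \<subseteq> carrier R" using s4(4) by auto
      \<comment> \<open>The certificate for the rank of \<open>A\<close> is a \<open>bad\<close>
        formula, so the requirements in \<Gamma> exclude exactly this configuration.\<close>
      obtain W B where W: "card B = cl_dim cl (s4 ` {..<n + c}) (s4 ` {})" "wf_fm L W" "fv W \<subseteq> {..<n + c} \<union> {}"
        "sat R s4 W"
        and W6: "\<And>(N :: ('f, 'r, 'u) struct) s'. models L T N \<Longrightarrow>
          s' ` ({..<n + c} \<union> {}) \<subseteq> carrier N \<Longrightarrow> sat N s' W \<Longrightarrow>
          s' ` {..<n + c} \<subseteq> acl L N (s' ` (B \<union> {})) \<and> cl_dim (acl L N) (s' ` {..<n + c}) (s' ` {}) \<le> card B"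
        by (rule dim_witness[OF R_models fin sub], rule that)
      have "bad n Y c W" unfolding bad_def
      proof (intro conjI allI impI)
        fix s assume s: "s ` {..<n + c} \<subseteq> carrier M" "sat R s W"
        have "rk (s ` {..<n + c}) \<le> card B" using W6[OF R_models _ s(2)] s(1) by simp
        then have "rk (s ` {..<n + c}) \<le> rk A" using W(1) s4A by simp
        then have "int q * int (rk (s ` {..<n + c})) \<le> int q * int (rk A)" by (intro mult_left_mono) simp_all
        also have "\<dots> < \<delta> Y + int p * int (card (C \<inter> Y) + c)" using less unfolding \<delta>_def[of A] cA by simp
        finally show "int q * int (rk (s ` {..<n + c})) < \<delta> Y + int p * int (card (C \<inter> Y) + c)" .
      qed (use W(2,3) in simp_all)
      then have "no_bad n c W \<in> \<Gamma>" by (auto simp: \<Gamma>_def)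
      then have "sat M s2 (no_bad n c W)" using s2(2) by blast
      moreover have "\<forall>x. x \<notin> {n..<n + c} \<longrightarrow> s4 x = s2 x" by (simp add: s4_def)
      moreover have "s4 ` {n..<n + c} \<subseteq> C" "s4 ` {..<n} \<inter> s4 ` {n..<n + c} = {}"
        unfolding s4 by (auto simp: Z_def)
      ultimately show False unfolding sat_no_bad using s4(2) W(4) by blast
    qed
  qed (use Yf gYM in auto)
  then have "iso Y g" using Y(1) gY gC by (simp add: iso_def)
  then show thesis using that g_ext by blast
qed

text \<open>A further colored point that is algebraic would lower the predimension by
  \<open>p\<close> without raising the rank.\<close>

lemma closed_uncolored:
  assumes "closed X" "y \<in> cl X" "y \<notin> X" shows "y \<notin> C"
proof
  assume "y \<in> C"
  note X = closedD(1,2)[OF assms(1)]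
  have yM: "y \<in> carrier M" using assms(2) cl_closed[OF X(2)] by blast
  have "\<delta> X \<le> \<delta> (insert y X)" by (rule closedD(3)[OF assms(1)]) (use X yM in auto)
  moreover have "rk (insert y X) = rk X" using rk_insert[OF X yM] assms(2) by simp
  moreover have "card (C \<inter> insert y X) = Suc (card (C \<inter> X))" using \<open>y \<in> C\<close> assms(3) X(1) by simp
  ultimately show False using alpha(2) by (simp add: \<delta>_def distrib_left)
qed

lemma closed_algebraic:
  assumes "closed X" "X \<subseteq> Y" "Y \<subseteq> cl X" "finite Y" shows "closed Y"
proof -
  note X = closedD(1,2)[OF assms(1)]
  have YM: "Y \<subseteq> carrier M" using assms(3) cl_closed[OF X(2)] by blast
  have "C \<inter> Y = C \<inter> X" using closed_uncolored[OF assms(1)] assms(2,3) by blast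
  moreover have "rk Y = rk X"
  proof -
    have "cl_dim cl Y X \<le> card ({} :: 'u set)" using assms X YM by (intro cl_dim_le_card) auto
    moreover have "Y \<union> X = Y" using assms(2) by auto
    ultimately show ?thesis using dim_additive[OF assms(4) X(1) YM X(2)] by simp
  qed
  ultimately have "\<delta> Y = \<delta> X" by (simp add: \<delta>_def)
  then show ?thesis unfolding closed_def using assms(4) YM closedD(3)[OF assms(1)] assms(2) by auto
qed

text \<open>Any elementary extension will do: new points algebraic over a closed set are uncolored,
  on either side, so colors are preserved and the predimension stays the same.\<close>

lemma iso_extend_algebraic:
  assumes iso: "iso X f" and Y: "X \<subseteq> Y" "Y \<subseteq> cl X" "finite Y"
  obtains g where "iso Y g" "\<And>x. x \<in> X \<Longrightarrow> g x = f x"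
proof -
  have X: "closed X" "closed (f ` X)" "elem L R X f" "\<And>x. x \<in> X \<Longrightarrow> f x \<in> C \<longleftrightarrow> x \<in> C"
    using iso by (auto simp: iso_def)
  note Xf = closedD(1,2)[OF X(1)]
  have YR: "Y \<subseteq> carrier R" using Y(2) cl_closed[OF Xf(2)] by auto
  obtain g where g: "elem L R Y g" "\<And>x. x \<in> X \<Longrightarrow> g x = f x"
    by (rule elem_extend[OF sat_R X(3) Y(1) YR countable_finite[OF Y(3)]], rule that)
  have gX: "g ` X = f ` X" using g(2) by auto
  have gcl: "g ` Y \<subseteq> cl (f ` X)"
    using elem_acl[OF R_models g(1) Y(1)] Y(2) gX by auto
  have gC: "g y \<in> C \<longleftrightarrow> y \<in> C" if y: "y \<in> Y" for y
  proof (cases "y \<in> X")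
    case True
    then show ?thesis using g(2) X(4) by simp
  next
    case False
    then have "g y \<notin> f ` X" using elem_inj[OF g(1)] y Y(1) unfolding gX[symmetric] by (auto simp: inj_on_def)
    then have "g y \<notin> C" using closed_uncolored[OF X(2)] gcl y by auto
    moreover have "y \<notin> C" using closed_uncolored[OF X(1)] False y Y(2) by auto
    ultimately show ?thesis by simp
  qed
  have "closed Y" by (rule closed_algebraic[OF X(1) Y])
  moreover have "closed (g ` Y)"
  proof (rule closed_algebraic[OF X(2) _ gcl])
    show "f ` X \<subseteq> g ` Y" unfolding gX[symmetric] using Y(1) by (rule image_mono)
  qed (use Y in simp)
  ultimately have "iso Y g" using g(1) gC by (simp add: iso_def)
  then show thesis using that g(2) by blast
qed

lemma iso_extend:
  assumes iso: "iso X f" and b: "b \<in> carrier M"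
  obtains Y g where "iso Y g" "X \<subseteq> Y" "b \<in> Y" "\<And>x. x \<in> X \<Longrightarrow> g x = f x"
proof -
  have X: "finite X" "X \<subseteq> carrier M" "closed X" using iso closedD(1,2) by (auto simp: iso_def)
  have fin: "finite (insert b X)" "insert b X \<subseteq> carrier M" using X b by auto
  obtain E where E: "finite E" "insert b X \<subseteq> E" "E \<subseteq> carrier M" "\<delta> E = int (dd (insert b X))"
    by (rule hull[OF fin], rule that)
  have "dd (insert b X) \<le> dd E" by (rule dd_mono[OF E(1-3)])
  then have clE: "closed E" using closed_iff_dd[OF E(1,3)] E(4) by simp
  \<comment> \<open>The extension axioms only provide transcendental points, so the part of the hull
    that is algebraic over \<open>X\<close> is added beforehand.\<close>
  define Y0 where "Y0 = E \<inter> cl X"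
  have Y0: "X \<subseteq> Y0" "Y0 \<subseteq> cl X" "finite Y0" "Y0 \<subseteq> E" using E(1,2) cl_extensive[OF X(2)] by (auto simp: Y0_def)
  obtain g0 where g0: "iso Y0 g0" "\<And>x. x \<in> X \<Longrightarrow> g0 x = f x"
    by (rule iso_extend_algebraic[OF iso Y0(1-3)], rule that)
  have "cl Y0 \<subseteq> cl X" by (rule cl_least[OF Y0(2) X(2)])
  then have disj: "(E - Y0) \<inter> cl Y0 = {}" by (auto simp: Y0_def)
  obtain g where g: "iso E g" "\<And>x. x \<in> Y0 \<Longrightarrow> g x = g0 x"
    by (rule iso_extend_transcendental[OF g0(1) clE Y0(4) disj], rule that)
  show thesis
    by (rule that[OF g(1)]) (use E(2) g(2) g0(2) Y0(1) in auto)
qed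

lemma iso_inv:
  assumes "iso X f" shows "iso (f ` X) (inv_into X f)"
proof -
  have f: "closed X" "closed (f ` X)" "elem L R X f" "\<forall>x\<in>X. f x \<in> C \<longleftrightarrow> x \<in> C"
    using assms by (auto simp: iso_def)
  have inj: "inj_on f X" by (rule elem_inj[OF f(3)])
  then have "inv_into X f ` f ` X = X" by simp
  then show ?thesis using f elem_inv[OF f(3)] inj by (simp add: iso_def)
qed

text \<open>Back-and-forth, as an induction on formulas: for a quantifier the inverse isomorphism is
  extended to the given element. A color atom may concern a term whose value is not in
  \<open>X\<close>, and then the isomorphism is extended to this value as well.\<close>

theorem iso_elementary:
  assumes "iso X f" "wf_fm (colored_language L) \<phi>" "s ` fv \<phi> \<subseteq> X"
  shows "sat M s \<phi> \<longleftrightarrow> sat M (f \<circ> s) \<phi>"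
  using assms
proof (induction \<phi> arbitrary: X f s)
  case (Equal t u)
  have "sat R s (Equal t u) \<longleftrightarrow> sat R (f \<circ> s) (Equal t u)"
    by (rule elemD[of L R X f]) (use Equal.prems in \<open>auto simp: iso_def\<close>)
  then show ?case by (simp add: comp_def)
next
  case (Rel r ts)
  show ?case
  proof (cases r)
    case (Some r')
    have "sat R s (Rel r' ts) \<longleftrightarrow> sat R (f \<circ> s) (Rel r' ts)"
      by (rule elemD[of L R X f]) (use Rel.prems Some in \<open>auto simp: iso_def\<close>)
    moreover have "lift (Rel r' ts) = Rel r ts" using Some by (simp add: lift_def map_idI)
    ultimately show ?thesis by (metis sat_lift)
  next
    case None
    then obtain t where t: "ts = [t]" using Rel.prems(2) by (auto simp: length_Suc_conv)
    have wt: "wf_tm L t" "s ` fv_tm t \<subseteq> X" using Rel.prems(2,3) t by auto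
    have str: "is_structure L R" using R_models by (simp add: models_def)
    have X: "X \<subseteq> carrier M" using Rel.prems(1) closedD(2) by (auto simp: iso_def)
    define c where "c = val R s t"
    have cM: "c \<in> carrier M"
      using val_closed[OF str wt(1), of s] wt(2) X by (auto simp: c_def)
    obtain Y g where g: "iso Y g" "X \<subseteq> Y" "c \<in> Y" "\<And>x. x \<in> X \<Longrightarrow> g x = f x"
      by (rule iso_extend[OF Rel.prems(1) cM], rule that)
    \<comment> \<open>The value of \<open>t\<close> is named by a fresh variable, so that the
      equation between \<open>t\<close> and this variable determines the value of \<open>t\<close>
      on the other side.\<close>
    obtain v where v: "v \<notin> fv_tm t" using ex_new_if_finite[OF infinite_UNIV_nat finite_fv_tm] by blast
    have val_s: "val R (s(v := c)) t = c" unfolding c_def by (rule val_cong) (use v in auto)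
    have "sat R (s(v := c)) (Equal t (Var v)) \<longleftrightarrow> sat R (g \<circ> s(v := c)) (Equal t (Var v))"
      by (rule elemD[of L R Y g]) (use g wt in \<open>auto simp: iso_def\<close>)
    moreover have "val R (g \<circ> s(v := c)) t = val R (f \<circ> s) t"
      by (rule val_cong) (use v wt(2) g(4) in auto)
    ultimately have "val R (f \<circ> s) t = g c" using val_s by simp
    moreover have "g c \<in> carrier M" using g(1,3) by (auto simp: iso_def elem_def)
    moreover have "g c \<in> C \<longleftrightarrow> c \<in> C" using g(1,3) by (simp add: iso_def)
    ultimately show ?thesis using None t cM by (simp add: c_def colored_def comp_def)
  qed
next
  case (Imp \<phi> \<psi>)
  have "sat M s \<phi> \<longleftrightarrow> sat M (f \<circ> s) \<phi>" "sat M s \<psi> \<longleftrightarrow> sat M (f \<circ> s) \<psi>"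
    using Imp.prems by (intro Imp.IH[OF Imp.prems(1)]; auto)+
  then show ?case by (simp add: comp_def)
next
  case (All x \<phi>)
  have imp: "sat M (f \<circ> s) (All x \<phi>)"
    if all: "sat M s (All x \<phi>)" and f: "iso X f" and s: "s ` fv (All x \<phi>) \<subseteq> X" for X f s
    unfolding sat.simps
  proof
    fix b assume b: "b \<in> carrier M"
    obtain Y g where g: "iso Y g" "f ` X \<subseteq> Y" "b \<in> Y" "\<And>y. y \<in> f ` X \<Longrightarrow> g y = inv_into X f y"
      by (rule iso_extend[OF iso_inv[OF f] b], rule that)
    have inj: "inj_on f X" using f elem_inj by (auto simp: iso_def)
    have "g b \<in> carrier M" using g(1,3) by (auto simp: iso_def elem_def)
    then have "sat M (s(x := g b)) \<phi>" using all by simp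
    moreover have "sat M ((f \<circ> s)(x := b)) \<phi> \<longleftrightarrow> sat M (g \<circ> (f \<circ> s)(x := b)) \<phi>"
      by (rule All.IH[OF g(1)]) (use All.prems(2) g(2,3) s in auto)
    moreover have "sat M (g \<circ> (f \<circ> s)(x := b)) \<phi> \<longleftrightarrow> sat M (s(x := g b)) \<phi>"
    proof (rule sat_cong)
      fix y assume y: "y \<in> fv \<phi>"
      show "(g \<circ> (f \<circ> s)(x := b)) y = (s(x := g b)) y"
      proof (cases "y = x")
        case False
        then have "s y \<in> X" using s y by auto
        then show ?thesis using False g(4)[of "f (s y)"] inj by simp
      qed simp
    qed
    ultimately show "sat M ((f \<circ> s)(x := b)) \<phi>" by simp
  qed
  show ?case
  proof
    show "sat M s (All x \<phi>) \<Longrightarrow> sat M (f \<circ> s) (All x \<phi>)" using imp All.prems by blast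
    assume "sat M (f \<circ> s) (All x \<phi>)"
    then have "sat M (inv_into X f \<circ> (f \<circ> s)) (All x \<phi>)"
      by (rule imp[OF _ iso_inv[OF All.prems(1)]]) (use All.prems(3) in auto)
    moreover have "inj_on f X" using All.prems(1) elem_inj by (auto simp: iso_def)
    ultimately show "sat M s (All x \<phi>)"
      by (elim sat_cong[THEN iffD1, rotated]) (use All.prems(3) in auto)
  qed
qed simp

end

section \<open>Extraction of mutually indiscernible arrays\<close>

lemma ramsey_colors:
  assumes "finite K"
  shows "\<exists>R::nat. \<forall>f. (\<forall>S\<in>nsets {..<R} m. f S \<in> K) \<longrightarrow> (\<exists>H\<in>nsets {..<R} N. \<exists>c. \<forall>S\<in>nsets H m. f S = c)"
proof -
  obtain e where e: "bij_betw e K {..<card K}" using ex_bij_betw_finite_nat[OF assms] atLeast0LessThan by metis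
  obtain R :: nat where R: "partn_lst {..<R} (replicate (card K) N) m" using ramsey_full by blast
  show ?thesis
  proof (intro exI allI impI)
    fix f :: "nat set \<Rightarrow> 'a" assume f: "\<forall>S\<in>nsets {..<R} m. f S \<in> K"
    have "(\<lambda>S. e (f S)) \<in> nsets {..<R} m \<rightarrow> {..<card K}"
      using f e by (auto simp: bij_betw_def)
    then obtain i H where H: "i < card K" "H \<in> nsets {..<R} N" "(\<lambda>S. e (f S)) ` nsets H m \<subseteq> {i}"
      
      using R unfolding partn_lst_def monochromatic_def by fastforce
    have "f S = inv_into K e i" if S: "S \<in> nsets H m" for S
    proof -
      have "S \<in> nsets {..<R} m" using S H(2) by (auto simp: nsets_def)
      then have "f S \<in> K" using f by blast
      moreover have "e (f S) = i" using H(3) S by blast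
      ultimately show ?thesis using e by (auto simp: bij_betw_def)
    qed
    then show "\<exists>H\<in>nsets {..<R} N. \<exists>c. \<forall>S\<in>nsets H m. f S = c" using H(2) by blast
  qed
qed

text \<open>Induction on the number of rows. A subset of the last row is colored by the whole
  function that sends a choice in the other rows to the color of the combined choice; there are
  finitely many such functions. On a homogeneous set for this coloring the color no longer depends
  on the last component, and the induction hypothesis treats the other rows.\<close>

lemma product_ramsey:
  assumes "finite K"
  shows "\<exists>R::nat. \<forall>\<chi>. (\<forall>S\<in>PiE {..<T::nat} (\<lambda>_. nsets {..<R} m). \<chi> S \<in> K) \<longrightarrow>
    (\<exists>H. (\<forall>t<T. H t \<in> nsets {..<R} N) \<and> (\<exists>c. \<forall>S\<in>PiE {..<T} (\<lambda>t. nsets (H t) m). \<chi> S = c))"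
proof (induction T)
  case 0
  show ?case by (intro exI[of _ 0]) auto
next
  case (Suc T)
  then obtain R1 :: nat where R1: "\<forall>\<chi>. (\<forall>S\<in>PiE {..<T} (\<lambda>_. nsets {..<R1} m). \<chi> S \<in> K) \<longrightarrow>
    (\<exists>H. (\<forall>t<T. H t \<in> nsets {..<R1} N) \<and> (\<exists>c. \<forall>S\<in>PiE {..<T} (\<lambda>t. nsets (H t) m). \<chi> S = c))"
    by (rule exE)
  define D where "D = PiE {..<T} (\<lambda>_. nsets {..<R1} m)"
  define K2 where "K2 = PiE D (\<lambda>_. K)"
  have "finite D" unfolding D_def by (intro finite_PiE) (auto intro: finite_imp_finite_nsets)
  then have "finite K2" unfolding K2_def using assms by (intro finite_PiE) auto
  from ramsey_colors[OF this, of m N] obtain R2 :: nat where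
    R2: "\<forall>f. (\<forall>S\<in>nsets {..<R2} m. f S \<in> K2) \<longrightarrow> (\<exists>H\<in>nsets {..<R2} N. \<exists>c. \<forall>S\<in>nsets H m. f S = c)"
    by (rule exE)
  define R where "R = max R1 R2"
  have mono: "nsets {..<R1} k \<subseteq> nsets {..<R} k" "nsets {..<R2} k \<subseteq> nsets {..<R} k" for k
    by (intro nsets_mono; simp add: R_def)+
  show ?case
  proof (intro exI[of _ R] allI impI)
    fix \<chi> :: "(nat \<Rightarrow> nat set) \<Rightarrow> 'a"
    assume \<chi>: "\<forall>S\<in>PiE {..<Suc T} (\<lambda>_. nsets {..<R} m). \<chi> S \<in> K"
    define f where "f S' = restrict (\<lambda>F. \<chi> (F(T := S'))) D" for S'
    have upd: "F(T := S') \<in> PiE {..<Suc T} (\<lambda>_. nsets {..<R} m)" if "F \<in> D" "S' \<in> nsets {..<R2} m" for F S'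
    proof (rule PiE_I)
      fix t assume t: "t \<in> {..<Suc T}"
      show "(F(T := S')) t \<in> nsets {..<R} m"
      proof (cases "t = T")
        case True
        then show ?thesis using that(2) mono(2)[of m] by auto
      next
        case False
        then have "F t \<in> nsets {..<R1} m" using t that(1) by (auto simp: D_def)
        then show ?thesis using False mono(1)[of m] by auto
      qed
    next
      fix t assume "t \<notin> {..<Suc T}"
      then show "(F(T := S')) t = undefined" using that(1) by (auto simp: D_def PiE_def extensional_def)
    qed
    have "\<forall>S'\<in>nsets {..<R2} m. f S' \<in> K2"
      using \<chi> upd by (auto simp: f_def K2_def)
    from R2[THEN spec, THEN mp, OF this] obtain H2 c2 where
      H2: "H2 \<in> nsets {..<R2} N" and H2': "\<forall>S\<in>nsets H2 m. f S = c2"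
      by (elim bexE exE) (rule that)
    have H2R: "H2 \<in> nsets {..<R} N" using H2 mono by blast
    show "\<exists>H. (\<forall>t<Suc T. H t \<in> nsets {..<R} N) \<and> (\<exists>c. \<forall>S\<in>PiE {..<Suc T} (\<lambda>t. nsets (H t) m). \<chi> S = c)"
    proof (cases "nsets H2 m = {}")
      \<comment> \<open>When \<open>N < m\<close> there are no \<open>m\<close>-subsets to compare,
        and the claim about the product is vacuous.\<close>
      case True
      then have "PiE {..<Suc T} (\<lambda>t. nsets ((\<lambda>_. H2) t) m) = {}" by (auto simp: PiE_eq_empty_iff)
      then show ?thesis using H2R by (intro exI[of _ "\<lambda>_. H2"]) auto
    next
      case False
      then obtain S0 where S0: "S0 \<in> nsets H2 m" by blast
      have sub2: "nsets H2 m \<subseteq> nsets {..<R2} m" using H2 by (intro nsets_mono) (simp add: nsets_def)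
      have "\<forall>F\<in>PiE {..<T} (\<lambda>_. nsets {..<R1} m). \<chi> (F(T := S0)) \<in> K"
        using \<chi> upd S0 sub2 unfolding D_def by blast
      from R1[THEN spec[of _ "\<lambda>F. \<chi> (F(T := S0))"], THEN mp, OF this] obtain H1 c where
        H1': "\<forall>t<T. H1 t \<in> nsets {..<R1} N" "\<forall>F\<in>PiE {..<T} (\<lambda>t. nsets (H1 t) m). \<chi> (F(T := S0)) = c"
        by (elim exE conjE) (rule that)
      note H1 = H1'[rule_format]
      have "\<chi> S = c" if S: "S \<in> PiE {..<Suc T} (\<lambda>t. nsets ((H1(T := H2)) t) m)" for S
      proof -
        define F where "F = S(T := undefined)"
        have ST: "S T \<in> nsets H2 m" using PiE_mem[OF S, of T] by simp
        have "S t = undefined" if "t \<notin> {..<Suc T}" for t by (rule PiE_arb[OF S that])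
        moreover have "S t \<in> nsets (H1 t) m" if "t < T" for t using PiE_mem[OF S, of t] that by simp
        ultimately have F1: "F \<in> PiE {..<T} (\<lambda>t. nsets (H1 t) m)"
          by (intro PiE_I) (auto simp: F_def not_less less_Suc_eq)
        have "nsets (H1 t) m \<subseteq> nsets {..<R1} m" if "t < T" for t
          using H1(1)[OF that] by (intro nsets_mono) (simp add: nsets_def)
        then have FD: "F \<in> D" using F1 unfolding D_def by (auto simp: PiE_def Pi_def)
        have "\<chi> S = \<chi> (F(T := S T))" by (simp add: F_def)
        also have "\<dots> = f (S T) F" using FD by (simp add: f_def)
        also have "\<dots> = f S0 F" using H2' ST S0 by simp
        also have "\<dots> = \<chi> (F(T := S0))" using FD by (simp add: f_def)
        also have "\<dots> = c" by (rule H1(2)[OF F1])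
        finally show ?thesis .
      qed
      moreover have "(H1(T := H2)) t \<in> nsets {..<R} N" if "t < Suc T" for t
        using that H1(1)[of t] H2R mono(1)[of N] by (cases "t = T") auto
      ultimately show ?thesis by (intro exI[of _ "H1(T := H2)"]) blast
    qed
  qed
qed

text \<open>Variables for the entries of an array of sequences (row \<open>t\<close>, position \<open>i\<close> in the row, coordinate
  \<open>k\<close>), and a second supply of variables \<open>wv j\<close> for parameters.\<close>

definition av :: "nat \<Rightarrow> nat \<Rightarrow> nat \<Rightarrow> nat" where
  "av t i k = sum_encode (Inl (prod_encode (t, prod_encode (i, k))))"

definition wv :: "nat \<Rightarrow> nat" where
  "wv j = sum_encode (Inr j)"

text \<open>Mutual indiscernibility of the rows of an array is invariance of truth under these maps
  for strictly increasing \<open>h t\<close>. In this form it is a set of formulas, to which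
  compactness applies.\<close>

definition reindex :: "(nat \<Rightarrow> nat \<Rightarrow> nat) \<Rightarrow> nat \<Rightarrow> nat" where
  "reindex h x = (case sum_decode x of
     Inl y \<Rightarrow> (case prod_decode y of (t, z) \<Rightarrow> (case prod_decode z of (i, k) \<Rightarrow> av t (h t i) k))
   | Inr j \<Rightarrow> wv j)"

lemma reindex_simps [simp]: "reindex h (av t i k) = av t (h t i) k" "reindex h (wv j) = wv j"
  by (simp_all add: reindex_def av_def wv_def)

lemma av_wv_simps [simp]:
  "av t i k = av t' i' k' \<longleftrightarrow> t = t' \<and> i = i' \<and> k = k'" "wv j = wv j' \<longleftrightarrow> j = j'"
  "av t i k \<noteq> wv j" "wv j \<noteq> av t i k"
  by (auto simp: av_def wv_def sum_encode_eq prod_encode_eq)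

lemma var_cases: obtains t i k where "x = av t i k" | j where "x = wv j"
proof (cases "sum_decode x")
  case (Inl y)
  obtain t z where y: "prod_decode y = (t, z)" by (cases "prod_decode y")
  obtain i k where z: "prod_decode z = (i, k)" by (cases "prod_decode z")
  have "x = av t i k" unfolding av_def
    by (metis Inl y z prod_decode_inverse sum_decode_inverse)
  then show thesis using that by blast
next
  case (Inr j)
  then have "x = wv j" unfolding wv_def by (metis sum_decode_inverse)
  then show thesis using that by blast
qed

lemma inj_reindex:
  assumes "\<And>t. strict_mono (h t)" shows "inj (reindex h)"
proof (rule injI)
  fix x y assume eq: "reindex h x = reindex h y"
  have inj: "h t i = h t j \<longleftrightarrow> i = j" for t i j using assms strict_mono_eq by blast
  show "x = y"
    by (rule var_cases[of x]; rule var_cases[of y]) (use eq inj in auto)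
qed

definition row :: "nat \<Rightarrow> nat" where
  "row x = (case sum_decode x of Inl y \<Rightarrow> fst (prod_decode y) | Inr j \<Rightarrow> 0)"

definition col :: "nat \<Rightarrow> nat" where
  "col x = (case sum_decode x of Inl y \<Rightarrow> fst (prod_decode (snd (prod_decode y))) | Inr j \<Rightarrow> 0)"

lemma row_col_simps [simp]: "row (av t i k) = t" "col (av t i k) = i"
  by (simp_all add: row_def col_def av_def)

lemma sorted_list_of_strict_mono_image:
  fixes f :: "nat \<Rightarrow> nat"
  assumes "strict_mono_on {..<m} f" shows "sorted_list_of_set (f ` {..<m}) = map f [0..<m]"
proof -
  have "sorted_wrt (<) (map f [0..<m])"
    using assms by (auto simp: sorted_wrt_iff_nth_less strict_mono_on_def)
  moreover have "set (map f [0..<m]) = f ` {..<m}" by (auto simp: atLeast0LessThan)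
  ultimately show ?thesis by (metis sorted_list_of_set.idem_if_sorted_distinct strict_sorted_iff)
qed

text \<open>The new assignment realizes two sets of formulas: those that hold under every reindexing
  of \<open>s\<close>, and the implications that express invariance. Finite parts are satisfied by
  suitable reindexings of \<open>s\<close>, found by the product Ramsey theorem. The values on
  \<open>P\<close> can be kept because formulas over \<open>P\<close> are invariant from the start,
  so existence at a reindexing can be pulled back to \<open>s\<close>.\<close>

theorem extract_reindex_invariant:
  fixes M :: "('f, 'r, 'u) struct"
  assumes sat1: "aleph1_saturated L M" and s: "range s \<subseteq> carrier M"
    and fix_inv: "\<And>\<phi> h. wf_fm L \<phi> \<Longrightarrow> fv \<phi> \<subseteq> P \<Longrightarrow> (\<And>t. strict_mono (h t)) \<Longrightarrow>
      sat M s \<phi> \<longleftrightarrow> sat M (s \<circ> reindex h) \<phi>"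
  obtains s' where "s' \<in> assignments_over M P s"
    "\<forall>\<phi>. wf_fm L \<phi> \<longrightarrow> (\<forall>h. (\<forall>t. strict_mono (h t)) \<longrightarrow> sat M (s \<circ> reindex h) \<phi>) \<longrightarrow> sat M s' \<phi>"
    "\<forall>\<phi> h. wf_fm L \<phi> \<longrightarrow> (\<forall>t. strict_mono (h t)) \<longrightarrow> (sat M s' \<phi> \<longleftrightarrow> sat M (s' \<circ> reindex h) \<phi>)"
proof -
  define sm where "sm h \<longleftrightarrow> (\<forall>t. strict_mono (h t))" for h :: "nat \<Rightarrow> nat \<Rightarrow> nat"
  define \<Gamma>1 where "\<Gamma>1 = {\<phi>. wf_fm L \<phi> \<and> (\<forall>h. sm h \<longrightarrow> sat M (s \<circ> reindex h) \<phi>)}"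
  define imp where "imp = (\<lambda>(\<phi>, h). Imp \<phi> (rename (reindex h) \<phi>) :: ('f, 'r) fm)"
  define \<Gamma>2 where "\<Gamma>2 = imp ` {(\<phi>, h). wf_fm L \<phi> \<and> sm h}"
  have wf: "wf_fm L \<phi>" if "\<phi> \<in> \<Gamma>1 \<union> \<Gamma>2" for \<phi>
    using that by (auto simp: \<Gamma>1_def \<Gamma>2_def imp_def)
  have "\<exists>s'\<in>assignments_over M P s. \<forall>\<phi>\<in>\<Gamma>1 \<union> \<Gamma>2. sat M s' \<phi>"
  proof (rule saturated_assignment[OF sat1 wf])
    fix \<Gamma>0 assume \<Gamma>0: "finite \<Gamma>0" "\<Gamma>0 \<subseteq> \<Gamma>1 \<union> \<Gamma>2"
    have "finite (\<Gamma>0 \<inter> \<Gamma>2)" using \<Gamma>0(1) by simp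
    from finite_subset_image[OF this[unfolded \<Gamma>2_def] Int_lower2] obtain D where
      D: "D \<subseteq> {(\<phi>, h). wf_fm L \<phi> \<and> sm h}" "finite D"
        "\<Gamma>0 \<inter> imp ` {(\<phi>, h). wf_fm L \<phi> \<and> sm h} = imp ` D"
      by (elim exE conjE) (rule that)
    define Uv where "Uv = (\<Union>\<phi>\<in>fst ` D. fv \<phi>)"
    have fU: "finite Uv" using D(2) by (auto simp: Uv_def)
    \<comment> \<open>Only \<open>T\<close> rows and \<open>m\<close> positions in each occur in the
      formulas of \<open>D\<close>. The bound \<open>N\<close> exceeds all positions to which the
      finitely many maps \<open>h\<close> of \<open>D\<close> move these.\<close>
    define T where "T = Suc (Max (insert 0 (row ` Uv)))"
    define m where "m = Suc (Max (insert 0 (col ` Uv)))"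
    have Tm: "row x < T" "col x < m" if "x \<in> Uv" for x
      using that fU unfolding T_def m_def less_Suc_eq_le by (auto intro!: Max_ge)
    define N where "N = Suc (Max (insert m ((\<lambda>((\<phi>, h), t, i). h t i) ` (D \<times> {..<T} \<times> {..<m}))))"
    have fin: "finite (insert m ((\<lambda>((\<phi>, h), t, i). h t i) ` (D \<times> {..<T} \<times> {..<m})))"
      using D(2) by simp
    have mN: "m < N" unfolding N_def less_Suc_eq_le using fin by (intro Max_ge) auto
    have hN: "h t i < N" if "(\<phi>, h) \<in> D" "t < T" "i < m" for \<phi> h t i
      unfolding N_def less_Suc_eq_le using fin that by (intro Max_ge) force+
    define asg where "asg S = s \<circ> reindex (\<lambda>t i. sorted_list_of_set (S t) ! i)" for S :: "nat \<Rightarrow> nat set"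
    define \<chi> where "\<chi> S = {\<phi> \<in> fst ` D. sat M (asg S) \<phi>}" for S
    have "finite (Pow (fst ` D))" using D(2) by simp
    from product_ramsey[OF this, of T m N] obtain R :: nat where
      R: "\<forall>\<chi>. (\<forall>S\<in>PiE {..<T} (\<lambda>_. nsets {..<R} m). \<chi> S \<in> Pow (fst ` D)) \<longrightarrow>
        (\<exists>H. (\<forall>t<T. H t \<in> nsets {..<R} N) \<and> (\<exists>c. \<forall>S\<in>PiE {..<T} (\<lambda>t. nsets (H t) m). \<chi> S = c))"
      by (rule exE)
    have "\<forall>S\<in>PiE {..<T} (\<lambda>_. nsets {..<R} m). \<chi> S \<in> Pow (fst ` D)" by (auto simp: \<chi>_def)
    from R[THEN spec, THEN mp, OF this] obtain H c where H': "\<forall>t<T. H t \<in> nsets {..<R} N"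
      "\<forall>S\<in>PiE {..<T} (\<lambda>t. nsets (H t) m). \<chi> S = c" by (elim exE conjE) (rule that)
    note H = H'[rule_format]
    \<comment> \<open>Beyond the \<open>N\<close> positions chosen in row \<open>t\<close> the map
      continues from \<open>R\<close> on, above all of \<open>H t\<close>, which makes it strictly
      increasing on all positions.\<close>
    define g where "g t i = (if t < T \<and> i < N then sorted_list_of_set (H t) ! i else R + i)" for t i
    have Hl: "finite (H t)" "length (sorted_list_of_set (H t)) = N" "H t \<subseteq> {..<R}" if "t < T" for t
      using H(1)[OF that] by (auto simp: nsets_def)
    have gH: "g t i \<in> H t" if "t < T" "i < N" for t i
    proof -
      have "sorted_list_of_set (H t) ! i \<in> set (sorted_list_of_set (H t))" using that Hl by (intro nth_mem) simp
      then show ?thesis using that Hl by (simp add: g_def)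
    qed
    have gsm: "strict_mono (g t)" for t
    proof (rule strict_monoI)
      fix i j :: nat assume ij: "i < j"
      show "g t i < g t j"
      proof (cases "t < T \<and> i < N")
        case True
        show ?thesis
        proof (cases "j < N")
          case j: True
          have "sorted_list_of_set (H t) ! i < sorted_list_of_set (H t) ! j"
            using sorted_wrt_nth_less[OF strict_sorted_list_of_set ij, of "H t"] Hl True j by simp
          then show ?thesis using True j by (simp add: g_def)
        next
          case False
          then show ?thesis using gH[of t i] Hl(3)[of t] True by (auto simp: g_def)
        qed
      next
        case False
        then show ?thesis using ij by (auto simp: g_def)
      qed
    qed
    have homog: "sat M (s \<circ> reindex (\<lambda>t i. g t (e t i))) \<phi> \<longleftrightarrow> \<phi> \<in> c"
      if \<phi>: "\<phi> \<in> fst ` D" and e: "\<And>t. strict_mono (e t)" "\<And>t i. t < T \<Longrightarrow> i < m \<Longrightarrow> e t i < N" for \<phi> e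
    proof -
      define S where "S = restrict (\<lambda>t. (\<lambda>i. g t (e t i)) ` {..<m}) {..<T}"
      have sme: "strict_mono (\<lambda>i. g t (e t i))" for t
        using strict_mono_o[OF gsm e(1)] by (simp add: comp_def)
      have inje: "inj_on (\<lambda>i. g t (e t i)) {..<m}" for t
        using strict_mono_eq[OF sme] by (auto simp: inj_on_def)
      have "S \<in> PiE {..<T} (\<lambda>t. nsets (H t) m)"
      proof (rule PiE_I)
        fix t assume t: "t \<in> {..<T}"
        then have "S t = (\<lambda>i. g t (e t i)) ` {..<m}" by (simp add: S_def)
        then show "S t \<in> nsets (H t) m"
          using gH e(2) t card_image[OF inje] by (auto simp: nsets_def)
      qed (simp add: S_def)
      then have c: "\<chi> S = c" by (rule H(2))
      have "sat M (s \<circ> reindex (\<lambda>t i. g t (e t i))) \<phi> \<longleftrightarrow> sat M (asg S) \<phi>"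
      proof (rule sat_cong)
        fix x assume x: "x \<in> fv \<phi>"
        then have xU: "x \<in> Uv" using \<phi> by (auto simp: Uv_def)
        show "(s \<circ> reindex (\<lambda>t i. g t (e t i))) x = asg S x"
        proof (rule var_cases[of x])
          fix t i k assume xeq: "x = av t i k"
          then have ti: "t < T" "i < m" using Tm[OF xU] by simp_all
          have "strict_mono_on {..<m} (\<lambda>i. g t (e t i))" using sme by (simp add: strict_mono_on_def strict_mono_def)
          then have "sorted_list_of_set (S t) ! i = g t (e t i)"
            using ti by (simp add: S_def sorted_list_of_strict_mono_image)
          then show ?thesis using xeq by (simp add: asg_def)
        qed (simp add: asg_def)
      qed
      also have "\<dots> \<longleftrightarrow> \<phi> \<in> c" using \<phi> c by (auto simp: \<chi>_def)
      finally show ?thesis .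
    qed
    have smg: "sm g" using gsm by (simp add: sm_def)
    have sat_g: "sat M (s \<circ> reindex g) \<psi>" if \<psi>: "\<psi> \<in> \<Gamma>0" for \<psi>
    proof (cases "\<psi> \<in> \<Gamma>1")
      case True
      then show ?thesis using smg by (simp add: \<Gamma>1_def)
    next
      case False
      then have "\<psi> \<in> imp ` D" using \<psi> \<Gamma>0(2) unfolding D(3)[folded \<Gamma>2_def, symmetric] by blast
      then obtain z where z: "z \<in> D" "\<psi> = imp z" by blast
      obtain \<phi> h where "z = (\<phi>, h)" by (cases z)
      then have \<phi>h: "(\<phi>, h) \<in> D" "\<psi> = imp (\<phi>, h)" using z by simp_all
      have h: "strict_mono (h t)" for t using \<phi>h(1) D(1) by (auto simp: sm_def)
      have \<phi>D: "\<phi> \<in> fst ` D" using \<phi>h(1) by force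
      have 1: "sat M (s \<circ> reindex g) \<phi> \<longleftrightarrow> \<phi> \<in> c"
        using homog[OF \<phi>D, of "\<lambda>_ i. i"] mN by (simp add: strict_mono_def)
      have 2: "sat M (s \<circ> reindex (\<lambda>t i. g t (h t i))) \<phi> \<longleftrightarrow> \<phi> \<in> c"
        by (rule homog[OF \<phi>D h hN[OF \<phi>h(1)]])
      have "(s \<circ> reindex g) \<circ> reindex h = s \<circ> reindex (\<lambda>t i. g t (h t i))"
      proof
        fix x show "((s \<circ> reindex g) \<circ> reindex h) x = (s \<circ> reindex (\<lambda>t i. g t (h t i))) x"
          by (rule var_cases[of x]) simp_all
      qed
      then show ?thesis unfolding \<phi>h(2) imp_def prod.case sat.simps sat_rename[OF inj_reindex[of h, OF h]]
        by (simp only: 1 2 simp_thms)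
    qed
    obtain \<phi>s where \<phi>s: "set \<phi>s = \<Gamma>0" using finite_list[OF \<Gamma>0(1)] by blast
    define V where "V = (\<Union>\<phi>\<in>\<Gamma>0. fv \<phi>)"
    have fV: "finite V" using \<Gamma>0(1) by (auto simp: V_def)
    \<comment> \<open>With the variables outside \<open>P\<close> quantified away, a formula over
      \<open>P\<close> remains. Its truth passes from the reindexed assignment to \<open>s\<close>,
      and a witness there has the required values on \<open>P\<close>.\<close>
    define \<theta> where "\<theta> = ExL (sorted_list_of_set (V - P)) (ConjL \<phi>s)"
    have \<theta>: "wf_fm L \<theta>" "fv \<theta> \<subseteq> P"
      using \<phi>s \<Gamma>0(2) wf fV by (auto simp: \<theta>_def V_def)
    have sgM: "(s \<circ> reindex g) x \<in> carrier M" for x using s by auto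
    have "sat M (s \<circ> reindex g) \<theta>" unfolding \<theta>_def sat_ExL
      using sat_g sgM \<phi>s by (intro exI[of _ "s \<circ> reindex g"]) simp
    then have "sat M s \<theta>" using fix_inv[OF \<theta> gsm] by simp
    then obtain s' where s': "\<forall>x. x \<notin> V - P \<longrightarrow> s' x = s x" "\<forall>x\<in>V - P. s' x \<in> carrier M" "\<forall>\<phi>\<in>\<Gamma>0. sat M s' \<phi>"
      unfolding \<theta>_def sat_ExL using fV \<phi>s by auto
    have "s' x \<in> carrier M" for x using s'(1,2) s by (cases "x \<in> V - P") auto
    then have "s' \<in> assignments_over M P s" using s'(1) by (auto simp: assignments_over_def)
    then show "\<exists>s'\<in>assignments_over M P s. \<forall>\<phi>\<in>\<Gamma>0. sat M s' \<phi>" using s'(3) by blast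
  qed
  then obtain s' where s': "s' \<in> assignments_over M P s" "\<And>\<phi>. \<phi> \<in> \<Gamma>1 \<union> \<Gamma>2 \<Longrightarrow> sat M s' \<phi>" by blast
  show thesis
  proof (rule that[OF s'(1)]; intro allI impI)
    show "sat M s' \<phi>" if "wf_fm L \<phi>" "\<forall>h. (\<forall>t. strict_mono (h t)) \<longrightarrow> sat M (s \<circ> reindex h) \<phi>" for \<phi>
      using that by (intro s'(2)) (simp add: \<Gamma>1_def sm_def)
    fix \<phi> :: "('f, 'r) fm" and h :: "nat \<Rightarrow> nat \<Rightarrow> nat"
    assume \<phi>: "wf_fm L \<phi>" and "\<forall>t. strict_mono (h t)"
    then have h: "strict_mono (h t)" for t by blast
    have one: "sat M s' \<psi> \<Longrightarrow> sat M (s' \<circ> reindex h) \<psi>" if "wf_fm L \<psi>" for \<psi>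
    proof -
      have "imp (\<psi>, h) \<in> \<Gamma>2" using that h by (auto simp: \<Gamma>2_def sm_def)
      then have "sat M s' (imp (\<psi>, h))" using s'(2) by blast
      then show "sat M s' \<psi> \<Longrightarrow> sat M (s' \<circ> reindex h) \<psi>"
        by (simp add: imp_def sat_rename[OF inj_reindex[of h, OF h]])
    qed
    show "sat M s' \<phi> \<longleftrightarrow> sat M (s' \<circ> reindex h) \<phi>" using one[of \<phi>] one[of "Neg \<phi>"] \<phi> by auto
  qed
qed

section \<open>Indiscernible sequences and invariance under reindexing\<close>

lemma nth_concat_map:
  assumes "\<And>i. i \<in> set is \<Longrightarrow> length (f i) = n" "j < length is" "k < n"
  shows "concat (map f is) ! (j * n + k) = f (is ! j) ! k" "length (concat (map f is)) = length is * n"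
proof -
  have len: "length (concat (map f xs)) = length xs * n" if "\<And>i. i \<in> set xs \<Longrightarrow> length (f i) = n" for xs
    using that by (induction xs) auto
  show "length (concat (map f is)) = length is * n" using len assms by blast
  show "concat (map f is) ! (j * n + k) = f (is ! j) ! k"
    using assms(1,2)
  proof (induction "is" arbitrary: j)
    case (Cons a xs)
    show ?case
    proof (cases j)
      case 0
      then show ?thesis using Cons.prems(1)[of a] assms(3) by (simp add: nth_append)
    next
      case (Suc j')
      have "concat (map f (a # xs)) ! (j * n + k) = concat (map f xs) ! (j' * n + k)"
        using Cons.prems(1)[of a] Suc by (simp add: nth_append)
      also have "\<dots> = f (xs ! j') ! k" using Cons Suc by auto
      finally show ?thesis using Suc by simp
    qed
  qed simp
qed

text \<open>One row is shifted at a time; the other rows, shifted already or not yet, consist of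
  parameters over which it is indiscernible. Only finitely many rows occur in \<phi>, so finitely
  many such steps suffice.\<close>

lemma mutually_indiscernible_reindex:
  fixes M :: "('f, 'r, 'u) struct"
  assumes mi: "mutually_indiscernible L M A (UNIV :: nat set) I"
    and I: "\<And>t. range (I t) \<subseteq> tuples M (n t)" and A: "A \<subseteq> carrier M"
    and s: "\<And>t i k. k < n t \<Longrightarrow> s (av t i k) = I t i ! k" "\<And>j. j < r \<Longrightarrow> s (wv j) \<in> A"
    and \<phi>: "wf_fm L \<phi>" "fv \<phi> \<subseteq> {av t i k | t i k. k < n t} \<union> wv ` {..<r}"
    and h: "\<And>t. strict_mono (h t)"
  shows "sat M s \<phi> \<longleftrightarrow> sat M (s \<circ> reindex h) \<phi>"
proof -
  have lI: "length (I t i) = n t" "set (I t i) \<subseteq> carrier M" for t i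
    using I[of t] by (auto simp: tuples_def)
  have step: "sat M (s \<circ> reindex g) \<phi> \<longleftrightarrow> sat M (s \<circ> reindex (g(t0 := h t0))) \<phi>" if g: "g t0 = id" for g t0
  proof -
    define N where "N = Suc (Max (insert 0 (col ` fv \<phi>)))"
    have N: "i < N" if "av t i k \<in> fv \<phi>" for t i k
    proof -
      have "col (av t i k) \<in> insert 0 (col ` fv \<phi>)" using that by (intro insertI2 imageI)
      then have "col (av t i k) \<le> Max (insert 0 (col ` fv \<phi>))" by (intro Max_ge) simp_all
      then show ?thesis by (simp add: N_def)
    qed
    \<comment> \<open>The variables outside row \<open>t0\<close> become parameters, so that the
      formula speaks about row \<open>t0\<close> alone.\<close>
    define ws where "ws = sorted_list_of_set (fv \<phi> - {av t0 i k | i k. True})"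
    have ws: "set ws = fv \<phi> - {av t0 i k | i k. True}" by (simp add: ws_def)
    define as where "as = map (s \<circ> reindex g) ws"
    define B where "B = A \<union> (\<Union>t\<in>UNIV - {t0}. \<Union>i. set (I t i))"
    have "(s \<circ> reindex g) x \<in> B" if x: "x \<in> set ws" for x
    proof (rule var_cases[of x])
      fix t i k assume xeq: "x = av t i k"
      then have "k < n t" "t \<noteq> t0" using x ws \<phi>(2) by auto
      then have "(s \<circ> reindex g) x = I t (g t i) ! k" "I t (g t i) ! k \<in> set (I t (g t i))"
        using s(1) lI xeq by simp_all
      then show ?thesis using \<open>t \<noteq> t0\<close> unfolding B_def by auto
    next
      fix j assume xeq: "x = wv j"
      then have "j < r" using x ws \<phi>(2) by auto
      then show ?thesis using s(2) xeq by (simp add: B_def)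
    qed
    then have asB: "set as \<subseteq> B" by (auto simp: as_def)
    have BM: "B \<subseteq> carrier M" unfolding B_def using A lI(2) by blast
    \<comment> \<open>The tuple to be tested consists of \<open>N\<close> entries of row
      \<open>t0\<close>, each of length \<open>n t0\<close>, followed by the parameters. The
      projections undo the coding in \<open>av\<close> to recover the coordinate.\<close>
    define pos where "pos x = (if x \<in> set ws then N * n t0 + index_of ws x
      else col x * n t0 + snd (prod_decode (snd (prod_decode (projl (sum_decode x))))))" for x
    have pos_av: "pos (av t0 i k) = i * n t0 + k" for i k
      using ws by (auto simp: pos_def) (simp_all add: av_def)
    have val: "(concat (map (I t0) is) @ as) ! pos x = (s \<circ> reindex (g(t0 := \<lambda>i. is ! i))) x
        \<and> pos x < N * n t0 + length as"
      if len_is: "length is = N" and xfv: "x \<in> fv \<phi>" for x "is"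
    proof (cases "x \<in> set ws")
      case True
      have "length (concat (map (I t0) is)) = N * n t0"
        using len_is lI by (induction "is" arbitrary: N) auto
      moreover have "(s \<circ> reindex (g(t0 := \<lambda>i. is ! i))) x = (s \<circ> reindex g) x"
        by (rule var_cases[of x]) (use True ws in auto)
      ultimately show ?thesis using True index_of[OF True] by (simp add: pos_def nth_append as_def)
    next
      case False
      then obtain i k where x: "x = av t0 i k" using xfv ws by auto
      then have ik: "i < N" "k < n t0" using N xfv \<phi>(2) by auto
      have len: "length (concat (map (I t0) is)) = length is * n t0"
        and nth: "concat (map (I t0) is) ! (i * n t0 + k) = I t0 (is ! i) ! k"
        using nth_concat_map[of "is" "I t0" "n t0" i k] lI ik len_is by auto
      have "i * n t0 + k < N * n t0"
      proof -
        have "i * n t0 + k < Suc i * n t0" using ik by simp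
        also have "\<dots> \<le> N * n t0" using ik by (intro mult_le_mono1) simp
        finally show ?thesis .
      qed
      then show ?thesis using x nth len len_is ik s(1) by (simp add: pos_av nth_append)
    qed
    define \<phi>' where "\<phi>' = subst pos \<phi>"
    define l where "l = N * n t0 + length as"
    have lc: "length (concat (map (I t0) is)) = N * n t0" if "length is = N" for "is"
      using that lI by (induction "is" arbitrary: N) auto
    have f\<phi>': "formula L l \<phi>'"
      unfolding formula_def \<phi>'_def l_def
      using \<phi>(1) fv_subst[of pos \<phi>] val[of "[0..<N]"] by fastforce
    have sat: "sat_at M \<phi>' (concat (map (I t0) is) @ as) \<longleftrightarrow> sat M (s \<circ> reindex (g(t0 := \<lambda>i. is ! i))) \<phi>"
      if "length is = N" for "is"
    proof -
      have "set (I t0 i) \<subseteq> carrier M" for i by (rule lI(2))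
      then have "set (concat (map (I t0) is) @ as) \<subseteq> carrier M" using asB BM by (simp add: UN_subset_iff)
      then have c: "(concat (map (I t0) is) @ as) ! pos x \<in> carrier M" if "x \<in> fv \<phi>" for x
        using val[OF \<open>length is = N\<close> that] lc[OF \<open>length is = N\<close>]
          nth_mem[of "pos x" "concat (map (I t0) is) @ as"] by auto
      have "sat_at M \<phi>' (concat (map (I t0) is) @ as) \<longleftrightarrow> sat M (\<lambda>x. (concat (map (I t0) is) @ as) ! pos x) \<phi>"
        unfolding \<phi>'_def by (rule sat_subst) (rule c)
      also have "\<dots> \<longleftrightarrow> sat M (s \<circ> reindex (g(t0 := \<lambda>i. is ! i))) \<phi>"
        by (rule sat_cong) (use val[OF that] in blast)
      finally show ?thesis .
    qed
    have ind: "indiscernible L M B (I t0)" using mi by (simp add: mutually_indiscernible_def B_def)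
    define js where "js = map (h t0) [0..<N]"
    have "sorted_wrt (<) [0..<N]" by simp
    moreover have "sorted_wrt (<) js" using h[of t0] by (auto simp: js_def sorted_wrt_iff_nth_less strict_mono_def)
    ultimately have "sat_at M \<phi>' (concat (map (I t0) [0..<N]) @ as) \<longleftrightarrow> sat_at M \<phi>' (concat (map (I t0) js) @ as)"
      using ind[unfolded indiscernible_def, THEN conjunct2, rule_format, of as "[0..<N]" js \<phi>'] asB f\<phi>' lc[of "[0..<N]"]
      by (simp add: js_def l_def)
    then have "sat M (s \<circ> reindex (g(t0 := \<lambda>i. [0..<N] ! i))) \<phi> \<longleftrightarrow> sat M (s \<circ> reindex (g(t0 := \<lambda>i. js ! i))) \<phi>"
      using sat[of "[0..<N]"] sat[of js] by (simp add: js_def)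
    moreover have "sat M (s \<circ> reindex (g(t0 := \<lambda>i. [0..<N] ! i))) \<phi> \<longleftrightarrow> sat M (s \<circ> reindex g) \<phi>"
    proof (rule sat_cong)
      fix x assume "x \<in> fv \<phi>"
      then show "(s \<circ> reindex (g(t0 := \<lambda>i. [0..<N] ! i))) x = (s \<circ> reindex g) x"
        using N g by (cases rule: var_cases[of x]) auto
    qed
    moreover have "sat M (s \<circ> reindex (g(t0 := \<lambda>i. js ! i))) \<phi> \<longleftrightarrow> sat M (s \<circ> reindex (g(t0 := h t0))) \<phi>"
    proof (rule sat_cong)
      fix x assume "x \<in> fv \<phi>"
      then show "(s \<circ> reindex (g(t0 := \<lambda>i. js ! i))) x = (s \<circ> reindex (g(t0 := h t0))) x"
        using N by (cases rule: var_cases[of x]) (auto simp: js_def)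
    qed
    ultimately show ?thesis by simp
  qed
  define gr where "gr m t = (if t < m then h t else id)" for m t
  have "sat M (s \<circ> reindex (gr m)) \<phi> \<longleftrightarrow> sat M s \<phi>" for m
  proof (induction m)
    case 0
    have "s \<circ> reindex (gr 0) = s"
    proof
      fix x show "(s \<circ> reindex (gr 0)) x = s x" by (rule var_cases[of x]) (simp_all add: gr_def)
    qed
    then show ?case by simp
  next
    case (Suc m)
    have "(gr m)(m := h m) = gr (Suc m)" by (auto simp: gr_def fun_eq_iff less_Suc_eq)
    moreover have "gr m m = id" by (simp add: gr_def)
    ultimately have "sat M (s \<circ> reindex (gr m)) \<phi> \<longleftrightarrow> sat M (s \<circ> reindex (gr (Suc m))) \<phi>"
      using step[of "gr m" m] by argo
    with Suc show ?case by blast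
  qed
  moreover define m where "m = Suc (Max (insert 0 (row ` fv \<phi>)))"
  have "sat M (s \<circ> reindex (gr m)) \<phi> \<longleftrightarrow> sat M (s \<circ> reindex h) \<phi>"
  proof (rule sat_cong)
    fix x assume x: "x \<in> fv \<phi>"
    have "row x < m" unfolding m_def less_Suc_eq_le using x by (intro Max_ge) auto
    then show "(s \<circ> reindex (gr m)) x = (s \<circ> reindex h) x"
      by (cases rule: var_cases[of x]) (auto simp: gr_def)
  qed
  ultimately show ?thesis by simp
qed

text \<open>Indiscernibility is tested on increasing lists of positions, invariance on increasing
  maps of all positions; this passes from the former to the latter.\<close>

lemma strict_mono_extension:
  assumes "sorted_wrt (<) (is :: nat list)"
  obtains h where "strict_mono h" "\<And>i. i < length is \<Longrightarrow> h i = is ! i"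
proof -
  define h where "h i = (if i < length is then is ! i else (if is = [] then 0 else last is) + Suc i)" for i
  have le: "is ! i \<le> last is" if "i < length is" for i
  proof (cases "i = length is - 1")
    case True
    then show ?thesis using that by (cases "is" rule: rev_cases) auto
  next
    case False
    then have "is ! i < is ! (length is - 1)" using that assms by (intro sorted_wrt_nth_less[OF assms]) auto
    then show ?thesis using that by (metis last_conv_nth less_imp_le list.size(3) not_less_zero)
  qed
  have "strict_mono h"
  proof (rule strict_monoI)
    fix i j :: nat assume ij: "i < j"
    show "h i < h j"
    proof (cases "i < length is")
      case True
      show ?thesis
      proof (cases "j < length is")
        case j: True
        then show ?thesis using sorted_wrt_nth_less[OF assms ij] True by (simp add: h_def)
      next
        case False
        have "is \<noteq> []" using True by auto
        then show ?thesis using le[OF True] True False by (simp add: h_def)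
      qed
    next
      case False
      then show ?thesis using ij by (simp add: h_def)
    qed
  qed
  then show thesis by (rule that) (simp add: h_def)
qed

text \<open>Any increasing list of \<open>m\<close> positions in row \<open>t\<close> is the image
  of the first \<open>m\<close> positions under an increasing map, which can be combined with the
  identity on all other rows. So every such list agrees with the first \<open>m\<close> positions
  over the other rows.\<close>

lemma reindex_mutually_indiscernible:
  fixes M :: "('f, 'r, 'u) struct"
  assumes s: "range s \<subseteq> carrier M"
    and inv: "\<And>\<phi> h. wf_fm L \<phi> \<Longrightarrow> (\<And>t. strict_mono (h t)) \<Longrightarrow> sat M s \<phi> \<longleftrightarrow> sat M (s \<circ> reindex h) \<phi>"
    and J: "\<And>t i. J t i = map (\<lambda>k. s (av t i k)) [0..<n t]"
  shows "mutually_indiscernible L M {} (UNIV :: nat set) J"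
  unfolding mutually_indiscernible_def indiscernible_def
proof (intro ballI conjI allI impI)
  fix t :: nat
  have "J t i \<in> tuples M (n t)" for i using s by (auto simp: J tuples_def)
  then show "\<exists>m. range (J t) \<subseteq> tuples M m" by blast
  fix \<phi> as and is' js :: "nat list"
  assume *: "set as \<subseteq> {} \<union> (\<Union>s\<in>UNIV - {t}. \<Union>i. set (J s i)) \<and> sorted_wrt (<) is' \<and> sorted_wrt (<) js \<and>
    length is' = length js \<and> formula L (length (concat (map (J t) is')) + length as) \<phi>"
  define m where "m = length is'"
  have lJ: "length (J t i) = n t" for i by (simp add: J)
  have lc: "length (concat (map (J t) xs)) = length xs * n t" for xs
    by (induction xs) (auto simp: lJ)
  have "\<forall>a\<in>set as. \<exists>x. s x = a \<and> (\<exists>r i k. x = av r i k \<and> r \<noteq> t)"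
  proof
    fix a assume "a \<in> set as"
    then obtain r i where "r \<noteq> t" "a \<in> set (J r i)" using * by blast
    then obtain k where "a = s (av r i k)" by (auto simp: J)
    then show "\<exists>x. s x = a \<and> (\<exists>r i k. x = av r i k \<and> r \<noteq> t)" using \<open>r \<noteq> t\<close> by blast
  qed
  then obtain z where z: "\<And>a. a \<in> set as \<Longrightarrow> s (z a) = a \<and> (\<exists>r i k. z a = av r i k \<and> r \<noteq> t)" by metis
  define pos where "pos x = (if x < m * n t then av t (x div n t) (x mod n t) else z (as ! (x - m * n t)))" for x
  have key: "sat_at M \<phi> (concat (map (J t) xs) @ as) \<longleftrightarrow> sat M s (subst pos \<phi>)"
    if xs: "sorted_wrt (<) xs" "length xs = m" for xs
  proof -
    obtain h0 where h0: "strict_mono h0" "\<And>i. i < length xs \<Longrightarrow> h0 i = xs ! i"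
      by (rule strict_mono_extension[OF xs(1)], rule that)
    define h where "h = (\<lambda>_. id)(t := h0)"
    have h: "strict_mono (h r)" for r using h0(1) by (simp add: h_def strict_mono_def)
    have "sat M s (subst pos \<phi>) \<longleftrightarrow> sat M (s \<circ> reindex h) (subst pos \<phi>)"
      by (rule inv) (use * h in \<open>simp_all add: formula_def\<close>)
    also have "\<dots> \<longleftrightarrow> sat M (\<lambda>x. (s \<circ> reindex h) (pos x)) \<phi>" by (rule sat_subst) (use s in auto)
    also have "\<dots> \<longleftrightarrow> sat_at M \<phi> (concat (map (J t) xs) @ as)"
    proof (rule sat_cong)
      fix x assume "x \<in> fv \<phi>"
      then have x: "x < m * n t + length as" using * lc by (auto simp: formula_def m_def)
      show "(s \<circ> reindex h) (pos x) = (concat (map (J t) xs) @ as) ! x"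
      proof (cases "x < m * n t")
        case True
        then have nt: "0 < n t" by (cases "n t = 0") auto
        have d: "x div n t < m" "x mod n t < n t" using True nt by (simp_all add: less_mult_imp_div_less)
        have "concat (map (J t) xs) ! (x div n t * n t + x mod n t) = J t (xs ! (x div n t)) ! (x mod n t)"
          by (rule nth_concat_map(1)) (use d xs lJ in auto)
        also have "\<dots> = s (av t (xs ! (x div n t)) (x mod n t))" using d by (simp add: J)
        finally show ?thesis using True d h0(2) xs(2) lc by (simp add: pos_def h_def nth_append)
      next
        case False
        define a where "a = as ! (x - m * n t)"
        have "a \<in> set as" using False x by (simp add: a_def)
        then obtain r i k where zr: "s (z a) = a" "z a = av r i k" "r \<noteq> t" using z by blast
        have "(s \<circ> reindex h) (pos x) = a" using False zr by (simp add: pos_def a_def[symmetric] h_def)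
        then show ?thesis using False xs(2) lc by (simp add: nth_append a_def)
      qed
    qed
    finally show ?thesis by simp
  qed
  show "sat_at M \<phi> (concat (map (J t) is') @ as) \<longleftrightarrow> sat_at M \<phi> (concat (map (J t) js) @ as)"
    using key[of is'] key[of js] * by (simp add: m_def)
qed

definition assign :: "(nat \<Rightarrow> nat \<Rightarrow> nat \<Rightarrow> 'u) \<Rightarrow> (nat \<Rightarrow> 'u) \<Rightarrow> nat \<Rightarrow> 'u" where
  "assign a w x = (case sum_decode x of
     Inl y \<Rightarrow> (case prod_decode y of (t, z) \<Rightarrow> (case prod_decode z of (i, k) \<Rightarrow> a t i k))
   | Inr j \<Rightarrow> w j)"

lemma assign_simps [simp]: "assign a w (av t i k) = a t i k" "assign a w (wv j) = w j"
  by (simp_all add: assign_def av_def wv_def)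

lemma indiscernible_mono: "indiscernible L M A I \<Longrightarrow> A0 \<subseteq> A \<Longrightarrow> indiscernible L M A0 I"
  unfolding indiscernible_def by (meson subset_trans)

lemma sorted_wrt_concat:
  assumes "\<And>i. sorted_wrt (<) (blk i :: nat list)" "\<And>i j a b. i < j \<Longrightarrow> a \<in> set (blk i) \<Longrightarrow> b \<in> set (blk j) \<Longrightarrow> a < b"
    and "sorted_wrt (<) (xs :: nat list)"
  shows "sorted_wrt (<) (concat (map blk xs))"
  using assms(3) by (induction xs) (auto simp: sorted_wrt_append assms(1) intro: assms(2))

lemma indiscernible_blocks:
  assumes ind: "indiscernible L M A I" and blk: "\<And>i. sorted_wrt (<) (blk i)" "\<And>i. length (blk i) = m"
    "\<And>i j a b. i < j \<Longrightarrow> a \<in> set (blk i) \<Longrightarrow> b \<in> set (blk j) \<Longrightarrow> a < b"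
  shows "indiscernible L M A (\<lambda>i. concat (map I (blk i)))"
proof -
  obtain n where n: "range I \<subseteq> tuples M n" using ind by (auto simp: indiscernible_def)
  have lI: "length (I i) = n" "set (I i) \<subseteq> carrier M" for i using n by (auto simp: tuples_def)
  have len: "length (concat (map I xs)) = length xs * n" for xs by (induction xs) (auto simp: lI)
  have lb: "length (concat (map blk xs)) = length xs * m" for xs by (induction xs) (auto simp: blk)
  have eq: "concat (map (\<lambda>i. concat (map I (blk i))) xs) = concat (map I (concat (map blk xs)))" for xs
    by (induction xs) auto
  have "concat (map I (blk i)) \<in> tuples M (m * n)" for i
  proof -
    have "set (concat (map I (blk i))) \<subseteq> carrier M" using lI(2) by (simp add: UN_subset_iff)
    then show ?thesis using len[of "blk i"] blk(2) by (simp add: tuples_def)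
  qed
  then have "\<exists>l. range (\<lambda>i. concat (map I (blk i))) \<subseteq> tuples M l" by blast
  moreover have "sat_at M \<phi> (concat (map (\<lambda>i. concat (map I (blk i))) is) @ as) \<longleftrightarrow>
      sat_at M \<phi> (concat (map (\<lambda>i. concat (map I (blk i))) js) @ as)"
    if *: "set as \<subseteq> A" "sorted_wrt (<) is" "sorted_wrt (<) js" "length is = length js"
      "formula L (length (concat (map (\<lambda>i. concat (map I (blk i))) is)) + length as) \<phi>" for \<phi> as "is" js
    unfolding eq
    by (rule ind[unfolded indiscernible_def, THEN conjunct2, rule_format])
      (use * sorted_wrt_concat[of blk "is"] sorted_wrt_concat[of blk js] blk(1,3) lb eq in simp)
  ultimately show ?thesis unfolding indiscernible_def by blast
qed

text \<open>When two lists of positions disagree on a formula, one of them also disagrees with a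
  third list lying beyond both. That one becomes the first block, and consecutive intervals further
  up become the others.\<close>

lemma distinguishing_blocks:
  assumes "\<not> indiscernible L M A' I" and n: "range I \<subseteq> tuples M n"
  obtains blk m \<phi> as where "\<And>i. sorted_wrt (<) (blk i)" "\<And>i. length (blk i) = m"
    "\<And>i j a b. i < j \<Longrightarrow> a \<in> set (blk i) \<Longrightarrow> b \<in> set (blk j) \<Longrightarrow> a < b"
    "set as \<subseteq> A'" "formula L (m * n + length as) \<phi>"
    "sat_at M \<phi> (concat (map I (blk 0)) @ as) \<noteq> sat_at M \<phi> (concat (map I (blk (Suc 0))) @ as)"
proof -
  have lI: "length (I i) = n" for i using n by (auto simp: tuples_def)
  have len: "length (concat (map I xs)) = length xs * n" for xs by (induction xs) (auto simp: lI)
  obtain \<phi> as is' js where *: "set as \<subseteq> A'" "sorted_wrt (<) is'" "sorted_wrt (<) js" "length is' = length js"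
    "formula L (length (concat (map I is')) + length as) \<phi>"
    "sat_at M \<phi> (concat (map I is') @ as) \<noteq> sat_at M \<phi> (concat (map I js) @ as)"
    using assms(1) n unfolding indiscernible_def by blast
  define m where "m = length is'"
  define N where "N = Suc (Max (insert 0 (set is' \<union> set js)))"
  have N: "a < N" if "a \<in> set is' \<union> set js" for a
    unfolding N_def less_Suc_eq_le using that by (intro Max_ge) auto
  define ks where "ks i = [N + i * m..<N + Suc i * m]" for i
  have "\<exists>ls. ls \<in> {is', js} \<and> sat_at M \<phi> (concat (map I ls) @ as) \<noteq> sat_at M \<phi> (concat (map I (ks 0)) @ as)"
    using *(6) by auto
  then obtain ls where ls: "ls \<in> {is', js}" "sat_at M \<phi> (concat (map I ls) @ as) \<noteq> sat_at M \<phi> (concat (map I (ks 0)) @ as)"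
    by blast
  have ls': "sorted_wrt (<) ls" "length ls = m" "\<And>a. a \<in> set ls \<Longrightarrow> a < N"
    using ls(1) * N by (auto simp: m_def)
  define blk where "blk i = (case i of 0 \<Rightarrow> ls | Suc j \<Rightarrow> ks j)" for i
  show thesis
  proof (rule that[of blk m as \<phi>])
    show "sorted_wrt (<) (blk i)" "length (blk i) = m" for i
      using ls' by (auto simp: blk_def ks_def split: nat.splits)
    show "a < b" if ij: "i < j" and a: "a \<in> set (blk i)" and b: "b \<in> set (blk j)" for i j a b
    proof -
      obtain j' where j': "j = Suc j'" using ij by (cases j) auto
      then have bN: "N + j' * m \<le> b" using b by (simp add: blk_def ks_def)
      show ?thesis
      proof (cases i)
        case 0
        then have "a < N" using a ls'(3) by (simp add: blk_def)
        then show ?thesis using bN by linarith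
      next
        case (Suc i')
        then have "a < N + Suc i' * m" using a by (simp add: blk_def ks_def)
        moreover have "Suc i' * m \<le> j' * m" using ij Suc j' by (intro mult_le_mono1) simp
        ultimately show ?thesis using bN by linarith
      qed
    qed
    show "formula L (m * n + length as) \<phi>" using *(5) len by (simp add: m_def)
    show "sat_at M \<phi> (concat (map I (blk 0)) @ as) \<noteq> sat_at M \<phi> (concat (map I (blk (Suc 0))) @ as)"
      using ls(2) by (simp add: blk_def)
  qed (rule *(1))
qed

lemma indiscernible_reduct:
  assumes "indiscernible (colored_language L) M A I" shows "indiscernible L (reduct M) A I"
proof -
  have "range I \<subseteq> tuples (reduct M) n \<longleftrightarrow> range I \<subseteq> tuples M n" for n by (simp add: tuples_def)
  then show ?thesis
    using assms unfolding indiscernible_def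
  proof (elim conjE, intro conjI allI impI)
    fix \<phi> as and "is" js :: "nat list"
    assume *: "\<forall>\<phi> as (is :: nat list) js. set as \<subseteq> A \<and> sorted_wrt (<) is \<and> sorted_wrt (<) js \<and> length is = length js \<and>
        formula (colored_language L) (length (concat (map I is)) + length as) \<phi> \<longrightarrow>
        (sat_at M \<phi> (concat (map I is) @ as) \<longleftrightarrow> sat_at M \<phi> (concat (map I js) @ as))"
      "set as \<subseteq> A \<and> sorted_wrt (<) is \<and> sorted_wrt (<) js \<and> length is = length js \<and>
        formula L (length (concat (map I is)) + length as) \<phi>"
    show "sat_at (reduct M) \<phi> (concat (map I is) @ as) \<longleftrightarrow> sat_at (reduct M) \<phi> (concat (map I js) @ as)"
      using *(1)[rule_format, of as "is" js "lift \<phi>"] *(2) by simp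
  qed simp
qed

lemma indiscernible_pair:
  assumes "indiscernible L M A I" "set as \<subseteq> A" "formula L (length (I i) + length as) \<phi>"
  shows "sat_at M \<phi> (I i @ as) \<longleftrightarrow> sat_at M \<phi> (I j @ as)"
  using assms(1)[unfolded indiscernible_def, THEN conjunct2, rule_format, of as "[i]" "[j]" \<phi>] assms(2,3) by simp

text \<open>A pairing function arranges an independence pattern in infinitely many rows. However two
  positions are chosen in each row, some parameter separates the earlier from the later one in all
  rows simultaneously. Extraction makes the rows mutually indiscernible, and compactness yields one
  tuple over which no row is indiscernible.\<close>

lemma NIP_of_dp_rank:
  fixes M :: "('f, 'r, 'u) struct"
  assumes sat1: "aleph1_saturated L M"
    and dp: "\<And>m. dp_rank_less L M m {(Equal (Var i) (Var i), []) | i. i < m} {} (UNIV :: nat set)"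
    and \<phi>: "formula L (n + m) \<phi>"
  shows "\<not> has_IP M n m \<phi>"
proof
  assume "has_IP M n m \<phi>"
  then obtain a :: "nat \<Rightarrow> 'u list" and b :: "nat set \<Rightarrow> 'u list" where ab': "\<forall>i. a i \<in> tuples M n" "\<forall>S. b S \<in> tuples M m"
    "\<forall>i S. sat_at M \<phi> (a i @ b S) \<longleftrightarrow> i \<in> S" unfolding has_IP_def by (elim exE conjE) (rule that)
  note ab = ab'[rule_format]
  have la: "length (a i) = n" "set (a i) \<subseteq> carrier M" for i using ab(1)[of i] by (auto simp: tuples_def)
  have lb: "length (b S) = m" "set (b S) \<subseteq> carrier M" for S using ab(2)[of S] by (auto simp: tuples_def)
  have "carrier M \<noteq> {}"
  proof
    assume "carrier M = {}"
    then have "a 0 = []" "b {} = []" "b {0} = []" using la[of 0] lb[of "{}"] lb[of "{0}"] by auto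
    then show False using ab(3)[of 0 "{}"] ab(3)[of 0 "{0}"] by simp
  qed
  then obtain c where c: "c \<in> carrier M" by blast
  define s where "s = assign (\<lambda>t i k. if k < n then a (prod_encode (t, i)) ! k else c) (\<lambda>_. c)"
  have sM: "s x \<in> carrier M" for x
  proof (rule var_cases[of x])
    fix t i k assume "x = av t i k"
    then show ?thesis using la[of "prod_encode (t, i)"] c nth_mem[of k "a (prod_encode (t, i))"] by (auto simp: s_def)
  qed (simp add: s_def c)
  have srange: "range s \<subseteq> carrier M" using sM by blast
  obtain s' where s'0: "s' \<in> assignments_over M {} s"
    "\<forall>\<phi>. wf_fm L \<phi> \<longrightarrow> (\<forall>h. (\<forall>t. strict_mono (h t)) \<longrightarrow> sat M (s \<circ> reindex h) \<phi>) \<longrightarrow> sat M s' \<phi>"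
    "\<forall>\<phi> h. wf_fm L \<phi> \<longrightarrow> (\<forall>t. strict_mono (h t)) \<longrightarrow> (sat M s' \<phi> \<longleftrightarrow> sat M (s' \<circ> reindex h) \<phi>)"
  proof (rule extract_reindex_invariant[OF sat1 srange])
    show "sat M s \<phi> \<longleftrightarrow> sat M (s \<circ> reindex h) \<phi>" if "fv \<phi> \<subseteq> {}" for \<phi> :: "('f, 'r) fm" and h
      by (rule sat_cong) (use that in auto)
  qed (rule that)
  note s' = s'0[rule_format]
  have s'M: "range s' \<subseteq> carrier M" using s'(1) by (simp add: assignments_over_def)
  define J where "J t i = map (\<lambda>k. s' (av t i k)) [0..<n]" for t i
  have mi: "mutually_indiscernible L M {} (UNIV :: nat set) J"
    by (rule reindex_mutually_indiscernible[OF s'M, of L J "\<lambda>_. n"]) (use s'(3) in \<open>auto simp: J_def\<close>)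
  define pos where "pos t i x = (if x < n then av t i x else wv (x - n))" for t i x
  define \<psi> where "\<psi> t = And (subst (pos t 0) \<phi>) (Neg (subst (pos t 1) \<phi>))" for t
  have wf\<psi>: "wf_fm L (\<psi> t)" for t using \<phi> by (simp add: \<psi>_def formula_def)
  have fv\<phi>: "x < n + m" if "x \<in> fv \<phi>" for x using \<phi> that by (auto simp: formula_def)
  have fv\<psi>: "fv (\<psi> t) \<inter> range wv \<subseteq> wv ` {..<m}" for t
  proof -
    have "fv (\<psi> t) \<subseteq> pos t 0 ` fv \<phi> \<union> pos t 1 ` fv \<phi>" using fv_subst by (auto simp: \<psi>_def)
    moreover have "y \<in> wv ` {..<m}" if "y \<in> pos t i ` fv \<phi>" "y \<in> range wv" for y i
    proof -
      obtain x where x: "y = pos t i x" "x \<in> fv \<phi>" using \<open>y \<in> pos t i ` fv \<phi>\<close> by blast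
      then have "\<not> x < n" using that(2) by (auto simp: pos_def)
      then show ?thesis using x fv\<phi>[OF x(2)] by (auto simp: pos_def)
    qed
    ultimately show ?thesis by blast
  qed
  have sat_pos: "sat M \<sigma> (subst (pos t i) \<phi>) \<longleftrightarrow>
      sat_at M \<phi> (map (\<lambda>k. \<sigma> (av t i k)) [0..<n] @ map (\<lambda>j. \<sigma> (wv j)) [0..<m])"
    if "range \<sigma> \<subseteq> carrier M" for \<sigma> t i
  proof -
    have "sat M \<sigma> (subst (pos t i) \<phi>) \<longleftrightarrow> sat M (\<lambda>x. \<sigma> (pos t i x)) \<phi>"
      by (rule sat_subst) (use that in auto)
    also have "\<dots> \<longleftrightarrow> sat_at M \<phi> (map (\<lambda>k. \<sigma> (av t i k)) [0..<n] @ map (\<lambda>j. \<sigma> (wv j)) [0..<m])"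
      by (rule sat_cong) (use fv\<phi> in \<open>fastforce simp: pos_def nth_append\<close>)
    finally show ?thesis .
  qed
  have "\<exists>s''\<in>assignments_over M (- wv ` {..<m}) s'. \<forall>\<theta>\<in>range \<psi>. sat M s'' \<theta>"
  proof (rule saturated_assignment[OF sat1])
    fix \<Gamma>0 assume "finite \<Gamma>0" "\<Gamma>0 \<subseteq> range \<psi>"
    from finite_subset_image[OF this] obtain D where D: "finite D" "\<Gamma>0 = \<psi> ` D" by blast
    obtain Dl where Dl: "set Dl = D" using finite_list[OF D(1)] by blast
    \<comment> \<open>That a single tuple separates the first two entries of all rows in
      \<open>D\<close> is a formula about the array alone. It holds under every reindexing of
      \<open>s\<close>, so it survives the extraction.\<close>
    define \<theta> where "\<theta> = ExL (map wv [0..<m]) (ConjL (map \<psi> Dl))"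
    have "sat M s' \<theta>"
    proof (rule s'(2))
      show "wf_fm L \<theta>" using wf\<psi> by (simp add: \<theta>_def)
      fix h :: "nat \<Rightarrow> nat \<Rightarrow> nat" assume h: "\<And>t. strict_mono (h t)"
      \<comment> \<open>The pattern selects, in each row, the position that has become the first
        one, and nothing else.\<close>
      define S where "S = {prod_encode (t, h t 0) | t. True}"
      define \<sigma> where "\<sigma> = assign (\<lambda>t i k. s (av t (h t i) k)) (\<lambda>j. if j < m then b S ! j else c)"
      have \<sigma>M: "range \<sigma> \<subseteq> carrier M"
      proof -
        have "\<sigma> x \<in> carrier M" for x
        proof (rule var_cases[of x])
          fix j assume "x = wv j"
          then show ?thesis using lb[of S] nth_mem[of j "b S"] c by (auto simp: \<sigma>_def)
        qed (use sM in \<open>simp add: \<sigma>_def\<close>)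
        then show ?thesis by blast
      qed
      have \<sigma>a: "map (\<lambda>k. \<sigma> (av t i k)) [0..<n] = a (prod_encode (t, h t i))" for t i
        by (rule nth_equalityI) (use la in \<open>auto simp: \<sigma>_def s_def\<close>)
      have \<sigma>b: "map (\<lambda>j. \<sigma> (wv j)) [0..<m] = b S"
        by (rule nth_equalityI) (use lb in \<open>auto simp: \<sigma>_def\<close>)
      have "sat M \<sigma> (\<psi> t)" for t
      proof -
        have "h t 0 < h t 1" using h by (simp add: strict_mono_def)
        then have "prod_encode (t, h t 0) \<in> S" "prod_encode (t, h t 1) \<notin> S"
          by (auto simp: S_def prod_encode_eq)
        then show ?thesis unfolding \<psi>_def And_simps sat.simps sat_pos[OF \<sigma>M] \<sigma>a \<sigma>b ab(3) by simp
      qed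
      moreover have "\<forall>x. x \<notin> set (map wv [0..<m]) \<longrightarrow> \<sigma> x = (s \<circ> reindex h) x"
      proof (intro allI impI)
        fix x assume x: "x \<notin> set (map wv [0..<m])"
        show "\<sigma> x = (s \<circ> reindex h) x"
          by (rule var_cases[of x]) (use x in \<open>auto simp: \<sigma>_def s_def\<close>)
      qed
      ultimately show "sat M (s \<circ> reindex h) \<theta>"
        unfolding \<theta>_def sat_ExL using \<sigma>M by (intro exI[of _ \<sigma>]) auto
    qed
    then obtain s'' where s'': "\<forall>x. x \<notin> set (map wv [0..<m]) \<longrightarrow> s'' x = s' x"
      "\<forall>x\<in>set (map wv [0..<m]). s'' x \<in> carrier M" "sat M s'' (ConjL (map \<psi> Dl))"
      unfolding \<theta>_def sat_ExL by (elim exE conjE) (rule that)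
    have "s'' x \<in> carrier M" for x using s''(1,2) s'M by (cases "x \<in> set (map wv [0..<m])") auto
    then have "s'' \<in> assignments_over M (- wv ` {..<m}) s'" using s''(1)
      by (auto simp: assignments_over_def atLeast0LessThan)
    then show "\<exists>s''\<in>assignments_over M (- wv ` {..<m}) s'. \<forall>\<theta>\<in>\<Gamma>0. sat M s'' \<theta>"
      using s''(3) D(2) Dl by (intro bexI[of _ s'']) auto
  qed (use wf\<psi> in auto)
  then obtain s'' where s'': "s'' \<in> assignments_over M (- wv ` {..<m}) s'" "\<And>t. sat M s'' (\<psi> t)" by blast
  have s''M: "range s'' \<subseteq> carrier M" using s''(1) by (simp add: assignments_over_def)
  define bs where "bs = map (\<lambda>j. s'' (wv j)) [0..<m]"
  have "s'' (av t i k) = s' (av t i k)" for t i k using s''(1) by (auto simp: assignments_over_def)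
  then have J'': "map (\<lambda>k. s'' (av t i k)) [0..<n] = J t i" for t i by (simp add: J_def)
  have dist: "sat_at M \<phi> (J t 0 @ bs)" "\<not> sat_at M \<phi> (J t 1 @ bs)" for t
    using s''(2)[of t] unfolding \<psi>_def And_simps sat.simps sat_pos[OF s''M] J'' bs_def by simp_all
  have "realizes M m {(Equal (Var i) (Var i), []) | i. i < m} bs"
    using s''M by (auto simp: realizes_def tuples_def bs_def)
  then obtain t where "indiscernible L M ({} \<union> set bs) (J t)"
    using dp[of m] mi unfolding dp_rank_less_def by blast
  then have "sat_at M \<phi> (J t 0 @ bs) \<longleftrightarrow> sat_at M \<phi> (J t 1 @ bs)"
    by (rule indiscernible_pair) (use \<phi> in \<open>simp_all add: J_def bs_def\<close>)
  then show False using dist by blast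
qed

section \<open>The dp-rank of the colored theory\<close>

context T_alpha_monster
begin

abbreviation "LC \<equiv> colored_language L"

lemma elem_colored:
  assumes "elem LC M X f"
  shows "elem L R X f" "x \<in> X \<Longrightarrow> f x \<in> C \<longleftrightarrow> x \<in> C"
proof -
  have "sat R s \<phi> \<longleftrightarrow> sat R (f \<circ> s) \<phi>" if "wf_fm L \<phi>" "s ` fv \<phi> \<subseteq> X" for \<phi> s
    using elemD[OF assms, of "lift \<phi>" s] that by simp
  then show "elem L R X f" using assms by (simp add: elem_def)
  assume x: "x \<in> X"
  have "sat M (\<lambda>_. x) (Col 0) \<longleftrightarrow> sat M (f \<circ> (\<lambda>_. x)) (Col 0)"
    by (rule elemD[OF assms]) (use x in auto)
  moreover have "x \<in> carrier M" "f x \<in> carrier M" using x assms by (auto simp: elem_def)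
  ultimately show "f x \<in> C \<longleftrightarrow> x \<in> C" by (simp add: colored_def)
qed

lemma \<delta>_elem_colored:
  assumes "elem LC M X f" "finite X" shows "\<delta> (f ` X) = \<delta> X"
  using \<delta>_elem(1) elem_colored[OF assms(1)] assms(2) by blast

text \<open>An extension of \<open>f\<close> maps a hull of \<open>Z\<close> to a superset of the
  image of \<open>Z\<close>, with the same predimension. Applied to the inverse map as well, this
  shows that \<open>dd\<close> is invariant.\<close>

lemma dd_elem_le:
  assumes f: "elem LC M Z f" and Z: "finite Z" shows "dd (f ` Z) \<le> dd Z"
proof -
  have ZM: "Z \<subseteq> carrier M" using f by (simp add: elem_def)
  obtain E where E: "finite E" "Z \<subseteq> E" "E \<subseteq> carrier M" "\<delta> E = int (dd Z)" by (rule hull[OF Z ZM], rule that)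
  obtain g where g: "elem LC M E g" "\<And>x. x \<in> Z \<Longrightarrow> g x = f x"
    by (rule elem_extend[OF sat_M f E(2,3) countable_finite[OF E(1)]], rule that)
  have "f ` Z = g ` Z" using g(2) by auto
  then have "f ` Z \<subseteq> g ` E" using E(2) by auto
  moreover have "g ` E \<subseteq> carrier M" using g(1) by (simp add: elem_def)
  ultimately have "int (dd (f ` Z)) \<le> \<delta> (g ` E)" using E(1) by (intro dd_le) simp_all
  then show ?thesis using \<delta>_elem_colored[OF g(1) E(1)] E(4) by simp
qed

lemma dd_elem:
  assumes f: "elem LC M Z f" and Z: "finite Z" shows "dd (f ` Z) = dd Z"
proof (rule antisym)
  show "dd (f ` Z) \<le> dd Z" by (rule dd_elem_le[OF f Z])
  have "inv_into Z f ` f ` Z = Z" using elem_inj[OF f] by simp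
  then show "dd Z \<le> dd (f ` Z)" using dd_elem_le[OF elem_inv[OF f]] Z by simp
qed

text \<open>A minimal closed superset is finite but has no canonical enumeration; the enumerations appended
  to the entries are made coherent by extraction.\<close>

lemma closed_array:
  assumes mi: "mutually_indiscernible LC M A (UNIV :: nat set) I"
    and I: "\<And>t. range (I t) \<subseteq> tuples M (n t)" and A: "finite A" "A \<subseteq> carrier M"
  obtains J e where "mutually_indiscernible LC M {} (UNIV :: nat set) J"
    "\<And>t i. length (J t i) = n t + e t" "\<And>t i. set (J t i) \<subseteq> carrier M"
    "\<And>t i k. k < n t \<Longrightarrow> J t i ! k = I t i ! k"
    "\<And>t i. \<delta> (set (J t i) \<union> A) = int (dd (set (I t i) \<union> A))"
    "\<And>t k. k < n t + e t \<Longrightarrow> J t 0 ! k \<in> C \<longleftrightarrow> J t 1 ! k \<in> C"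
proof -
  have lI: "length (I t i) = n t" "set (I t i) \<subseteq> carrier M" for t i using I[of t] by (auto simp: tuples_def)
  obtain al where al: "set al = A" using finite_list[OF A(1)] by blast
  obtain c where c: "c \<in> carrier M" using R_models by (auto simp: models_def is_structure_def)
  \<comment> \<open>A hull is chosen only for the entry at position 0 of each row. Those at the
    other positions are its elementary images, so they have the same size and a matching
    enumeration.\<close>
  have "\<forall>t. \<exists>E. finite E \<and> set (I t 0) \<union> A \<subseteq> E \<and> E \<subseteq> carrier M \<and> \<delta> E = int (dd (set (I t 0) \<union> A))"
  proof
    fix t
    have ZM: "finite (set (I t 0) \<union> A)" "set (I t 0) \<union> A \<subseteq> carrier M" using lI A by auto
    obtain E where "finite E" "set (I t 0) \<union> A \<subseteq> E" "E \<subseteq> carrier M"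
      "\<delta> E = int (dd (set (I t 0) \<union> A))" by (rule hull[OF ZM], rule that)
    then show "\<exists>E. finite E \<and> set (I t 0) \<union> A \<subseteq> E \<and> E \<subseteq> carrier M \<and> \<delta> E = int (dd (set (I t 0) \<union> A))"
      by (intro exI conjI)
  qed
  from choice[OF this] obtain E where
    E': "\<forall>t. finite (E t) \<and> set (I t 0) \<union> A \<subseteq> E t \<and> E t \<subseteq> carrier M \<and> \<delta> (E t) = int (dd (set (I t 0) \<union> A))"
    by (rule exE)
  have E: "\<And>t. finite (E t)" "\<And>t. set (I t 0) \<union> A \<subseteq> E t" "\<And>t. E t \<subseteq> carrier M"
    "\<And>t. \<delta> (E t) = int (dd (set (I t 0) \<union> A))" using E' by simp_all
  have "\<forall>t. \<exists>l. set l = E t" using finite_list[OF E(1)] by (rule allI)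
  from choice[OF this] obtain el where "\<forall>t. set (el t) = E t" by (rule exE)
  then have el: "set (el t) = E t" for t by (rule spec)
  define e where "e t = length (el t)" for t
  define r where "r = length al"
  define w where "w j = (if j < r then al ! j else c)" for j
  have wA: "w j \<in> A" if "j < r" for j using that al nth_mem[of j al] by (simp add: w_def r_def)
  have wM: "w j \<in> carrier M" for j using wA[of j] A c by (cases "j < r") (auto simp: w_def)
  define s0 where "s0 = assign (\<lambda>t i k. if k < n t then I t i ! k else c) w"
  define P where "P = {av t i k | t i k. k < n t} \<union> wv ` {..<r}"
  have IM: "I t i ! k \<in> carrier M" if "k < n t" for t i k using lI[of t i] nth_mem[of k "I t i"] that by auto
  have inv0: "sat M s \<phi> \<longleftrightarrow> sat M (s \<circ> reindex h) \<phi>"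
    if "wf_fm LC \<phi>" "fv \<phi> \<subseteq> P" "\<And>t. strict_mono (h t)"
      "\<And>t i k. k < n t \<Longrightarrow> s (av t i k) = I t i ! k" "\<And>j. j < r \<Longrightarrow> s (wv j) = w j" for \<phi> h s
    by (rule mutually_indiscernible_reindex[OF mi I A(2), of s r]) (use that wA in \<open>simp_all add: P_def\<close>)
  \<comment> \<open>By indiscernibility over \<open>A\<close> the map that fixes \<open>A\<close>
    and takes the entry at 0 to the entry at \<open>i\<close> is elementary; saturation extends it
    to the hull.\<close>
  have ex_G: "\<exists>g. elem LC M (E t) g \<and> (\<forall>k<n t. g (I t 0 ! k) = I t i ! k) \<and> (\<forall>x\<in>A. g x = x)" for t i
  proof -
    define V where "V = {av t 0 k | k. k < n t} \<union> wv ` {..<r}"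
    define h where "h = (\<lambda>(_ :: nat) j. j + i)"
    have h: "strict_mono (h t')" for t' by (simp add: h_def strict_mono_def)
    have s0V: "s0 x \<in> set (I t 0) \<union> A" "(s0 \<circ> reindex h) x \<in> carrier M" if "x \<in> V" for x
      using that wA wM IM lI by (auto simp: V_def s0_def)
    have "set (I t 0) \<union> A \<subseteq> carrier M" using lI(2) A(2) by simp
    then have a1: "s0 ` V \<subseteq> carrier M" "(s0 \<circ> reindex h) ` V \<subseteq> carrier M"
      using s0V by blast+
    have a2: "sat M (s0 \<circ> reindex h) \<phi>" if "wf_fm LC \<phi>" "fv \<phi> \<subseteq> V" "sat M s0 \<phi>" for \<phi>
    proof -
      have "fv \<phi> \<subseteq> P" using that(2) by (auto simp: V_def P_def)
      then show ?thesis using inv0[OF that(1) _ h, of s0] that(3) by (simp add: s0_def)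
    qed
    obtain f where f: "elem LC M (s0 ` V) f" "\<And>v. v \<in> V \<Longrightarrow> f (s0 v) = (s0 \<circ> reindex h) v"
      by (rule elem_of_assignments[OF a1 a2], assumption, assumption, assumption, rule that)
    have "s0 ` V = set (I t 0) \<union> A"
    proof
      show "s0 ` V \<subseteq> set (I t 0) \<union> A" using s0V by blast
      have "x \<in> s0 ` V" if x: "x \<in> set (I t 0)" for x
      proof -
        obtain k where k: "k < n t" "x = I t 0 ! k" using x lI(1)[of t 0] by (auto simp: in_set_conv_nth)
        then have "x = s0 (av t 0 k)" "av t 0 k \<in> V" by (auto simp: s0_def V_def)
        then show ?thesis by blast
      qed
      moreover have "x \<in> s0 ` V" if x: "x \<in> A" for x
      proof -
        obtain j where "j < r" "x = al ! j" using x al by (auto simp: in_set_conv_nth r_def)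
        then have "x = s0 (wv j)" "wv j \<in> V" by (auto simp: s0_def w_def V_def)
        then show ?thesis by blast
      qed
      ultimately show "set (I t 0) \<union> A \<subseteq> s0 ` V" by blast
    qed
    then have sub: "s0 ` V \<subseteq> E t" using E(2) by simp
    obtain g where g: "elem LC M (E t) g" "\<And>x. x \<in> s0 ` V \<Longrightarrow> g x = f x"
      by (rule elem_extend[OF sat_M f(1) sub E(3) countable_finite[OF E(1)]], rule that)
    have "g (I t 0 ! k) = I t i ! k" if "k < n t" for k
    proof -
      have v: "av t 0 k \<in> V" using that by (auto simp: V_def)
      then have "g (s0 (av t 0 k)) = (s0 \<circ> reindex h) (av t 0 k)" using g(2) f(2) by auto
      then show ?thesis using that by (simp add: s0_def h_def)
    qed
    moreover have "g x = x" if x: "x \<in> A" for x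
    proof -
      obtain j where j: "j < r" "x = al ! j" using x al by (auto simp: in_set_conv_nth r_def)
      then have v: "wv j \<in> V" by (auto simp: V_def)
      then have "g (s0 (wv j)) = (s0 \<circ> reindex h) (wv j)" using g(2) f(2) by auto
      then show ?thesis using j by (simp add: s0_def w_def)
    qed
    ultimately show ?thesis using g(1) by blast
  qed
  define G where "G t i = (SOME g. elem LC M (E t) g \<and> (\<forall>k<n t. g (I t 0 ! k) = I t i ! k) \<and> (\<forall>x\<in>A. g x = x))" for t i
  have "elem LC M (E t) (G t i) \<and> (\<forall>k<n t. G t i (I t 0 ! k) = I t i ! k) \<and> (\<forall>x\<in>A. G t i x = x)" for t i
    unfolding G_def by (rule someI_ex[OF ex_G])
  then have G: "\<And>t i. elem LC M (E t) (G t i)" "\<And>t i k. k < n t \<Longrightarrow> G t i (I t 0 ! k) = I t i ! k"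
    "\<And>t i x. x \<in> A \<Longrightarrow> G t i x = x" by blast+
  define s where "s = assign (\<lambda>t i k. if k < n t then I t i ! k else
     if k < n t + e t then G t i (el t ! (k - n t)) else c) w"
  have elE: "el t ! (k - n t) \<in> E t" if "\<not> k < n t" "k < n t + e t" for t k
    using that nth_mem[of "k - n t" "el t"] el by (simp add: e_def)
  have sM: "s x \<in> carrier M" for x
  proof (rule var_cases[of x])
    fix t i k assume x: "x = av t i k"
    have "G t i y \<in> carrier M" if "y \<in> E t" for y using G(1)[of t i] that by (auto simp: elem_def)
    then show ?thesis using x IM c elE by (simp add: s_def)
  qed (simp add: s_def wM)
  have srange: "range s \<subseteq> carrier M" using sM by blast
  \<comment> \<open>The original entries and the elements of \<open>A\<close> are kept, since
    invariance holds for them already. Only the enumerations of the hulls are replaced.\<close>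
  obtain s' where s'0: "s' \<in> assignments_over M P s"
    "\<forall>\<phi>. wf_fm LC \<phi> \<longrightarrow> (\<forall>h. (\<forall>t. strict_mono (h t)) \<longrightarrow> sat M (s \<circ> reindex h) \<phi>) \<longrightarrow> sat M s' \<phi>"
    "\<forall>\<phi> h. wf_fm LC \<phi> \<longrightarrow> (\<forall>t. strict_mono (h t)) \<longrightarrow> (sat M s' \<phi> \<longleftrightarrow> sat M (s' \<circ> reindex h) \<phi>)"
  proof (rule extract_reindex_invariant[OF sat_M srange])
    show "sat M s \<phi> \<longleftrightarrow> sat M (s \<circ> reindex h) \<phi>"
      if "wf_fm LC \<phi>" "fv \<phi> \<subseteq> P" "\<And>t. strict_mono (h t)" for \<phi> h
      by (rule inv0[OF that]) (simp_all add: s_def)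
  qed (rule that)
  note s' = s'0[rule_format]
  have s'M: "range s' \<subseteq> carrier M" using s'(1) by (simp add: assignments_over_def)
  have s'P: "s' x = s x" if "x \<in> P" for x using s'(1) that by (simp add: assignments_over_def)
  define J where "J t i = map (\<lambda>k. s' (av t i k)) [0..<n t + e t]" for t i
  have lJ: "length (J t i) = n t + e t" for t i by (simp add: J_def)
  show thesis
  proof (rule that[of J e])
    show "mutually_indiscernible LC M {} (UNIV :: nat set) J"
      by (rule reindex_mutually_indiscernible[OF s'M, of LC J "\<lambda>t. n t + e t"]) (use s'(3) in \<open>auto simp: J_def\<close>)
    show "length (J t i) = n t + e t" for t i by (rule lJ)
    show "set (J t i) \<subseteq> carrier M" for t i using s'M by (auto simp: J_def)
    show J_I: "J t i ! k = I t i ! k" if "k < n t" for t i k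
    proof -
      have "av t i k \<in> P" using that by (auto simp: P_def)
      then show ?thesis using that s'P by (simp add: J_def s_def)
    qed
    show "J t 0 ! k \<in> C \<longleftrightarrow> J t 1 ! k \<in> C" if "k < n t + e t" for t k
    proof -
      have "sat M s' (Col (av t 0 k)) \<longleftrightarrow> sat M (s' \<circ> reindex (\<lambda>_ j. j + 1)) (Col (av t 0 k))"
        by (rule s'(3)) (simp_all add: strict_mono_def)
      moreover have "s' (av t 0 k) \<in> carrier M" "s' (av t 1 k) \<in> carrier M" using s'M by auto
      ultimately show ?thesis using that by (simp add: J_def colored_def)
    qed
    fix t i :: nat
    define V where "V = {av t 0 k | k. k < n t + e t} \<union> wv ` {..<r}"
    define h where "h = (\<lambda>(_ :: nat) j. j + i)"
    have h: "strict_mono (h t')" for t' by (simp add: h_def strict_mono_def)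
    define \<tau> where "\<tau> = assign (\<lambda>t i k. if k < n t then I t 0 ! k else if k < n t + e t then el t ! (k - n t) else c) w"
    have \<tau>E: "\<tau> ` V = E t"
    proof
      have "\<tau> v \<in> E t" if v: "v \<in> V" for v
      proof (rule var_cases[of v])
        fix t' i k assume "v = av t' i k"
        then have v': "v = av t 0 k" "k < n t + e t" using v by (auto simp: V_def)
        show ?thesis
        proof (cases "k < n t")
          case True
          then have "I t 0 ! k \<in> set (I t 0)" using lI(1)[of t 0] by simp
          then show ?thesis using v' True E(2)[of t] by (auto simp: \<tau>_def)
        next
          case False
          then show ?thesis using v' elE by (simp add: \<tau>_def)
        qed
      next
        fix j assume "v = wv j"
        then have "j < r" "\<tau> v = w j" using v by (auto simp: V_def \<tau>_def)
        then show ?thesis using wA[of j] E(2)[of t] by auto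
      qed
      then show "\<tau> ` V \<subseteq> E t" by blast
      show "E t \<subseteq> \<tau> ` V"
      proof
        fix x assume "x \<in> E t"
        then obtain k where k: "k < e t" "x = el t ! k" unfolding el[symmetric] e_def by (auto simp: in_set_conv_nth)
        then have "x = \<tau> (av t 0 (n t + k))" "av t 0 (n t + k) \<in> V" by (auto simp: \<tau>_def V_def)
        then show "x \<in> \<tau> ` V" by blast
      qed
    qed
    \<comment> \<open>What is true of the hull at position 0 is true of each of its images under
      \<open>G\<close>, hence under every reindexing, and therefore holds after the extraction
      too.\<close>
    have imp: "sat M (s' \<circ> reindex h) \<phi>" if \<phi>: "wf_fm LC \<phi>" "fv \<phi> \<subseteq> V" "sat M \<tau> \<phi>" for \<phi>
    proof -
      have "sat M s' \<phi>"
      proof (rule s'(2)[OF \<phi>(1)])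
        fix h' :: "nat \<Rightarrow> nat \<Rightarrow> nat" assume "\<And>t. strict_mono (h' t)"
        have "sat M (G t (h' t 0) \<circ> \<tau>) \<phi>"
          by (rule elemD[OF G(1) \<phi>(1), THEN iffD1]) (use \<phi>(2,3) \<tau>E in auto)
        moreover have "(G t (h' t 0) \<circ> \<tau>) v = (s \<circ> reindex h') v" if "v \<in> V" for v
          using that wA G(2,3) by (auto simp: V_def \<tau>_def s_def)
        ultimately show "sat M (s \<circ> reindex h') \<phi>"
          by (elim sat_cong[THEN iffD1, rotated]) (use \<phi>(2) in blast)
      qed
      then show ?thesis using s'(3)[OF \<phi>(1), of h, OF h] by blast
    qed
    have VM: "\<tau> ` V \<subseteq> carrier M" "(s' \<circ> reindex h) ` V \<subseteq> carrier M" using \<tau>E E(3) s'M by auto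
    obtain f where f: "elem LC M (\<tau> ` V) f" "\<And>v. v \<in> V \<Longrightarrow> f (\<tau> v) = (s' \<circ> reindex h) v"
      by (rule elem_of_assignments[OF VM imp], assumption, assumption, assumption, rule that)
    note fE = f(1)[unfolded \<tau>E]
    have wvP: "s' (wv j) = w j" if "j < r" for j
      using s'P[of "wv j"] that by (simp add: P_def s_def)
    have imE: "f ` E t = set (J t i) \<union> A"
    proof -
      have "f ` E t = (s' \<circ> reindex h) ` V" unfolding \<tau>E[symmetric] image_image using f(2) by (intro image_cong) auto
      also have "\<dots> = (\<lambda>k. s' (av t i k)) ` {..<n t + e t} \<union> w ` {..<r}"
      proof -
        have "V = av t 0 ` {..<n t + e t} \<union> wv ` {..<r}" by (auto simp: V_def)
        moreover have "(\<lambda>j. s' (wv j)) ` {..<r} = w ` {..<r}" by (rule image_cong) (simp_all add: wvP)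
        ultimately show ?thesis by (simp add: image_Un image_image h_def)
      qed
      also have "w ` {..<r} = A"
      proof -
        have "w ` {..<r} = (!) al ` {..<length al}" by (rule image_cong) (simp_all add: w_def r_def)
        then show ?thesis using al by (auto simp: set_conv_nth)
      qed
      also have "(\<lambda>k. s' (av t i k)) ` {..<n t + e t} = set (J t i)" by (simp add: J_def atLeast0LessThan)
      finally show ?thesis .
    qed
    have fI: "f (I t 0 ! k) = I t i ! k" if "k < n t" for k
    proof -
      have "av t 0 k \<in> V" "\<tau> (av t 0 k) = I t 0 ! k" using that by (auto simp: V_def \<tau>_def)
      then have "f (I t 0 ! k) = s' (av t i k)" using f(2)[of "av t 0 k"] by (simp add: h_def)
      then show ?thesis using J_I[OF that, of i] that by (simp add: J_def)
    qed
    have fA: "f x = x" if x: "x \<in> A" for x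
    proof -
      obtain j where j: "j < r" "x = al ! j" using x al by (auto simp: in_set_conv_nth r_def)
      then have "wv j \<in> V" "\<tau> (wv j) = x" by (auto simp: V_def \<tau>_def w_def)
      then show ?thesis using f(2)[of "wv j"] wvP[OF j(1)] j by (simp add: w_def)
    qed
    have imI: "f ` (set (I t 0) \<union> A) = set (I t i) \<union> A"
    proof -
      have "f ` set (I t 0) = (\<lambda>k. f (I t 0 ! k)) ` {..<n t}"
        using lI(1)[of t 0] by (auto simp: set_conv_nth image_def)
      also have "\<dots> = (!) (I t i) ` {..<n t}" by (rule image_cong) (simp_all add: fI)
      also have "\<dots> = set (I t i)" using lI(1)[of t i] by (auto simp: set_conv_nth)
      finally show ?thesis using fA by (simp add: image_Un)
    qed
    have "\<delta> (set (J t i) \<union> A) = \<delta> (E t)" using \<delta>_elem_colored[OF fE E(1)] imE by simp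
    also have "\<dots> = int (dd (set (I t 0) \<union> A))" by (rule E(4))
    also have "dd (set (I t 0) \<union> A) = dd (set (I t i) \<union> A)"
      using dd_elem[OF elem_subset[OF fE E(2)]] A(1) imI by simp
    finally show "\<delta> (set (J t i) \<union> A) = int (dd (set (I t i) \<union> A))" .
  qed
qed

lemma dp_rank_colored:
  assumes sd: "strongly_dependent U L T"
  shows "dp_rank_less LC M n0 {(Equal (Var i) (Var i), []) | i. i < n0} {} (UNIV :: nat set)"
  unfolding dp_rank_less_def
proof (intro allI impI, elim conjE)
  fix I :: "nat \<Rightarrow> nat \<Rightarrow> 'u list" and bs
  assume mi: "mutually_indiscernible LC M {} UNIV I"
    and bs: "realizes M n0 {(Equal (Var i) (Var i), []) | i. i < n0} bs"
  have bsM: "set bs \<subseteq> carrier M" using bs by (simp add: realizes_def tuples_def)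
  show "\<exists>t\<in>UNIV. indiscernible LC M ({} \<union> set bs) (I t)"
  proof (rule ccontr)
    assume neg: "\<not> ?thesis"
    have "\<exists>n. range (I t) \<subseteq> tuples M n" for t using mi by (auto simp: mutually_indiscernible_def indiscernible_def)
    then have "\<forall>t. \<exists>n. range (I t) \<subseteq> tuples M n" by (rule allI)
    from choice[OF this] obtain n where "\<forall>t. range (I t) \<subseteq> tuples M (n t)" by (rule exE)
    then have n: "range (I t) \<subseteq> tuples M (n t)" for t by (rule spec)
    define good where "good t blk m \<phi> as \<longleftrightarrow> (\<forall>i. sorted_wrt (<) (blk i)) \<and> (\<forall>i. length (blk i) = m) \<and>
      (\<forall>i j a b. i < j \<longrightarrow> a \<in> set (blk i) \<longrightarrow> b \<in> set (blk j) \<longrightarrow> a < b) \<and>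
      set as \<subseteq> set bs \<and> formula LC (m * n t + length as) \<phi> \<and>
      sat_at M \<phi> (concat (map (I t) (blk 0)) @ as) \<noteq> sat_at M \<phi> (concat (map (I t) (blk (Suc 0))) @ as)"
      for t blk m \<phi> as
    have "\<forall>t. \<exists>z. good t (fst z) (fst (snd z)) (fst (snd (snd z))) (snd (snd (snd z)))"
    proof
      fix t
      have neg_t: "\<not> indiscernible LC M (set bs) (I t)" using neg by auto
      obtain blk m \<phi> as where
        "\<And>i. sorted_wrt (<) (blk i)" "\<And>i. length (blk i) = m"
        "\<And>i j a b. i < j \<Longrightarrow> a \<in> set (blk i) \<Longrightarrow> b \<in> set (blk j) \<Longrightarrow> a < b"
        "set as \<subseteq> set bs" "formula LC (m * n t + length as) \<phi>"
        "sat_at M \<phi> (concat (map (I t) (blk 0)) @ as) \<noteq> sat_at M \<phi> (concat (map (I t) (blk (Suc 0))) @ as)"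
        by (rule distinguishing_blocks[OF neg_t n], rule that)
      then have "good t blk m \<phi> as" unfolding good_def by (intro conjI allI impI)
      then show "\<exists>z. good t (fst z) (fst (snd z)) (fst (snd (snd z))) (snd (snd (snd z)))"
        by (intro exI[of _ "(blk, m, \<phi>, as)"]) simp
    qed
    from choice[OF this] obtain z where
      z: "\<forall>t. good t (fst (z t)) (fst (snd (z t))) (fst (snd (snd (z t)))) (snd (snd (snd (z t))))" by (rule exE)
    define blk where "blk t = fst (z t)" for t
    define m where "m t = fst (snd (z t))" for t
    define \<phi> where "\<phi> t = fst (snd (snd (z t)))" for t
    define as where "as t = snd (snd (snd (z t)))" for t
    have good: "good t (blk t) (m t) (\<phi> t) (as t)" for t using z by (simp add: blk_def m_def \<phi>_def as_def)
    have blk: "\<And>t i. sorted_wrt (<) (blk t i)" "\<And>t i. length (blk t i) = m t"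
      "\<And>t i j a b. i < j \<Longrightarrow> a \<in> set (blk t i) \<Longrightarrow> b \<in> set (blk t j) \<Longrightarrow> a < b"
      and dist: "\<And>t. set (as t) \<subseteq> set bs" "\<And>t. formula LC (m t * n t + length (as t)) (\<phi> t)"
      "\<And>t. sat_at M (\<phi> t) (concat (map (I t) (blk t 0)) @ as t) \<noteq>
        sat_at M (\<phi> t) (concat (map (I t) (blk t (Suc 0))) @ as t)"
    proof -
      note g = good[unfolded good_def]
      show "sorted_wrt (<) (blk t i)" "length (blk t i) = m t" for t i using g by simp_all
      show "a < b" if "i < j" "a \<in> set (blk t i)" "b \<in> set (blk t j)" for t i j a b
        using g[of t, THEN conjunct2, THEN conjunct2, THEN conjunct1] that by simp
      note g3 = g[THEN conjunct2, THEN conjunct2, THEN conjunct2]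
      show "set (as t) \<subseteq> set bs" for t by (rule g3[THEN conjunct1])
      show "formula LC (m t * n t + length (as t)) (\<phi> t)" for t by (rule g3[THEN conjunct2, THEN conjunct1])
      show "sat_at M (\<phi> t) (concat (map (I t) (blk t 0)) @ as t) \<noteq>
          sat_at M (\<phi> t) (concat (map (I t) (blk t (Suc 0))) @ as t)" for t
        by (rule g3[THEN conjunct2, THEN conjunct2])
    qed
    define B where "B t i = concat (map (I t) (blk t i))" for t i
    have lI: "length (I t i) = n t" "set (I t i) \<subseteq> carrier M" for t i using n[of t] by (auto simp: tuples_def)
    have lB: "length (B t i) = m t * n t" for t i
    proof -
      have "length (concat (map (I t) xs)) = length xs * n t" for xs by (induction xs) (auto simp: lI)
      then show ?thesis using blk(2) by (simp add: B_def)
    qed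
    have BI: "set (B t i) \<subseteq> (\<Union>i. set (I t i))" for t i by (auto simp: B_def)
    have BM: "set (B t i) \<subseteq> carrier M" for t i using BI[of t i] lI(2) by blast
    have miB: "mutually_indiscernible LC M {} (UNIV :: nat set) B"
      unfolding mutually_indiscernible_def
    proof
      fix t :: nat
      have "indiscernible LC M ({} \<union> (\<Union>s\<in>UNIV - {t}. \<Union>i. set (I s i))) (I t)"
        using mi by (simp add: mutually_indiscernible_def)
      then have "indiscernible LC M ({} \<union> (\<Union>s\<in>UNIV - {t}. \<Union>i. set (I s i))) (B t)"
        unfolding B_def[abs_def] by (rule indiscernible_blocks[of _ _ _ "I t" "blk t" "m t"]) (rule blk, assumption?)+
      then show "indiscernible LC M ({} \<union> (\<Union>s\<in>UNIV - {t}. \<Union>i. set (B s i))) (B t)"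
      proof (rule indiscernible_mono)
        have "(\<Union>s\<in>UNIV - {t}. \<Union>i. set (B s i)) \<subseteq> (\<Union>s\<in>UNIV - {t}. \<Union>i. set (I s i))"
          by (rule UN_mono[OF order_refl], rule UN_least, rule BI)
        then show "{} \<union> (\<Union>s\<in>UNIV - {t}. \<Union>i. set (B s i)) \<subseteq> {} \<union> (\<Union>s\<in>UNIV - {t}. \<Union>i. set (I s i))"
          by simp
      qed
    qed
    define IF where "IF F = (\<Union>(t, i)\<in>F. set (B t i))" for F :: "(nat \<times> nat) set"
    have IF: "finite (IF F)" "IF F \<subseteq> carrier M" if "finite F" for F
      using that BM by (auto simp: IF_def)
    text \<open>For \<open>F\<close> minimizing the following gain in predimension, the union of a closed hull over
      \<open>bs\<close> and a closed hull of any further entry is automatically closed.\<close>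
    define gain where "gain F = dd (IF F \<union> set bs) - dd (IF F)" for F
    obtain F where F: "finite F" "\<And>F'. finite F' \<Longrightarrow> gain F \<le> gain F'"
      using ex_has_least_nat[of finite "{}" gain] by auto
    define A where "A = IF F"
    have A: "finite A" "A \<subseteq> carrier M" using IF[OF F(1)] by (simp_all add: A_def)
    have Abs: "finite (A \<union> set bs)" "A \<union> set bs \<subseteq> carrier M" using A bsM by auto
    obtain E where E: "finite E" "A \<union> set bs \<subseteq> E" "E \<subseteq> carrier M" "\<delta> E = int (dd (A \<union> set bs))"
      by (rule hull[OF Abs], rule that)
    \<comment> \<open>Only the rows from \<open>T0\<close> on are used further. No entry in
      \<open>F\<close> belongs to them, so they are mutually indiscernible over
      \<open>A\<close>.\<close>
    define T0 where "T0 = Suc (Max (insert 0 (fst ` F)))"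
    have T0: "t < T0" if "(t, i) \<in> F" for t i
    proof -
      have "t \<in> insert 0 (fst ` F)" using that by force
      then show ?thesis unfolding T0_def less_Suc_eq_le using F(1) by (intro Max_ge) simp_all
    qed
    define B' where "B' t = B (T0 + t)" for t
    have miB': "mutually_indiscernible LC M A (UNIV :: nat set) B'"
      unfolding mutually_indiscernible_def
    proof
      fix t :: nat
      have "indiscernible LC M ({} \<union> (\<Union>s\<in>UNIV - {T0 + t}. \<Union>i. set (B s i))) (B (T0 + t))"
        using miB by (simp add: mutually_indiscernible_def)
      moreover have "A \<union> (\<Union>s\<in>UNIV - {t}. \<Union>i. set (B' s i)) \<subseteq> {} \<union> (\<Union>s\<in>UNIV - {T0 + t}. \<Union>i. set (B s i))"
      proof -
        have "A \<subseteq> (\<Union>s\<in>UNIV - {T0 + t}. \<Union>i. set (B s i))"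
        proof
          fix x assume "x \<in> A"
          then obtain s i where si: "(s, i) \<in> F" "x \<in> set (B s i)" by (auto simp: A_def IF_def)
          then have "s \<noteq> T0 + t" using T0[OF si(1)] by simp
          then show "x \<in> (\<Union>s\<in>UNIV - {T0 + t}. \<Union>i. set (B s i))" using si(2) by blast
        qed
        moreover have "(\<Union>s\<in>UNIV - {t}. \<Union>i. set (B' s i)) \<subseteq> (\<Union>s\<in>UNIV - {T0 + t}. \<Union>i. set (B s i))"
        proof
          fix x assume "x \<in> (\<Union>s\<in>UNIV - {t}. \<Union>i. set (B' s i))"
          then obtain s i where "s \<noteq> t" "x \<in> set (B (T0 + s) i)" by (auto simp: B'_def)
          then show "x \<in> (\<Union>s\<in>UNIV - {T0 + t}. \<Union>i. set (B s i))" by (intro UN_I[of "T0 + s"] UN_I[of i]) auto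
        qed
        ultimately show ?thesis by simp
      qed
      ultimately show "indiscernible LC M (A \<union> (\<Union>s\<in>UNIV - {t}. \<Union>i. set (B' s i))) (B' t)"
        unfolding B'_def[of t] by (rule indiscernible_mono)
    qed
    define n' where "n' t = m (T0 + t) * n (T0 + t)" for t
    have "B' t i \<in> tuples M (n' t)" for t i
      using lB[of "T0 + t" i] BM[of "T0 + t" i] by (simp add: B'_def n'_def tuples_def)
    then have B'n: "range (B' t) \<subseteq> tuples M (n' t)" for t by blast
    obtain J e where J: "mutually_indiscernible LC M {} (UNIV :: nat set) J"
      "\<And>t i. length (J t i) = n' t + e t" "\<And>t i. set (J t i) \<subseteq> carrier M"
      "\<And>t i k. k < n' t \<Longrightarrow> J t i ! k = B' t i ! k"
      "\<And>t i. \<delta> (set (J t i) \<union> A) = int (dd (set (B' t i) \<union> A))"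
      "\<And>t k. k < n' t + e t \<Longrightarrow> J t 0 ! k \<in> C \<longleftrightarrow> J t 1 ! k \<in> C"
      by (rule closed_array[OF miB' B'n A], rule that)
    \<comment> \<open>Submodularity for \<open>E\<close> and the hull \<open>X\<close> of
      \<open>A\<close> with the new entry, whose intersection contains \<open>A\<close>, bounds the
      predimension of the union by \<open>dd (A \<union> set bs) + dd (IF F') - dd A\<close>. By
      minimality of \<open>gain F\<close> this is at most \<open>dd (IF F' \<union> set bs)\<close>,
      and no set containing \<open>E \<union> X\<close> has smaller predimension than that.\<close>
    have clX: "closed (set (J t i) \<union> E)" for t i
    proof -
      define X where "X = set (J t i) \<union> A"
      define F' where "F' = insert (T0 + t, i) F"
      have F': "finite F'" "IF F' = set (B' t i) \<union> A" using F(1) by (auto simp: F'_def IF_def A_def B'_def)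
      have X: "finite X" "X \<subseteq> carrier M" "A \<subseteq> X" using J(3) A by (auto simp: X_def)
      have BX: "set (B' t i) \<subseteq> X"
      proof
        fix x assume "x \<in> set (B' t i)"
        then obtain k where "k < n' t" "x = B' t i ! k" using lB by (auto simp: in_set_conv_nth B'_def n'_def)
        then show "x \<in> X" using J(2,4) nth_mem[of k "J t i"] by (auto simp: X_def)
      qed
      have EX: "E \<union> X = set (J t i) \<union> E" using E(2) by (auto simp: X_def)
      have fin: "finite (E \<union> X)" "E \<union> X \<subseteq> carrier M" using E X by auto
      have 1: "\<delta> (E \<union> X) + \<delta> (E \<inter> X) \<le> \<delta> E + \<delta> X" by (rule \<delta>_submodular) (use E X in auto)
      have 2: "int (dd A) \<le> \<delta> (E \<inter> X)" by (rule dd_le) (use E X in auto)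
      have 3: "gain F \<le> gain F'" by (rule F(2)[OF F'(1)])
      \<comment> \<open>Monotonicity of \<open>dd\<close> shows that the subtractions in
        \<open>gain\<close> are not truncated.\<close>
      have 4: "dd (IF F) \<le> dd (IF F \<union> set bs)" "dd (IF F') \<le> dd (IF F' \<union> set bs)"
        using IF[OF F(1)] IF[OF F'(1)] bsM by (auto intro!: dd_mono)
      have 5: "dd (IF F' \<union> set bs) \<le> dd (E \<union> X)"
        by (rule dd_mono) (use fin F'(2) BX X(3) E(2) in auto)
      have "\<delta> X = int (dd (IF F'))" using J(5) F'(2) by (simp add: X_def)
      then have "\<delta> (E \<union> X) \<le> int (dd (A \<union> set bs)) + int (dd (IF F')) - int (dd A)"
        using 1 2 E(4) by linarith
      also have "\<dots> \<le> int (dd (IF F' \<union> set bs))" using 3 4 unfolding gain_def A_def by linarith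
      also have "\<dots> \<le> int (dd (E \<union> X))" using 5 by simp
      finally show ?thesis using closed_iff_dd[OF fin] EX by simp
    qed
    have miJ: "mutually_indiscernible L R {} (UNIV :: nat set) J"
      using J(1) indiscernible_reduct unfolding mutually_indiscernible_def by blast
    \<comment> \<open>Strong dependence of \<open>T\<close> is applied to the whole hull
      \<open>E\<close> as a tuple, so that the resulting map will be defined on closed sets.\<close>
    obtain El where El: "set El = E" using finite_list[OF E(1)] by blast
    have "realizes R (length El) {(Equal (Var i) (Var i), []) | i. i < length El} El"
      using E(3) El by (auto simp: realizes_def tuples_def)
    moreover have "dp_rank_less L R (length El) {(Equal (Var i) (Var i), []) | i. i < length El} {} (UNIV :: nat set)"
      using sd R_monster by (simp add: strongly_dependent_def)
    ultimately obtain t where t: "indiscernible L R ({} \<union> set El) (J t)"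
      using miJ unfolding dp_rank_less_def by blast
    define l where "l = n' t + e t + length El"
    define s1 where "s1 i = (!) (J t i @ El)" for i
    have s1im: "s1 i ` {..<l} = set (J t i) \<union> E" for i
    proof -
      have "s1 i ` {..<l} = set (J t i @ El)" unfolding s1_def l_def using J(2)[of t i]
        by (auto simp: set_conv_nth simp del: set_append)
      then show ?thesis using El by simp
    qed
    have sub: "s1 i ` {..<l} \<subseteq> carrier R" for i unfolding s1im using J(3) E(3) by simp
    have imp: "sat R (s1 1) \<psi>" if "wf_fm L \<psi>" "fv \<psi> \<subseteq> {..<l}" "sat R (s1 0) \<psi>" for \<psi>
    proof -
      have "formula L (length (J t 0) + length El) \<psi>" using that J(2) by (simp add: formula_def l_def)
      from indiscernible_pair[OF t _ this, of 1] show ?thesis using that(3) by (simp add: s1_def)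
    qed
    \<comment> \<open>Indiscernibility over \<open>E\<close> gives an \<open>L\<close>-elementary
      map that fixes \<open>E\<close> and takes the first hull of the row to the second. Colors
      agree and both sides are closed, so it is elementary for the colored language as well.\<close>
    obtain f where f: "elem L R (s1 0 ` {..<l}) f" "\<And>v. v \<in> {..<l} \<Longrightarrow> f (s1 0 v) = s1 1 v"
      by (rule elem_of_assignments[OF sub sub imp], assumption, assumption, assumption, rule that)
    define X0 where "X0 = set (J t 0) \<union> E"
    have fX0: "elem L R X0 f" using f(1) s1im by (simp add: X0_def)
    have fJ: "f (J t 0 ! k) = J t 1 ! k" if "k < n' t + e t" for k
      using f(2)[of k] that J(2) by (simp add: s1_def l_def nth_append)
    have fE: "f x = x" if x: "x \<in> E" for x
    proof -
      obtain k where k: "k < length El" "x = El ! k" using x El by (auto simp: in_set_conv_nth)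
      then show ?thesis using f(2)[of "n' t + e t + k"] J(2) by (simp add: s1_def l_def nth_append)
    qed
    have imf: "f ` X0 = set (J t 1) \<union> E"
    proof -
      have "f ` X0 = s1 1 ` {..<l}" unfolding X0_def s1im[of 0, symmetric] image_image using f(2) by (intro image_cong) auto
      then show ?thesis using s1im by simp
    qed
    have "f x \<in> C \<longleftrightarrow> x \<in> C" if "x \<in> X0" for x
    proof (cases "x \<in> E")
      case True
      then show ?thesis using fE by simp
    next
      case False
      then obtain k where "k < n' t + e t" "x = J t 0 ! k" using \<open>x \<in> X0\<close> J(2) by (auto simp: X0_def in_set_conv_nth)
      then show ?thesis using fJ J(6) by simp
    qed
    then have iso: "iso X0 f" using clX[of t 0] clX[of t 1] fX0 imf by (simp add: iso_def X0_def)
    define t1 where "t1 = T0 + t"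
    have form: "formula LC (length (B t1 0) + length (as t1)) (\<phi> t1)" using dist(2)[of t1] lB by simp
    have val: "(B t1 0 @ as t1) ! x \<in> X0 \<and> f ((B t1 0 @ as t1) ! x) = (B t1 1 @ as t1) ! x"
      if "x < length (B t1 0) + length (as t1)" for x
    proof (cases "x < n' t")
      case True
      then have "(B t1 i @ as t1) ! x = J t i ! x" for i
        using J(4)[OF True, of i] lB[of t1] by (simp add: nth_append B'_def t1_def n'_def)
      moreover have "J t 0 ! x \<in> set (J t 0)" using True J(2)[of t 0] by simp
      ultimately show ?thesis using fJ[of x] True by (simp add: X0_def)
    next
      case False
      define y where "y = as t1 ! (x - n' t)"
      have "(B t1 i @ as t1) ! x = y" for i
        using False lB[of t1] by (simp add: nth_append y_def n'_def t1_def)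
      moreover have "y \<in> set (as t1)" using False that lB[of t1] by (simp add: y_def n'_def t1_def)
      then have "y \<in> E" using dist(1)[of t1] E(2) by auto
      ultimately show ?thesis using fE by (simp add: X0_def)
    qed
    have "sat_at M (\<phi> t1) (B t1 0 @ as t1) \<longleftrightarrow> sat M (f \<circ> (!) (B t1 0 @ as t1)) (\<phi> t1)"
      by (rule iso_elementary[OF iso]) (use form val in \<open>auto simp: formula_def\<close>)
    also have "\<dots> \<longleftrightarrow> sat_at M (\<phi> t1) (B t1 1 @ as t1)"
      by (rule sat_cong) (use form val in \<open>auto simp: formula_def\<close>)
    finally show False using dist(3)[of t1] by (simp add: B_def)
  qed
qed

end

theorem theorem4p0p24:
  fixes L :: "('f, 'r) language" and T :: "('f, 'r) fm set" and \<alpha> :: real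
  assumes universe: "(UNIV :: nat set set) \<lesssim> (UNIV :: 'u set)"
    and "countable (funs L)" and "countable (rels L)"
    and "complete_theory TYPE('u) L T"
    and "no_finite_models TYPE('u) L T"
    and "quantifier_elimination TYPE('u) L T"
    and "geometric TYPE('u) L T"
    and "indecomposable TYPE('u) L T"
    and "free_amalgamation TYPE('u) L T"
    and "0 < \<alpha>" and "\<alpha> \<le> 1" and "\<alpha> \<in> \<rat>"
    and "strongly_dependent TYPE('u) L T"
  shows "strongly_dependent TYPE('u) (colored_language L) (T_alpha TYPE('u) L T \<alpha>)"
proof -
  \<comment> \<open>The fraction is provided for the absolute value, which is \<alpha> itself by
    positivity; \<open>p' \<le> q\<close> is the condition \<alpha> \<le> 1.\<close>
  obtain p' q :: nat where pq: "q \<noteq> 0" "\<bar>\<alpha>\<bar> = real p' / real q"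
    using Rats_abs_nat_div_natE[OF assms(12)] by metis
  have \<alpha>: "\<alpha> = real p' / real q" using pq(2) assms(10) by simp
  have pos: "0 < p'" using \<alpha> assms(10) by (cases p') auto
  have le: "p' \<le> q" using \<alpha> assms(11) pq(1) by (simp add: divide_le_eq)
  have loc: "T_alpha_monster TYPE('u) L T \<alpha> p' q M"
    if "monster (colored_language L) (T_alpha TYPE('u) L T \<alpha>) M" for M :: "('f, 'r option, 'u) struct"
    by unfold_locales (use assms that \<alpha> pos le in \<open>auto simp: complete_theory_def\<close>)
  have dp: "dp_rank_less (colored_language L) M n {(Equal (Var i) (Var i), []) | i. i < n} {} (UNIV :: nat set)"
    if "monster (colored_language L) (T_alpha TYPE('u) L T \<alpha>) M" for M :: "('f, 'r option, 'u) struct" and n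
    by (rule T_alpha_monster.dp_rank_colored[OF loc[OF that] assms(13)])
  show ?thesis
    unfolding strongly_dependent_def NIP_def
  proof (intro conjI allI impI)
    fix M :: "('f, 'r option, 'u) struct" and n m \<phi>
    assume M: "monster (colored_language L) (T_alpha TYPE('u) L T \<alpha>) M" and \<phi>: "formula (colored_language L) (n + m) \<phi>"
    have "aleph1_saturated (colored_language L) M" using M by (simp add: monster_def)
    then show "\<not> has_IP M n m \<phi>" by (rule NIP_of_dp_rank[OF _ dp[OF M] \<phi>])
  qed (rule dp)
qed

end
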